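(* Let $\xi$ be a co-oriented contact structure on a closed manifold $M$. Let $\alpha,\beta\in\mathcal{F}(M,\xi)$ and assume that $$d(\alpha,\beta)=\max_M f-\min_M f$$ for some $f\in C^\infty(M)$ and $\varphi\in\mathrm{Cont}_0(M,\xi)$ such that $\varphi^*\beta=e^f\alpha$. Then the following facts hold: (i) There are probability measures which are supported in the level sets $f^{-1}(\min f)$ and $f^{-1}(\max f)$ (one for each of these two sets) and are invariant with respect to the Reeb flows of both $\alpha$ and $\varphi^*\beta$. (ii) For every path of contactomorphisms $\{\psi_t\}_{t\in[0,1]}\subset\mathrm{Cont}_0(M,\xi)$ such that $\psi_0=\mathrm{id}$ and $\psi_1=\varphi^{-1}$, the path $$\gamma(t)=\psi_t^*(e^{tf}\alpha),\qquad t\in[0,1],$$ is a minimizing geodesic with $\gamma(0)=\alpha$ and $\gamma(1)=\beta$.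
   Context: $\mathcal{F}(M,\xi)$ is the set of contact forms $\alpha$ on $M$ defining $\xi$, i.e. $\ker\alpha=\xi$ and $\alpha$ is positive on tangent vectors positively transverse to $\xi$. $\mathrm{Cont}_0(M,\xi)$ is the identity component of the contactomorphism group: the diffeomorphisms of $M$ which are smoothly isotopic to the identity by a path of diffeomorphisms whose differential maps $\xi$ to itself. The Reeb vector field $R_\alpha$ of $\alpha$ is defined by $\imath_{R_\alpha}d\alpha=0$, $\imath_{R_\alpha}\alpha=1$; its flow is the Reeb flow. The contact Banach--Mazur pseudo-metric on $\mathcal{F}(M,\xi)$ is $$d(\alpha,\beta)=\inf\{\max f-\min f : \exists\,\varphi\in\mathrm{Cont}_0(M,\xi)\text{ such that }\varphi^*\beta=e^f\alpha\}.$$ A continuous curve $\gamma:[0,1]\to\mathcal{F}(M,\xi)$ is a minimizing geodesic if its length $\mathrm{Length}(\gamma)=\sup\{\sum_{j=1}^k d(\gamma(t_{j-1}),\gamma(t_j)) : k\in\mathbb{N},\ 0=t_0<t_1<\dots<t_k=1\}$ equals $d(\gamma(0),\gamma(1))$. Paths of contactomorphisms and curves of contact forms are understood to be continuous in the $C^\infty$-topology. *)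

theory Defs
  imports "HOL-Probability.Probability"
begin

section \<open>Smoothness in Euclidean space\<close>

primrec iter_deriv :: "'a::euclidean_space list \<Rightarrow> ('a \<Rightarrow> 'b::real_normed_vector) \<Rightarrow> 'a \<Rightarrow> 'b" where
  "iter_deriv [] f = f"
| "iter_deriv (v # vs) f = (\<lambda>x. frechet_derivative (iter_deriv vs f) (at x) v)"

text \<open>Smoothness on an arbitrary set means having, locally, a smooth extension to an open set. On
  open sets this is the usual notion: differentiability of all iterated directional derivatives
  includes their continuity. The general version is needed for isotopies, whose time interval is
  \<open>[0,1]\<close>.\<close>

definition smooth_on :: "'a::euclidean_space set \<Rightarrow> ('a \<Rightarrow> 'b::real_normed_vector) \<Rightarrow> bool" where
  "smooth_on S f \<longleftrightarrow>
     (\<forall>x\<in>S. \<exists>U g. open U \<and> x \<in> U \<and> (\<forall>y\<in>U \<inter> S. g y = f y) \<and>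
        (\<forall>vs. iter_deriv vs g differentiable_on U))"


section \<open>Smooth manifolds\<close>

text \<open>The manifold is the whole type \<open>'m\<close>, together with a smooth atlas \<open>A\<close> of charts with values in
  \<open>'e\<close>. A chart is a pair of its domain and its coordinate map.\<close>

type_synonym ('m, 'e) chart = "'m set \<times> ('m \<Rightarrow> 'e)"

abbreviation chart_inv :: "('m, 'e) chart \<Rightarrow> 'e \<Rightarrow> 'm" where
  "chart_inv c \<equiv> inv_into (fst c) (snd c)"

definition smooth_atlas ::
  "('m::{t2_space,second_countable_topology}, 'e::euclidean_space) chart set \<Rightarrow> bool" where
  "smooth_atlas A \<longleftrightarrow>
     (\<Union>c\<in>A. fst c) = UNIV \<and>
     (\<forall>c\<in>A. open (fst c) \<and> open (snd c ` fst c) \<and>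
        homeomorphism (fst c) (snd c ` fst c) (snd c) (chart_inv c)) \<and>
     (\<forall>c\<in>A. \<forall>c'\<in>A. smooth_on (snd c ` (fst c \<inter> fst c')) (snd c' \<circ> chart_inv c))"

text \<open>The tangent space at \<open>p\<close> is identified with \<open>'e\<close> through one chart chosen at \<open>p\<close>: a vector
  \<open>v :: 'e\<close> at \<open>p\<close> stands for the tangent vector with coordinates \<open>v\<close> in the chart \<open>chart_at A p\<close>.
  Everything below is independent of this choice up to the induced isomorphisms. There is no
  continuity of \<open>chart_at\<close> in \<open>p\<close>, so regularity of tensor fields must be (and is) expressed through
  their representations in a fixed chart.\<close>

definition chart_at :: "('m, 'e) chart set \<Rightarrow> 'm \<Rightarrow> ('m, 'e) chart" where
  "chart_at A p = (SOME c. c \<in> A \<and> p \<in> fst c)"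

definition smooth_fun ::
  "('m, 'e::euclidean_space) chart set \<Rightarrow> ('m \<Rightarrow> real) \<Rightarrow> bool" where
  "smooth_fun A f \<longleftrightarrow> (\<forall>c\<in>A. smooth_on (snd c ` fst c) (f \<circ> chart_inv c))"

definition smooth_map ::
  "('m::topological_space, 'e::euclidean_space) chart set \<Rightarrow> ('m \<Rightarrow> 'm) \<Rightarrow> bool" where
  "smooth_map A \<phi> \<longleftrightarrow>
     continuous_on UNIV \<phi> \<and>
     (\<forall>c\<in>A. \<forall>c'\<in>A.
        smooth_on (snd c ` (fst c \<inter> \<phi> -` fst c')) (snd c' \<circ> \<phi> \<circ> chart_inv c))"

definition diffeo ::
  "('m::topological_space, 'e::euclidean_space) chart set \<Rightarrow> ('m \<Rightarrow> 'm) \<Rightarrow> bool" where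
  "diffeo A \<phi> \<longleftrightarrow> bij \<phi> \<and> smooth_map A \<phi> \<and> smooth_map A (inv \<phi>)"

definition tangent_map ::
  "('m, 'e::euclidean_space) chart set \<Rightarrow> ('m \<Rightarrow> 'm) \<Rightarrow> 'm \<Rightarrow> 'e \<Rightarrow> 'e" where
  "tangent_map A \<phi> p =
     frechet_derivative (snd (chart_at A (\<phi> p)) \<circ> \<phi> \<circ> chart_inv (chart_at A p))
       (at (snd (chart_at A p) p))"

text \<open>Joint smoothness of \<open>(t, p) \<mapsto> \<Phi> t p\<close> on \<open>[0,1] \<times> M\<close>; the values of \<open>\<Phi>\<close> at other times are
  irrelevant.\<close>

definition smooth_isotopy ::
  "('m::topological_space, 'e::euclidean_space) chart set \<Rightarrow> (real \<Rightarrow> 'm \<Rightarrow> 'm) \<Rightarrow> bool" where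
  "smooth_isotopy A \<Phi> \<longleftrightarrow>
     (\<forall>t\<in>{0..1}. diffeo A (\<Phi> t)) \<and>
     continuous_on ({0..1} \<times> UNIV) (\<lambda>(t, p). \<Phi> t p) \<and>
     (\<forall>c\<in>A. \<forall>c'\<in>A.
        smooth_on {(t, x). t \<in> {0..1} \<and> x \<in> snd c ` fst c \<and> \<Phi> t (chart_inv c x) \<in> fst c'}
          (\<lambda>(t, x). snd c' (\<Phi> t (chart_inv c x))))"


section \<open>Differential 1-forms\<close>

type_synonym ('m, 'e) form = "'m \<Rightarrow> 'e \<Rightarrow> real"

text \<open>The representation of a 1-form in a chart \<open>c\<close>, evaluated at the coordinate point \<open>x\<close> on the
  coordinate vector \<open>v\<close>. The derivative converts coordinates in \<open>c\<close> to coordinates in the chart that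
  is used to identify the tangent space.\<close>

definition form_rep ::
  "('m, 'e::euclidean_space) chart set \<Rightarrow> ('m, 'e) form \<Rightarrow> ('m, 'e) chart \<Rightarrow> 'e \<Rightarrow> 'e \<Rightarrow> real" where
  "form_rep A \<alpha> c x v =
     \<alpha> (chart_inv c x)
       (frechet_derivative (snd (chart_at A (chart_inv c x)) \<circ> chart_inv c) (at x) v)"

definition smooth_form :: "('m, 'e::euclidean_space) chart set \<Rightarrow> ('m, 'e) form \<Rightarrow> bool" where
  "smooth_form A \<alpha> \<longleftrightarrow>
     (\<forall>p. linear (\<alpha> p)) \<and>
     (\<forall>c\<in>A. \<forall>v. smooth_on (snd c ` fst c) (\<lambda>x. form_rep A \<alpha> c x v))"

definition pullback ::
  "('m, 'e::euclidean_space) chart set \<Rightarrow> ('m \<Rightarrow> 'm) \<Rightarrow> ('m, 'e) form \<Rightarrow> ('m, 'e) form" where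
  "pullback A \<phi> \<alpha> = (\<lambda>p v. \<alpha> (\<phi> p) (tangent_map A \<phi> p v))"

definition scale_form :: "('m \<Rightarrow> real) \<Rightarrow> ('m, 'e) form \<Rightarrow> ('m, 'e) form" where
  "scale_form h \<alpha> = (\<lambda>p v. h p * \<alpha> p v)"

text \<open>The coordinate formula \<open>d\<alpha>(u, v) = \<partial>\<^sub>u (\<alpha> v) - \<partial>\<^sub>v (\<alpha> u)\<close> for constant coordinate fields.\<close>

definition ext_deriv ::
  "('m, 'e::euclidean_space) chart set \<Rightarrow> ('m, 'e) form \<Rightarrow> 'm \<Rightarrow> 'e \<Rightarrow> 'e \<Rightarrow> real" where
  "ext_deriv A \<alpha> p u v =
     (let c = chart_at A p; x = snd c p in
        frechet_derivative (\<lambda>y. form_rep A \<alpha> c y v) (at x) u -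
        frechet_derivative (\<lambda>y. form_rep A \<alpha> c y u) (at x) v)"


section \<open>The \<open>C\<^sup>\<infinity>\<close>-topologies\<close>

text \<open>Uniform convergence of all derivatives on compact subsets of charts. For maps this is the
  (weak) \<open>C\<^sup>\<infinity>\<close>-topology in the sense of Hirsch, on all smooth self-maps; the manifold being compact,
  it coincides with the strong one.\<close>

definition Cinf_map_topology ::
  "('m::topological_space, 'e::euclidean_space) chart set \<Rightarrow> ('m \<Rightarrow> 'm) topology" where
  "Cinf_map_topology A =
     topology_generated_by
       {{\<psi>. smooth_map A \<psi> \<and> \<psi> ` K \<subseteq> fst c' \<and>
            (\<forall>x\<in>snd c ` K. norm (iter_deriv vs (snd c' \<circ> \<psi> \<circ> chart_inv c) x
                               - iter_deriv vs (snd c' \<circ> \<phi> \<circ> chart_inv c) x) < \<epsilon>)}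
        | \<phi> c c' K vs \<epsilon>.
            smooth_map A \<phi> \<and> c \<in> A \<and> c' \<in> A \<and> compact K \<and> K \<subseteq> fst c \<and> \<phi> ` K \<subseteq> fst c' \<and>
            0 < (\<epsilon>::real)}"

definition Cinf_form_topology ::
  "('m::topological_space, 'e::euclidean_space) chart set \<Rightarrow> ('m, 'e) form topology" where
  "Cinf_form_topology A =
     topology_generated_by
       {{\<beta>. smooth_form A \<beta> \<and>
            (\<forall>x\<in>snd c ` K. \<bar>iter_deriv vs (\<lambda>y. form_rep A \<beta> c y v) x
                           - iter_deriv vs (\<lambda>y. form_rep A \<alpha> c y v) x\<bar> < \<epsilon>)}
        | \<alpha> c K vs v \<epsilon>.
            smooth_form A \<alpha> \<and> c \<in> A \<and> compact K \<and> K \<subseteq> fst c \<and> 0 < (\<epsilon>::real)}"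


section \<open>Contact structures and contact forms\<close>

definition contact_form :: "('m, 'e::euclidean_space) chart set \<Rightarrow> ('m, 'e) form \<Rightarrow> bool" where
  "contact_form A \<alpha> \<longleftrightarrow>
     smooth_form A \<alpha> \<and>
     (\<forall>p. (\<exists>v. \<alpha> p v \<noteq> 0) \<and>
          (\<forall>u. \<alpha> p u = 0 \<and> (\<forall>v. \<alpha> p v = 0 \<longrightarrow> ext_deriv A \<alpha> p u v = 0) \<longrightarrow> u = 0))"

text \<open>A co-oriented hyperplane field is given by the hyperplanes \<open>\<xi> p\<close> together with the sets \<open>P p\<close>
  of tangent vectors that are positively transverse to them.\<close>

definition cooriented_contact_structure ::
  "('m, 'e::euclidean_space) chart set \<Rightarrow> ('m \<Rightarrow> 'e set) \<Rightarrow> ('m \<Rightarrow> 'e set) \<Rightarrow> bool" where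
  "cooriented_contact_structure A \<xi> P \<longleftrightarrow>
     (\<exists>\<alpha>. contact_form A \<alpha> \<and> (\<forall>p. \<xi> p = {v. \<alpha> p v = 0} \<and> P p = {v. 0 < \<alpha> p v}))"

definition contact_forms ::
  "('m, 'e::euclidean_space) chart set \<Rightarrow> ('m \<Rightarrow> 'e set) \<Rightarrow> ('m \<Rightarrow> 'e set) \<Rightarrow> ('m, 'e) form set" where
  "contact_forms A \<xi> P =
     {\<alpha>. contact_form A \<alpha> \<and> (\<forall>p. {v. \<alpha> p v = 0} = \<xi> p \<and> (\<forall>v\<in>P p. 0 < \<alpha> p v))}"

definition Cont0 ::
  "('m::topological_space, 'e::euclidean_space) chart set \<Rightarrow> ('m \<Rightarrow> 'e set) \<Rightarrow> ('m \<Rightarrow> 'm) set" where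
  "Cont0 A \<xi> =
     {\<phi>. \<exists>\<Phi>. smooth_isotopy A \<Phi> \<and>
            (\<forall>t\<in>{0..1}. \<forall>p. tangent_map A (\<Phi> t) p ` \<xi> p = \<xi> (\<Phi> t p)) \<and>
            \<Phi> 0 = id \<and> \<Phi> 1 = \<phi>}"


section \<open>Reeb flows and invariant measures\<close>

definition has_velocity ::
  "('m::topological_space, 'e::euclidean_space) chart set \<Rightarrow> (real \<Rightarrow> 'm) \<Rightarrow> real \<Rightarrow> 'e \<Rightarrow> bool" where
  "has_velocity A \<gamma> t w \<longleftrightarrow>
     isCont \<gamma> t \<and> ((snd (chart_at A (\<gamma> t)) \<circ> \<gamma>) has_vector_derivative w) (at t)"

definition flow_of ::
  "('m::topological_space, 'e::euclidean_space) chart set \<Rightarrow> ('m \<Rightarrow> 'e) \<Rightarrow> real \<Rightarrow> 'm \<Rightarrow> 'm" where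
  "flow_of A X =
     (THE \<theta>. \<forall>p. \<theta> 0 p = p \<and> (\<forall>t. has_velocity A (\<lambda>s. \<theta> s p) t (X (\<theta> t p))))"

definition Reeb_field :: "('m, 'e::euclidean_space) chart set \<Rightarrow> ('m, 'e) form \<Rightarrow> 'm \<Rightarrow> 'e" where
  "Reeb_field A \<alpha> p = (THE r. (\<forall>u. ext_deriv A \<alpha> p r u = 0) \<and> \<alpha> p r = 1)"

definition Reeb_flow ::
  "('m::topological_space, 'e::euclidean_space) chart set \<Rightarrow> ('m, 'e) form \<Rightarrow> real \<Rightarrow> 'm \<Rightarrow> 'm" where
  "Reeb_flow A \<alpha> = flow_of A (Reeb_field A \<alpha>)"

definition borel_prob :: "'m::topological_space measure \<Rightarrow> bool" where
  "borel_prob \<mu> \<longleftrightarrow> prob_space \<mu> \<and> sets \<mu> = sets borel"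

text \<open>For a closed set \<open>K\<close> in a second countable space, vanishing outside \<open>K\<close> is the same as the
  support being contained in \<open>K\<close>.\<close>

definition supported_in :: "'m::topological_space measure \<Rightarrow> 'm set \<Rightarrow> bool" where
  "supported_in \<mu> K \<longleftrightarrow> emeasure \<mu> (- K) = 0"

definition flow_invariant ::
  "(real \<Rightarrow> 'm \<Rightarrow> 'm) \<Rightarrow> 'm::topological_space measure \<Rightarrow> bool" where
  "flow_invariant \<theta> \<mu> \<longleftrightarrow> (\<forall>t. \<theta> t \<in> borel_measurable borel \<and> distr \<mu> borel (\<theta> t) = \<mu>)"


section \<open>The contact Banach--Mazur pseudo-metric\<close>

text \<open>On a closed manifold \<open>max f\<close> and \<open>min f\<close> are the supremum and infimum of the continuous
  function \<open>f\<close>.\<close>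

abbreviation max_val :: "('m \<Rightarrow> real) \<Rightarrow> real" where
  "max_val f \<equiv> (SUP p. f p)"

abbreviation min_val :: "('m \<Rightarrow> real) \<Rightarrow> real" where
  "min_val f \<equiv> (INF p. f p)"

definition bm_dist ::
  "('m::topological_space, 'e::euclidean_space) chart set \<Rightarrow> ('m \<Rightarrow> 'e set) \<Rightarrow>
     ('m, 'e) form \<Rightarrow> ('m, 'e) form \<Rightarrow> real" where
  "bm_dist A \<xi> \<alpha> \<beta> =
     Inf {max_val f - min_val f | f.
            smooth_fun A f \<and>
            (\<exists>\<phi>\<in>Cont0 A \<xi>. pullback A \<phi> \<beta> = scale_form (\<lambda>p. exp (f p)) \<alpha>)}"

definition bm_length ::
  "('m::topological_space, 'e::euclidean_space) chart set \<Rightarrow> ('m \<Rightarrow> 'e set) \<Rightarrow>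
     (real \<Rightarrow> ('m, 'e) form) \<Rightarrow> ereal" where
  "bm_length A \<xi> \<gamma> =
     Sup {ereal (\<Sum>j=1..k. bm_dist A \<xi> (\<gamma> (t (j - 1))) (\<gamma> (t j))) | (k::nat) (t::nat \<Rightarrow> real).
            t 0 = 0 \<and> t k = 1 \<and> (\<forall>j<k. t j < t (Suc j))}"

definition minimizing_geodesic ::
  "('m::topological_space, 'e::euclidean_space) chart set \<Rightarrow> ('m \<Rightarrow> 'e set) \<Rightarrow> ('m \<Rightarrow> 'e set) \<Rightarrow>
     (real \<Rightarrow> ('m, 'e) form) \<Rightarrow> bool" where
  "minimizing_geodesic A \<xi> P \<gamma> \<longleftrightarrow>
     continuous_map (top_of_set {0..1})
       (subtopology (Cinf_form_topology A) (contact_forms A \<xi> P)) \<gamma> \<and>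
     bm_length A \<xi> \<gamma> = ereal (bm_dist A \<xi> (\<gamma> 0) (\<gamma> 1))"

end

theory Submission
  imports Defs
begin

text \<open>Let \<open>R\<close> be the Reeb field of \<open>\<alpha>\<close>. Composing \<open>\<phi>\<close> with the time-\<open>\<epsilon>\<close> flow of the contact Hamiltonian
  \<open>h\<close> changes \<open>f\<close> into \<open>f + \<epsilon> R h\<close> up to reparametrisation and \<open>o(\<epsilon>)\<close>, so minimality of the oscillation
  of \<open>f\<close> forces the oscillation of \<open>f + R h\<close> to be at least that of \<open>f\<close>, for every \<open>h\<close>. A weighted sum
  of \<open>f\<close> along Reeb orbits is a choice of \<open>h\<close> for which \<open>f + R h\<close> is close to the average of \<open>f\<close> over
  orbit segments of length \<open>T\<close>. Hence some orbit segments of every length stay in \<open>f\<^sup>-\<^sup>1(max f)\<close>, and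
  some in \<open>f\<^sup>-\<^sup>1(min f)\<close>, and a limit of the uniform measures on them is invariant. There \<open>df = 0\<close>, so
  the Reeb field of \<open>e\<^sup>f \<alpha>\<close> is a constant multiple of \<open>R\<close>. For the geodesic it suffices that the
  distance from \<open>\<gamma>(s)\<close> to \<open>\<gamma>(t)\<close> is at most \<open>t - s\<close> times the oscillation of \<open>f\<close>, which
  \<open>\<psi>\<^sub>t\<^sup>-\<^sup>1 \<circ> \<psi>\<^sub>s\<close> shows.\<close>

section \<open>Calculus with a topological parameter\<close>

text \<open>The path \<psi> is merely continuous in t, together with all its space derivatives. This
  dictates a calculus in which one variable is a parameter that is never differentiated; the same
  calculus proves that flows depend smoothly on time and initial point. The weights originate in an
  integration by parts: the average over s in [0, T] of (T - s) times the value of f after Reeb time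
  s has as Reeb derivative the orbit average of f minus f itself. A Riemann sum stands in for this
  integral, because a finite sum of smooth functions is smooth with no derivative under an integral
  sign, and its error is uniform on the manifold. The orbit measures are made to cluster as set
  functions, in a product of unit intervals, which yields only a finitely additive content;
  vanishing off the level set and invariance are closed conditions on finitely many values and
  survive the passage to a measure. Invariance under the second Reeb flow requires the whole orbit
  of almost every point to stay in the level set, since the flows are compared only there.\<close>

definition open_slices :: "('t::topological_space \<times> 'a::topological_space) set \<Rightarrow> bool" where
  "open_slices W \<longleftrightarrow> (\<forall>t. open {x. (t, x) \<in> W})"

definition slice_deriv ::
  "('t \<times> 'a::real_normed_vector \<Rightarrow> 'b::real_normed_vector) \<Rightarrow> 'a \<Rightarrow> 't \<times> 'a \<Rightarrow> 'b" where
  "slice_deriv F v p = frechet_derivative (\<lambda>y. F (fst p, y)) (at (snd p)) v"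

text \<open>The first component is a mere parameter, in which only continuity is required, but of all
  derivatives and jointly with the second component.\<close>

primrec CkP :: "nat \<Rightarrow> ('t::topological_space \<times> 'a::real_normed_vector) set \<Rightarrow>
    ('t \<times> 'a \<Rightarrow> 'b::real_normed_vector) \<Rightarrow> bool" where
  "CkP 0 W F \<longleftrightarrow> continuous_on W F"
| "CkP (Suc n) W F \<longleftrightarrow> continuous_on W F \<and>
     (\<forall>p\<in>W. (\<lambda>y. F (fst p, y)) differentiable at (snd p)) \<and> (\<forall>v. CkP n W (slice_deriv F v))"

lemma CkP_continuous: "CkP n W F \<Longrightarrow> continuous_on W F"
  by (cases n) auto

lemma CkP_subset: "CkP n W F \<Longrightarrow> W' \<subseteq> W \<Longrightarrow> CkP n W' F"
  by (induction n arbitrary: F) (auto intro: continuous_on_subset)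

lemma CkP_Suc_imp: "CkP (Suc n) W F \<Longrightarrow> CkP n W F"
proof (induction n arbitrary: F)
  case (Suc n)
  then show ?case using CkP.simps(2)[of n W F] CkP.simps(2)[of "Suc n" W F] by blast
qed simp

lemma CkP_mono: "CkP n W F \<Longrightarrow> m \<le> n \<Longrightarrow> CkP m W F"
  by (induction n) (auto simp: le_Suc_eq simp del: CkP.simps(2) dest: CkP_Suc_imp)

lemma slice_deriv_eqI:
  assumes "((\<lambda>y. F (t, y)) has_derivative F') (at x)"
  shows "slice_deriv F v (t, x) = F' v"
  using frechet_derivative_at[OF assms] by (simp add: slice_deriv_def)

text \<open>A derivative in the second variable sees one slice of \<open>W\<close> only. Openness of
  the slices is therefore enough to replace \<open>F\<close> by a function that agrees with it on
  \<open>W\<close>, and the parameter may range over a closed interval.\<close>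

lemma slice_deriv_cong:
  assumes "open_slices W" "\<And>p. p \<in> W \<Longrightarrow> F p = G p" "p \<in> W"
  shows "((\<lambda>y. F (fst p, y)) has_derivative F') (at (snd p)) \<longleftrightarrow>
         ((\<lambda>y. G (fst p, y)) has_derivative F') (at (snd p))"
proof -
  have o: "open {x. (fst p, x) \<in> W}" and x: "snd p \<in> {x. (fst p, x) \<in> W}"
    using assms by (auto simp: open_slices_def)
  show ?thesis
    using has_derivative_transform_within_open[OF _ o x] assms(2) by (metis mem_Collect_eq)
qed

lemma slice_deriv_cong':
  assumes "open_slices W" "\<And>p. p \<in> W \<Longrightarrow> F p = G p" "p \<in> W"
  shows "slice_deriv F v p = slice_deriv G v p"
  unfolding slice_deriv_def frechet_derivative_def using slice_deriv_cong[of W F G, OF assms] by presburger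

lemma CkP_cong:
  assumes "open_slices W" "\<And>p. p \<in> W \<Longrightarrow> F p = G p" "CkP n W F"
  shows "CkP n W G"
  using assms(2,3)
proof (induction n arbitrary: F G)
  case 0
  then show ?case by (simp cong: continuous_on_cong)
next
  case (Suc n)
  have "continuous_on W G"
    using Suc.prems by (simp cong: continuous_on_cong)
  moreover have "CkP n W (slice_deriv G v)" for v
    using Suc.IH[of "slice_deriv F v" "slice_deriv G v"] Suc.prems
      slice_deriv_cong'[OF assms(1), of F G] by auto
  moreover have "(\<lambda>y. G (fst p, y)) differentiable at (snd p)" if "p \<in> W" for p
    unfolding differentiable_def
    using slice_deriv_cong[of W F G, OF assms(1) Suc.prems(1) that] Suc.prems(2) that
    by (metis CkP.simps(2) differentiable_def)
  ultimately show ?case by simp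
qed

text \<open>The introduction rule behind the later inductions: an explicit formula \<open>F'\<close>
  for the derivative is examined in place of \<open>slice_deriv\<close>, to which its regularity is
  carried over by \<open>CkP_cong\<close>.\<close>

lemma CkP_SucI:
  assumes "open_slices W" "continuous_on W F"
    and "\<And>t x. (t, x) \<in> W \<Longrightarrow> ((\<lambda>y. F (t, y)) has_derivative F' (t, x)) (at x)"
    and "\<And>v. CkP n W (\<lambda>p. F' p v)"
  shows "CkP (Suc n) W F"
proof -
  have "CkP n W (slice_deriv F v)" for v
    by (rule CkP_cong[OF assms(1) _ assms(4)[of v]])
      (use assms(3) in \<open>auto simp: slice_deriv_eqI[symmetric]\<close>)
  moreover have "(\<lambda>y. F (fst p, y)) differentiable at (snd p)" if "p \<in> W" for p
    using assms(3)[of "fst p" "snd p"] that by (auto intro: differentiableI)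
  ultimately show ?thesis using assms(2) by simp
qed

lemma CkP_SucD:
  assumes "CkP (Suc n) W F" "(t, x) \<in> W"
  shows "((\<lambda>y. F (t, y)) has_derivative (\<lambda>v. slice_deriv F v (t, x))) (at x)"
  using assms frechet_derivative_works by (fastforce simp: slice_deriv_def)

text \<open>Slice derivatives of a function of the parameter vanish, so its continuity already gives
  every order.\<close>

lemma CkP_param:
  assumes "open_slices W" "continuous_on W (\<lambda>p. g (fst p))"
  shows "CkP n W (\<lambda>p. g (fst p))"
proof -
  have *: "slice_deriv (\<lambda>p. h (fst p)) v = (\<lambda>p. 0)"
    for h :: "'a \<Rightarrow> 'c" and v :: 'b
    by (auto simp: slice_deriv_def)
  have 0: "CkP n W (\<lambda>p. 0 :: 'c)" for n
    using *[of "\<lambda>_. 0"] by (induction n) auto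
  show ?thesis
    by (cases n) (use assms 0 * in auto)
qed

lemma CkP_const: "open_slices W \<Longrightarrow> CkP n W (\<lambda>p. c)"
  using CkP_param[of W "\<lambda>_. c" n] by simp

lemma CkP_linear:
  assumes "open_slices W" "bounded_linear L"
  shows "CkP n W (\<lambda>p. L (snd p))"
proof -
  have "continuous_on W (\<lambda>p. L (snd p))"
    by (intro bounded_linear.continuous_on[OF assms(2)] continuous_intros)
  then show ?thesis
  proof (cases n)
  case (Suc m)
  assume "continuous_on W (\<lambda>p. L (snd p))"
  then show ?thesis unfolding Suc
    by (rule CkP_SucI[OF assms(1), where F' = "\<lambda>_. L"])
      (auto intro: CkP_const assms bounded_linear_imp_has_derivative)
  qed simp
qed

lemma CkP_add:
  assumes "open_slices W" "CkP n W F" "CkP n W G"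
  shows "CkP n W (\<lambda>p. F p + G p)"
  using assms(2,3)
proof (induction n arbitrary: F G)
  case 0
  then show ?case by (auto intro: continuous_intros)
next
  case (Suc n)
  show ?case
    by (rule CkP_SucI[OF assms(1), where F' = "\<lambda>p v. slice_deriv F v p + slice_deriv G v p"])
      (use Suc in \<open>auto simp del: CkP.simps(2)
         intro!: continuous_intros has_derivative_add CkP_SucD dest: CkP_continuous\<close>, use Suc in auto)
qed

lemma CkP_bilinear:
  assumes "open_slices W" "bounded_bilinear B" "CkP n W F" "CkP n W G"
  shows "CkP n W (\<lambda>p. B (F p) (G p))"
  using assms(3,4)
proof (induction n arbitrary: F G)
  case 0
  then show ?case by (auto intro!: bounded_bilinear.continuous_on[OF assms(2)])
next
  case (Suc n)
  show ?case
  proof (rule CkP_SucI[OF assms(1), where F' = "\<lambda>p v. B (F p) (slice_deriv G v p) + B (slice_deriv F v p) (G p)"])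
    show "continuous_on W (\<lambda>p. B (F p) (G p))"
      using Suc.prems by (auto intro!: bounded_bilinear.continuous_on[OF assms(2)])
    show "((\<lambda>y. B (F (t, y)) (G (t, y))) has_derivative
          (\<lambda>v. B (F (t, x)) (slice_deriv G v (t, x)) + B (slice_deriv F v (t, x)) (G (t, x)))) (at x)"
      if "(t, x) \<in> W" for t x
      by (rule bounded_bilinear.FDERIV[OF assms(2)]) (use Suc.prems that CkP_SucD in blast)+
    show "CkP n W (\<lambda>p. B (F p) (slice_deriv G v p) + B (slice_deriv F v p) (G p))" for v
      by (intro CkP_add[OF assms(1)] Suc.IH) (use Suc.prems CkP_Suc_imp[of n W] in auto)
  qed
qed

lemma CkP_sum:
  assumes "open_slices W" "\<And>i. i \<in> I \<Longrightarrow> CkP n W (F i)"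
  shows "CkP n W (\<lambda>p. \<Sum>i\<in>I. F i p)"
  using assms(2) by (induction I rule: infinite_finite_induct) (auto intro: CkP_const CkP_add assms(1))

lemma CkP_bounded_linear:
  assumes "open_slices W" "bounded_linear L" "CkP n W F"
  shows "CkP n W (\<lambda>p. L (F p))"
  using assms(3)
proof (induction n arbitrary: F)
  case 0
  then show ?case by (auto intro: bounded_linear.continuous_on[OF assms(2)])
next
  case (Suc n)
  show ?case
    by (rule CkP_SucI[OF assms(1), where F' = "\<lambda>p v. L (slice_deriv F v p)"])
      (use Suc in \<open>auto simp del: CkP.simps(2) dest: CkP_continuous
         intro!: bounded_linear.continuous_on[OF assms(2)] bounded_linear.has_derivative[OF assms(2)] CkP_SucD\<close>,
       use Suc in auto)
qed

lemma open_slices_Times: "open U \<Longrightarrow> open_slices (T \<times> U)"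
  unfolding open_slices_def
proof
  fix t
  assume "open U"
  then show "open {x. (t, x) \<in> T \<times> U}"
    by (cases "t \<in> T") auto
qed

text \<open>The outer map may have a parameter of another type, reached through \<sigma>. The chain
  rule puts a vector that varies with the point into \<open>slice_deriv G\<close>, whereas the
  induction hypothesis speaks of constant directions; expansion in the basis bridges this.\<close>

lemma CkP_compose:
  fixes F :: "'s::topological_space \<times> 'a::real_normed_vector \<Rightarrow> 'b::euclidean_space"
    and G :: "'t::topological_space \<times> 'b \<Rightarrow> 'c::real_normed_vector"
  assumes "open_slices W" "CkP n W F" "CkP n W2 G" "continuous_on W (\<lambda>p. \<sigma> (fst p))"
    and "\<And>p. p \<in> W \<Longrightarrow> (\<sigma> (fst p), F p) \<in> W2"
  shows "CkP n W (\<lambda>p. G (\<sigma> (fst p), F p))"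
  using assms(2,3)
proof (induction n arbitrary: G)
  case 0
  then show ?case
    by (auto intro!: continuous_on_compose2[of W2 G] continuous_intros assms)
next
  case (Suc n)
  have c: "continuous_on W (\<lambda>p. G (\<sigma> (fst p), F p))"
    using Suc.prems by (auto intro!: continuous_on_compose2[of W2 G] continuous_intros assms)
  show ?case
  proof (rule CkP_SucI[OF assms(1) c, where F' = "\<lambda>p v. \<Sum>b\<in>Basis. (slice_deriv F v p \<bullet> b) *\<^sub>R slice_deriv G b (\<sigma> (fst p), F p)"])
    fix t x assume tx: "(t, x) \<in> W"
    have dG: "((\<lambda>y. G (\<sigma> t, y)) has_derivative (\<lambda>v. slice_deriv G v (\<sigma> t, F (t, x)))) (at (F (t, x)))"
      using CkP_SucD[OF Suc.prems(2)] assms(5)[OF tx] by simp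
    have d: "((\<lambda>y. G (\<sigma> t, F (t, y))) has_derivative (\<lambda>v. slice_deriv G (slice_deriv F v (t, x)) (\<sigma> t, F (t, x)))) (at x)"
      using diff_chain_at[OF CkP_SucD[OF Suc.prems(1) tx] dG] by (simp add: o_def)
    have "slice_deriv G w (\<sigma> t, F (t, x)) = (\<Sum>b\<in>Basis. (w \<bullet> b) *\<^sub>R slice_deriv G b (\<sigma> t, F (t, x)))" for w
      using linear_sum[OF has_derivative_linear[OF dG], of "\<lambda>b. (w \<bullet> b) *\<^sub>R b" Basis]
      by (simp add: euclidean_representation linear_scale[OF has_derivative_linear[OF dG]])
    then have "(\<lambda>v. slice_deriv G (slice_deriv F v (t, x)) (\<sigma> t, F (t, x))) =
        (\<lambda>v. \<Sum>b\<in>Basis. (slice_deriv F v (t, x) \<bullet> b) *\<^sub>R slice_deriv G b (\<sigma> (fst (t, x)), F (t, x)))"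
      by (metis fst_conv)
    then show "((\<lambda>y. G (\<sigma> (fst (t, y)), F (t, y))) has_derivative
        (\<lambda>v. \<Sum>b\<in>Basis. (slice_deriv F v (t, x) \<bullet> b) *\<^sub>R slice_deriv G b (\<sigma> (fst (t, x)), F (t, x)))) (at x)"
      using d by (simp only: fst_conv)
  next
    fix v
    show "CkP n W (\<lambda>p. \<Sum>b\<in>Basis. (slice_deriv F v p \<bullet> b) *\<^sub>R slice_deriv G b (\<sigma> (fst p), F p))"
    proof (rule CkP_sum[OF assms(1)])
      fix b :: 'b
      have "CkP n W (\<lambda>p. slice_deriv F v p \<bullet> b)"
        by (rule CkP_bounded_linear[OF assms(1) bounded_linear_inner_left]) (use Suc.prems in simp)
      moreover have "CkP n W (\<lambda>p. slice_deriv G b (\<sigma> (fst p), F p))"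
        by (rule Suc.IH) (use Suc.prems CkP_Suc_imp[of n W F] in auto)
      ultimately show "CkP n W (\<lambda>p. (slice_deriv F v p \<bullet> b) *\<^sub>R slice_deriv G b (\<sigma> (fst p), F p))"
        by (rule CkP_bilinear[OF assms(1) bounded_bilinear_scaleR])
    qed
  qed
qed

section \<open>Maps of class C^n and smooth maps on open sets\<close>

definition Ck :: "nat \<Rightarrow> 'a::real_normed_vector set \<Rightarrow> ('a \<Rightarrow> 'b::real_normed_vector) \<Rightarrow> bool" where
  "Ck n U f \<longleftrightarrow> CkP n ((UNIV :: real set) \<times> U) (\<lambda>p. f (snd p))"

lemma slice_deriv_snd: "slice_deriv (\<lambda>p. f (snd p)) v = (\<lambda>p. frechet_derivative f (at (snd p)) v)"
  by (auto simp: slice_deriv_def)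

text \<open>The real parameter inside \<open>Ck\<close> is a dummy through which every rule for
  \<open>CkP\<close> is reused; fixing it at 0 removes it again.\<close>

lemma Ck_0: "Ck 0 U f \<longleftrightarrow> continuous_on U f"
proof
  assume "Ck 0 U f"
  then have "continuous_on U ((\<lambda>p. f (snd p)) \<circ> (\<lambda>x. (0::real, x)))"
    unfolding Ck_def by (intro continuous_on_compose) (auto intro!: continuous_intros elim: continuous_on_subset)
  then show "continuous_on U f" by (simp add: o_def)
qed (auto simp: Ck_def intro!: continuous_on_compose2[of U f] continuous_intros)

lemma Ck_Suc:
  assumes "open U"
  shows "Ck (Suc n) U f \<longleftrightarrow> f differentiable_on U \<and> (\<forall>v. Ck n U (\<lambda>x. frechet_derivative f (at x) v))"
proof -
  have "continuous_on (UNIV \<times> U) (\<lambda>p. f (snd p))" if "f differentiable_on U"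
    using differentiable_imp_continuous_on[OF that]
    by (auto intro!: continuous_on_compose2[of U f] continuous_intros)
  then show ?thesis
    using assms by (auto simp: Ck_def slice_deriv_snd differentiable_on_eq_differentiable_at)
qed

lemma CkP_slice:
  fixes F :: "'t::topological_space \<times> 'a::euclidean_space \<Rightarrow> 'b::real_normed_vector"
  assumes "open_slices W" "CkP n W F" "\<And>x. x \<in> U \<Longrightarrow> (t, x) \<in> W" "open U"
  shows "Ck n U (\<lambda>x. F (t, x))"
proof -
  have "CkP n ((UNIV::real set) \<times> U) (\<lambda>p. F ((\<lambda>_. t) (fst p), snd p))"
    by (rule CkP_compose[OF _ _ assms(2)])
      (use assms in \<open>auto intro!: open_slices_Times CkP_linear bounded_linear_ident\<close>)
  then show ?thesis by (simp add: Ck_def)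
qed

lemma Ck_CkP:
  fixes f :: "'a::euclidean_space \<Rightarrow> 'b::real_normed_vector"
  assumes "Ck n U f" "open_slices W" "\<And>p. p \<in> W \<Longrightarrow> snd p \<in> U" 
  shows "CkP n W (\<lambda>p. f (snd p))"
  using CkP_compose[OF assms(2) _ assms(1)[unfolded Ck_def], where \<sigma> = "\<lambda>_. 0" and F = snd]
    CkP_linear[OF assms(2) bounded_linear_ident] assms(3) by auto

lemma Ck_compose_CkP:
  fixes f :: "'a::euclidean_space \<Rightarrow> _"
  assumes "Ck n U f" "open_slices W" "CkP n W F" "\<And>p. p \<in> W \<Longrightarrow> F p \<in> U" 
  shows "CkP n W (\<lambda>p. f (F p))"
  using CkP_compose[OF assms(2,3) assms(1)[unfolded Ck_def], where \<sigma> = "\<lambda>_. 0"] assms(4) by auto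

lemma Ck_compose:
  fixes f :: "'a::euclidean_space \<Rightarrow> _"
  assumes "Ck n U f" "open V" "Ck n V g" "\<And>x. x \<in> V \<Longrightarrow> g x \<in> U" 
  shows "Ck n V (\<lambda>x. f (g x))"
  using Ck_compose_CkP[OF assms(1) open_slices_Times[OF assms(2)] assms(3)[unfolded Ck_def]] assms(4)
  by (auto simp: Ck_def)

lemma Ck_subset: "Ck n U f \<Longrightarrow> V \<subseteq> U \<Longrightarrow> Ck n V f"
  unfolding Ck_def by (erule CkP_subset) auto

lemma Ck_Suc_imp: "Ck (Suc n) U f \<Longrightarrow> Ck n U f"
  unfolding Ck_def by (rule CkP_Suc_imp)

lemma Ck_cong: "Ck n U f \<Longrightarrow> open U \<Longrightarrow> (\<And>x. x \<in> U \<Longrightarrow> f x = g x) \<Longrightarrow> Ck n U g"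
  unfolding Ck_def by (rule CkP_cong[OF open_slices_Times]) auto

lemma Ck_bilinear:
  "open U \<Longrightarrow> bounded_bilinear B \<Longrightarrow> Ck n U f \<Longrightarrow> Ck n U g \<Longrightarrow> Ck n U (\<lambda>x. B (f x) (g x))"
  unfolding Ck_def by (rule CkP_bilinear[OF open_slices_Times])

lemma Ck_add: "open U \<Longrightarrow> Ck n U f \<Longrightarrow> Ck n U g \<Longrightarrow> Ck n U (\<lambda>x. f x + g x)"
  unfolding Ck_def by (rule CkP_add[OF open_slices_Times])

lemma Ck_const: "open U \<Longrightarrow> Ck n U (\<lambda>x. c)"
  unfolding Ck_def by (rule CkP_const[OF open_slices_Times])

lemma Ck_linear: "open U \<Longrightarrow> bounded_linear L \<Longrightarrow> Ck n U L"
  unfolding Ck_def by (rule CkP_linear[OF open_slices_Times])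

lemma Ck_bounded_linear: "open U \<Longrightarrow> bounded_linear L \<Longrightarrow> Ck n U f \<Longrightarrow> Ck n U (\<lambda>x. L (f x))"
  unfolding Ck_def by (rule CkP_bounded_linear[OF open_slices_Times])

lemma Ck_sum: "open U \<Longrightarrow> (\<And>i. i \<in> I \<Longrightarrow> Ck n U (f i)) \<Longrightarrow> Ck n U (\<lambda>x. \<Sum>i\<in>I. f i x)"
  unfolding Ck_def by (rule CkP_sum[OF open_slices_Times])

lemma Ck_SucI:
  assumes "open U" "\<And>x. x \<in> U \<Longrightarrow> (f has_derivative f' x) (at x)" "\<And>v. Ck n U (\<lambda>x. f' x v)"
  shows "Ck (Suc n) U f"
  unfolding Ck_Suc[OF assms(1)]
proof safe
  show "f differentiable_on U"
    using assms(1,2) differentiableI by (auto simp: differentiable_on_eq_differentiable_at)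
  show "Ck n U (\<lambda>x. frechet_derivative f (at x) v)" for v
    by (rule Ck_cong[OF assms(3)[of v] assms(1)]) (use frechet_derivative_at[OF assms(2)] in metis)
qed

lemma Ck_open_Union:
  assumes "\<And>x. x \<in> U \<Longrightarrow> \<exists>V. open V \<and> x \<in> V \<and> Ck n V f"
    and "open U"
  shows "Ck n U f"
  using assms(1)
proof (induction n arbitrary: f)
  case 0
  then show ?case unfolding Ck_0 using continuous_on_eq_continuous_at assms(2) by metis
next
  case (Suc n)
  have *: "\<exists>V. open V \<and> x \<in> V \<and> f differentiable_on V \<and> (\<forall>v. Ck n V (\<lambda>x. frechet_derivative f (at x) v))"
    if "x \<in> U" for x
    using Suc.prems[OF that] Ck_Suc by metis
  show ?case unfolding Ck_Suc[OF assms(2)]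
  proof safe
    show "f differentiable_on U"
      using * assms(2) differentiable_on_eq_differentiable_at by metis
    show "Ck n U (\<lambda>x. frechet_derivative f (at x) v)" for v
      by (rule Suc.IH) (use * in blast)
  qed
qed

text \<open>The head of the list is the outermost derivative, whereas \<open>Ck\<close> takes off
  the innermost one. Moving the last entry inside links the two orders of induction.\<close>

lemma iter_deriv_snoc:
  "iter_deriv (vs @ [v]) f = iter_deriv vs (\<lambda>x. frechet_derivative f (at x) v)"
  by (induction vs) auto

lemma Ck_imp_iter_deriv:
  assumes "open U" "Ck (length vs + n) U f"
  shows "Ck n U (iter_deriv vs f)"
  using assms(2)
proof (induction vs arbitrary: f rule: rev_induct)
  case (snoc v vs)
  then show ?case unfolding iter_deriv_snoc using Ck_Suc[OF assms(1)] by (auto simp: ac_simps)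
qed simp

lemma iter_deriv_imp_Ck:
  assumes "open U" "\<And>vs. iter_deriv vs f differentiable_on U"
  shows "Ck n U f"
  using assms(2)
proof (induction n arbitrary: f)
  case 0
  then show ?case using 0[of "[]"] differentiable_imp_continuous_on Ck_0 by fastforce
next
  case (Suc n)
  show ?case unfolding Ck_Suc[OF assms(1)]
    using Suc.prems[of "[]"] Suc.prems[of "_ @ [_]"]
    by (auto simp: iter_deriv_snoc intro!: Suc.IH)
qed

definition smooth :: "'a::euclidean_space set \<Rightarrow> ('a \<Rightarrow> 'b::real_normed_vector) \<Rightarrow> bool" where
  "smooth U f \<longleftrightarrow> open U \<and> (\<forall>n. Ck n U f)"

text \<open>Differentiability of every iterated derivative includes continuity of all of them, so
  the condition used for \<open>smooth_on\<close> coincides on open sets with being of every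
  class.\<close>

lemma smooth_iff: "smooth U f \<longleftrightarrow> open U \<and> (\<forall>vs. iter_deriv vs f differentiable_on U)"
proof -
  have "iter_deriv vs f differentiable_on U" if "open U" "\<forall>n. Ck n U f" for vs
    using Ck_imp_iter_deriv[OF that(1), of vs "Suc 0" f] Ck_Suc[OF that(1)] that(2) by blast
  then show ?thesis unfolding smooth_def using iter_deriv_imp_Ck by blast
qed

lemma smooth_open: "smooth U f \<Longrightarrow> open U"
  by (simp add: smooth_def)

lemma smooth_subset: "smooth U f \<Longrightarrow> open V \<Longrightarrow> V \<subseteq> U \<Longrightarrow> smooth V f"
  by (auto simp: smooth_def intro: Ck_subset)

lemma smooth_cong: "smooth U f \<Longrightarrow> (\<And>x. x \<in> U \<Longrightarrow> f x = g x) \<Longrightarrow> smooth U g"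
  by (auto simp: smooth_def intro: Ck_cong)

lemma smooth_continuous: "smooth U f \<Longrightarrow> continuous_on U f"
  using Ck_0 smooth_def by blast

lemma smooth_has_derivative:
  "smooth U f \<Longrightarrow> x \<in> U \<Longrightarrow> (f has_derivative frechet_derivative f (at x)) (at x)"
  using frechet_derivative_works Ck_Suc[of U 0 f]
  by (auto simp: smooth_def differentiable_on_eq_differentiable_at)

lemma smooth_differentiable: "smooth U f \<Longrightarrow> x \<in> U \<Longrightarrow> f differentiable at x"
  using smooth_has_derivative differentiableI by blast

lemma smooth_deriv: "smooth U f \<Longrightarrow> smooth U (\<lambda>x. frechet_derivative f (at x) v)"
  using Ck_Suc by (auto simp: smooth_def)

lemma smooth_const: "open U \<Longrightarrow> smooth U (\<lambda>x. c)"
  by (auto simp: smooth_def intro: Ck_const)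

lemma smooth_linear: "open U \<Longrightarrow> bounded_linear L \<Longrightarrow> smooth U L"
  by (auto simp: smooth_def intro: Ck_linear)

lemma smooth_add: "smooth U f \<Longrightarrow> smooth U g \<Longrightarrow> smooth U (\<lambda>x. f x + g x)"
  by (auto simp: smooth_def intro: Ck_add)

lemma smooth_bilinear:
  "bounded_bilinear B \<Longrightarrow> smooth U f \<Longrightarrow> smooth U g \<Longrightarrow> smooth U (\<lambda>x. B (f x) (g x))"
  by (auto simp: smooth_def intro: Ck_bilinear)

lemma smooth_scaleR: "smooth U f \<Longrightarrow> smooth U g \<Longrightarrow> smooth U (\<lambda>x. f x *\<^sub>R g x)"
  by (rule smooth_bilinear[OF bounded_bilinear_scaleR])

lemma smooth_mult: "smooth U f \<Longrightarrow> smooth U g \<Longrightarrow> smooth U (\<lambda>x. f x * g x :: real)"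
  by (rule smooth_bilinear[OF bounded_bilinear_mult])

lemma smooth_inner: "smooth U f \<Longrightarrow> smooth U g \<Longrightarrow> smooth U (\<lambda>x. f x \<bullet> g x)"
  by (rule smooth_bilinear[OF bounded_bilinear_inner])

lemma smooth_bounded_linear: "bounded_linear L \<Longrightarrow> smooth U f \<Longrightarrow> smooth U (\<lambda>x. L (f x))"
  by (auto simp: smooth_def intro: Ck_bounded_linear)

lemma smooth_minus: "smooth U f \<Longrightarrow> smooth U (\<lambda>x. - f x)"
  by (rule smooth_bounded_linear[OF bounded_linear_minus[OF bounded_linear_ident]])

lemma smooth_diff: "smooth U f \<Longrightarrow> smooth U g \<Longrightarrow> smooth U (\<lambda>x. f x - g x)"
  using smooth_add[OF _ smooth_minus] by fastforce

lemma smooth_sum: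
  "open U \<Longrightarrow> (\<And>i. i \<in> I \<Longrightarrow> smooth U (f i)) \<Longrightarrow> smooth U (\<lambda>x. \<Sum>i\<in>I. f i x)"
  by (auto simp: smooth_def intro: Ck_sum)

lemma smooth_compose:
  "smooth U f \<Longrightarrow> smooth V g \<Longrightarrow> (\<And>x. x \<in> V \<Longrightarrow> g x \<in> U) \<Longrightarrow> smooth V (\<lambda>x. f (g x))"
  by (auto simp: smooth_def intro: Ck_compose)

lemma smooth_Pair:
  assumes "smooth U f" "smooth U g"
  shows "smooth U (\<lambda>x. (f x, g x))"
proof -
  have "smooth U (\<lambda>x. (f x, 0) + (0, g x))"
    by (intro smooth_add smooth_bounded_linear[of "\<lambda>y. (y, 0)"] smooth_bounded_linear[of "\<lambda>y. (0, y)"] assms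
        bounded_linear_Pair bounded_linear_ident bounded_linear_zero)
  then show ?thesis by simp
qed

lemma smooth_Union:
  "(\<And>x. x \<in> U \<Longrightarrow> \<exists>V. x \<in> V \<and> smooth V f) \<Longrightarrow> open U \<Longrightarrow> smooth U f"
  by (simp add: smooth_def) (meson Ck_open_Union)

lemma smooth_on_alt:
  "smooth_on S f \<longleftrightarrow> (\<forall>x\<in>S. \<exists>U g. x \<in> U \<and> (\<forall>y\<in>U \<inter> S. g y = f y) \<and> smooth U g)"
  unfolding smooth_on_def smooth_iff by (intro ball_cong ex_cong1 refl) (simp only: conj_ac)

lemma smooth_on_iff:
  assumes "open U"
  shows "smooth_on U f \<longleftrightarrow> smooth U f"
proof
  assume s: "smooth_on U f"
  show "smooth U f"
  proof (rule smooth_Union[OF _ assms])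
    fix x assume "x \<in> U"
    then obtain V g where V: "x \<in> V" "\<forall>y\<in>V \<inter> U. g y = f y" "smooth V g"
      using s unfolding smooth_on_alt by metis
    have "smooth (V \<inter> U) f"
      by (rule smooth_cong[OF smooth_subset[OF V(3)]]) (use V assms smooth_open[OF V(3)] in auto)
    then show "\<exists>V. x \<in> V \<and> smooth V f" using V \<open>x \<in> U\<close> by blast
  qed
next
  assume "smooth U f"
  then show "smooth_on U f" unfolding smooth_on_alt by auto
qed

lemma smooth_on_subset: "smooth_on S f \<Longrightarrow> T \<subseteq> S \<Longrightarrow> smooth_on T f"
  unfolding smooth_on_alt
proof
  fix x assume "\<forall>x\<in>S. \<exists>U g. x \<in> U \<and> (\<forall>y\<in>U \<inter> S. g y = f y) \<and> smooth U g" "T \<subseteq> S" "x \<in> T"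
  then obtain U g where "x \<in> U" "\<forall>y\<in>U \<inter> S. g y = f y" "smooth U g" by (metis subsetD)
  then show "\<exists>U g. x \<in> U \<and> (\<forall>y\<in>U \<inter> T. g y = f y) \<and> smooth U g"
    using \<open>T \<subseteq> S\<close> by (intro exI[of _ U] exI[of _ g]) auto
qed

lemma smooth_on_cong: "smooth_on S f \<Longrightarrow> (\<And>x. x \<in> S \<Longrightarrow> f x = g x) \<Longrightarrow> smooth_on S g"
  unfolding smooth_on_alt by auto

lemma smooth_imp_on: "smooth U f \<Longrightarrow> S \<subseteq> U \<Longrightarrow> smooth_on S f"
  unfolding smooth_on_alt by blast

lemma smooth_on_compose:
  assumes "smooth_on T f" "smooth_on S g" "\<And>x. x \<in> S \<Longrightarrow> g x \<in> T"
  shows "smooth_on S (\<lambda>x. f (g x))"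
  unfolding smooth_on_alt
proof safe
  fix x assume x: "x \<in> S"
  obtain U g' where U: "x \<in> U" "\<forall>y\<in>U \<inter> S. g' y = g y" "smooth U g'"
    using assms(2) x unfolding smooth_on_alt by metis
  obtain V f' where V: "g x \<in> V" "\<forall>y\<in>V \<inter> T. f' y = f y" "smooth V f'"
    using assms(1,3) x unfolding smooth_on_alt by metis
  \<comment> \<open>The extension of \<open>f\<close> may be applied to that of \<open>g\<close>
    only where the latter has its values in \<open>V\<close>.\<close>
  let ?U = "U \<inter> g' -` V"
  have o: "open ?U"
    by (rule continuous_open_preimage[OF smooth_continuous[OF U(3)] smooth_open[OF U(3)] smooth_open[OF V(3)]])
  have "smooth ?U (\<lambda>x. f' (g' x))"
    by (rule smooth_compose[OF V(3) smooth_subset[OF U(3) o]]) auto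
  moreover have "\<forall>y\<in>?U \<inter> S. f' (g' y) = f (g y)" "x \<in> ?U"
    using U V assms(3) x by auto
  ultimately show "\<exists>U h. x \<in> U \<and> (\<forall>y\<in>U \<inter> S. h y = f (g y)) \<and> smooth U h"
    by (intro exI[of _ ?U] exI[of _ "\<lambda>x. f' (g' x)"]) simp
qed

lemma smooth_on_local:
  assumes "\<And>x. x \<in> S \<Longrightarrow> \<exists>T. openin (top_of_set S) T \<and> x \<in> T \<and> smooth_on T f"
  shows "smooth_on S f"
  unfolding smooth_on_alt
proof safe
  fix x assume "x \<in> S"
  then obtain T where T: "openin (top_of_set S) T" "x \<in> T" "smooth_on T f" using assms by blast
  then obtain W where W: "open W" "T = S \<inter> W" by (auto simp: openin_open)
  obtain U g where U: "x \<in> U" "\<forall>y\<in>U \<inter> T. g y = f y" "smooth U g"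
    using T unfolding smooth_on_alt by blast
  have "smooth (U \<inter> W) g" using smooth_subset[OF U(3)] smooth_open[OF U(3)] W by auto
  then show "\<exists>U g. x \<in> U \<and> (\<forall>y\<in>U \<inter> S. g y = f y) \<and> smooth U g"
    using T W U by (intro exI[of _ "U \<inter> W"] exI[of _ g]) auto
qed

lemma smooth_on_continuous: "smooth_on S f \<Longrightarrow> continuous_on S f"
  unfolding continuous_on_eq_continuous_within
proof
  fix x assume "smooth_on S f" and x: "x \<in> S"
  then obtain U g where U: "x \<in> U" "\<forall>y\<in>U \<inter> S. g y = f y" "smooth U g"
    unfolding smooth_on_alt by blast
  have "isCont g x" using smooth_continuous[OF U(3)] smooth_open[OF U(3)] U(1)
    by (simp add: continuous_on_eq_continuous_at)
  then have "continuous (at x within S) g" by (rule continuous_at_imp_continuous_at_within)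
  moreover have "openin (top_of_set S) (U \<inter> S)"
    using smooth_open[OF U(3)] by (metis Int_commute openin_open_Int)
  ultimately show "continuous (at x within S) f"
    using continuous_transform_within_openin[of x S g "U \<inter> S" f] U x by auto
qed

section \<open>Symmetry of second derivatives\<close>

lemma has_derivative_line:
  assumes "(g has_derivative g') (at (y + s *\<^sub>R u))"
  shows "((\<lambda>s. g (y + s *\<^sub>R u)) has_vector_derivative g' u) (at s)"
proof -
  have "((\<lambda>s. y + s *\<^sub>R u) has_derivative (\<lambda>h. h *\<^sub>R u)) (at s)"
    by (auto intro!: derivative_eq_intros)
  from diff_chain_at[OF this assms] show ?thesis
    using linear_scale[OF has_derivative_linear[OF assms]]
    by (simp add: o_def has_vector_derivative_def)
qed

lemma smooth_line:
  assumes "smooth U g" "y + s *\<^sub>R u \<in> U"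
  shows "((\<lambda>s. g (y + s *\<^sub>R u)) has_vector_derivative frechet_derivative g (at (y + s *\<^sub>R u)) u) (at s)"
  using has_derivative_line smooth_has_derivative assms by metis

text \<open>The mean value theorem is applied twice, to the increment \<open>G\<close> along u and
  then to the first derivative along v. The summand \<open>+ h\<close> makes the bound on the
  distance of \<open>p\<close> strict even for u = v = 0.\<close>

lemma second_difference:
  fixes f :: "'a::euclidean_space \<Rightarrow> real"
  assumes f: "smooth (ball x r) f" and h: "0 < h" "h * (norm u + norm v) < r"
  shows "\<exists>p. dist x p < h * (norm u + norm v) + h \<and> p \<in> ball x r \<and>
     f (x + h *\<^sub>R u + h *\<^sub>R v) - f (x + h *\<^sub>R u) - f (x + h *\<^sub>R v) + f x =
     h * (h * frechet_derivative (\<lambda>y. frechet_derivative f (at y) u) (at p) v)"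
proof -
  have near: "norm (s *\<^sub>R u + t *\<^sub>R v) \<le> h * (norm u + norm v)" if "0 \<le> s" "s \<le> h" "0 \<le> t" "t \<le> h" for s t
    using norm_triangle_ineq[of "s *\<^sub>R u" "t *\<^sub>R v"] that
      mult_right_mono[of s h "norm u"] mult_right_mono[of t h "norm v"]
    by (simp add: distrib_left)
  have dx: "dist x (x + s *\<^sub>R u + t *\<^sub>R v) = norm (s *\<^sub>R u + t *\<^sub>R v)" for s t
    by (metis add.assoc add_diff_cancel_left' dist_commute dist_norm)
  have inb: "x + s *\<^sub>R u + t *\<^sub>R v \<in> ball x r" if "0 \<le> s" "s \<le> h" "0 \<le> t" "t \<le> h" for s t
    using h near[OF that] by (simp only: mem_ball dx)
  define G where "G s = f (x + s *\<^sub>R u + h *\<^sub>R v) - f (x + s *\<^sub>R u)" for s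
  define g where "g y = frechet_derivative f (at y) u" for y
  have "(G has_real_derivative (g (x + s *\<^sub>R u + h *\<^sub>R v) - g (x + s *\<^sub>R u))) (at s)"
    if "0 \<le> s" "s \<le> h" for s
  proof -
    have "((\<lambda>s. f ((x + h *\<^sub>R v) + s *\<^sub>R u)) has_vector_derivative g ((x + h *\<^sub>R v) + s *\<^sub>R u)) (at s)"
      unfolding g_def by (rule smooth_line[OF f]) (use inb[of s h] that h in \<open>simp add: ac_simps\<close>)
    moreover have "((\<lambda>s. f (x + s *\<^sub>R u)) has_vector_derivative g (x + s *\<^sub>R u)) (at s)"
      unfolding g_def by (rule smooth_line[OF f]) (use inb[of s 0] that h in simp)
    ultimately show ?thesis
      unfolding G_def[abs_def] has_real_derivative_iff_has_vector_derivative
      by (auto intro: has_vector_derivative_diff simp: ac_simps)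
  qed
  from MVT2[OF h(1) this] obtain s where s: "0 < s" "s < h"
    and Gs: "G h - G 0 = h * (g (x + s *\<^sub>R u + h *\<^sub>R v) - g (x + s *\<^sub>R u))"
    by auto
  have sg: "smooth (ball x r) g"
    unfolding g_def by (rule smooth_deriv[OF f])
  have "((\<lambda>t. g (x + s *\<^sub>R u + t *\<^sub>R v)) has_real_derivative
      frechet_derivative g (at (x + s *\<^sub>R u + t *\<^sub>R v)) v) (at t)" if "0 \<le> t" "t \<le> h" for t
    unfolding has_real_derivative_iff_has_vector_derivative
    by (rule smooth_line[OF sg]) (use inb[of s t] s that in simp)
  from MVT2[OF h(1) this] obtain t where t: "0 < t" "t < h"
    and gt: "g (x + s *\<^sub>R u + h *\<^sub>R v) - g (x + s *\<^sub>R u) = h * frechet_derivative g (at (x + s *\<^sub>R u + t *\<^sub>R v)) v"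
    by auto
  have d: "dist x (x + s *\<^sub>R u + t *\<^sub>R v) \<le> h * (norm u + norm v)"
    using near[of s t] s t by (simp only: dx)
  have "f (x + h *\<^sub>R u + h *\<^sub>R v) - f (x + h *\<^sub>R u) - f (x + h *\<^sub>R v) + f x = G h - G 0"
    by (simp add: G_def)
  then have "f (x + h *\<^sub>R u + h *\<^sub>R v) - f (x + h *\<^sub>R u) - f (x + h *\<^sub>R v) + f x =
      h * (h * frechet_derivative g (at (x + s *\<^sub>R u + t *\<^sub>R v)) v)"
    using Gs gt by simp
  moreover have "dist x (x + s *\<^sub>R u + t *\<^sub>R v) < h * (norm u + norm v) + h"
    using d h by simp
  moreover have "x + s *\<^sub>R u + t *\<^sub>R v \<in> ball x r"
    using inb[of s t] s t by simp
  ultimately show ?thesis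
    unfolding g_def[abs_def] by blast
qed

text \<open>The second difference is symmetric in u and v, so the two mixed derivatives take a
  common value at two points \<open>p\<close> and \<open>q\<close> near x; their continuity moves
  both points to x.\<close>

lemma deriv_commute_real:
  fixes f :: "'a::euclidean_space \<Rightarrow> real"
  assumes f: "smooth U f" and x: "x \<in> U"
  shows "frechet_derivative (\<lambda>y. frechet_derivative f (at y) u) (at x) v =
         frechet_derivative (\<lambda>y. frechet_derivative f (at y) v) (at x) u" (is "?A x = ?B x")
proof (rule ccontr)
  assume ne: "?A x \<noteq> ?B x"
  \<comment> \<open>Half of the supposed gap, which two errors below \<open>e\<close> cannot
    bridge.\<close>
  define e where "e = \<bar>?A x - ?B x\<bar> / 2"
  have e: "0 < e" using ne by (simp add: e_def)
  have o: "open U" using f by (rule smooth_open)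
  have cA: "isCont ?A x" and cB: "isCont ?B x"
    using smooth_continuous[OF smooth_deriv[OF smooth_deriv[OF f]]] x o
    by (auto simp: continuous_on_eq_continuous_at)
  obtain d1 where d1: "d1 > 0" "\<And>y. dist y x < d1 \<Longrightarrow> dist (?A y) (?A x) < e"
    using cA e unfolding continuous_at_eps_delta by (metis)
  obtain d2 where d2: "d2 > 0" "\<And>y. dist y x < d2 \<Longrightarrow> dist (?B y) (?B x) < e"
    using cB e unfolding continuous_at_eps_delta by (metis)
  obtain r where r: "r > 0" "ball x r \<subseteq> U" using o x open_contains_ball by blast
  have fr: "smooth (ball x r) f" using smooth_subset[OF f _ r(2)] by simp
  \<comment> \<open>Small enough for the parallelogram to stay in the ball and for \<open>p\<close>
    and \<open>q\<close> to be within reach of both continuity estimates; the 1 in the denominator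
    covers vanishing u and v.\<close>
  define h where "h = min r (min d1 d2) / (2 * (norm u + norm v + 1))"
  have pos: "norm u + norm v + 1 > 0" by (smt (verit) norm_ge_zero)
  have h: "h > 0" using r d1 d2 pos by (simp add: h_def)
  have "h * (norm u + norm v) + h = min r (min d1 d2) / 2"
  proof -
    have "h * (norm u + norm v + 1) = min r (min d1 d2) / 2"
      unfolding h_def using pos by (simp add: divide_simps)
    then show ?thesis by (simp add: distrib_left)
  qed
  then have hs: "h * (norm u + norm v) < r" "h * (norm u + norm v) + h < d1" "h * (norm u + norm v) + h < d2"
    using r d1 d2 h by auto
  obtain p where p: "dist x p < h * (norm u + norm v) + h" 
    "f (x + h *\<^sub>R u + h *\<^sub>R v) - f (x + h *\<^sub>R u) - f (x + h *\<^sub>R v) + f x = h * (h * ?A p)"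
    using second_difference[OF fr h hs(1)] by auto
  obtain q where q: "dist x q < h * (norm v + norm u) + h" 
    "f (x + h *\<^sub>R v + h *\<^sub>R u) - f (x + h *\<^sub>R v) - f (x + h *\<^sub>R u) + f x = h * (h * ?B q)"
    using second_difference[OF fr h, of v u] hs(1) by (auto simp: add.commute)
  have "h * (h * ?A p) = h * (h * ?B q)"
    using p(2) q(2) by (simp add: algebra_simps)
  then have "?A p = ?B q" using h by simp
  moreover have "dist (?A p) (?A x) < e" by (rule d1(2)) (use p(1) hs in \<open>simp add: dist_commute\<close>)
  moreover have "dist (?B q) (?B x) < e" by (rule d2(2)) (use q(1) hs in \<open>simp add: dist_commute add.commute\<close>)
  ultimately have "dist (?A x) (?B x) < e + e"
    using dist_triangle3[of "?A x" "?B x" "?A p"] by simp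
  then show False by (simp add: e_def dist_real_def)
qed

lemma frechet_derivative_linear_compose:
  assumes "bounded_linear L" "g differentiable at x"
  shows "frechet_derivative (\<lambda>y. L (g y)) (at x) v = L (frechet_derivative g (at x) v)"
  using bounded_linear.has_derivative[OF assms(1) assms(2)[unfolded frechet_derivative_works]]
  by (metis frechet_derivative_at)

lemma frechet_derivative_cong_open:
  assumes "open U" "x \<in> U" "\<And>y. y \<in> U \<Longrightarrow> f y = g y"
  shows "frechet_derivative f (at x) = frechet_derivative g (at x)"
proof -
  have "(f has_derivative D) (at x) \<longleftrightarrow> (g has_derivative D) (at x)" for D
    using has_derivative_transform_within_open[OF _ assms(1,2)] assms(3) by metis
  then show ?thesis by (simp add: frechet_derivative_def)
qed

lemma deriv_commute:
  fixes f :: "'a::euclidean_space \<Rightarrow> 'b::euclidean_space"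
  assumes f: "smooth U f" and x: "x \<in> U"
  shows "frechet_derivative (\<lambda>y. frechet_derivative f (at y) u) (at x) v =
         frechet_derivative (\<lambda>y. frechet_derivative f (at y) v) (at x) u"
proof (rule euclidean_eqI)
  fix b :: 'b assume "b \<in> Basis"
  have *: "frechet_derivative (\<lambda>y. frechet_derivative (\<lambda>z. f z \<bullet> b) (at y) u) (at x) v
       = frechet_derivative (\<lambda>y. frechet_derivative f (at y) u) (at x) v \<bullet> b" for u v
  proof -
    have "frechet_derivative (\<lambda>y. frechet_derivative (\<lambda>z. f z \<bullet> b) (at y) u) (at x) =
      frechet_derivative (\<lambda>y. frechet_derivative f (at y) u \<bullet> b) (at x)"
      by (rule frechet_derivative_cong_open[OF smooth_open[OF f] x])
        (intro frechet_derivative_linear_compose bounded_linear_inner_left smooth_differentiable[OF f])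
    then show ?thesis
      by (simp add: frechet_derivative_linear_compose[OF bounded_linear_inner_left
            smooth_differentiable[OF smooth_deriv[OF f] x]])
  qed
  show "frechet_derivative (\<lambda>y. frechet_derivative f (at y) u) (at x) v \<bullet> b =
        frechet_derivative (\<lambda>y. frechet_derivative f (at y) v) (at x) u \<bullet> b"
    using deriv_commute_real[OF smooth_inner[OF f smooth_const[OF smooth_open[OF f]]] x, of b u v] * by simp
qed

section \<open>Smoothness of exp, inverse and ln\<close>

lemma smooth_exp: "smooth UNIV (exp :: real \<Rightarrow> real)"
proof -
  have "Ck n UNIV (exp :: real \<Rightarrow> real)" for n
  proof (induction n)
    case (Suc n)
    show ?case
      by (rule Ck_SucI[where f' = "\<lambda>x v. exp x * v"])
        (auto intro!: derivative_eq_intros Ck_bounded_linear[OF _ bounded_linear_mult_left] Suc)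
  qed (simp add: Ck_0 continuous_on_exp)
  then show ?thesis by (simp add: smooth_def)
qed

lemma smooth_inverse: "smooth {x::real. x \<noteq> 0} inverse"
proof -
  have o: "open {x::real. x \<noteq> 0}"
    by (simp add: open_Collect_neq)
  have "Ck n {x::real. x \<noteq> 0} inverse" for n
  proof (induction n)
    case (Suc n)
    show ?case
    proof (rule Ck_SucI[where f' = "\<lambda>x v. (inverse x * inverse x) * (- v)", OF o])
      show "(inverse has_derivative (\<lambda>v. (inverse x * inverse x) * (- v))) (at x)"
        if "x \<in> {x. x \<noteq> 0}" for x :: real
        using that by (auto intro!: derivative_eq_intros)
      show "Ck n {x. x \<noteq> 0} (\<lambda>x. (inverse x * inverse x) * (- v))" for v :: real
        by (rule Ck_bounded_linear[OF o bounded_linear_mult_left])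
          (rule Ck_bilinear[OF o bounded_bilinear_mult Suc Suc])
    qed
  qed (auto simp: Ck_0 intro: continuous_intros)
  then show ?thesis using o by (simp add: smooth_def)
qed

lemma smooth_ln: "smooth {0<..} (ln :: real \<Rightarrow> real)"
proof -
  have "Ck n {0<..} (ln :: real \<Rightarrow> real)" for n
  proof (cases n)
    case (Suc m)
    have "smooth {0<..} (inverse :: real \<Rightarrow> real)"
      by (rule smooth_subset[OF smooth_inverse]) auto
    then show ?thesis unfolding Suc
      by (intro Ck_SucI[where f' = "\<lambda>x v. inverse x * v"])
        (auto intro!: derivative_eq_intros Ck_bounded_linear[OF _ bounded_linear_mult_left]
           simp: smooth_def divide_inverse)
  qed (auto simp: Ck_0 intro!: continuous_intros)
  then show ?thesis by (simp add: smooth_def)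
qed

section \<open>Linear systems with smooth coefficients\<close>

lemma linear_expand:
  fixes z :: "'b::euclidean_space"
  assumes "linear f"
  shows "f z = (\<Sum>b\<in>Basis. (z \<bullet> b) *\<^sub>R f b)"
proof -
  have "f z = f (\<Sum>b\<in>Basis. (z \<bullet> b) *\<^sub>R b)"
    by (simp add: euclidean_representation)
  then show ?thesis
    by (simp only: linear_sum[OF assms] linear_scale[OF assms])
qed

text \<open>Let y be the increment of \<open>u\<close> and \<open>J\<close> a left inverse of
  \<open>L x0\<close>. Then J (L x y) = J (w x - L x (u x0)) is explicit, and it differs from y = J
  (L x0 y) by a term that is small relative to y. The solution is thus compared with an explicit
  expression, and no inverse of \<open>L x\<close> has to be studied as a function of x.\<close>

lemma linear_system_perturb:
  fixes L :: "'a::real_normed_vector \<Rightarrow> 'b::euclidean_space \<Rightarrow> 'b"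
  assumes U: "open U" "x0 \<in> U" and lin: "\<And>x. x \<in> U \<Longrightarrow> linear (L x)"
    and inj: "\<And>z. L x0 z = 0 \<Longrightarrow> z = 0"
    and cont: "\<And>z. continuous_on U (\<lambda>x. L x z)"
    and eq: "\<And>x. x \<in> U \<Longrightarrow> L x (u x) = w x"
  obtains J where "bounded_linear J" "\<And>z. J (L x0 z) = z"
    and "\<And>e. e > 0 \<Longrightarrow> \<exists>d>0. ball x0 d \<subseteq> U \<and> (\<forall>x\<in>ball x0 d.
        norm (u x - u x0 - J (w x - L x (u x0))) \<le> e * norm (J (w x - L x (u x0))))"
proof -
  have "inj (L x0)"
    using inj linear_injective_0[OF lin[OF U(2)]] by blast
  then obtain J where J: "linear J" "J \<circ> L x0 = id"
    using linear_injective_left_inverse[OF lin[OF U(2)]] by blast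
  have Jb: "bounded_linear J" using J(1) by (simp add: linear_conv_bounded_linear)
  have JL: "J (L x0 z) = z" for z using J(2) by (metis comp_apply id_apply)
  \<comment> \<open>A bound for the operator norm of \<open>J\<close> composed with
    \<open>L x0 - L x\<close>, read off on the basis; it is continuous and vanishes at
    \<open>x0\<close>.\<close>
  define N where "N x = (\<Sum>b\<in>Basis. norm (J (L x0 b - L x b)))" for x
  have cN: "continuous_on U N"
    unfolding N_def by (intro continuous_intros bounded_linear.continuous_on[OF Jb] cont)
  have N0: "N x0 = 0" by (simp add: N_def linear_0[OF J(1)])
  have Nb: "norm (J (L x0 y - L x y)) \<le> N x * norm y" if "x \<in> U" for x y
  proof -
    have "linear (\<lambda>y. J (L x0 y - L x y))"
      using linear_compose[OF linear_compose_sub[OF lin[OF U(2)] lin[OF that]] J(1)] by (simp add: o_def)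
    then have "J (L x0 y - L x y) = (\<Sum>b\<in>Basis. (y \<bullet> b) *\<^sub>R J (L x0 b - L x b))"
      by (rule linear_expand)
    also have "norm \<dots> \<le> (\<Sum>b\<in>Basis. norm y * norm (J (L x0 b - L x b)))"
      by (rule order_trans[OF norm_sum sum_mono]) (auto intro!: mult_right_mono Basis_le_norm)
    finally show ?thesis by (simp add: N_def sum_distrib_left mult.commute)
  qed
  show thesis
  proof (rule that[OF Jb JL])
    fix e :: real assume e: "e > 0"
    \<comment> \<open>The bound 1/2 allows \<open>norm y\<close> to be absorbed, which gives
      \<open>norm y \<le> 2 * norm r\<close>; the bound e/2 pays for that factor 2.\<close>
    define e' where "e' = min (1/2) (e/2)"
    have e': "e' > 0" "e' \<le> 1/2" "2 * e' \<le> e" using e by (auto simp: e'_def)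
    have "isCont N x0" using cN U by (simp add: continuous_on_eq_continuous_at)
    then obtain d1 where d1: "d1 > 0" "\<And>y. dist y x0 < d1 \<Longrightarrow> dist (N y) (N x0) < e'"
      using e' unfolding continuous_at_eps_delta by metis
    obtain d2 where d2: "d2 > 0" "ball x0 d2 \<subseteq> U" using U open_contains_ball by blast
    have "norm (u x - u x0 - J (w x - L x (u x0))) \<le> e * norm (J (w x - L x (u x0)))"
      if x: "x \<in> ball x0 (min d1 d2)" for x
    proof -
      have xU: "x \<in> U" using x d2 by auto
      define y r where "y = u x - u x0" and "r = J (w x - L x (u x0))"
      have Nx: "N x \<le> e'" using d1(2)[of x] x N0 by (auto simp: dist_commute dist_real_def)
      have "r = J (L x y)"
        by (simp add: r_def y_def eq[OF xU, symmetric] linear_diff[OF lin[OF xU]])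
      then have yr: "y - r = J (L x0 y - L x y)"
        by (simp add: linear_diff[OF J(1)] JL)
      then have b: "norm (y - r) \<le> e' * norm y"
        using Nb[OF xU, of y] mult_right_mono[OF Nx norm_ge_zero[of y]] by simp
      then have "norm (y - r) \<le> 1/2 * norm y"
        using mult_right_mono[OF e'(2) norm_ge_zero[of y]] by linarith
      then have "norm y \<le> 2 * norm r"
        using norm_triangle_sub[of y r] by linarith
      then have "e' * norm y \<le> e' * (2 * norm r)"
        using e' by (intro mult_left_mono) auto
      also have "\<dots> \<le> e * norm r"
        using mult_right_mono[OF e'(3) norm_ge_zero[of r]] by simp
      finally show ?thesis using b by (simp add: y_def r_def)
    qed
    moreover have "ball x0 (min d1 d2) \<subseteq> U" using d2 by auto
    ultimately show "\<exists>d>0. ball x0 d \<subseteq> U \<and> (\<forall>x\<in>ball x0 d.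
        norm (u x - u x0 - J (w x - L x (u x0))) \<le> e * norm (J (w x - L x (u x0))))"
      using d1 d2 by (intro exI[of _ "min d1 d2"]) auto
  qed
qed

text \<open>The residual \<open>?r\<close> is continuous and vanishes at \<open>x0\<close>, and the
  perturbation estimate with e = 1 bounds the increment of \<open>u\<close> by twice its
  norm.\<close>

lemma linear_system_continuous:
  fixes L :: "'a::real_normed_vector \<Rightarrow> 'b::euclidean_space \<Rightarrow> 'b"
  assumes U: "open U" and lin: "\<And>x. x \<in> U \<Longrightarrow> linear (L x)"
    and inj: "\<And>x z. x \<in> U \<Longrightarrow> L x z = 0 \<Longrightarrow> z = 0"
    and cont: "\<And>z. continuous_on U (\<lambda>x. L x z)"
    and eq: "\<And>x. x \<in> U \<Longrightarrow> L x (u x) = w x" and w: "continuous_on U w"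
  shows "continuous_on U u"
  unfolding continuous_on_eq_continuous_at[OF U]
proof
  fix x0 assume x0: "x0 \<in> U"
  obtain J where J: "bounded_linear J" and b: "\<And>e. e > 0 \<Longrightarrow> \<exists>d>0. ball x0 d \<subseteq> U \<and> (\<forall>x\<in>ball x0 d.
        norm (u x - u x0 - J (w x - L x (u x0))) \<le> e * norm (J (w x - L x (u x0))))"
    using linear_system_perturb[of U x0 L u w] x0 assms by metis
  let ?r = "\<lambda>x. J (w x - L x (u x0))"
  obtain d where d: "d > 0" "ball x0 d \<subseteq> U" "\<forall>x\<in>ball x0 d. norm (u x - u x0 - ?r x) \<le> 1 * norm (?r x)"
    using b[of 1] by auto
  have "continuous_on U ?r"
    by (intro bounded_linear.continuous_on[OF J] continuous_intros w cont)
  then have "isCont ?r x0" using x0 U by (simp add: continuous_on_eq_continuous_at)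
  moreover have "?r x0 = 0" using eq[OF x0] by (simp add: linear_0 bounded_linear.linear[OF J])
  ultimately have "((\<lambda>x. 2 * norm (?r x)) \<longlongrightarrow> 0) (at x0)"
    by (auto intro!: tendsto_eq_intros simp: isCont_def)
  moreover have "\<forall>\<^sub>F x in at x0. norm (u x - u x0) \<le> 2 * norm (?r x)"
    unfolding eventually_at
  proof (intro exI[of _ d] conjI ballI impI d(1))
    fix x assume "x \<noteq> x0 \<and> dist x x0 < d"
    then have "norm (u x - u x0 - ?r x) \<le> norm (?r x)" using d(3) by (auto simp: dist_commute)
    then show "norm (u x - u x0) \<le> 2 * norm (?r x)"
      using norm_triangle_sub[of "u x - u x0" "?r x"] by linarith
  qed
  ultimately have "((\<lambda>x. u x - u x0) \<longlongrightarrow> 0) (at x0)"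
    by (rule Lim_null_comparison[rotated])
  then show "isCont u x0" unfolding isCont_def by (simp add: LIM_zero_iff)
qed

lemma linear_system_differentiable:
  fixes L :: "'a::euclidean_space \<Rightarrow> 'b::euclidean_space \<Rightarrow> 'b"
  assumes U: "open U" and x0: "x0 \<in> U" and lin: "\<And>x. x \<in> U \<Longrightarrow> linear (L x)"
    and inj: "\<And>x z. x \<in> U \<Longrightarrow> L x z = 0 \<Longrightarrow> z = 0"
    and L: "\<And>z. smooth U (\<lambda>x. L x z)"
    and eq: "\<And>x. x \<in> U \<Longrightarrow> L x (u x) = w x" and w: "w differentiable at x0"
  shows "u differentiable at x0"
proof -
  obtain J where J: "bounded_linear J" and b: "\<And>e. e > 0 \<Longrightarrow> \<exists>d>0. ball x0 d \<subseteq> U \<and> (\<forall>x\<in>ball x0 d.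
        norm (u x - u x0 - J (w x - L x (u x0))) \<le> e * norm (J (w x - L x (u x0))))"
    using linear_system_perturb[of U x0 L u w] x0 assms smooth_continuous[OF L] by metis
  let ?r = "\<lambda>x. J (w x - L x (u x0))"
  have r0: "?r x0 = 0" using eq[OF x0] by (simp add: linear_0 bounded_linear.linear[OF J])
  obtain w' where w': "(w has_derivative w') (at x0)" using w by (auto simp: differentiable_def)
  \<comment> \<open>The residual involves the solution only through the fixed vector
    \<open>u x0\<close>, so it can be differentiated; its derivative at \<open>x0\<close> turns out
    to be that of \<open>u\<close>.\<close>
  define r' where "r' v = J (w' v - frechet_derivative (\<lambda>x. L x (u x0)) (at x0) v)" for v
  have r': "(?r has_derivative r') (at x0)"
    unfolding r'_def[abs_def]
    by (intro bounded_linear.has_derivative[OF J] has_derivative_diff w' smooth_has_derivative[OF L x0])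
  then have blr: "bounded_linear r'" by (rule has_derivative_bounded_linear)
  obtain C where C: "C > 0" "\<And>h. norm (r' h) \<le> norm h * C"
    using bounded_linear.pos_bounded[OF blr] by blast
  have alt: "\<exists>d>0. \<forall>y. norm (y - x0) < d \<longrightarrow> norm (?r y - r' (y - x0)) \<le> e * norm (y - x0)" if "e > 0" for e
    using r' that r0 unfolding has_derivative_at_alt by simp
  have "(u has_derivative r') (at x0)"
    unfolding has_derivative_at_alt
  proof (intro conjI blr allI impI)
    fix e :: real assume e: "e > 0"
    \<comment> \<open>The residual has norm at most C + 1 times the increment of x, so this half of
      the error costs e/2.\<close>
    define e1 where "e1 = e / (2 * (C + 1))"
    have e1: "e1 > 0" using e C by (simp add: e1_def)
    define e2 where "e2 = min 1 (e / 2)"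
    have e2: "e2 > 0" "e2 \<le> 1" "e2 \<le> e/2" using e by (auto simp: e2_def)
    obtain d1 where d1: "d1 > 0" "\<forall>x\<in>ball x0 d1. norm (u x - u x0 - ?r x) \<le> e1 * norm (?r x)"
      using b[OF e1] by auto
    obtain d2 where d2: "d2 > 0" "\<And>y. norm (y - x0) < d2 \<Longrightarrow> norm (?r y - r' (y - x0)) \<le> e2 * norm (y - x0)"
      using alt[OF e2(1)] by auto
    show "\<exists>d>0. \<forall>y. norm (y - x0) < d \<longrightarrow> norm (u y - u x0 - r' (y - x0)) \<le> e * norm (y - x0)"
    proof (intro exI[of _ "min d1 d2"] conjI allI impI)
      show "0 < min d1 d2" using d1 d2 by simp
      fix y assume y: "norm (y - x0) < min d1 d2"
      let ?n = "norm (y - x0)"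
      have 1: "norm (?r y - r' (y - x0)) \<le> e2 * ?n" using d2 y by simp
      have "norm (?r y) \<le> norm (r' (y - x0)) + norm (?r y - r' (y - x0))"
        by (rule norm_triangle_sub)
      also have "\<dots> \<le> ?n * C + 1 * ?n"
        using C(2)[of "y - x0"] 1 mult_right_mono[OF e2(2) norm_ge_zero[of "y - x0"]] by linarith
      finally have "e1 * norm (?r y) \<le> e1 * ((C + 1) * ?n)"
        using e1 by (intro mult_left_mono) (auto simp: algebra_simps)
      also have "\<dots> = e / 2 * ?n"
      proof -
        have "e1 * (C + 1) = e / 2" unfolding e1_def using C by (simp add: divide_simps)
        then show ?thesis by (metis mult.assoc)
      qed
      finally have 2: "norm (u y - u x0 - ?r y) \<le> e / 2 * ?n"
        using d1(2) y by (force simp: dist_norm norm_minus_commute)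
      have "norm ((u y - u x0 - ?r y) + (?r y - r' (y - x0))) \<le> e / 2 * ?n + e2 * ?n"
        by (intro norm_triangle_le add_mono 1 2)
      then have "norm (u y - u x0 - r' (y - x0)) \<le> e / 2 * ?n + e2 * ?n"
        by simp
      also have "\<dots> \<le> e * ?n"
        using mult_right_mono[OF e2(3) norm_ge_zero[of "y - x0"]] by (simp add: field_simps)
      finally show "norm (u y - u x0 - r' (y - x0)) \<le> e * norm (y - x0)" .
    qed
  qed
  then show ?thesis by (rule differentiableI)
qed

text \<open>Differentiating \<open>L x (u x) = w x\<close> shows that each directional derivative of
  \<open>u\<close> solves the same system with a right-hand side of one order less, so the induction
  runs with \<open>L\<close> fixed.\<close>

lemma linear_system_Ck:
  fixes L :: "'a::euclidean_space \<Rightarrow> 'b::euclidean_space \<Rightarrow> 'b"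
  assumes U: "open U" and lin: "\<And>x. x \<in> U \<Longrightarrow> linear (L x)"
    and inj: "\<And>x z. x \<in> U \<Longrightarrow> L x z = 0 \<Longrightarrow> z = 0"
    and L: "\<And>z. smooth U (\<lambda>x. L x z)"
    and eq: "\<And>x. x \<in> U \<Longrightarrow> L x (u x) = w x" and w: "Ck n U w"
  shows "Ck n U u"
  using eq w
proof (induction n arbitrary: u w)
  case 0
  show ?case unfolding Ck_0
  proof (rule linear_system_continuous[of U L u w])
    show "continuous_on U w" using 0 by (simp add: Ck_0)
  qed (use 0 U lin inj smooth_continuous[OF L] in auto)
next
  case (Suc n)
  have wd: "w differentiable at x" if "x \<in> U" for x
    using Suc.prems(2) that unfolding Ck_Suc[OF U] using U differentiable_on_eq_differentiable_at by blast
  have ud: "u differentiable at x" if "x \<in> U" for x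
    by (rule linear_system_differentiable[OF U that lin inj L Suc.prems(1) wd[OF that]])
  have un: "Ck n U u" by (rule Suc.IH[OF Suc.prems(1) Ck_Suc_imp[OF Suc.prems(2)]])
  show ?case unfolding Ck_Suc[OF U]
  proof safe
    show "u differentiable_on U" using ud U differentiable_on_eq_differentiable_at by blast
    fix v
    let ?u = "\<lambda>x. frechet_derivative u (at x) v"
    let ?w = "\<lambda>x. frechet_derivative w (at x) v + - (\<Sum>b\<in>Basis. (u x \<bullet> b) *\<^sub>R frechet_derivative (\<lambda>x. L x b) (at x) v)"
    show "Ck n U ?u"
    proof (rule Suc.IH)
      show "L x (?u x) = ?w x" if x: "x \<in> U" for x
      proof -
        have "((\<lambda>y. \<Sum>b\<in>Basis. (u y \<bullet> b) *\<^sub>R L y b) has_derivative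
          (\<lambda>v. \<Sum>b\<in>Basis. (u x \<bullet> b) *\<^sub>R frechet_derivative (\<lambda>x. L x b) (at x) v
             + (frechet_derivative u (at x) v \<bullet> b) *\<^sub>R L x b)) (at x)"
          by (intro has_derivative_sum has_derivative_scaleR has_derivative_inner_left
              smooth_has_derivative[OF L x] ud[OF x, unfolded frechet_derivative_works])
        then have "(w has_derivative
          (\<lambda>v. \<Sum>b\<in>Basis. (u x \<bullet> b) *\<^sub>R frechet_derivative (\<lambda>x. L x b) (at x) v
             + (frechet_derivative u (at x) v \<bullet> b) *\<^sub>R L x b)) (at x)"
          by (rule has_derivative_transform_within_open[OF _ U x])
            (simp only: linear_expand[OF lin, symmetric] Suc.prems(1))
        from frechet_derivative_at[OF this, symmetric] show ?thesis
          using linear_expand[OF lin[OF x], of "?u x"] by (simp add: sum.distrib)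
      qed
      show "Ck n U ?w"
        using Suc.prems(2) un L smooth_deriv[OF L]
        unfolding Ck_Suc[OF U] smooth_def
        by (intro Ck_add[OF U] Ck_bounded_linear[OF U bounded_linear_minus[OF bounded_linear_ident]] Ck_sum[OF U]
            Ck_bilinear[OF U bounded_bilinear_scaleR] Ck_bounded_linear[OF U bounded_linear_inner_left]) auto
    qed
  qed
qed

lemma linear_system_smooth:
  fixes L :: "'a::euclidean_space \<Rightarrow> 'b::euclidean_space \<Rightarrow> 'b"
  assumes "\<And>x. x \<in> U \<Longrightarrow> linear (L x)" "\<And>x z. x \<in> U \<Longrightarrow> L x z = 0 \<Longrightarrow> z = 0"
    and "\<And>z. smooth U (\<lambda>x. L x z)" "\<And>x. x \<in> U \<Longrightarrow> L x (u x) = w x" "smooth U w"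
  shows "smooth U u"
  using linear_system_Ck[of U L u w] assms unfolding smooth_def by blast

section \<open>Ordinary differential equations\<close>

text \<open>An integral over the fixed interval [0, 1] depends continuously on t and on further
  parameters jointly, by continuity under the integral sign; this is how Picard's operator is kept
  within jointly continuous functions.\<close>

lemma integral_rescale:
  fixes h :: "real \<Rightarrow> 'a::banach"
  assumes "continuous_on {0..1} h" "t \<in> {0..1}"
  shows "t *\<^sub>R integral {0..1} (\<lambda>s. h (t * s)) = integral {0..t} h"
proof (cases "t = 0")
  case False
  then have t: "t > 0" using assms by auto
  have im: "(\<lambda>x. x / t) ` {0..t} = {0..1}"
  proof (intro equalityI subsetI)
    fix x assume "x \<in> {0..1::real}"
    then show "x \<in> (\<lambda>x. x / t) ` {0..t}"
      using t by (intro image_eqI[of _ _ "x * t"]) (auto simp: mult_left_le_one_le)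
  qed (use t in auto)
  have "h integrable_on {0..t}"
    using assms by (intro integrable_continuous_real) (auto elim: continuous_on_subset)
  from has_integral_stretch_real[OF integrable_integral[OF this], of t] t im
  have "((\<lambda>x. h (t * x)) has_integral (1 / t) *\<^sub>R integral {0..t} h) {0..1}" by simp
  from integral_unique[OF this] t show ?thesis by simp
qed simp

text \<open>The iteration runs on functions of time and parameter together, in the uniform norm, so
  that the limit is jointly continuous. On a time interval of length 1 the bound \<open>r\<close>
  keeps the iterates in the ball and the Lipschitz constant 1/2 gives the contraction. Vector fields
  are brought to this form by rescaling time.\<close>

lemma picard_solution:
  fixes F :: "real \<times> ('p::topological_space \<times> 'e::euclidean_space) \<Rightarrow> 'e"
  assumes cont: "continuous_on ({0..1} \<times> (K \<times> cball 0 r)) F" and r: "r > 0"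
    and bd: "\<And>t p w. t \<in> {0..1} \<Longrightarrow> p \<in> K \<Longrightarrow> norm w \<le> r \<Longrightarrow> norm (F (t, (p, w))) \<le> r"
    and lip: "\<And>t p w w'. t \<in> {0..1} \<Longrightarrow> p \<in> K \<Longrightarrow> norm w \<le> r \<Longrightarrow> norm w' \<le> r \<Longrightarrow>
       norm (F (t, (p, w)) - F (t, (p, w'))) \<le> 1/2 * norm (w - w')"
  obtains W where "continuous_on ({0..1} \<times> K) W"
    and "\<And>t p. t \<in> {0..1} \<Longrightarrow> p \<in> K \<Longrightarrow> norm (W (t, p)) \<le> r"
    and "\<And>p. p \<in> K \<Longrightarrow> W (0, p) = 0"
    and "\<And>t p. t \<in> {0..1} \<Longrightarrow> p \<in> K \<Longrightarrow>
       ((\<lambda>t. W (t, p)) has_vector_derivative F (t, (p, W (t, p)))) (at t within {0..1})"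
proof -
  define \<Phi> :: "(real \<times> 'p \<Rightarrow> 'e) \<Rightarrow> real \<times> 'p \<Rightarrow> 'e" where
    "\<Phi> W q = fst q *\<^sub>R integral {0..1} (\<lambda>s. F (fst q * s, (snd q, W (fst q * s, snd q))))" for W q
  define good :: "(real \<times> 'p \<Rightarrow> 'e) \<Rightarrow> bool" where
    "good W \<longleftrightarrow> continuous_on ({0..1} \<times> K) W \<and> (\<forall>q\<in>{0..1} \<times> K. norm (W q) \<le> r)" for W
  have contF: "continuous_on {0..1} (\<lambda>s. F (s, (p, W (s, p))))" if "good W" "p \<in> K" for W :: "real \<times> 'p \<Rightarrow> 'e" and p
  proof (rule continuous_on_compose2[OF cont])
    have "continuous_on {0..1} (\<lambda>s. W (s, p))"
      by (rule continuous_on_compose2[of "{0..1} \<times> K" W]) (use that in \<open>auto simp: good_def intro!: continuous_intros\<close>)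
    then show "continuous_on {0..1} (\<lambda>s. (s, (p, W (s, p))))" by (intro continuous_intros)
  qed (use that in \<open>auto simp: good_def\<close>)
  have \<Phi>_int: "\<Phi> W (t, p) = integral {0..t} (\<lambda>s. F (s, (p, W (s, p))))"
    if "good W" "p \<in> K" "t \<in> {0..1}" for W p t
    unfolding \<Phi>_def fst_conv snd_conv by (rule integral_rescale[OF contF[OF that(1,2)] that(3)])
  have good\<Phi>: "good (\<Phi> W)" if W: "good W" for W
    unfolding good_def
  proof safe
    have "continuous_on (({0..1} \<times> K) \<times> cbox 0 1)
       (\<lambda>(q, s). F (fst q * s, (snd q, W (fst q * s, snd q))))"
      unfolding split_beta
    proof (rule continuous_on_compose2[OF cont])
      have "continuous_on (({0..1} \<times> K) \<times> cbox 0 (1::real)) (\<lambda>x. W (fst (fst x) * snd x, snd (fst x)))"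
        by (rule continuous_on_compose2[of "{0..1} \<times> K" W])
          (use W in \<open>auto simp: good_def mult_le_one intro!: continuous_intros\<close>)
      then show "continuous_on (({0..1} \<times> K) \<times> cbox 0 (1::real))
         (\<lambda>x. (fst (fst x) * snd x, snd (fst x), W (fst (fst x) * snd x, snd (fst x))))"
        by (intro continuous_intros)
    qed (use W in \<open>auto simp: good_def mult_le_one\<close>)
    from integral_continuous_on_param[OF this]
    show "continuous_on ({0..1} \<times> K) (\<Phi> W)"
      unfolding \<Phi>_def by (intro continuous_intros) simp
    fix t p assume t: "t \<in> {0..1::real}" and p: "p \<in> K"
    have "norm (integral {0..t} (\<lambda>s. F (s, (p, W (s, p))))) \<le> r * (t - 0)"
    proof (rule integral_bound)
      show "continuous_on {0..t} (\<lambda>s. F (s, (p, W (s, p))))"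
        by (rule continuous_on_subset[OF contF[OF W p]]) (use t in auto)
    qed (use t W p bd in \<open>auto simp: good_def\<close>)
    then show "norm (\<Phi> W (t, p)) \<le> r"
      using \<Phi>_int[OF W p t] t r mult_left_le[of t r] by (simp add: order_trans[of _ "r * t" r])
  qed
  have contr: "norm (\<Phi> W q - \<Phi> W' q) \<le> 1/2 * d"
    if W: "good W" and W': "good W'" and d: "\<And>q. q \<in> {0..1} \<times> K \<Longrightarrow> norm (W q - W' q) \<le> d"
      and q: "q \<in> {0..1} \<times> K" for W W' d q
  proof -
    obtain t p where tp: "q = (t, p)" "t \<in> {0..1}" "p \<in> K" using q by auto
    have sub: "{0..t} \<subseteq> {0..1}" using tp by auto
    note c = contF[OF W tp(3), THEN continuous_on_subset, OF sub]
      contF[OF W' tp(3), THEN continuous_on_subset, OF sub]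
    have "norm (\<Phi> W q - \<Phi> W' q) =
       norm (integral {0..t} (\<lambda>s. F (s, (p, W (s, p))) - F (s, (p, W' (s, p)))))"
      unfolding tp(1) \<Phi>_int[OF W tp(3,2)] \<Phi>_int[OF W' tp(3,2)]
      by (simp add: integral_diff c integrable_continuous_real)
    also have "\<dots> \<le> (1/2 * d) * (t - 0)"
    proof (rule integral_bound)
      fix s assume s: "s \<in> {0..t}"
      have "norm (F (s, (p, W (s, p))) - F (s, (p, W' (s, p)))) \<le> 1/2 * norm (W (s, p) - W' (s, p))"
        using lip s tp W W' by (auto simp: good_def)
      also have "\<dots> \<le> 1/2 * d" using d[of "(s, p)"] s tp by auto
      finally show "norm (F (s, (p, W (s, p))) - F (s, (p, W' (s, p)))) \<le> 1/2 * d" .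
    qed (use tp c in \<open>auto intro!: continuous_on_diff\<close>)
    also have "\<dots> \<le> 1/2 * d"
    proof -
      have "0 \<le> d" using d[OF q] norm_ge_zero order_trans by blast
      then show ?thesis using tp by (auto simp: mult_left_le)
    qed
    finally show ?thesis .
  qed
  define W where "W n = (\<Phi> ^^ n) (\<lambda>q. 0)" for n
  have W0: "W 0 = (\<lambda>q. 0)" and WS: "W (Suc n) = \<Phi> (W n)" for n by (auto simp: W_def)
  have goodW: "good (W n)" for n
    by (induction n) (use r in \<open>auto simp: W0 WS good\<Phi> good_def[of "\<lambda>q. 0"]\<close>)
  have diff: "norm (W (Suc n) q - W n q) \<le> (1/2)^n * r" if "q \<in> {0..1} \<times> K" for n q
    using that
  proof (induction n arbitrary: q)
    case 0
    then show ?case using goodW[of 1] by (auto simp: W0 good_def)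
  next
    case (Suc n)
    then show ?case using contr[OF goodW goodW, of "Suc n" n "(1/2)^n * r"] by (simp add: WS)
  qed
  define V where "V q = (\<Sum>n. W (Suc n) q - W n q)" for q
  have "uniform_limit ({0..1} \<times> K) (\<lambda>n q. \<Sum>i<n. W (Suc i) q - W i q) V sequentially"
    unfolding V_def
    by (rule Weierstrass_m_test[OF diff]) (auto intro!: summable_mult2 summable_geometric)
  moreover have "(\<Sum>i<n. W (Suc i) q - W i q) = W n q" for n q
    using sum_lessThan_telescope[of "\<lambda>i. W i q" n] by (simp add: W0)
  ultimately have lim: "uniform_limit ({0..1} \<times> K) W V sequentially" by simp
  have contV: "continuous_on ({0..1} \<times> K) V"
    by (rule uniform_limit_theorem[OF _ lim]) (use goodW in \<open>auto simp: good_def\<close>)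
  have Vr: "norm (V q) \<le> r" if "q \<in> {0..1} \<times> K" for q
    using tendsto_uniform_limitI[OF lim that] goodW that
    by (intro Lim_norm_ubound[of sequentially "\<lambda>n. W n q"]) (auto simp: good_def)
  have goodV: "good V" using contV Vr by (simp add: good_def)
  have fix_V: "\<Phi> V q = V q" if q: "q \<in> {0..1} \<times> K" for q
  proof -
    have "norm (\<Phi> V q - V q) \<le> e" if e: "e > 0" for e
    proof -
      have e2: "e/2 > 0" using e by simp
      obtain N where N: "\<And>n q. n \<ge> N \<Longrightarrow> q \<in> {0..1} \<times> K \<Longrightarrow> dist (W n q) (V q) < e/2"
        using uniform_limitD[OF lim e2] unfolding eventually_sequentially by blast
      have "norm (\<Phi> V q - \<Phi> (W N) q) \<le> 1/2 * (e/2)"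
        by (rule contr[OF goodV goodW _ q]) (use N in \<open>auto simp: dist_norm norm_minus_commute less_imp_le\<close>)
      moreover have "norm (W (Suc N) q - V q) < e/2" using N[of "Suc N" q] q by (simp add: dist_norm)
      ultimately show ?thesis
        using norm_triangle_ineq[of "\<Phi> V q - \<Phi> (W N) q" "W (Suc N) q - V q"] e by (simp add: WS)
    qed
    then show ?thesis using field_le_epsilon[of "norm (\<Phi> V q - V q)" 0] by simp
  qed
  show thesis
  proof (rule that[of V])
    show "V (0, p) = 0" if "p \<in> K" for p using fix_V[of "(0, p)"] that by (simp add: \<Phi>_def)
    fix t p assume t: "t \<in> {0..1::real}" and p: "p \<in> K"
    have "((\<lambda>t. integral {0..t} (\<lambda>s. F (s, (p, V (s, p))))) has_vector_derivative F (t, (p, V (t, p)))) (at t within {0..1})"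
      by (rule integral_has_vector_derivative[OF contF[OF goodV p] t])
    then show "((\<lambda>t. V (t, p)) has_vector_derivative F (t, (p, V (t, p)))) (at t within {0..1})"
      by (rule has_vector_derivative_transform[OF t, rotated]) (use fix_V \<Phi>_int[OF goodV p] p in auto)
  qed (use contV Vr in auto)
qed

text \<open>In the role of Gronwall's inequality: where \<open>norm (D t)\<close> attains its
  maximum m on [0, 1], the mean value inequality gives m \<le> c m + e, and c < 1 allows m to be
  absorbed. With e = 0 it expresses uniqueness of solutions.\<close>

lemma growth_bound:
  fixes D :: "real \<Rightarrow> 'a::real_normed_vector"
  assumes D: "\<And>t. t \<in> {0..1} \<Longrightarrow> (D has_vector_derivative D' t) (at t within {0..1})"
    and D0: "D 0 = 0" and c: "0 \<le> c" "c < 1"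
    and b: "\<And>t. t \<in> {0..1} \<Longrightarrow> norm (D' t) \<le> c * norm (D t) + e"
    and t: "t \<in> {0..1}"
  shows "norm (D t) \<le> e / (1 - c)"
proof -
  have "continuous_on {0..1} (\<lambda>t. norm (D t))"
    using has_vector_derivative_continuous[OF D]
    by (intro continuous_on_norm) (auto simp: continuous_on_eq_continuous_within)
  then obtain s where s: "s \<in> {0..1}" "\<And>t. t \<in> {0..1} \<Longrightarrow> norm (D t) \<le> norm (D s)"
    using continuous_attains_sup[of "{0..1::real}" "\<lambda>t. norm (D t)"] by auto
  have "norm (D s - D 0) \<le> (c * norm (D s) + e) * norm (s - 0)"
  proof (rule differentiable_bound[where S = "{0..1}" and f' = "\<lambda>t h. h *\<^sub>R D' t"])
    show "onorm (\<lambda>h. h *\<^sub>R D' x) \<le> c * norm (D s) + e" if "x \<in> {0..1}" for x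
    proof (rule onorm_le)
      fix h
      have "norm (D' x) \<le> c * norm (D s) + e"
        using b[OF that] mult_left_mono[OF s(2)[OF that] c(1)] by linarith
      then show "norm (h *\<^sub>R D' x) \<le> (c * norm (D s) + e) * norm h"
        using mult_right_mono[of "norm (D' x)" "c * norm (D s) + e" "\<bar>h\<bar>"]
        by (simp add: mult.commute)
    qed
  qed (use D s in \<open>auto simp: has_vector_derivative_def\<close>)
  also have "\<dots> \<le> c * norm (D s) + e"
  proof -
    have "0 \<le> c * norm (D s) + e" using b[OF s(1)] norm_ge_zero order_trans by blast
    then show ?thesis using s(1) by (auto simp: mult_left_le)
  qed
  finally have "norm (D s) * (1 - c) \<le> e" using D0 by (simp add: algebra_simps)
  then have "norm (D s) \<le> e / (1 - c)" using c by (simp add: pos_le_divide_eq)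
  then show ?thesis using s(2)[OF t] by linarith
qed

section \<open>Dependence of solutions on parameters\<close>

lemma compact_tube:
  fixes g :: "real \<times> 'q::euclidean_space \<Rightarrow> 'b::metric_space"
  assumes g: "continuous_on ({0..1} \<times> Q) g" and Q: "open Q"
    and q: "continuous_on {0..1} q" "\<And>t. t \<in> {0..1} \<Longrightarrow> q t \<in> Q" and e: "e > 0"
  obtains d where "d > 0" "\<And>t x. t \<in> {0..1} \<Longrightarrow> dist x (q t) < d \<Longrightarrow> x \<in> Q \<and> dist (g (t, x)) (g (t, q t)) < e"
proof -
  have cq: "compact (q ` {0..1})" by (intro compact_continuous_image q) simp
  obtain r where r: "r > 0" "(\<Union>x\<in>q ` {0..1}. cball x r) \<subseteq> Q"
    using compact_subset_open_imp_cball_epsilon_subset[OF cq Q] q(2) by blast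
  \<comment> \<open>The closed \<open>r\<close>-neighbourhood of the curve, written as a sum of two
    compact sets.\<close>
  define S where "S = (\<lambda>z. fst z + snd z) ` (q ` {0..1} \<times> cball 0 r)"
  have cS: "compact S" unfolding S_def
    by (intro compact_continuous_image compact_Times cq compact_cball continuous_intros)
  have S: "x \<in> S" if "t \<in> {0..1}" "dist x (q t) \<le> r" for x t
    unfolding S_def using that
    by (intro image_eqI[of _ _ "(q t, x - q t)"]) (auto simp: dist_norm norm_minus_commute)
  have "S \<subseteq> Q"
  proof
    fix z assume "z \<in> S"
    then obtain t y where "t \<in> {0..1}" "z = q t + y" "norm y \<le> r" by (auto simp: S_def)
    then have "z \<in> cball (q t) r" by (simp add: dist_norm)
    then show "z \<in> Q" using r \<open>t \<in> {0..1}\<close> by blast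
  qed
  then have "uniformly_continuous_on ({0..1} \<times> S) g"
    by (intro compact_uniformly_continuous compact_Times cS continuous_on_subset[OF g]) auto
  then obtain d where d: "d > 0" "\<And>x x'. x \<in> {0..1} \<times> S \<Longrightarrow> x' \<in> {0..1} \<times> S \<Longrightarrow> dist x' x < d \<Longrightarrow> dist (g x') (g x) < e"
    using e unfolding uniformly_continuous_on_def by metis
  show thesis
  proof (rule that[of "min d r"])
    fix t x assume t: "t \<in> {0..1::real}" and x: "dist x (q t) < min d r"
    have "(t, x) \<in> {0..1} \<times> S" "(t, q t) \<in> {0..1} \<times> S" using S[of t] t x r by auto
    moreover have "dist (t, x) (t, q t) < d" using x by (simp add: dist_Pair_Pair)
    ultimately have "dist (g (t, x)) (g (t, q t)) < e" by (intro d(2))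
    then show "x \<in> Q \<and> dist (g (t, x)) (g (t, q t)) < e"
      using S[of t x] t x \<open>S \<subseteq> Q\<close> by auto
  qed (use d r in simp)
qed

lemma continuous_on_local:
  fixes f :: "'a::t2_space \<Rightarrow> 'b::topological_space"
  assumes "\<And>x. x \<in> S \<Longrightarrow> \<exists>T. open T \<and> x \<in> T \<and> continuous_on (S \<inter> T) f"
  shows "continuous_on S f"
  unfolding continuous_on_eq_continuous_within
proof
  fix x assume x: "x \<in> S"
  then obtain T where T: "open T" "x \<in> T" "continuous_on (S \<inter> T) f" using assms by blast
  have "at x within S \<inter> T = at x within S"
    by (rule at_within_nhd[OF T(2,1)]) auto
  then show "continuous (at x within S) f"
    using T x unfolding continuous_on_eq_continuous_within by (metis IntI)
qed

text \<open>The right-hand side is Lipschitz in w on the whole space, so existence is local in the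
  parameter only: a closed ball of parameters bounds G at w = 0, which fixes an invariant ball.
  Solutions over overlapping parameter balls agree by uniqueness and are glued.\<close>

lemma linear_ode_solution:
  fixes G :: "real \<times> ('p::euclidean_space \<times> 'e::euclidean_space) \<Rightarrow> 'e"
  assumes U: "open U" and cont: "continuous_on ({0..1} \<times> (U \<times> UNIV)) G"
    and lip: "\<And>t p w w'. t \<in> {0..1} \<Longrightarrow> p \<in> U \<Longrightarrow>
       norm (G (t, (p, w)) - G (t, (p, w'))) \<le> 1/2 * norm (w - w')"
  obtains Z where "continuous_on ({0..1} \<times> U) Z" and "\<And>p. p \<in> U \<Longrightarrow> Z (0, p) = 0"
    and "\<And>t p. t \<in> {0..1} \<Longrightarrow> p \<in> U \<Longrightarrow>
       ((\<lambda>t. Z (t, p)) has_vector_derivative G (t, (p, Z (t, p)))) (at t within {0..1})"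
proof -
  define sol where "sol B Z \<longleftrightarrow> continuous_on ({0..1} \<times> B) Z \<and> (\<forall>p\<in>B. Z (0, p) = 0) \<and>
    (\<forall>t\<in>{0..1}. \<forall>p\<in>B. ((\<lambda>t. Z (t, p)) has_vector_derivative G (t, (p, Z (t, p)))) (at t within {0..1}))"
    for B Z
  have uniq: "Z (t, p) = Z' (t, p)" if "sol B Z" "sol B' Z'" "p \<in> B" "p \<in> B'" "p \<in> U" "t \<in> {0..1}" for B B' Z Z' t p
  proof -
    have "norm (Z (t, p) - Z' (t, p)) \<le> 0 / (1 - 1/2)"
      by (rule growth_bound[where D = "\<lambda>t. Z (t, p) - Z' (t, p)" and c = "1/2",
            OF has_vector_derivative_diff])
        (use that lip in \<open>auto simp: sol_def\<close>)
    then show ?thesis by simp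
  qed
  have "\<exists>d>0. \<exists>Z. ball p0 d \<subseteq> U \<and> sol (ball p0 d) Z" if p0: "p0 \<in> U" for p0
  proof -
    obtain d where d: "d > 0" "cball p0 d \<subseteq> U" using U p0 open_contains_cball by blast
    have "compact ((\<lambda>q. norm (G (fst q, (snd q, 0)))) ` ({0..1} \<times> cball p0 d))"
      by (intro compact_continuous_image compact_Times continuous_on_norm
          continuous_on_compose2[OF cont] continuous_intros) (use d in auto)
    then obtain b where b: "\<And>t p. t \<in> {0..1} \<Longrightarrow> p \<in> cball p0 d \<Longrightarrow> norm (G (t, (p, 0))) \<le> b"
      by (fastforce dest: compact_imp_bounded simp: bounded_iff)
    have b0: "b \<ge> 0" using order_trans[OF norm_ge_zero b[of 0 p0]] d by simp
    \<comment> \<open>Chosen so that \<open>b + r / 2 \<le> r\<close>, which makes the ball of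
      radius \<open>r\<close> invariant; the 1 keeps it positive.\<close>
    define r where "r = 2 * b + 1"
    obtain W where "continuous_on ({0..1} \<times> cball p0 d) W"
      and "\<And>p. p \<in> cball p0 d \<Longrightarrow> W (0, p) = 0"
      and "\<And>t p. t \<in> {0..1} \<Longrightarrow> p \<in> cball p0 d \<Longrightarrow>
       ((\<lambda>t. W (t, p)) has_vector_derivative G (t, (p, W (t, p)))) (at t within {0..1})"
    proof (rule picard_solution[of "cball p0 d" r G])
      show "continuous_on ({0..1} \<times> cball p0 d \<times> cball 0 r) G"
        by (rule continuous_on_subset[OF cont]) (use d in auto)
      fix t p w assume *: "t \<in> {0..1::real}" "p \<in> cball p0 d" "norm (w::'e) \<le> r"
      have "norm (G (t, (p, w))) \<le> norm (G (t, (p, 0))) + norm (G (t, (p, w)) - G (t, (p, 0)))"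
        by (rule norm_triangle_sub)
      also have "\<dots> \<le> b + 1/2 * r"
        using b[OF *(1,2)] lip[of t p w 0] * d by fastforce
      finally show "norm (G (t, (p, w))) \<le> r" using b0 by (simp add: r_def field_simps)
    qed (use lip d b0 in \<open>auto simp: r_def\<close>)
    then have "sol (ball p0 d) W"
      unfolding sol_def using ball_subset_cball[of p0 d] by (auto elim!: continuous_on_subset)
    moreover have "ball p0 d \<subseteq> U" using d ball_subset_cball by blast
    ultimately show ?thesis using d by blast
  qed
  then obtain d S where dS: "\<And>p. p \<in> U \<Longrightarrow> d p > 0 \<and> ball p (d p) \<subseteq> U \<and> sol (ball p (d p)) (S p)"
    by metis
  define Z where "Z q = S (snd q) q" for q
  have Zeq: "Z (t, p) = S p0 (t, p)" if "p0 \<in> U" "p \<in> ball p0 (d p0)" "t \<in> {0..1}" for t p p0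
  proof -
    have pU: "p \<in> U" using dS[OF that(1)] that by auto
    show ?thesis unfolding Z_def snd_conv
      by (rule uniq[of "ball p (d p)" "S p" "ball p0 (d p0)" "S p0"]) (use dS pU that in auto)
  qed
  show thesis
  proof (rule that[of Z])
    show "continuous_on ({0..1} \<times> U) Z"
    proof (rule continuous_on_local)
      fix x assume "x \<in> {0..1::real} \<times> U"
      then obtain t p0 where x: "x = (t, p0)" "t \<in> {0..1}" "p0 \<in> U" by auto
      have "continuous_on ({0..1} \<times> ball p0 (d p0)) Z"
        by (rule continuous_on_eq[of _ "S p0"]) (use dS[OF x(3)] Zeq[OF x(3)] in \<open>auto simp: sol_def\<close>)
      then have "continuous_on ({0..1} \<times> U \<inter> UNIV \<times> ball p0 (d p0)) Z"
        by (rule continuous_on_subset) auto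
      then show "\<exists>T. open T \<and> x \<in> T \<and> continuous_on ({0..1} \<times> U \<inter> T) Z"
        using x dS[OF x(3)] by (intro exI[of _ "UNIV \<times> ball p0 (d p0)"]) (auto intro: open_Times)
    qed
    show "Z (0, p) = 0" if "p \<in> U" for p
      using dS[OF that] by (auto simp: Z_def sol_def)
    show "((\<lambda>t. Z (t, p)) has_vector_derivative G (t, (p, Z (t, p)))) (at t within {0..1})"
      if "t \<in> {0..1}" "p \<in> U" for t p
      using dS[OF that(2)] that by (auto simp: Z_def sol_def)
  qed
qed

text \<open>\<open>Z v\<close> solves the equation linearised along \<open>W\<close>. The increment
  of \<open>W\<close> in direction h satisfies that linear equation up to an error e times
  \<open>norm h\<close>, and \<open>growth_bound\<close> converts this into closeness to
  \<open>Z h\<close> on all of [0, 1].\<close>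

lemma param_ode_derivative:
  fixes F :: "real \<times> ('p::euclidean_space \<times> 'e::euclidean_space) \<Rightarrow> 'e"
  assumes U: "open U" and O: "open Q" and F: "CkP (Suc 0) ({0..1} \<times> (U \<times> Q)) F"
    and half: "\<And>t p w z. t \<in> {0..1} \<Longrightarrow> p \<in> U \<Longrightarrow> w \<in> Q \<Longrightarrow>
        norm (slice_deriv F (0, z) (t, (p, w))) \<le> 1/2 * norm z"
    and W: "continuous_on ({0..1} \<times> U) W" "\<And>t p. t \<in> {0..1} \<Longrightarrow> p \<in> U \<Longrightarrow> W (t, p) \<in> Q"
      "\<And>p. p \<in> U \<Longrightarrow> W (0, p) = 0"
      "\<And>t p. t \<in> {0..1} \<Longrightarrow> p \<in> U \<Longrightarrow>
       ((\<lambda>t. W (t, p)) has_vector_derivative F (t, (p, W (t, p)))) (at t within {0..1})"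
    and Z: "\<And>p v. p \<in> U \<Longrightarrow> Z v (0, p) = 0"
      "\<And>t p v. t \<in> {0..1} \<Longrightarrow> p \<in> U \<Longrightarrow>
       ((\<lambda>t. Z v (t, p)) has_vector_derivative slice_deriv F (v, Z v (t, p)) (t, (p, W (t, p)))) (at t within {0..1})"
    and p0: "p0 \<in> U" and t0: "t0 \<in> {0..1}"
  shows "((\<lambda>p. W (t0, p)) has_derivative (\<lambda>v. Z v (t0, p0))) (at p0)"
proof -
  define q where "q t = (p0, W (t, p0))" for t
  have UQ: "open (U \<times> Q)" using U O by (rule open_Times)
  have DF: "((\<lambda>x. F (t, x)) has_derivative (\<lambda>v. slice_deriv F v (t, x))) (at x)"
    if "t \<in> {0..1}" "x \<in> U \<times> Q" for t x
    by (rule CkP_SucD[OF F]) (use that in auto)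
  have qc: "continuous_on {0..1} q" unfolding q_def
    by (intro continuous_intros continuous_on_compose2[OF W(1)]) (use p0 in auto)
  have qQ: "q t \<in> U \<times> Q" if "t \<in> {0..1}" for t using that p0 W by (auto simp: q_def)
  have linF: "linear (\<lambda>v. slice_deriv F v (t, q t))" if "t \<in> {0..1}" for t
    using has_derivative_linear[OF DF[OF that qQ[OF that]]] .
  \<comment> \<open>Linearisation of \<open>F\<close> with one distance \<open>d\<close> for the
    whole curve \<open>q\<close>. In a tube around this compact curve each partial derivative moves
    by less than \<open>e'\<close>, and summing over the basis costs the dimension by which
    \<open>e\<close> is divided.\<close>
  have near: "\<exists>d>0. \<forall>t\<in>{0..1}. \<forall>k. norm k < d \<longrightarrow>
      norm (F (t, q t + k) - F (t, q t) - slice_deriv F k (t, q t)) \<le> e * norm k" if e: "e > 0" for e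
  proof -
    define g where "g x = (\<Sum>b\<in>Basis. slice_deriv F b x)" for x
    define e' where "e' = e / DIM('p \<times> 'e)"
    have e': "e' > 0" unfolding e'_def by (intro divide_pos_pos e of_nat_0_less_iff[THEN iffD2] DIM_positive)
    have "\<exists>d>0. \<forall>t x. t \<in> {0..1} \<longrightarrow> dist x (q t) < d \<longrightarrow>
        x \<in> U \<times> Q \<and> dist (slice_deriv F b (t, x)) (slice_deriv F b (t, q t)) < e'" for b
    proof (rule compact_tube[OF _ UQ qc qQ e', of "slice_deriv F b"])
      show "continuous_on ({0..1} \<times> (U \<times> Q)) (slice_deriv F b)"
        using F CkP.simps(1,2) by blast
    qed auto
    then obtain d where d: "\<And>b. d b > 0" "\<And>b t x. t \<in> {0..1} \<Longrightarrow> dist x (q t) < d b \<Longrightarrow>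
        x \<in> U \<times> Q \<and> dist (slice_deriv F b (t, x)) (slice_deriv F b (t, q t)) < e'" by metis
    define d0 where "d0 = Min (d ` Basis)"
    have d0: "d0 > 0" "\<And>b. b \<in> Basis \<Longrightarrow> d0 \<le> d b" using d(1) by (auto simp: d0_def)
    have "norm (F (t, q t + k) - F (t, q t) - slice_deriv F k (t, q t)) \<le> e * norm k"
      if t: "t \<in> {0..1}" and k: "norm k < d0" for t k
    proof -
      have inb: "x \<in> U \<times> Q \<and> (\<forall>b\<in>Basis. dist (slice_deriv F b (t, x)) (slice_deriv F b (t, q t)) < e')"
        if "x \<in> ball (q t) d0" for x
      proof -
        have "dist x (q t) < d b" if "b \<in> Basis" for b
          using d0(2)[OF that] \<open>x \<in> ball (q t) d0\<close> by (simp add: dist_commute)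
        moreover obtain b :: "'p \<times> 'e" where "b \<in> Basis" using nonempty_Basis by blast
        ultimately show ?thesis using d(2)[OF t] by blast
      qed
      have "norm (F (t, q t + k) - F (t, q t) - (\<lambda>v. slice_deriv F v (t, q t)) (q t + k - q t)) \<le> norm (q t + k - q t) * e"
      proof (rule differentiable_bound_linearization[where S = "ball (q t) d0" and f' = "\<lambda>x v. slice_deriv F v (t, x)"])
        show "q t + s *\<^sub>R (q t + k - q t) \<in> ball (q t) d0" if "s \<in> {0..1}" for s
        proof -
          have "norm (s *\<^sub>R k) \<le> norm k" using that by (simp add: mult_left_le_one_le)
          then show ?thesis using k by (simp add: dist_norm)
        qed
        show "((\<lambda>x. F (t, x)) has_derivative (\<lambda>v. slice_deriv F v (t, x))) (at x within ball (q t) d0)"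
          if "x \<in> ball (q t) d0" for x
          using DF[OF t] inb[OF that] has_derivative_at_withinI by blast
        show "onorm ((\<lambda>v. slice_deriv F v (t, x)) - (\<lambda>v. slice_deriv F v (t, q t))) \<le> e"
          if x: "x \<in> ball (q t) d0" for x
        proof (rule onorm_le)
          fix v :: "'p \<times> 'e"
          have l: "linear (\<lambda>v. slice_deriv F v (t, x))" using has_derivative_linear DF[OF t] inb[OF x] by blast
          have "linear (\<lambda>v. slice_deriv F v (t, x) - slice_deriv F v (t, q t))"
            by (rule linear_compose_sub[OF l linF[OF t]])
          from linear_expand[OF this]
          have "slice_deriv F v (t, x) - slice_deriv F v (t, q t) =
             (\<Sum>b\<in>Basis. (v \<bullet> b) *\<^sub>R (slice_deriv F b (t, x) - slice_deriv F b (t, q t)))" .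
          also have "norm \<dots> \<le> (\<Sum>b\<in>(Basis :: ('p \<times> 'e) set). norm v * e')"
            by (rule order_trans[OF norm_sum sum_mono])
              (use inb[OF x] in \<open>auto simp: dist_norm less_imp_le intro!: mult_mono Basis_le_norm\<close>)
          also have "\<dots> = e * norm v"
            using DIM_positive[where 'a = 'p] by (simp add: e'_def add_pos_pos field_simps add_nonneg_eq_0_iff)
          finally show "norm (((\<lambda>v. slice_deriv F v (t, x)) - (\<lambda>v. slice_deriv F v (t, q t))) v) \<le> e * norm v"
            by simp
        qed
        show "q t \<in> ball (q t) d0" using d0 by simp
      qed
      then show ?thesis by (simp add: mult.commute)
    qed
    then show ?thesis using d0(1) by blast
  qed
  obtain C where C: "C \<ge> 0" "\<And>t h. t \<in> {0..1} \<Longrightarrow> norm (slice_deriv F (h, 0) (t, q t)) \<le> C * norm h"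
  proof -
    have "\<exists>B. \<forall>t\<in>{0..1}. norm (slice_deriv F (b, 0) (t, q t)) \<le> B" for b :: 'p
    proof -
      have "continuous_on ({0..1} \<times> (U \<times> Q)) (slice_deriv F (b, 0))" using F by simp
      then have "continuous_on {0..1} (\<lambda>t. slice_deriv F (b, 0) (t, q t))"
      proof (rule continuous_on_compose2)
        show "continuous_on {0..1} (\<lambda>t. (t, q t))" by (intro continuous_intros qc)
        show "(\<lambda>t. (t, q t)) ` {0..1} \<subseteq> {0..1} \<times> (U \<times> Q)" using qQ by blast
      qed
      then have "compact ((\<lambda>t. slice_deriv F (b, 0) (t, q t)) ` {0..1})"
        by (rule compact_continuous_image) simp
      then show ?thesis by (fastforce dest: compact_imp_bounded simp: bounded_iff)
    qed
    then obtain B where B: "\<And>b t. t \<in> {0..1} \<Longrightarrow> norm (slice_deriv F (b :: 'p, 0) (t, q t)) \<le> B b" by metis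
    have B0: "B b \<ge> 0" for b using order_trans[OF norm_ge_zero B[of 0 b]] by simp
    show thesis
    proof (rule that[of "sum B Basis"])
      show "0 \<le> sum B Basis" using B0 by (rule sum_nonneg)
      fix t h assume t: "t \<in> {0..1::real}"
      have "linear (\<lambda>h. slice_deriv F (h, 0) (t, q t))"
        using linear_compose[of "\<lambda>h. (h, 0)" "\<lambda>v. slice_deriv F v (t, q t)"] linF[OF t]
        by (simp add: o_def linear_iff)
      from linear_expand[OF this, of h]
      have "norm (slice_deriv F (h, 0) (t, q t)) = norm (\<Sum>b\<in>Basis. (h \<bullet> b) *\<^sub>R slice_deriv F (b, 0) (t, q t))" by simp
      also have "\<dots> \<le> (\<Sum>b\<in>Basis. norm h * B b)"
        by (rule order_trans[OF norm_sum sum_mono])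
          (use B[OF t] in \<open>auto intro!: mult_mono Basis_le_norm\<close>)
      finally show "norm (slice_deriv F (h, 0) (t, q t)) \<le> sum B Basis * norm h"
        by (simp add: sum_distrib_left mult.commute)
    qed
  qed
  have split: "slice_deriv F (h, y) (t, q t) = slice_deriv F (h, 0) (t, q t) + slice_deriv F (0, y) (t, q t)"
    if "t \<in> {0..1}" for t h y
    using linear_add[OF linF[OF that], of "(h, 0)" "(0, y)"] by simp
  have halfq: "norm (slice_deriv F (0, y) (t, q t)) \<le> 1/2 * norm y" if "t \<in> {0..1}" for t y
    using half[OF that p0 W(2)[OF that p0], of y] by (simp add: q_def)
  have tubeW: "\<exists>d>0. \<forall>t\<in>{0..1}. \<forall>h. norm h < d \<longrightarrow> p0 + h \<in> U \<and> norm (W (t, p0 + h) - W (t, p0)) < e"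
    if e: "e > 0" for e
  proof (rule compact_tube[OF W(1) U _ _ e, of "\<lambda>_. p0"])
    fix d assume "d > 0" and d: "\<And>t x. t \<in> {0..1} \<Longrightarrow> dist x p0 < d \<Longrightarrow> x \<in> U \<and> dist (W (t, x)) (W (t, p0)) < e"
    then show ?thesis using d[of _ "p0 + _"] by (intro exI[of _ d]) (auto simp: dist_norm)
  qed (use p0 in auto)
  \<comment> \<open>The factors come from \<open>growth_bound\<close>: 4 is 1 / (1 - 3/4) in the
    bound for the increment \<open>y\<close>, and the leading 2 is 1 / (1 - 1/2) in the bound for
    its distance to \<open>Z h\<close>.\<close>
  have est: "\<exists>d>0. \<forall>h. norm h < d \<longrightarrow>
      norm (W (t0, p0 + h) - W (t0, p0) - Z h (t0, p0)) \<le> 2 * (e * (1 + 4 * (C + 1))) * norm h"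
    if e: "e > 0" "e \<le> 1/4" for e
  proof -
    obtain d1 where d1: "d1 > 0" "\<And>t k. t \<in> {0..1} \<Longrightarrow> norm k < d1 \<Longrightarrow>
      norm (F (t, q t + k) - F (t, q t) - slice_deriv F k (t, q t)) \<le> e * norm k"
      using near[OF e(1)] by blast
    obtain d2 where d2: "d2 > 0" "\<And>t h. t \<in> {0..1} \<Longrightarrow> norm h < d2 \<Longrightarrow> p0 + h \<in> U \<and> norm (W (t, p0 + h) - W (t, p0)) < d1 / 2"
      using tubeW[of "d1 / 2"] d1(1) by auto
    have "norm (W (t0, p0 + h) - W (t0, p0) - Z h (t0, p0)) \<le> 2 * (e * (1 + 4 * (C + 1))) * norm h"
      if h: "norm h < min (d1 / 2) d2" for h
    proof -
      have hU: "p0 + h \<in> U" using d2(2)[of 0 h] h by auto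
      define y where "y t = W (t, p0 + h) - W (t, p0)" for t
      define y' where "y' t = F (t, (p0 + h, W (t, p0 + h))) - F (t, q t)" for t
      have dy: "(y has_vector_derivative y' t) (at t within {0..1})" if "t \<in> {0..1}" for t
        unfolding y_def[abs_def] y'_def q_def
        by (intro has_vector_derivative_diff W(4) that hU p0)
      have y0: "y 0 = 0" using W(3) hU p0 by (simp add: y_def)
      have k: "norm (h, y t) \<le> norm h + norm (y t)" for t
        by (metis norm_Pair sqrt_sum_squares_le_sum norm_ge_zero)
      have lin: "norm (y' t - slice_deriv F (h, y t) (t, q t)) \<le> e * (norm h + norm (y t))" if t: "t \<in> {0..1}" for t
      proof -
        have "norm (h, y t) < d1" using k[of t] d2(2)[OF t, of h] h by (auto simp: y_def)
        moreover have "q t + (h, y t) = (p0 + h, W (t, p0 + h))" by (simp add: q_def y_def)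
        ultimately have "norm (y' t - slice_deriv F (h, y t) (t, q t)) \<le> e * norm (h, y t)"
          using d1(2)[OF t, of "(h, y t)"] by (simp add: y'_def)
        also have "\<dots> \<le> e * (norm h + norm (y t))" using k e by (intro mult_left_mono) auto
        finally show ?thesis .
      qed
      \<comment> \<open>3/4 is 1/2 from the Lipschitz bound plus 1/4 from the linearisation error;
        the restriction \<open>e \<le> 1/4\<close> serves to keep this sum below 1.\<close>
      have y'b: "norm (y' t) \<le> 3/4 * norm (y t) + (C + 1) * norm h" if t: "t \<in> {0..1}" for t
      proof -
        have "norm (y' t) \<le> norm (slice_deriv F (h, y t) (t, q t)) + norm (y' t - slice_deriv F (h, y t) (t, q t))"
          by (rule norm_triangle_sub)
        moreover have "norm (slice_deriv F (h, y t) (t, q t)) \<le> C * norm h + 1/2 * norm (y t)"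
          unfolding split[OF t, of h "y t"] by (intro norm_triangle_le add_mono C(2) halfq t)
        moreover have "norm (y' t - slice_deriv F (h, y t) (t, q t)) \<le> 1/4 * (norm h + norm (y t))"
          using lin[OF t] mult_right_mono[OF e(2), of "norm h + norm (y t)"] by simp
        ultimately show ?thesis using norm_ge_zero[of h] unfolding distrib_right distrib_left by linarith
      qed
      have yb: "norm (y t) \<le> 4 * (C + 1) * norm h" if t: "t \<in> {0..1}" for t
        using growth_bound[of y y' "3/4" "(C + 1) * norm h" t, OF dy y0 _ _ y'b t]
        by (simp add: algebra_simps)
      have "norm (y t0 - Z h (t0, p0)) \<le> (e * (1 + 4 * (C + 1)) * norm h) / (1 - 1/2)"
      proof (rule growth_bound[where D = "\<lambda>t. y t - Z h (t, p0)" and c = "1/2" and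
            D' = "\<lambda>t. y' t - slice_deriv F (h, Z h (t, p0)) (t, q t)", OF _ _ _ _ _ t0])
        show "((\<lambda>t. y t - Z h (t, p0)) has_vector_derivative (y' t - slice_deriv F (h, Z h (t, p0)) (t, q t))) (at t within {0..1})"
          if "t \<in> {0..1}" for t
          using Z(2)[OF that p0, of h] unfolding q_def by (intro has_vector_derivative_diff dy that)
        show "y 0 - Z h (0, p0) = 0" using y0 Z(1)[OF p0] by simp
        fix t :: real assume t: "t \<in> {0..1}"
        have eq: "y' t - slice_deriv F (h, Z h (t, p0)) (t, q t) =
          (y' t - slice_deriv F (h, y t) (t, q t)) + slice_deriv F (0, y t - Z h (t, p0)) (t, q t)"
          using linear_diff[OF linF[OF t], of "(h, y t)" "(h, Z h (t, p0))"] by simp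
        have "e * (norm h + norm (y t)) \<le> e * (norm h + 4 * (C + 1) * norm h)"
          using yb[OF t] e by (intro mult_left_mono add_left_mono) auto
        also have "\<dots> = e * (1 + 4 * (C + 1)) * norm h" by (simp add: algebra_simps)
        finally have "norm (y' t - slice_deriv F (h, y t) (t, q t)) \<le> e * (1 + 4 * (C + 1)) * norm h"
          using lin[OF t] by linarith
        then show "norm (y' t - slice_deriv F (h, Z h (t, p0)) (t, q t)) \<le>
            1/2 * norm (y t - Z h (t, p0)) + e * (1 + 4 * (C + 1)) * norm h"
          unfolding eq using halfq[OF t, of "y t - Z h (t, p0)"] by (intro norm_triangle_le) linarith
      qed auto
      then show ?thesis by (simp add: y_def)
    qed
    then show ?thesis using d1 d2 by (intro exI[of _ "min (d1 / 2) d2"]) auto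
  qed
  \<comment> \<open>Linearity in v follows from uniqueness: the defect \<open>?D\<close> starts at 0
    and solves the linearised equation without forcing term.\<close>
  have linZ: "linear (\<lambda>v. Z v (t0, p0))"
  proof -
    have comb: "Z (a *\<^sub>R u + b *\<^sub>R v) (t0, p0) = a *\<^sub>R Z u (t0, p0) + b *\<^sub>R Z v (t0, p0)" for a b u v
    proof -
      let ?D = "\<lambda>t. Z (a *\<^sub>R u + b *\<^sub>R v) (t, p0) - (a *\<^sub>R Z u (t, p0) + b *\<^sub>R Z v (t, p0))"
      have "norm (?D t0) \<le> 0 / (1 - 1/2)"
      proof (rule growth_bound[where D = ?D and c = "1/2" and e = 0 and
          D' = "\<lambda>t. slice_deriv F (a *\<^sub>R u + b *\<^sub>R v, Z (a *\<^sub>R u + b *\<^sub>R v) (t, p0)) (t, q t)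
           - (a *\<^sub>R slice_deriv F (u, Z u (t, p0)) (t, q t) + b *\<^sub>R slice_deriv F (v, Z v (t, p0)) (t, q t))",
          OF _ _ _ _ _ t0])
        show "(?D has_vector_derivative (slice_deriv F (a *\<^sub>R u + b *\<^sub>R v, Z (a *\<^sub>R u + b *\<^sub>R v) (t, p0)) (t, q t)
           - (a *\<^sub>R slice_deriv F (u, Z u (t, p0)) (t, q t) + b *\<^sub>R slice_deriv F (v, Z v (t, p0)) (t, q t)))) (at t within {0..1})"
          if t: "t \<in> {0..1}" for t
        proof -
          have sc: "((\<lambda>t. c *\<^sub>R Z w (t, p0)) has_vector_derivative c *\<^sub>R slice_deriv F (w, Z w (t, p0)) (t, q t)) (at t within {0..1})" for c w
            unfolding q_def by (rule bounded_linear.has_vector_derivative[OF bounded_linear_scaleR_right Z(2)[OF t p0]])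
          show ?thesis
            using has_vector_derivative_diff[OF sc[of 1 "a *\<^sub>R u + b *\<^sub>R v"] has_vector_derivative_add[OF sc[of a u] sc[of b v]]] by simp
        qed
        fix t :: real assume t: "t \<in> {0..1}"
        have "slice_deriv F (0, ?D t) (t, q t) = (slice_deriv F (a *\<^sub>R u + b *\<^sub>R v, Z (a *\<^sub>R u + b *\<^sub>R v) (t, p0)) (t, q t)
           - (a *\<^sub>R slice_deriv F (u, Z u (t, p0)) (t, q t) + b *\<^sub>R slice_deriv F (v, Z v (t, p0)) (t, q t)))"
          unfolding linear_diff[OF linF[OF t], symmetric] linear_add[OF linF[OF t], symmetric]
            linear_scale[OF linF[OF t], symmetric] by simp
        then show "norm (slice_deriv F (a *\<^sub>R u + b *\<^sub>R v, Z (a *\<^sub>R u + b *\<^sub>R v) (t, p0)) (t, q t)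
           - (a *\<^sub>R slice_deriv F (u, Z u (t, p0)) (t, q t) + b *\<^sub>R slice_deriv F (v, Z v (t, p0)) (t, q t)))
          \<le> 1/2 * norm (?D t) + 0"
          using halfq[OF t, of "?D t"] by simp
      qed (use Z(1) p0 in auto)
      then show ?thesis by simp
    qed
    show ?thesis
      using comb[of 1 _ 1] comb[of _ _ 0] by (auto simp: linear_iff)
  qed
  show ?thesis
    unfolding has_derivative_at_alt
  proof (intro conjI allI impI)
    show "bounded_linear (\<lambda>v. Z v (t0, p0))" using linZ by (simp add: linear_conv_bounded_linear)
    fix e :: real assume e: "e > 0"
    let ?M = "2 * (1 + 4 * (C + 1))"
    have M: "?M > 0" using C by simp
    define e' where "e' = min (1/4) (e / ?M)"
    have e': "e' > 0" using e M by (simp add: e'_def)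
    have e'4: "e' \<le> 1/4" unfolding e'_def by (rule min.cobounded1)
    have "e' \<le> e / ?M" by (simp add: e'_def)
    then have e'M: "e' * ?M \<le> e" using M pos_le_divide_eq by blast
    obtain d where d: "d > 0" "\<And>h. norm h < d \<Longrightarrow>
      norm (W (t0, p0 + h) - W (t0, p0) - Z h (t0, p0)) \<le> 2 * (e' * (1 + 4 * (C + 1))) * norm h"
      using est[OF e' e'4] by blast
    show "\<exists>d>0. \<forall>y. norm (y - p0) < d \<longrightarrow> norm (W (t0, y) - W (t0, p0) - Z (y - p0) (t0, p0)) \<le> e * norm (y - p0)"
    proof (intro exI[of _ d] conjI allI impI d(1))
      fix y assume "norm (y - p0) < d"
      from d(2)[OF this] have "norm (W (t0, y) - W (t0, p0) - Z (y - p0) (t0, p0)) \<le> (e' * ?M) * norm (y - p0)"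
        by (simp add: mult_ac)
      also have "\<dots> \<le> e * norm (y - p0)" by (rule mult_right_mono[OF e'M]) simp
      finally show "norm (W (t0, y) - W (t0, p0) - Z (y - p0) (t0, p0)) \<le> e * norm (y - p0)" .
    qed
  qed
qed

lemma CkP_Pair:
  assumes "open_slices W" "CkP n W f" "CkP n W g"
  shows "CkP n W (\<lambda>p. (f p, g p))"
proof -
  have "CkP n W (\<lambda>p. (f p, 0) + (0, g p))"
    by (intro CkP_add assms CkP_bounded_linear[of _ "\<lambda>y. (y, 0)"] CkP_bounded_linear[of _ "\<lambda>y. (0, y)"]
        bounded_linear_Pair bounded_linear_ident bounded_linear_zero)
  then show ?thesis by simp
qed

text \<open>The derivative of the solution in a parameter direction solves a linear equation of the same
  kind, whose right hand side loses one derivative; this drives the induction.\<close>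

lemma param_ode_CkP:
  fixes F :: "real \<times> ('p::euclidean_space \<times> 'e::euclidean_space) \<Rightarrow> 'e"
  assumes U: "open U" and Q: "open Q" and F: "CkP n ({0..1} \<times> (U \<times> Q)) F"
    and half: "\<And>t p w z. n > 0 \<Longrightarrow> t \<in> {0..1} \<Longrightarrow> p \<in> U \<Longrightarrow> w \<in> Q \<Longrightarrow>
        norm (slice_deriv F (0, z) (t, (p, w))) \<le> 1/2 * norm z"
    and W: "continuous_on ({0..1} \<times> U) W" "\<And>t p. t \<in> {0..1} \<Longrightarrow> p \<in> U \<Longrightarrow> W (t, p) \<in> Q"
      "\<And>p. p \<in> U \<Longrightarrow> W (0, p) = 0"
      "\<And>t p. t \<in> {0..1} \<Longrightarrow> p \<in> U \<Longrightarrow>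
       ((\<lambda>t. W (t, p)) has_vector_derivative F (t, (p, W (t, p)))) (at t within {0..1})"
  shows "CkP n ({0..1} \<times> U) W"
  using Q F half W
proof (induction n arbitrary: F Q W)
  case 0
  then show ?case by simp
next
  case (Suc n)
  note Q = Suc.prems(1) and F = Suc.prems(2) and half = Suc.prems(3)[OF zero_less_Suc] and W = Suc.prems(4-7)
  let ?D = "{0..1::real} \<times> (U \<times> (UNIV :: 'e set))"
  have oD: "open_slices ?D" by (intro open_slices_Times open_Times U open_UNIV)
  have oU: "open_slices ({0..1::real} \<times> U)" by (intro open_slices_Times U)
  have F1: "CkP (Suc 0) ({0..1} \<times> (U \<times> Q)) F" by (rule CkP_mono[OF F]) simp
  have "CkP n ({0..1} \<times> (U \<times> Q)) F" by (rule CkP_Suc_imp[OF F])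
  from Suc.IH[OF Q this half W] have Wn: "CkP n ({0..1} \<times> U) W" by blast
  \<comment> \<open>The right-hand side of the linearised equation along \<open>W\<close>; the
    component \<open>snd (snd q)\<close> is the place of the unknown derivative.\<close>
  define G where "G v q = slice_deriv F (v, snd (snd q)) (fst q, (fst (snd q), W (fst q, fst (snd q))))"
    for v and q :: "real \<times> ('p \<times> 'e)"
  have lin: "linear (\<lambda>k. slice_deriv F k (t, (p, W (t, p))))" if "t \<in> {0..1}" "p \<in> U" for t p
    by (rule has_derivative_linear[OF CkP_SucD[OF F1]]) (use that W in auto)
  have Gn: "CkP n ?D (G v)" for v
  proof (rule CkP_cong[OF oD])
    have inner: "CkP n ?D (\<lambda>q. (fst (snd q), W (fst q, fst (snd q))))"
    proof (rule CkP_Pair[OF oD CkP_linear[OF oD bounded_linear_fst]])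
      have "CkP n ?D (\<lambda>q. W (id (fst q), fst (snd q)))"
        by (rule CkP_compose[OF oD CkP_linear[OF oD bounded_linear_fst] Wn]) (auto intro!: continuous_intros)
      then show "CkP n ?D (\<lambda>q. W (fst q, fst (snd q)))" by simp
    qed
    show "CkP n ?D (\<lambda>q. \<Sum>b\<in>Basis. ((v, snd (snd q)) \<bullet> b) *\<^sub>R
        slice_deriv F b (id (fst q), (fst (snd q), W (fst q, fst (snd q)))))"
    proof (intro CkP_sum[OF oD] CkP_bilinear[OF oD bounded_bilinear_scaleR])
      fix b :: "'p \<times> 'e"
      show "CkP n ?D (\<lambda>q. (v, snd (snd q)) \<bullet> b)"
        by (intro CkP_bounded_linear[OF oD bounded_linear_inner_left] CkP_Pair[OF oD] CkP_const[OF oD]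
            CkP_linear[OF oD bounded_linear_snd])
      show "CkP n ?D (\<lambda>q. slice_deriv F b (id (fst q), (fst (snd q), W (fst q, fst (snd q)))))"
      proof (rule CkP_compose[OF oD inner])
        show "CkP n ({0..1} \<times> (U \<times> Q)) (slice_deriv F b)" using F CkP.simps(2) by blast
      qed (use W in \<open>auto intro!: continuous_intros\<close>)
    qed
    show "(\<Sum>b\<in>Basis. ((v, snd (snd q)) \<bullet> b) *\<^sub>R
        slice_deriv F b (id (fst q), (fst (snd q), W (fst q, fst (snd q))))) = G v q" if "q \<in> ?D" for q
      unfolding G_def id_apply by (rule linear_expand[symmetric], rule lin) (use that in auto)
  qed
  \<comment> \<open>\<open>G v\<close> is affine in its unknown, with the same linear part as
    \<open>F\<close>, so the constant 1/2 is inherited and the induction hypothesis applies to the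
    linearised equation.\<close>
  have Gdiff: "G v (t, (p, z)) - G v (t, (p, z')) = slice_deriv F (0, z - z') (t, (p, W (t, p)))"
    if "t \<in> {0..1}" "p \<in> U" for v t p z z'
    using linear_diff[OF lin[OF that], of "(v, z)" "(v, z')"] by (simp add: G_def)
  have "\<exists>Z. continuous_on ({0..1} \<times> U) Z \<and> (\<forall>p\<in>U. Z (0, p) = 0) \<and> (\<forall>t\<in>{0..1}. \<forall>p\<in>U.
       ((\<lambda>t. Z (t, p)) has_vector_derivative G v (t, (p, Z (t, p)))) (at t within {0..1}))" for v
    by (rule linear_ode_solution[OF U CkP_continuous[OF Gn[of v]]])
      (use half W in \<open>auto simp: Gdiff\<close>)
  then obtain Z where Z: "\<And>v. continuous_on ({0..1} \<times> U) (Z v)" "\<And>v p. p \<in> U \<Longrightarrow> Z v (0, p) = 0"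
    "\<And>v t p. t \<in> {0..1} \<Longrightarrow> p \<in> U \<Longrightarrow>
       ((\<lambda>t. Z v (t, p)) has_vector_derivative G v (t, (p, Z v (t, p)))) (at t within {0..1})"
    by metis
  show ?case
  proof (rule CkP_SucI[OF oU W(1), where F' = "\<lambda>q v. Z v q"])
    fix t :: real and p assume "(t, p) \<in> {0..1} \<times> U"
    then have tp: "t \<in> {0..1}" "p \<in> U" by auto
    show "((\<lambda>y. W (t, y)) has_derivative (\<lambda>v. Z v (t, p))) (at p)"
    proof (rule param_ode_derivative[OF U Q F1 half W _ _ tp(2,1)])
      show "((\<lambda>t. Z v (t, p)) has_vector_derivative slice_deriv F (v, Z v (t, p)) (t, (p, W (t, p)))) (at t within {0..1})"
        if "t \<in> {0..1}" "p \<in> U" for t p v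
        using Z(3)[OF that, of v] by (simp add: G_def)
    qed (use Z(2) in auto)
  next
    fix v
    show "CkP n ({0..1} \<times> U) (Z v)"
    proof (rule Suc.IH[OF open_UNIV Gn[of v] _ Z(1) _ Z(2) Z(3)])
      fix t :: real and p w z assume n: "0 < n" and tp: "t \<in> {0..1}" "p \<in> U"
      have G1: "CkP (Suc 0) ?D (G v)" by (rule CkP_mono[OF Gn]) (use n in simp)
      have "((\<lambda>y. G v (t, y)) has_derivative (\<lambda>k. slice_deriv (G v) k (t, (p, w)))) (at (p, w))"
        by (rule CkP_SucD[OF G1]) (use tp in auto)
      moreover have "((\<lambda>z. (p, z)) has_derivative (\<lambda>z. (0, z))) (at w)"
        by (auto intro!: derivative_eq_intros)
      ultimately have 1: "((\<lambda>z. G v (t, (p, z))) has_derivative (\<lambda>z. slice_deriv (G v) (0, z) (t, (p, w)))) (at w)"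
        using diff_chain_at[of "\<lambda>z. (p, z)" _ w "\<lambda>y. G v (t, y)"] by (simp add: o_def)
      have "linear (\<lambda>z. slice_deriv F (0, z) (t, (p, W (t, p))))"
        using linear_compose[of "\<lambda>z. (0, z)" "\<lambda>k. slice_deriv F k (t, (p, W (t, p)))"] lin[OF tp]
        by (simp add: o_def linear_iff)
      then have "((\<lambda>z. slice_deriv F (0, z) (t, (p, W (t, p)))) has_derivative
         (\<lambda>z. slice_deriv F (0, z) (t, (p, W (t, p))))) (at w)"
        by (intro bounded_linear_imp_has_derivative) (simp add: linear_conv_bounded_linear)
      then have "((\<lambda>z. G v (t, (p, 0)) + slice_deriv F (0, z) (t, (p, W (t, p)))) has_derivative
         (\<lambda>z. slice_deriv F (0, z) (t, (p, W (t, p))))) (at w)"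
        by (auto intro!: derivative_eq_intros)
      moreover have "(\<lambda>z. G v (t, (p, 0)) + slice_deriv F (0, z) (t, (p, W (t, p)))) = (\<lambda>z. G v (t, (p, z)))"
      proof
        fix z show "G v (t, (p, 0)) + slice_deriv F (0, z) (t, (p, W (t, p))) = G v (t, (p, z))"
          using Gdiff[OF tp, of v z 0] by (metis add.commute diff_add_cancel diff_zero)
      qed
      ultimately have "(\<lambda>z. slice_deriv (G v) (0, z) (t, (p, w))) = (\<lambda>z. slice_deriv F (0, z) (t, (p, W (t, p))))"
        using has_derivative_unique[OF 1] by simp
      from fun_cong[OF this, of z] show "norm (slice_deriv (G v) (0, z) (t, (p, w))) \<le> 1/2 * norm z"
        using half[OF tp W(2)[OF tp], of z] by (simp only:)
    qed auto
  qed
qed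

section \<open>Local flows on open subsets of Euclidean space\<close>

lemma compact_derivative_bound:
  assumes X: "smooth V X" and K: "compact K" "K \<subseteq> V"
  obtains L where "L \<ge> 0" "\<And>y z. y \<in> K \<Longrightarrow> norm (frechet_derivative X (at y) z) \<le> L * norm z"
proof -
  have "\<exists>B. \<forall>y\<in>K. norm (frechet_derivative X (at y) b) \<le> B" for b
  proof -
    have "compact ((\<lambda>y. frechet_derivative X (at y) b) ` K)"
      by (intro compact_continuous_image K(1) continuous_on_subset[OF smooth_continuous[OF smooth_deriv[OF X]] K(2)])
    then show ?thesis by (fastforce dest: compact_imp_bounded simp: bounded_iff)
  qed
  then obtain B where B: "\<And>b y. y \<in> K \<Longrightarrow> norm (frechet_derivative X (at y) b) \<le> B b" by metis
  show thesis
  proof (rule that[of "\<Sum>b\<in>Basis. \<bar>B b\<bar>"])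
    fix y z assume y: "y \<in> K"
    have "linear (frechet_derivative X (at y))"
      using has_derivative_linear[OF smooth_has_derivative[OF X]] y K by blast
    from linear_expand[OF this, of z]
    have "norm (frechet_derivative X (at y) z) = norm (\<Sum>b\<in>Basis. (z \<bullet> b) *\<^sub>R frechet_derivative X (at y) b)" by simp
    also have "\<dots> \<le> (\<Sum>b\<in>Basis. norm z * \<bar>B b\<bar>)"
      by (rule order_trans[OF norm_sum sum_mono])
        (use B[OF y] in \<open>auto intro!: mult_mono Basis_le_norm order_trans[OF _ abs_ge_self]\<close>)
    finally show "norm (frechet_derivative X (at y) z) \<le> (\<Sum>b\<in>Basis. \<bar>B b\<bar>) * norm z"
      by (simp add: sum_distrib_left mult.commute)
  qed (auto intro: sum_nonneg)
qed

lemma smooth_lipschitz: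
  assumes X: "smooth V X" and K: "compact K" "K \<subseteq> V" "convex K"
  obtains L where "L \<ge> 0" "\<And>x y. x \<in> K \<Longrightarrow> y \<in> K \<Longrightarrow> norm (X x - X y) \<le> L * norm (x - y)"
    "\<And>y z. y \<in> K \<Longrightarrow> norm (frechet_derivative X (at y) z) \<le> L * norm z"
proof -
  obtain L where L: "L \<ge> 0" "\<And>y z. y \<in> K \<Longrightarrow> norm (frechet_derivative X (at y) z) \<le> L * norm z"
    using compact_derivative_bound[OF X K(1,2)] by blast
  show thesis
  proof (rule that[OF L(1) _ L(2)])
    show "norm (X x - X y) \<le> L * norm (x - y)" if "x \<in> K" "y \<in> K" for x y
    proof (rule differentiable_bound[OF K(3) _ _ that])
      show "(X has_derivative frechet_derivative X (at x)) (at x within K)" if "x \<in> K" for x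
        using smooth_has_derivative[OF X] K that has_derivative_at_withinI by blast
      show "onorm (frechet_derivative X (at x)) \<le> L" if "x \<in> K" for x
        by (rule onorm_le[OF L(2)[OF that]])
    qed
  qed auto
qed

text \<open>Time is made a parameter: for fixed (s, x) the displacement w solves w' = s X (x + w) on
  the unit interval, and \<theta> (s, x) is x plus its value at time 1. Smooth dependence on the
  parameter (s, x) is then smoothness of the flow in time and point jointly.\<close>

lemma local_flow:
  fixes X :: "'a::euclidean_space \<Rightarrow> 'a"
  assumes X: "smooth V X" and x0: "x0 \<in> V"
  shows "\<exists>r e \<theta>. r > 0 \<and> e > 0 \<and> ball x0 r \<subseteq> V \<and> smooth ({-e<..<e} \<times> ball x0 r) \<theta> \<and>
    (\<forall>x\<in>ball x0 r. \<theta> (0, x) = x) \<and>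
    (\<forall>s x. \<bar>s\<bar> < e \<longrightarrow> x \<in> ball x0 r \<longrightarrow> \<theta> (s, x) \<in> V \<and>
       ((\<lambda>s. \<theta> (s, x)) has_vector_derivative X (\<theta> (s, x))) (at s))"
proof -
  obtain R where R: "R > 0" "cball x0 R \<subseteq> V" using smooth_open[OF X] x0 open_contains_cball by blast
  \<comment> \<open>Half of \<open>R\<close>, so that a base point in \<open>ball x0 r\<close> with
    a displacement of norm at most \<open>r\<close> stays in the compact ball.\<close>
  define r where "r = R / 2"
  have r: "r > 0" using R by (simp add: r_def)
  let ?K = "cball x0 R"
  have "compact (X ` ?K)"
    by (intro compact_continuous_image continuous_on_subset[OF smooth_continuous[OF X] R(2)] compact_cball)
  then obtain C where C: "C > 0" "\<And>y. y \<in> ?K \<Longrightarrow> norm (X y) \<le> C"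
    using bounded_pos compact_imp_bounded by (metis image_eqI)
  obtain L where L: "L \<ge> 0" "\<And>x y. x \<in> ?K \<Longrightarrow> y \<in> ?K \<Longrightarrow> norm (X x - X y) \<le> L * norm (x - y)"
    "\<And>y z. y \<in> ?K \<Longrightarrow> norm (frechet_derivative X (at y) z) \<le> L * norm z"
    using smooth_lipschitz[OF X compact_cball R(2) convex_cball] by blast
  \<comment> \<open>The first bound gives \<open>\<bar>s\<bar> * C \<le> r / 2\<close>, which keeps
    displacements small; the second gives \<open>\<bar>s\<bar> * L \<le> 1 / 2\<close>, as Picard
    iteration and \<open>growth_bound\<close> demand.\<close>
  define e where "e = min (r / (2 * C)) (1 / (2 * (L + 1)))"
  have e: "e > 0" using r C L by (simp add: e_def)
  have eC: "s * C \<le> r / 2" if "s < e" for s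
  proof -
    have "s < r / (2 * C)" using that by (simp add: e_def)
    then show ?thesis using C by (simp add: field_simps)
  qed
  have eL: "s * L \<le> 1 / 2" if "s < e" "s \<ge> 0" for s
  proof -
    have "s < 1 / (2 * (L + 1))" using that by (simp add: e_def)
    then have "s * (L + 1) < 1 / 2" using L by (simp add: field_simps)
    then show ?thesis using that by (simp add: distrib_left)
  qed
  define U where "U = {-e<..<e} \<times> ball x0 r"
  have oU: "open U" by (simp add: U_def open_Times)
  define g where "g y = fst (fst y) *\<^sub>R X (snd (fst y) + snd y)" for y :: "(real \<times> 'a) \<times> 'a"
  define F where "F q = g (snd q)" for q :: "real \<times> ((real \<times> 'a) \<times> 'a)"
  have inK: "x + w \<in> ?K" if "x \<in> ball x0 r" "norm w \<le> r" for x w :: 'a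
    using that norm_triangle_ineq[of "x0 - x" "-w"] by (simp add: dist_norm r_def algebra_simps)
  have UQ: "open (U \<times> ball 0 r)" by (intro open_Times oU open_ball)
  have sg: "smooth (U \<times> ball 0 r) g"
    unfolding g_def
  proof (rule smooth_scaleR)
    show "smooth (U \<times> ball 0 r) (\<lambda>x. fst (fst x))"
      by (rule smooth_linear[OF UQ]) (intro bounded_linear_compose[OF bounded_linear_fst] bounded_linear_fst)
    show "smooth (U \<times> ball 0 r) (\<lambda>x. X (snd (fst x) + snd x))"
    proof (rule smooth_compose[OF X])
      show "smooth (U \<times> ball 0 r) (\<lambda>x. snd (fst x) + snd x)"
        by (rule smooth_linear[OF UQ])
          (intro bounded_linear_add bounded_linear_compose[OF bounded_linear_snd] bounded_linear_fst bounded_linear_snd)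
      show "snd (fst x) + snd x \<in> V" if "x \<in> U \<times> ball 0 r" for x
        using inK[of "snd (fst x)" "snd x"] R(2) that by (auto simp: U_def)
    qed
  qed
  have FC: "CkP n ({0..1} \<times> (U \<times> ball 0 r)) F" for n
    unfolding F_def[abs_def]
    by (rule Ck_CkP[of n "U \<times> ball 0 r"]) (use sg UQ in \<open>auto simp: smooth_def intro: open_slices_Times\<close>)
  have dF: "slice_deriv F (0, z) (t, ((s, x), w)) = s *\<^sub>R frechet_derivative X (at (x + w)) z"
    if "x \<in> ball x0 r" "norm w \<le> r" for t s and x w z :: 'a
  proof -
    have X': "(X has_derivative frechet_derivative X (at (x + w))) (at (x + w))"
      by (rule smooth_has_derivative[OF X]) (use inK[OF that] R in auto)
    have l: "((\<lambda>y. snd (fst y) + snd y) has_derivative (\<lambda>h. snd (fst h) + snd h)) (at ((s, x), w))"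
      by (auto intro!: derivative_eq_intros)
    have "((\<lambda>y. X (snd (fst y) + snd y)) has_derivative
       (\<lambda>h. frechet_derivative X (at (x + w)) (snd (fst h) + snd h))) (at ((s, x), w))"
      using diff_chain_at[OF l, of X "frechet_derivative X (at (x + w))"] X' by (simp add: o_def)
    then have "((\<lambda>y. F (t, y)) has_derivative (\<lambda>h. s *\<^sub>R frechet_derivative X (at (x + w)) (snd (fst h) + snd h)
        + fst (fst h) *\<^sub>R X (x + w))) (at ((s, x), w))"
      unfolding F_def g_def by (auto intro!: derivative_eq_intros)
    from slice_deriv_eqI[OF this, of "(0, z)"] show ?thesis by simp
  qed
  obtain W where W: "continuous_on ({0..1} \<times> U) W"
    "\<And>t p. t \<in> {0..1} \<Longrightarrow> p \<in> U \<Longrightarrow> norm (W (t, p)) \<le> r / 2"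
    "\<And>p. p \<in> U \<Longrightarrow> W (0, p) = 0"
    "\<And>t p. t \<in> {0..1} \<Longrightarrow> p \<in> U \<Longrightarrow>
       ((\<lambda>t. W (t, p)) has_vector_derivative F (t, (p, W (t, p)))) (at t within {0..1})"
  proof (rule picard_solution[of U "r / 2" F])
    show "continuous_on ({0..1} \<times> U \<times> cball 0 (r / 2)) F"
      by (rule continuous_on_subset[OF CkP_continuous[OF FC[of 0]]]) (use r in auto)
    fix t p w assume a: "t \<in> {0..1::real}" "p \<in> U" "norm (w::'a) \<le> r / 2"
    obtain s x where p: "p = (s, x)" "\<bar>s\<bar> < e" "x \<in> ball x0 r" using a(2) by (auto simp: U_def)
    have w: "x + w \<in> ?K" using inK p a r by simp
    have "\<bar>s\<bar> * norm (X (x + w)) \<le> \<bar>s\<bar> * C" using C(2)[OF w] by (intro mult_left_mono) auto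
    then show "norm (F (t, (p, w))) \<le> r / 2" using eC[OF p(2)] by (simp add: F_def g_def p(1))
    fix w' assume "norm (w'::'a) \<le> r / 2"
    then have w': "x + w' \<in> ?K" using inK p a r by simp
    have "norm (F (t, (p, w)) - F (t, (p, w'))) = \<bar>s\<bar> * norm (X (x + w) - X (x + w'))"
      by (simp add: F_def g_def p(1) scaleR_diff_right[symmetric])
    also have "\<dots> \<le> \<bar>s\<bar> * (L * norm (w - w'))" using L(2)[OF w w'] by (intro mult_left_mono) auto
    also have "\<dots> \<le> 1/2 * norm (w - w')"
      using mult_right_mono[OF eL[OF p(2)], of "norm (w - w')"] by (simp add: mult.assoc)
    finally show "norm (F (t, (p, w)) - F (t, (p, w'))) \<le> 1/2 * norm (w - w')" .
  qed (use r in auto)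
  have WQ: "W (t, p) \<in> ball 0 r" if "t \<in> {0..1}" "p \<in> U" for t p
    using W(2)[OF that] r by simp
  have "CkP n ({0..1} \<times> U) W" for n
  proof (rule param_ode_CkP[OF oU open_ball FC _ W(1) WQ W(3,4)])
    fix t p and w z :: 'a assume a: "t \<in> {0..1::real}" "p \<in> U" "w \<in> ball 0 r"
    obtain s x where p: "p = (s, x)" "\<bar>s\<bar> < e" "x \<in> ball x0 r" using a(2) by (auto simp: U_def)
    have w: "x + w \<in> ?K" using inK p a r by simp
    have "\<bar>s\<bar> * norm (frechet_derivative X (at (x + w)) z) \<le> \<bar>s\<bar> * (L * norm z)"
      using L(3)[OF w] by (intro mult_left_mono) auto
    also have "\<dots> \<le> 1/2 * norm z"
      using mult_right_mono[OF eL[OF p(2)], of "norm z"] by (simp add: mult.assoc)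
    finally show "norm (slice_deriv F (0, z) (t, (p, w))) \<le> 1/2 * norm z"
      using dF[of x w] p a by simp
  qed
  then have "Ck n U (\<lambda>p. W (1, p))" for n
    by (intro CkP_slice[OF open_slices_Times[OF oU] _ _ oU]) auto
  then have sW: "smooth U (\<lambda>p. W (1, p))" using oU by (simp add: smooth_def)
  define \<theta> where "\<theta> p = snd p + W (1, p)" for p
  have s\<theta>: "smooth U \<theta>" unfolding \<theta>_def by (intro smooth_add sW smooth_linear[OF oU] bounded_linear_snd)
  \<comment> \<open>Following s X up to rescaled time t is the same as following t s X up to
    rescaled time 1, by uniqueness. This converts the known derivative of \<open>W\<close> in t into
    a derivative of \<theta> in s.\<close>
  have resc: "W (t, (s, x)) = W (1, (t * s, x))" if t: "t \<in> {0..1}" and s: "(s, x) \<in> U" for t s x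
  proof -
    have "\<bar>t * s\<bar> \<le> \<bar>s\<bar>" using t mult_left_le_one_le[of "\<bar>s\<bar>" t] by (simp add: abs_mult)
    then have ts: "(t * s, x) \<in> U" using s by (auto simp: U_def)
    let ?D = "\<lambda>u. W (t * u, (s, x)) - W (u, (t * s, x))"
    have "norm (?D 1) \<le> 0 / (1 - 1/2)"
    proof (rule growth_bound[where D = ?D and c = "1/2" and e = 0 and t = 1])
      fix u :: real assume u: "u \<in> {0..1}"
      have tu: "t * u \<in> {0..1}" using t u by (auto simp: mult_le_one)
      have "((\<lambda>u. t * u) has_vector_derivative t) (at u within {0..1})"
        by (auto intro!: derivative_eq_intros simp: has_vector_derivative_def)
      moreover have "((\<lambda>t. W (t, (s, x))) has_vector_derivative F (t * u, ((s, x), W (t * u, (s, x))))) (at (t * u) within (\<lambda>u. t * u) ` {0..1})"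
        by (rule has_vector_derivative_within_subset[OF W(4)[OF tu s]]) (use t in \<open>auto simp: mult_le_one\<close>)
      ultimately have "((\<lambda>u. W (t * u, (s, x))) has_vector_derivative t *\<^sub>R F (t * u, ((s, x), W (t * u, (s, x))))) (at u within {0..1})"
        using vector_diff_chain_within by (fastforce simp: o_def)
      then show "(?D has_vector_derivative (t *\<^sub>R F (t * u, ((s, x), W (t * u, (s, x)))) - F (u, ((t * s, x), W (u, (t * s, x)))))) (at u within {0..1})"
        by (intro has_vector_derivative_diff W(4) u ts)
      have xK: "x + W (t * u, (s, x)) \<in> ?K" "x + W (u, (t * s, x)) \<in> ?K"
        using W(2)[OF tu s] W(2)[OF u ts] s r inK by (auto simp: U_def)
      have "norm (t *\<^sub>R F (t * u, ((s, x), W (t * u, (s, x)))) - F (u, ((t * s, x), W (u, (t * s, x))))) =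
         \<bar>t * s\<bar> * norm (X (x + W (t * u, (s, x))) - X (x + W (u, (t * s, x))))"
        by (simp add: F_def g_def scaleR_diff_right[symmetric])
      also have "\<dots> \<le> \<bar>t * s\<bar> * (L * norm (?D u))"
        using L(2)[OF xK] by (intro mult_left_mono) auto
      also have "\<dots> \<le> 1/2 * norm (?D u)"
        using mult_right_mono[OF eL[of "\<bar>t * s\<bar>"], of "norm (?D u)"] ts by (auto simp: mult.assoc U_def)
      finally show "norm (t *\<^sub>R F (t * u, ((s, x), W (t * u, (s, x)))) - F (u, ((t * s, x), W (u, (t * s, x)))))
        \<le> 1/2 * norm (?D u) + 0" by simp
    qed (use W(3) s ts in auto)
    then show ?thesis by simp
  qed
  have \<theta>V: "\<theta> (s, x) \<in> V" if "\<bar>s\<bar> < e" "x \<in> ball x0 r" for s x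
  proof -
    have "norm (W (1, (s, x))) \<le> r / 2" by (rule W(2)) (use that in \<open>auto simp: U_def\<close>)
    then have "x + W (1, (s, x)) \<in> ?K" using inK[OF that(2)] r by simp
    then show ?thesis using R(2) by (auto simp: \<theta>_def)
  qed
  have der0: "((\<lambda>s. \<theta> (s, x)) has_vector_derivative X (\<theta> (s, x))) (at s)"
    if s: "\<bar>s\<bar> < e" "s \<noteq> 0" and x: "x \<in> ball x0 r" for s x
  proof -
    \<comment> \<open>A time of the same sign as \<open>s\<close> and farther from 0, so that
      \<open>s / S\<close> lies strictly between 0 and 1, where \<open>W\<close> has a two-sided
      derivative.\<close>
    define S where "S = (s + sgn s * e) / 2"
    have S: "\<bar>S\<bar> < e" "S \<noteq> 0" "0 < s / S" "s / S < 1"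
      using s e by (auto simp: S_def sgn_if field_simps split: if_splits)
    have SU: "(S, x) \<in> U" using S x by (auto simp: U_def)
    have eq: "\<theta> (u, x) = x + W (u / S, (S, x))" if "u / S \<in> {0..1}" for u
      using resc[OF that SU] S(2) by (simp add: \<theta>_def)
    have "at (s / S) within {0..1} = at (s / S)" using S by (intro at_within_interior) auto
    moreover have "s / S \<in> {0..1}" using S by auto
    ultimately have "((\<lambda>t. W (t, (S, x))) has_vector_derivative F (s / S, ((S, x), W (s / S, (S, x))))) (at (s / S))"
      using W(4)[OF _ SU, of "s / S"] by simp
    moreover have "((\<lambda>u. u / S) has_vector_derivative (1 / S)) (at s)"
      using S(2) by (auto intro!: derivative_eq_intros simp: has_vector_derivative_def)
    ultimately have "((\<lambda>u. W (u / S, (S, x))) has_vector_derivative (1 / S) *\<^sub>R F (s / S, ((S, x), W (s / S, (S, x))))) (at s)"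
      using vector_diff_chain_at by (fastforce simp: o_def)
    then have "((\<lambda>u. x + W (u / S, (S, x))) has_vector_derivative X (\<theta> (s, x))) (at s)"
      using S eq[OF \<open>s / S \<in> {0..1}\<close>] by (auto intro!: derivative_eq_intros simp: F_def g_def)
    then show ?thesis
    proof (rule has_vector_derivative_transform_within_open)
      show "open {u. 0 < u / S \<and> u / S < 1}"
        by (intro open_Collect_conj open_Collect_less continuous_intros) (simp_all add: S(2))
    qed (use S eq in auto)
  qed
  define T where "T s x = frechet_derivative \<theta> (at (s, x)) (1, 0)" for s x
  have dT: "((\<lambda>s. \<theta> (s, x)) has_vector_derivative T s x) (at s)" if "\<bar>s\<bar> < e" "x \<in> ball x0 r" for s x
    using smooth_line[OF s\<theta>, of "(0, x)" s "(1, 0)"] that by (simp add: T_def U_def abs_less_iff minus_less_iff)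
  have dall: "((\<lambda>s. \<theta> (s, x)) has_vector_derivative X (\<theta> (s, x))) (at s)"
    if s: "\<bar>s\<bar> < e" and x: "x \<in> ball x0 r" for s x
  proof (cases "s = 0")
    case False
    then show ?thesis using der0[OF s _ x] by blast
  next
    \<comment> \<open>Rescaling says nothing at s = 0. The time derivative of \<theta> and the field
      along \<theta> are both continuous there, and they agree at all other small times.\<close>
    case True
    have sx: "(0, x) \<in> U" using e x by (auto simp: U_def)
    have lne: "continuous_on {-e<..<e} (\<lambda>s. (s, x))" by (intro continuous_intros)
    have "continuous_on {-e<..<e} (\<lambda>s. T s x)"
      unfolding T_def using smooth_continuous[OF smooth_deriv[OF s\<theta>], of "(1, 0)"]
      by (rule continuous_on_compose2[OF _ lne]) (use x in \<open>auto simp: U_def\<close>)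
    moreover have "continuous_on {-e<..<e} (\<lambda>s. \<theta> (s, x))"
      using smooth_continuous[OF s\<theta>]
      by (rule continuous_on_compose2[OF _ lne]) (use x in \<open>auto simp: U_def\<close>)
    then have "continuous_on {-e<..<e} (\<lambda>s. X (\<theta> (s, x)))"
      by (rule continuous_on_compose2[OF smooth_continuous[OF X]]) (use \<theta>V x in auto)
    ultimately have "continuous_on {-e<..<e} (\<lambda>s. T s x - X (\<theta> (s, x)))" by (rule continuous_on_diff)
    then have "isCont (\<lambda>s. T s x - X (\<theta> (s, x))) 0" using e by (simp add: continuous_on_eq_continuous_at)
    moreover have "\<forall>\<^sub>F s in at 0. T s x - X (\<theta> (s, x)) = 0"
      unfolding eventually_at
    proof (intro exI[of _ e] conjI ballI impI e)
      fix s :: real assume "s \<noteq> 0 \<and> dist s 0 < e"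
      then have "\<bar>s\<bar> < e" "s \<noteq> 0" by auto
      then show "T s x - X (\<theta> (s, x)) = 0"
        using vector_derivative_unique_at[OF dT der0] x by auto
    qed
    then have "((\<lambda>s. T s x - X (\<theta> (s, x))) \<longlongrightarrow> 0) (at 0)" by (rule tendsto_eventually)
    ultimately have "T 0 x - X (\<theta> (0, x)) = 0"
      unfolding isCont_def using LIM_unique by blast
    then show ?thesis using dT[OF s x] True by simp
  qed
  have "W (1, (0, x)) = 0" if "x \<in> ball x0 r" for x
    using resc[of 0 0 x] W(3)[of "(0, x)"] that e by (auto simp: U_def)
  then have \<theta>0: "\<theta> (0, x) = x" if "x \<in> ball x0 r" for x using that by (simp add: \<theta>_def)
  have "ball x0 r \<subseteq> V" using R r by (auto simp: r_def)
  then show ?thesis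
    using r e s\<theta>[unfolded U_def] \<theta>0 \<theta>V dall
    by (intro exI[of _ r] exI[of _ e] exI[of _ \<theta>] conjI ballI allI impI)
qed

section \<open>Tangent maps and forms in charts\<close>

abbreviation (input) chart_image :: "('m, 'e) chart \<Rightarrow> 'e set" where
  "chart_image c \<equiv> snd c ` fst c"

text \<open>With \<open>id\<close> for \<phi> this is the coordinate change from \<open>c\<close> to
  \<open>c'\<close> at p, so that changes of chart and tangent maps obey one chain rule.\<close>

definition chart_deriv :: "('m \<Rightarrow> 'm) \<Rightarrow> ('m, 'e::euclidean_space) chart \<Rightarrow> ('m, 'e) chart \<Rightarrow> 'm \<Rightarrow> 'e \<Rightarrow> 'e" where
  "chart_deriv \<phi> c c' p = frechet_derivative (snd c' \<circ> \<phi> \<circ> chart_inv c) (at (snd c p))"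

text \<open>The formula of \<open>ext_deriv\<close> in an arbitrary chart. Derivatives near p have
  to be taken in one fixed chart, while \<open>chart_at\<close> may jump from point to
  point.\<close>

definition chart_ext_deriv ::
  "('m, 'e::euclidean_space) chart set \<Rightarrow> ('m, 'e) form \<Rightarrow> ('m, 'e) chart \<Rightarrow> 'e \<Rightarrow> 'e \<Rightarrow> 'e \<Rightarrow> real" where
  "chart_ext_deriv A \<alpha> c x u v =
     frechet_derivative (\<lambda>y. form_rep A \<alpha> c y v) (at x) u - frechet_derivative (\<lambda>y. form_rep A \<alpha> c y u) (at x) v"

text \<open>Second derivatives of \<open>F\<close> cancel by symmetry.\<close>

lemma ext_deriv_natural:
  fixes a :: "'b::euclidean_space \<Rightarrow> 'b \<Rightarrow> real" and F :: "'a::euclidean_space \<Rightarrow> 'b"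
  assumes lin: "\<And>z. z \<in> V \<Longrightarrow> linear (a z)" and a: "\<And>w. smooth V (\<lambda>z. a z w)"
    and F: "smooth U F" "\<And>x. x \<in> U \<Longrightarrow> F x \<in> V" and x: "x \<in> U"
  defines "b \<equiv> \<lambda>y v. a (F y) (frechet_derivative F (at y) v)"
  shows "frechet_derivative (\<lambda>y. b y v) (at x) u - frechet_derivative (\<lambda>y. b y u) (at x) v =
    frechet_derivative (\<lambda>z. a z (frechet_derivative F (at x) v)) (at (F x)) (frechet_derivative F (at x) u) -
    frechet_derivative (\<lambda>z. a z (frechet_derivative F (at x) u)) (at (F x)) (frechet_derivative F (at x) v)"
proof -
  let ?D = "\<lambda>v y. frechet_derivative F (at y) v"
  let ?H = "\<lambda>v u. frechet_derivative (?D v) (at x) u"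
  have Fx: "F x \<in> V" using F x by blast
  have dF: "(F has_derivative (\<lambda>h. ?D h x)) (at x)" using smooth_has_derivative[OF F(1) x] .
  have *: "frechet_derivative (\<lambda>y. b y v) (at x) u =
     a (F x) (?H v u) + frechet_derivative (\<lambda>z. a z (?D v x)) (at (F x)) (?D u x)" for u v
  proof -
    have da: "((\<lambda>y. a (F y) i) has_derivative (\<lambda>h. frechet_derivative (\<lambda>z. a z i) (at (F x)) (?D h x))) (at x)" for i
      using diff_chain_at[OF dF smooth_has_derivative[OF a Fx]] by (simp add: o_def)
    have dD: "((\<lambda>y. ?D v y \<bullet> i) has_derivative (\<lambda>h. ?H v h \<bullet> i)) (at x)" for i
      by (intro has_derivative_inner_left smooth_has_derivative[OF smooth_deriv[OF F(1)] x])
    \<comment> \<open>Coordinates separate the point at which the form is taken from the vector to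
      which it is applied, so that the product rule becomes available.\<close>
    have "((\<lambda>y. \<Sum>i\<in>Basis. (?D v y \<bullet> i) * a (F y) i) has_derivative
      (\<lambda>h. \<Sum>i\<in>Basis. (?D v x \<bullet> i) * frechet_derivative (\<lambda>z. a z i) (at (F x)) (?D h x) + (?H v h \<bullet> i) * a (F x) i)) (at x)"
      by (intro has_derivative_sum has_derivative_mult da dD)
    then have "((\<lambda>y. b y v) has_derivative
      (\<lambda>h. \<Sum>i\<in>Basis. (?D v x \<bullet> i) * frechet_derivative (\<lambda>z. a z i) (at (F x)) (?D h x) + (?H v h \<bullet> i) * a (F x) i)) (at x)"
    proof (rule has_derivative_transform_within_open[OF _ smooth_open[OF F(1)] x])
      fix y assume "y \<in> U"
      then show "(\<Sum>i\<in>Basis. (?D v y \<bullet> i) * a (F y) i) = b y v"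
        unfolding b_def using linear_expand[OF lin[OF F(2)], of y "?D v y"] by simp
    qed
    from frechet_derivative_at[OF this, symmetric]
    have 1: "frechet_derivative (\<lambda>y. b y v) (at x) u =
      (\<Sum>i\<in>Basis. (?D v x \<bullet> i) * frechet_derivative (\<lambda>z. a z i) (at (F x)) (?D u x)) + (\<Sum>i\<in>Basis. (?H v u \<bullet> i) * a (F x) i)"
      by (simp add: sum.distrib)
    have "((\<lambda>z. \<Sum>i\<in>Basis. (?D v x \<bullet> i) * a z i) has_derivative
       (\<lambda>h. \<Sum>i\<in>Basis. (?D v x \<bullet> i) * frechet_derivative (\<lambda>z. a z i) (at (F x)) h)) (at (F x))"
      by (intro has_derivative_sum has_derivative_mult_right smooth_has_derivative[OF a Fx])
    then have "((\<lambda>z. a z (?D v x)) has_derivative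
       (\<lambda>h. \<Sum>i\<in>Basis. (?D v x \<bullet> i) * frechet_derivative (\<lambda>z. a z i) (at (F x)) h)) (at (F x))"
    proof (rule has_derivative_transform_within_open[OF _ smooth_open[OF a] Fx])
      fix z assume "z \<in> V"
      then show "(\<Sum>i\<in>Basis. (?D v x \<bullet> i) * a z i) = a z (?D v x)"
        using linear_expand[OF lin, of z "?D v x"] by simp
    qed
    from frechet_derivative_at[OF this, symmetric]
    show ?thesis using 1 linear_expand[OF lin[OF Fx], of "?H v u"] by simp
  qed
  have "?H v u = ?H u v" by (rule deriv_commute[OF F(1) x])
  then show ?thesis unfolding * by simp
qed

section \<open>Charts, coordinate changes and tangent maps\<close>

locale manifold =
  fixes A :: "('m::{t2_space,second_countable_topology}, 'e::euclidean_space) chart set"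
  assumes atlas: "smooth_atlas A"
begin

lemma chart_open: "c \<in> A \<Longrightarrow> open (fst c)" "c \<in> A \<Longrightarrow> open (chart_image c)"
  and chart_homeo: "c \<in> A \<Longrightarrow> homeomorphism (fst c) (chart_image c) (snd c) (chart_inv c)"
  using atlas by (auto simp: smooth_atlas_def)

lemma chart_inv_coord [simp]: "c \<in> A \<Longrightarrow> p \<in> fst c \<Longrightarrow> chart_inv c (snd c p) = p"
  using chart_homeo by (auto simp: homeomorphism_def)

lemma chart_inv_image: "c \<in> A \<Longrightarrow> x \<in> chart_image c \<Longrightarrow> chart_inv c x \<in> fst c \<and> snd c (chart_inv c x) = x"
  using chart_homeo by (auto simp: homeomorphism_def)

lemma chart_continuous: "c \<in> A \<Longrightarrow> continuous_on (fst c) (snd c)" "c \<in> A \<Longrightarrow> continuous_on (chart_image c) (chart_inv c)"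
  using chart_homeo by (auto simp: homeomorphism_def)

lemma chart_at: "chart_at A p \<in> A" "p \<in> fst (chart_at A p)"
proof -
  have "p \<in> (\<Union>c\<in>A. fst c)" using atlas by (simp add: smooth_atlas_def)
  then have "\<exists>c. c \<in> A \<and> p \<in> fst c" by blast
  from someI_ex[OF this] show "chart_at A p \<in> A" "p \<in> fst (chart_at A p)" by (auto simp: chart_at_def)
qed

lemma chart_preimage_eq:
  assumes "c \<in> A" "U \<subseteq> fst c"
  shows "snd c ` U = chart_image c \<inter> chart_inv c -` U"
proof (intro equalityI subsetI)
  fix x assume "x \<in> snd c ` U"
  then obtain p where "p \<in> U" "x = snd c p" by auto
  then show "x \<in> chart_image c \<inter> chart_inv c -` U" using assms chart_inv_coord[of c p] by auto
next
  fix x assume "x \<in> chart_image c \<inter> chart_inv c -` U"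
  then show "x \<in> snd c ` U" using chart_inv_image[OF assms(1), of x] by (metis IntD1 IntD2 image_eqI vimageD)
qed

lemma chart_image_open:
  assumes "c \<in> A" "open U" "U \<subseteq> fst c"
  shows "open (snd c ` U)"
  unfolding chart_preimage_eq[OF assms(1,3)]
  by (rule continuous_open_preimage[OF chart_continuous(2)[OF assms(1)] chart_open(2)[OF assms(1)] assms(2)])

lemma chart_preimage_open:
  assumes "c \<in> A" "open V"
  shows "open (fst c \<inter> snd c -` V)"
  by (rule continuous_open_preimage[OF chart_continuous(1)[OF assms(1)] chart_open(1)[OF assms(1)] assms(2)])

lemma smooth_map_chart:
  assumes "smooth_map A \<phi>" "c \<in> A" "c' \<in> A"
  shows "smooth (snd c ` (fst c \<inter> \<phi> -` fst c')) (snd c' \<circ> \<phi> \<circ> chart_inv c)"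
proof -
  have "open (\<phi> -` fst c')"
    using assms(1) chart_open(1)[OF assms(3)] open_vimage by (auto simp: smooth_map_def)
  then have "open (snd c ` (fst c \<inter> \<phi> -` fst c'))"
    using chart_open(1)[OF assms(2)] by (intro chart_image_open assms) auto
  then show ?thesis using assms smooth_on_iff by (auto simp: smooth_map_def)
qed

lemma smooth_map_id: "smooth_map A id"
  using atlas by (auto simp: smooth_map_def smooth_atlas_def)

lemma chart_deriv_works:
  assumes "smooth_map A \<phi>" "c \<in> A" "c' \<in> A" "p \<in> fst c" "\<phi> p \<in> fst c'"
  shows "((snd c' \<circ> \<phi> \<circ> chart_inv c) has_derivative chart_deriv \<phi> c c' p) (at (snd c p))"
  unfolding chart_deriv_def
  by (rule smooth_has_derivative[OF smooth_map_chart[OF assms(1-3)]]) (use assms in auto)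

lemma chart_deriv_linear:
  assumes "smooth_map A \<phi>" "c \<in> A" "c' \<in> A" "p \<in> fst c" "\<phi> p \<in> fst c'"
  shows "linear (chart_deriv \<phi> c c' p)"
  using has_derivative_linear[OF chart_deriv_works[OF assms]] .

lemma chart_deriv_comp:
  assumes "smooth_map A \<phi>" "smooth_map A \<psi>" "c \<in> A" "c' \<in> A" "c'' \<in> A"
    and "p \<in> fst c" "\<phi> p \<in> fst c'" "\<psi> (\<phi> p) \<in> fst c''"
  shows "chart_deriv (\<psi> \<circ> \<phi>) c c'' p v = chart_deriv \<psi> c' c'' (\<phi> p) (chart_deriv \<phi> c c' p v)"
proof -
  have eq: "(snd c' \<circ> \<phi> \<circ> chart_inv c) (snd c p) = snd c' (\<phi> p)"
    using assms by simp
  have "((snd c'' \<circ> \<psi> \<circ> chart_inv c') \<circ> (snd c' \<circ> \<phi> \<circ> chart_inv c) has_derivative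
    chart_deriv \<psi> c' c'' (\<phi> p) \<circ> chart_deriv \<phi> c c' p) (at (snd c p))"
    by (rule diff_chain_at[OF chart_deriv_works]) (use assms eq chart_deriv_works in simp_all)
  then have "((snd c'' \<circ> (\<psi> \<circ> \<phi>) \<circ> chart_inv c) has_derivative
    chart_deriv \<psi> c' c'' (\<phi> p) \<circ> chart_deriv \<phi> c c' p) (at (snd c p))"
    by (rule has_derivative_transform_within_open[OF _ smooth_open[OF smooth_map_chart[OF assms(1,3,4)]]])
      (use assms in auto)
  from fun_cong[OF frechet_derivative_at[OF this], of v] show ?thesis
    by (simp add: chart_deriv_def)
qed

lemma chart_deriv_id: 
  assumes "c \<in> A" "p \<in> fst c"
  shows "chart_deriv id c c p v = v"
proof -
  have "((\<lambda>x. x) has_derivative (\<lambda>x. x)) (at (snd c p))" by (rule has_derivative_ident)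
  then have "((snd c \<circ> id \<circ> chart_inv c) has_derivative (\<lambda>x. x)) (at (snd c p))"
    by (rule has_derivative_transform_within_open[OF _ chart_open(2)[OF assms(1)]]) (use assms in auto)
  from fun_cong[OF frechet_derivative_at[OF this], of v] show ?thesis by (simp add: chart_deriv_def)
qed

lemma chart_deriv_change:
  assumes "c \<in> A" "c' \<in> A" "c'' \<in> A" "p \<in> fst c" "p \<in> fst c'" "p \<in> fst c''"
  shows "chart_deriv id c' c'' p (chart_deriv id c c' p v) = chart_deriv id c c'' p v"
  using chart_deriv_comp[OF smooth_map_id smooth_map_id, of c c' c'' p v] assms by simp

lemma chart_deriv_inv:
  assumes "c \<in> A" "c' \<in> A" "p \<in> fst c" "p \<in> fst c'"
  shows "chart_deriv id c' c p (chart_deriv id c c' p v) = v"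
  using chart_deriv_change[of c c' c p v] chart_deriv_id assms by simp

lemma tangent_map_eq: "tangent_map A \<phi> p = chart_deriv \<phi> (chart_at A p) (chart_at A (\<phi> p)) p"
  by (simp add: tangent_map_def chart_deriv_def)

text \<open>The chain rule for the two compositions \<open>id \<circ> \<phi>\<close> and
  \<open>\<phi> \<circ> id\<close>, with an intermediate chart inserted at the image point in one
  and at p in the other.\<close>

lemma tangent_map_chart:
  assumes "smooth_map A \<phi>" "c \<in> A" "c' \<in> A" "p \<in> fst c" "\<phi> p \<in> fst c'"
  shows "chart_deriv id (chart_at A (\<phi> p)) c' (\<phi> p) (tangent_map A \<phi> p v) =
         chart_deriv \<phi> c c' p (chart_deriv id (chart_at A p) c p v)"
proof -
  have "chart_deriv (id \<circ> \<phi>) (chart_at A p) c' p v = chart_deriv (\<phi> \<circ> id) (chart_at A p) c' p v" by simp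
  moreover have "chart_deriv (id \<circ> \<phi>) (chart_at A p) c' p v =
      chart_deriv id (chart_at A (\<phi> p)) c' (\<phi> p) (tangent_map A \<phi> p v)"
    unfolding tangent_map_eq by (rule chart_deriv_comp) (use assms smooth_map_id chart_at in auto)
  moreover have "chart_deriv (\<phi> \<circ> id) (chart_at A p) c' p v =
      chart_deriv \<phi> c c' (id p) (chart_deriv id (chart_at A p) c p v)"
    by (rule chart_deriv_comp) (use assms smooth_map_id chart_at in auto)
  ultimately show ?thesis by simp
qed

lemma tangent_map_linear: "smooth_map A \<phi> \<Longrightarrow> linear (tangent_map A \<phi> p)"
  unfolding tangent_map_eq by (intro chart_deriv_linear chart_at)

lemma tangent_map_comp:
  assumes "smooth_map A \<phi>" "smooth_map A \<psi>"
  shows "tangent_map A (\<psi> \<circ> \<phi>) p v = tangent_map A \<psi> (\<phi> p) (tangent_map A \<phi> p v)"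
  unfolding tangent_map_eq
  by (simp only: o_apply, rule chart_deriv_comp) (use assms chart_at in auto)

lemma tangent_map_id: "tangent_map A id p v = v"
  unfolding tangent_map_eq by (simp add: chart_deriv_id chart_at)

lemma pullback_id: "pullback A id \<alpha> = \<alpha>"
  by (simp add: pullback_def tangent_map_id)

lemma pullback_comp:
  assumes "smooth_map A \<phi>" "smooth_map A \<psi>"
  shows "pullback A (\<psi> \<circ> \<phi>) \<alpha> = pullback A \<phi> (pullback A \<psi> \<alpha>)"
  by (simp add: pullback_def tangent_map_comp[OF assms])

lemma pullback_scale:
  "pullback A \<phi> (scale_form h \<alpha>) = scale_form (h \<circ> \<phi>) (pullback A \<phi> \<alpha>)"
  by (simp add: pullback_def scale_form_def)

lemma form_rep_eq: "form_rep A \<alpha> c x w = \<alpha> (chart_inv c x) (chart_deriv id c (chart_at A (chart_inv c x)) (chart_inv c x) w)"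
  if "c \<in> A" "x \<in> chart_image c"
  using chart_inv_image[OF that] by (simp add: form_rep_def chart_deriv_def)

lemma form_rep_linear:
  assumes "\<And>p. linear (\<alpha> p)" "c \<in> A" "x \<in> chart_image c"
  shows "linear (form_rep A \<alpha> c x)"
proof -
  have "linear (chart_deriv id c (chart_at A (chart_inv c x)) (chart_inv c x))"
    by (intro chart_deriv_linear smooth_map_id) (use assms chart_at chart_inv_image in auto)
  moreover have "form_rep A \<alpha> c x = \<alpha> (chart_inv c x) \<circ> chart_deriv id c (chart_at A (chart_inv c x)) (chart_inv c x)"
    using form_rep_eq[OF assms(2,3)] by auto
  ultimately show ?thesis
    using linear_compose[OF _ assms(1)[of "chart_inv c x"]] by simp
qed

lemma form_rep_point:
  assumes "c \<in> A" "p \<in> fst c"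
  shows "form_rep A \<alpha> c (snd c p) (chart_deriv id (chart_at A p) c p v) = \<alpha> p v"
  using assms by (simp add: form_rep_eq chart_deriv_inv chart_at)

lemma form_rep_pullback:
  assumes "smooth_map A \<phi>" "c \<in> A" "c' \<in> A" "p \<in> fst c" "\<phi> p \<in> fst c'"
  shows "form_rep A (pullback A \<phi> \<omega>) c (snd c p) w = form_rep A \<omega> c' (snd c' (\<phi> p)) (chart_deriv \<phi> c c' p w)"
proof -
  have "chart_deriv id (chart_at A p) c p (chart_deriv id c (chart_at A p) p w) = w"
    using assms chart_at by (intro chart_deriv_inv) auto
  then show ?thesis
    using tangent_map_chart[OF assms, of "chart_deriv id c (chart_at A p) p w"] assms
      form_rep_point[OF assms(3,5), of \<omega> "tangent_map A \<phi> p (chart_deriv id c (chart_at A p) p w)"]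
    by (simp add: form_rep_eq pullback_def)
qed

lemma smooth_form_rep: "smooth_form A \<alpha> \<Longrightarrow> c \<in> A \<Longrightarrow> smooth (chart_image c) (\<lambda>x. form_rep A \<alpha> c x v)"
  using smooth_on_iff[OF chart_open(2), of c] unfolding smooth_form_def by blast

lemma smooth_form_linear: "smooth_form A \<alpha> \<Longrightarrow> linear (\<alpha> p)"
  by (auto simp: smooth_form_def)

text \<open>Naturality is proved between two arbitrary charts. The map \<open>id\<close> then yields
  independence of the chart, and the charts of \<open>chart_at\<close> yield compatibility of
  \<open>ext_deriv\<close> with pullback.\<close>

lemma chart_ext_deriv_pullback:
  assumes \<omega>: "smooth_form A \<omega>" and \<phi>: "smooth_map A \<phi>" "c \<in> A" "c' \<in> A" "p \<in> fst c" "\<phi> p \<in> fst c'"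
  shows "chart_ext_deriv A (pullback A \<phi> \<omega>) c (snd c p) u v =
         chart_ext_deriv A \<omega> c' (snd c' (\<phi> p)) (chart_deriv \<phi> c c' p u) (chart_deriv \<phi> c c' p v)"
proof -
  let ?U = "snd c ` (fst c \<inter> \<phi> -` fst c')" and ?F = "snd c' \<circ> \<phi> \<circ> chart_inv c"
  have F: "smooth ?U ?F" by (rule smooth_map_chart[OF \<phi>(1-3)])
  have x: "snd c p \<in> ?U" using \<phi> by auto
  have rep: "form_rep A (pullback A \<phi> \<omega>) c y w = form_rep A \<omega> c' (?F y) (frechet_derivative ?F (at y) w)"
    if y: "y \<in> ?U" for y w
  proof -
    obtain q where q: "q \<in> fst c" "\<phi> q \<in> fst c'" "y = snd c q" using y by auto
    then show ?thesis using form_rep_pullback[OF \<phi>(1-3) q(1,2), of \<omega> w] \<phi>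
      by (simp add: chart_deriv_def)
  qed
  have cong: "frechet_derivative (\<lambda>y. form_rep A (pullback A \<phi> \<omega>) c y w) (at (snd c p)) =
    frechet_derivative (\<lambda>y. form_rep A \<omega> c' (?F y) (frechet_derivative ?F (at y) w)) (at (snd c p))" for w
    by (rule frechet_derivative_cong_open[OF smooth_open[OF F] x]) (use rep in blast)
  have "frechet_derivative (\<lambda>y. form_rep A \<omega> c' (?F y) (frechet_derivative ?F (at y) v)) (at (snd c p)) u -
     frechet_derivative (\<lambda>y. form_rep A \<omega> c' (?F y) (frechet_derivative ?F (at y) u)) (at (snd c p)) v =
    frechet_derivative (\<lambda>z. form_rep A \<omega> c' z (frechet_derivative ?F (at (snd c p)) v)) (at (?F (snd c p))) (frechet_derivative ?F (at (snd c p)) u) -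
    frechet_derivative (\<lambda>z. form_rep A \<omega> c' z (frechet_derivative ?F (at (snd c p)) u)) (at (?F (snd c p))) (frechet_derivative ?F (at (snd c p)) v)"
    by (rule ext_deriv_natural[where V = "chart_image c'", OF _ _ F _ x])
      (use smooth_form_rep[OF \<omega> \<phi>(3)] form_rep_linear[OF smooth_form_linear[OF \<omega>] \<phi>(3)] \<phi> in auto)
  then show ?thesis
    using \<phi> by (simp add: chart_ext_deriv_def cong chart_deriv_def)
qed

lemma ext_deriv_chart:
  assumes "smooth_form A \<omega>" "c \<in> A" "p \<in> fst c"
  shows "ext_deriv A \<omega> p u v = chart_ext_deriv A \<omega> c (snd c p)
    (chart_deriv id (chart_at A p) c p u) (chart_deriv id (chart_at A p) c p v)"
  using chart_ext_deriv_pullback[OF assms(1) smooth_map_id chart_at(1) assms(2) chart_at(2), of p] assms(3)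
  by (simp add: pullback_id ext_deriv_def chart_ext_deriv_def Let_def)

lemma ext_deriv_pullback:
  assumes "smooth_form A \<omega>" "smooth_map A \<phi>" "smooth_form A (pullback A \<phi> \<omega>)"
  shows "ext_deriv A (pullback A \<phi> \<omega>) p u v = ext_deriv A \<omega> (\<phi> p) (tangent_map A \<phi> p u) (tangent_map A \<phi> p v)"
  using chart_ext_deriv_pullback[OF assms(1,2) chart_at(1) chart_at(1) chart_at(2) chart_at(2), of p]
  by (simp add: ext_deriv_def chart_ext_deriv_def tangent_map_eq Let_def)

section \<open>Joint smoothness in time and point\<close>

definition smooth_at_within :: "real set \<Rightarrow> (real \<Rightarrow> 'm \<Rightarrow> 'm) \<Rightarrow> real \<Rightarrow> 'm \<Rightarrow> bool" where
  "smooth_at_within S \<theta> t0 p0 \<longleftrightarrow> (\<exists>c\<in>A. \<exists>c'\<in>A. \<exists>T U. open T \<and> t0 \<in> T \<and> open U \<and> p0 \<in> U \<and> U \<subseteq> fst c \<and>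
     (\<forall>t\<in>T \<inter> S. \<forall>p\<in>U. \<theta> t p \<in> fst c') \<and>
     smooth_on ((T \<inter> S) \<times> snd c ` U) (\<lambda>(t, x). snd c' (\<theta> t (chart_inv c x))))"

lemma smooth_at_withinE:
  assumes "smooth_at_within S \<theta> t0 p0" "t0 \<in> S"
  obtains c c' T U where "c \<in> A" "c' \<in> A" "open T" "t0 \<in> T" "open U" "p0 \<in> U" "U \<subseteq> fst c"
    "\<And>t p. t \<in> T \<Longrightarrow> t \<in> S \<Longrightarrow> p \<in> U \<Longrightarrow> \<theta> t p \<in> fst c'"
    "smooth_on ((T \<inter> S) \<times> snd c ` U) (\<lambda>(t, x). snd c' (\<theta> t (chart_inv c x)))"
  using assms unfolding smooth_at_within_def by (metis IntI)

lemma smooth_at_within_continuous: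
  assumes "smooth_at_within S \<theta> t0 p0" "t0 \<in> S"
  shows "continuous (at (t0, p0) within S \<times> UNIV) (\<lambda>(t, p). \<theta> t p)"
proof -
  obtain c c' T U where *: "c \<in> A" "c' \<in> A" "open T" "t0 \<in> T" "open U" "p0 \<in> U" "U \<subseteq> fst c"
    "\<And>t p. t \<in> T \<Longrightarrow> t \<in> S \<Longrightarrow> p \<in> U \<Longrightarrow> \<theta> t p \<in> fst c'"
    "smooth_on ((T \<inter> S) \<times> snd c ` U) (\<lambda>(t, x). snd c' (\<theta> t (chart_inv c x)))"
    using smooth_at_withinE[OF assms] by metis
  have "continuous_on ((T \<inter> S) \<times> U) (\<lambda>q. (\<lambda>(t, x). snd c' (\<theta> t (chart_inv c x))) (fst q, snd c (snd q)))"
    by (rule continuous_on_compose2[OF smooth_on_continuous[OF *(9)]])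
      (use * in \<open>auto intro!: continuous_intros continuous_on_compose2[OF chart_continuous(1)[OF *(1)]]\<close>)
  then have "continuous_on ((T \<inter> S) \<times> U) (\<lambda>q. chart_inv c' ((\<lambda>(t, x). snd c' (\<theta> t (chart_inv c x))) (fst q, snd c (snd q))))"
  proof (rule continuous_on_compose2[OF chart_continuous(2)[OF *(2)]])
    show "(\<lambda>q. (\<lambda>(t, x). snd c' (\<theta> t (chart_inv c x))) (fst q, snd c (snd q))) ` ((T \<inter> S) \<times> U) \<subseteq> chart_image c'"
    proof safe
      fix t p assume "t \<in> T" "t \<in> S" "p \<in> U"
      moreover have "chart_inv c (snd c p) = p" using * \<open>p \<in> U\<close> by auto
      ultimately show "snd c' (\<theta> (fst (t, p)) (chart_inv c (snd c (snd (t, p))))) \<in> chart_image c'"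
        using *(8) by simp
    qed
  qed
  then have "continuous_on ((T \<inter> S) \<times> U) (\<lambda>(t, p). \<theta> t p)"
  proof (rule continuous_on_eq)
    fix q assume q: "q \<in> (T \<inter> S) \<times> U"
    then have "chart_inv c (snd c (snd q)) = snd q" "\<theta> (fst q) (snd q) \<in> fst c'" using * by auto
    then show "chart_inv c' ((\<lambda>(t, x). snd c' (\<theta> t (chart_inv c x))) (fst q, snd c (snd q))) = (case q of (t, p) \<Rightarrow> \<theta> t p)"
      using *(2) by (simp add: split_beta)
  qed
  moreover have "at (t0, p0) within (T \<inter> S) \<times> U = at (t0, p0) within S \<times> UNIV"
    by (rule at_within_nhd[of _ "T \<times> U"]) (use * in \<open>auto intro: open_Times\<close>)
  ultimately show ?thesis
    using * assms by (metis (no_types, lifting) IntI continuous_on_eq_continuous_within mem_Sigma_iff)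
qed

lemma smooth_at_within_nbhd:
  assumes \<theta>: "smooth_at_within S \<theta> t0 p0" and t0: "t0 \<in> S" and W: "open W" "\<theta> t0 p0 \<in> W"
  obtains T U where "open T" "t0 \<in> T" "open U" "p0 \<in> U" "\<And>t p. t \<in> T \<Longrightarrow> t \<in> S \<Longrightarrow> p \<in> U \<Longrightarrow> \<theta> t p \<in> W"
proof -
  obtain N where N: "open N" "(t0, p0) \<in> N" "\<forall>q\<in>N \<inter> S \<times> UNIV. (case q of (t, p) \<Rightarrow> \<theta> t p) \<in> W"
    using smooth_at_within_continuous[OF \<theta> t0] W unfolding continuous_within_topological
    by (metis (no_types, lifting) Int_iff case_prod_conv)
  obtain T U where TU: "open T" "open U" "(t0, p0) \<in> T \<times> U" "T \<times> U \<subseteq> N"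
    using open_prod_elim[OF N(1,2)] by metis
  have "\<theta> t p \<in> W" if "t \<in> T" "t \<in> S" "p \<in> U" for t p
  proof -
    have "(t, p) \<in> N \<inter> S \<times> UNIV" using that TU by auto
    from bspec[OF N(3) this] show ?thesis by simp
  qed
  then show thesis using that TU by auto
qed

text \<open>The definition asks for some pair of charts, which is easy to verify. Composition with
  coordinate changes on both sides, after shrinking the neighbourhoods by continuity, passes to any
  prescribed pair.\<close>

lemma smooth_at_within_charts:
  assumes \<theta>: "smooth_at_within S \<theta> t0 p0" and t0: "t0 \<in> S"
    and d: "d \<in> A" "d' \<in> A" "p0 \<in> fst d" "\<theta> t0 p0 \<in> fst d'"
  obtains T U where "open T" "t0 \<in> T" "open U" "p0 \<in> U" "U \<subseteq> fst d"
    "\<And>t p. t \<in> T \<Longrightarrow> t \<in> S \<Longrightarrow> p \<in> U \<Longrightarrow> \<theta> t p \<in> fst d'"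
    "smooth_on ((T \<inter> S) \<times> snd d ` U) (\<lambda>(t, x). snd d' (\<theta> t (chart_inv d x)))"
proof -
  obtain c c' T U where *: "c \<in> A" "c' \<in> A" "open T" "t0 \<in> T" "open U" "p0 \<in> U" "U \<subseteq> fst c"
    "\<And>t p. t \<in> T \<Longrightarrow> t \<in> S \<Longrightarrow> p \<in> U \<Longrightarrow> \<theta> t p \<in> fst c'"
    "smooth_on ((T \<inter> S) \<times> snd c ` U) (\<lambda>(t, x). snd c' (\<theta> t (chart_inv c x)))"
    using smooth_at_withinE[OF \<theta> t0] by metis
  obtain T1 U1 where 1: "open T1" "t0 \<in> T1" "open U1" "p0 \<in> U1"
    "\<And>t p. t \<in> T1 \<Longrightarrow> t \<in> S \<Longrightarrow> p \<in> U1 \<Longrightarrow> \<theta> t p \<in> fst d'"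
    using smooth_at_within_nbhd[OF \<theta> t0 chart_open(1)[OF d(2)] d(4)] by metis
  let ?T = "T \<inter> T1" and ?U = "U \<inter> U1 \<inter> fst d"
  have tr: "smooth (snd d ` (fst d \<inter> fst c)) (\<lambda>x. snd c (chart_inv d x))"
    using smooth_map_chart[OF smooth_map_id d(1) *(1)] by (simp add: o_def)
  have tr': "smooth (snd c' ` (fst c' \<inter> fst d')) (\<lambda>x. snd d' (chart_inv c' x))"
    using smooth_map_chart[OF smooth_map_id *(2) d(2)] by (simp add: o_def)
  have o: "open (UNIV \<times> snd d ` (fst d \<inter> fst c))" by (intro open_Times open_UNIV smooth_open[OF tr])
  have "smooth (UNIV \<times> snd d ` (fst d \<inter> fst c)) (\<lambda>q :: real \<times> 'e. (fst q, snd c (chart_inv d (snd q))))"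
    by (intro smooth_Pair smooth_linear[OF o] bounded_linear_fst
        smooth_compose[OF tr smooth_linear[OF o bounded_linear_snd]]) auto
  then have s1: "smooth_on ((?T \<inter> S) \<times> snd d ` ?U) (\<lambda>q :: real \<times> 'e. (fst q, snd c (chart_inv d (snd q))))"
    by (rule smooth_imp_on) (use * in auto)
  have s2: "smooth_on ((?T \<inter> S) \<times> snd d ` ?U) (\<lambda>q. (\<lambda>(t, x). snd c' (\<theta> t (chart_inv c x))) (fst q, snd c (chart_inv d (snd q))))"
    by (rule smooth_on_compose[OF *(9) s1]) (use * d in auto)
  have mem: "snd d' (\<theta> t p) = snd d' (chart_inv c' (snd c' (\<theta> t p)))" "\<theta> t p \<in> fst c' \<inter> fst d'" "chart_inv c (snd c p) = p" "chart_inv d (snd d p) = p"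
    if "t \<in> ?T" "t \<in> S" "p \<in> ?U" for t p
    using that * 1 d by auto
  have s3: "smooth_on ((?T \<inter> S) \<times> snd d ` ?U)
     (\<lambda>q. snd d' (chart_inv c' ((\<lambda>(t, x). snd c' (\<theta> t (chart_inv c x))) (fst q, snd c (chart_inv d (snd q))))))"
  proof (rule smooth_on_compose[OF smooth_imp_on[OF tr' subset_refl] s2])
    fix q assume "q \<in> (?T \<inter> S) \<times> snd d ` ?U"
    then obtain t p where q: "q = (t, snd d p)" "t \<in> ?T" "t \<in> S" "p \<in> ?U" by auto
    show "(\<lambda>(t, x). snd c' (\<theta> t (chart_inv c x))) (fst q, snd c (chart_inv d (snd q))) \<in> snd c' ` (fst c' \<inter> fst d')"
      using mem[OF q(2,3,4)] unfolding q(1) by auto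
  qed
  have "smooth_on ((?T \<inter> S) \<times> snd d ` ?U) (\<lambda>(t, x). snd d' (\<theta> t (chart_inv d x)))"
  proof (rule smooth_on_cong[OF s3])
    fix q assume "q \<in> (?T \<inter> S) \<times> snd d ` ?U"
    then obtain t p where q: "q = (t, snd d p)" "t \<in> ?T" "t \<in> S" "p \<in> ?U" by auto
    show "snd d' (chart_inv c' ((\<lambda>(t, x). snd c' (\<theta> t (chart_inv c x))) (fst q, snd c (chart_inv d (snd q))))) =
      (case q of (t, x) \<Rightarrow> snd d' (\<theta> t (chart_inv d x)))"
      using mem[OF q(2,3,4)] unfolding q(1) by simp
  qed
  moreover have "open ?U" "open ?T" using * 1 chart_open(1)[OF d(1)] by auto
  ultimately show thesis using that[of ?T ?U] * 1 d by auto
qed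

text \<open>Composition at equal times. It serves for products of isotopies and for doubling the
  time on which a flow is known to be smooth.\<close>

lemma smooth_at_within_comp:
  assumes \<theta>: "smooth_at_within S \<theta> t0 p0" and \<phi>: "smooth_at_within S \<phi> t0 (\<theta> t0 p0)" and t0: "t0 \<in> S"
  shows "smooth_at_within S (\<lambda>t p. \<phi> t (\<theta> t p)) t0 p0"
proof -
  let ?c = "chart_at A p0" and ?d = "chart_at A (\<theta> t0 p0)" and ?e = "chart_at A (\<phi> t0 (\<theta> t0 p0))"
  obtain T2 U2 where 2: "open T2" "t0 \<in> T2" "open U2" "\<theta> t0 p0 \<in> U2" "U2 \<subseteq> fst ?d"
    "\<And>t p. t \<in> T2 \<Longrightarrow> t \<in> S \<Longrightarrow> p \<in> U2 \<Longrightarrow> \<phi> t p \<in> fst ?e"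
    "smooth_on ((T2 \<inter> S) \<times> snd ?d ` U2) (\<lambda>(t, x). snd ?e (\<phi> t (chart_inv ?d x)))"
    using smooth_at_within_charts[OF \<phi> t0 chart_at(1) chart_at(1) chart_at(2) chart_at(2)] by metis
  obtain T1 U1 where 1: "open T1" "t0 \<in> T1" "open U1" "p0 \<in> U1" "U1 \<subseteq> fst ?c"
    "\<And>t p. t \<in> T1 \<Longrightarrow> t \<in> S \<Longrightarrow> p \<in> U1 \<Longrightarrow> \<theta> t p \<in> fst ?d"
    "smooth_on ((T1 \<inter> S) \<times> snd ?c ` U1) (\<lambda>(t, x). snd ?d (\<theta> t (chart_inv ?c x)))"
    using smooth_at_within_charts[OF \<theta> t0 chart_at(1) chart_at(1) chart_at(2) chart_at(2)] by metis
  obtain T3 U3 where 3: "open T3" "t0 \<in> T3" "open U3" "p0 \<in> U3"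
    "\<And>t p. t \<in> T3 \<Longrightarrow> t \<in> S \<Longrightarrow> p \<in> U3 \<Longrightarrow> \<theta> t p \<in> U2"
    using smooth_at_within_nbhd[OF \<theta> t0 2(3,4)] by metis
  let ?T = "T1 \<inter> T2 \<inter> T3" and ?U = "U1 \<inter> U3"
  have "smooth_on ((?T \<inter> S) \<times> snd ?c ` ?U) (\<lambda>(t, x). snd ?d (\<theta> t (chart_inv ?c x)))"
    by (rule smooth_on_subset[OF 1(7)]) auto
  moreover have "smooth_on ((?T \<inter> S) \<times> snd ?c ` ?U) fst"
    using smooth_imp_on[OF smooth_linear[OF open_UNIV bounded_linear_fst]] by blast
  ultimately have s: "smooth_on ((?T \<inter> S) \<times> snd ?c ` ?U) (\<lambda>q. (fst q, (\<lambda>(t, x). snd ?d (\<theta> t (chart_inv ?c x))) q))"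
    unfolding smooth_on_alt
  proof (intro ballI)
    fix q assume 4: "\<forall>x\<in>(?T \<inter> S) \<times> snd ?c ` ?U. \<exists>Ua g. x \<in> Ua \<and> (\<forall>y\<in>Ua \<inter> (?T \<inter> S) \<times> snd ?c ` ?U. g y = (case y of (t, x) \<Rightarrow> snd ?d (\<theta> t (chart_inv ?c x)))) \<and> smooth Ua g"
      and q: "q \<in> (?T \<inter> S) \<times> snd ?c ` ?U"
    obtain Ua g where g: "q \<in> Ua" "\<forall>y\<in>Ua \<inter> (?T \<inter> S) \<times> snd ?c ` ?U. g y = (case y of (t, x) \<Rightarrow> snd ?d (\<theta> t (chart_inv ?c x)))" "smooth Ua g"
      using bspec[OF 4 q] by metis
    have "smooth Ua (\<lambda>q. (fst q, g q))"
      by (intro smooth_Pair g(3) smooth_linear bounded_linear_fst smooth_open[OF g(3)])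
    then show "\<exists>Ub h. q \<in> Ub \<and> (\<forall>y\<in>Ub \<inter> (?T \<inter> S) \<times> snd ?c ` ?U. h y = (fst y, case y of (t, x) \<Rightarrow> snd ?d (\<theta> t (chart_inv ?c x)))) \<and> smooth Ub h"
      using g by (intro exI[of _ Ua] exI[of _ "\<lambda>q. (fst q, g q)"]) simp
  qed
  have mem: "\<theta> t p \<in> U2" "chart_inv ?c (snd ?c p) = p" "chart_inv ?d (snd ?d (\<theta> t p)) = \<theta> t p"
    if "t \<in> ?T" "t \<in> S" "p \<in> ?U" for t p
    using that 1 2 3 chart_at by auto
  have "smooth_on ((?T \<inter> S) \<times> snd ?c ` ?U)
     (\<lambda>q. (\<lambda>(t, x). snd ?e (\<phi> t (chart_inv ?d x))) (fst q, (\<lambda>(t, x). snd ?d (\<theta> t (chart_inv ?c x))) q))"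
    by (rule smooth_on_compose[OF 2(7) s]) (use mem in auto)
  then have "smooth_on ((?T \<inter> S) \<times> snd ?c ` ?U) (\<lambda>(t, x). snd ?e (\<phi> t (\<theta> t (chart_inv ?c x))))"
  proof (rule smooth_on_cong)
    fix q assume "q \<in> (?T \<inter> S) \<times> snd ?c ` ?U"
    then obtain t p where q: "q = (t, snd ?c p)" "t \<in> ?T" "t \<in> S" "p \<in> ?U" by auto
    show "(\<lambda>(t, x). snd ?e (\<phi> t (chart_inv ?d x))) (fst q, (\<lambda>(t, x). snd ?d (\<theta> t (chart_inv ?c x))) q) =
       (case q of (t, x) \<Rightarrow> snd ?e (\<phi> t (\<theta> t (chart_inv ?c x))))"
      using mem[OF q(2,3,4)] unfolding q(1) by simp
  qed
  moreover have "open ?T" "open ?U" "t0 \<in> ?T" "p0 \<in> ?U" "?U \<subseteq> fst ?c" using 1 2 3 by auto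
  moreover have "\<forall>t\<in>?T \<inter> S. \<forall>p\<in>?U. \<phi> t (\<theta> t p) \<in> fst ?e" using mem 2(6) by blast
  ultimately show ?thesis unfolding smooth_at_within_def
    by (intro bexI[OF _ chart_at(1)] exI[of _ ?T] exI[of _ ?U]) auto
qed

text \<open>One affine change of time covers restriction, reversal, rescaling and, with factor 0,
  freezing a path at a single time.\<close>

lemma smooth_at_within_time:
  assumes \<theta>: "smooth_at_within S \<theta> (a * t0 + b) p0" and t0: "t0 \<in> S'" and S': "\<And>t. t \<in> S' \<Longrightarrow> a * t + b \<in> S"
  shows "smooth_at_within S' (\<lambda>t. \<theta> (a * t + b)) t0 p0"
proof -
  obtain c c' T U where *: "c \<in> A" "c' \<in> A" "open T" "a * t0 + b \<in> T" "open U" "p0 \<in> U" "U \<subseteq> fst c"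
    "\<And>t p. t \<in> T \<Longrightarrow> t \<in> S \<Longrightarrow> p \<in> U \<Longrightarrow> \<theta> t p \<in> fst c'"
    "smooth_on ((T \<inter> S) \<times> snd c ` U) (\<lambda>(t, x). snd c' (\<theta> t (chart_inv c x)))"
    using smooth_at_withinE[OF \<theta> S'[OF t0]] by metis
  let ?T = "(\<lambda>t. a * t + b) -` T"
  have oT: "open ?T" by (intro open_vimage *(3) continuous_intros)
  have "smooth UNIV (\<lambda>q :: real \<times> 'e. (fst q * a + b, snd q))"
    by (intro smooth_Pair smooth_add smooth_const smooth_linear open_UNIV bounded_linear_snd
        bounded_linear_compose[OF bounded_linear_mult_left] bounded_linear_fst)
  then have s: "smooth_on ((?T \<inter> S') \<times> snd c ` U) (\<lambda>q :: real \<times> 'e. (fst q * a + b, snd q))"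
    by (rule smooth_imp_on) auto
  have "smooth_on ((?T \<inter> S') \<times> snd c ` U) (\<lambda>q. (\<lambda>(t, x). snd c' (\<theta> t (chart_inv c x))) (fst q * a + b, snd q))"
    by (rule smooth_on_compose[OF *(9) s]) (use S' in \<open>auto simp: mult.commute\<close>)
  then have "smooth_on ((?T \<inter> S') \<times> snd c ` U) (\<lambda>(t, x). snd c' (\<theta> (a * t + b) (chart_inv c x)))"
    by (rule smooth_on_cong) (auto simp: mult.commute)
  then show ?thesis unfolding smooth_at_within_def
    by (intro bexI[OF _ *(1)] bexI[OF _ *(2)] exI[of _ ?T] exI[of _ U]) (use * oT S' in auto)
qed

lemma smooth_at_within_subset: "smooth_at_within S \<theta> t0 p0 \<Longrightarrow> t0 \<in> S' \<Longrightarrow> S' \<subseteq> S \<Longrightarrow> smooth_at_within S' \<theta> t0 p0"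
  using smooth_at_within_time[of S \<theta> 1 t0 0 p0 S'] by auto

lemma smooth_at_within_continuous_on:
  assumes "\<And>t p. t \<in> S \<Longrightarrow> smooth_at_within S \<theta> t p"
  shows "continuous_on (S \<times> UNIV) (\<lambda>(t, p). \<theta> t p)"
  unfolding continuous_on_eq_continuous_within using smooth_at_within_continuous assms by auto

lemma smooth_at_within_imp_smooth_on:
  assumes "\<And>t p. t \<in> S \<Longrightarrow> smooth_at_within S \<theta> t p" and c: "c \<in> A" "c' \<in> A"
  shows "smooth_on {(t, x). t \<in> S \<and> x \<in> chart_image c \<and> \<theta> t (chart_inv c x) \<in> fst c'}
          (\<lambda>(t, x). snd c' (\<theta> t (chart_inv c x)))" (is "smooth_on ?S ?f")
proof (rule smooth_on_local)
  fix q assume q: "q \<in> ?S"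
  obtain t0 x0 where q': "q = (t0, x0)" by (cases q)
  have *: "t0 \<in> S" "x0 \<in> chart_image c" "\<theta> t0 (chart_inv c x0) \<in> fst c'" using q q' by auto
  have p: "chart_inv c x0 \<in> fst c" "snd c (chart_inv c x0) = x0" using chart_inv_image[OF c(1) *(2)] by auto
  obtain T U where TU: "open T" "t0 \<in> T" "open U" "chart_inv c x0 \<in> U" "U \<subseteq> fst c"
    "smooth_on ((T \<inter> S) \<times> snd c ` U) ?f"
    using smooth_at_within_charts[OF assms(1)[OF *(1)] *(1) c p(1) *(3)] by metis
  have "open (T \<times> snd c ` U)" by (intro open_Times TU chart_image_open[OF c(1)])
  then have "openin (top_of_set ?S) (?S \<inter> (T \<times> snd c ` U))" by (rule openin_open_Int)
  moreover have "q \<in> ?S \<inter> (T \<times> snd c ` U)" 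
  proof
    have "x0 \<in> snd c ` U" using TU(4) p(2) by (metis image_eqI)
    then show "q \<in> T \<times> snd c ` U" using q' TU(2) by simp
  qed (rule q)
  moreover have "smooth_on (?S \<inter> (T \<times> snd c ` U)) ?f"
    by (rule smooth_on_subset[OF TU(6)]) auto
  ultimately show "\<exists>T. openin (top_of_set ?S) T \<and> q \<in> T \<and> smooth_on T ?f" by blast
qed

lemma smooth_isotopyI:
  assumes "\<And>t. t \<in> {0..1} \<Longrightarrow> diffeo A (\<Phi> t)" "\<And>t p. t \<in> {0..1} \<Longrightarrow> smooth_at_within {0..1} \<Phi> t p"
  shows "smooth_isotopy A \<Phi>"
  unfolding smooth_isotopy_def
  using assms smooth_at_within_continuous_on[of "{0..1}" \<Phi>] smooth_at_within_imp_smooth_on[of "{0..1}" \<Phi>] by blast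

lemma smooth_isotopyD:
  assumes "smooth_isotopy A \<Phi>" "t \<in> {0..1}"
  shows "smooth_at_within {0..1} \<Phi> t p"
proof -
  let ?c = "chart_at A p" and ?c' = "chart_at A (\<Phi> t p)"
  have "continuous (at (t, p) within {0..1} \<times> UNIV) (\<lambda>(t, p). \<Phi> t p)"
    using assms by (auto simp: smooth_isotopy_def continuous_on_eq_continuous_within)
  then obtain N where N: "open N" "(t, p) \<in> N" "\<forall>q\<in>N \<inter> {0..1} \<times> UNIV. (case q of (t, p) \<Rightarrow> \<Phi> t p) \<in> fst ?c'"
    unfolding continuous_within_topological using chart_open(1)[OF chart_at(1)] chart_at(2)
    by (metis (no_types, lifting) Int_iff case_prod_conv)
  obtain T U where TU: "open T" "open U" "(t, p) \<in> T \<times> U" "T \<times> U \<subseteq> N"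
    using open_prod_elim[OF N(1,2)] by metis
  have mem: "\<Phi> s q \<in> fst ?c'" if "s \<in> T \<inter> {0..1}" "q \<in> U" for s q
  proof -
    have "(s, q) \<in> N \<inter> {0..1} \<times> UNIV" using that TU by auto
    from bspec[OF N(3) this] show ?thesis by simp
  qed
  have s: "smooth_on {(t, x). t \<in> {0..1} \<and> x \<in> chart_image ?c \<and> \<Phi> t (chart_inv ?c x) \<in> fst ?c'}
          (\<lambda>(t, x). snd ?c' (\<Phi> t (chart_inv ?c x)))"
    using assms(1) chart_at(1) unfolding smooth_isotopy_def by blast
  have "smooth_on ((T \<inter> {0..1}) \<times> snd ?c ` (U \<inter> fst ?c)) (\<lambda>(t, x). snd ?c' (\<Phi> t (chart_inv ?c x)))"
    by (rule smooth_on_subset[OF s]) (use mem chart_at in auto)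
  then show ?thesis unfolding smooth_at_within_def
    by (intro bexI[OF _ chart_at(1)] exI[of _ T] exI[of _ "U \<inter> fst ?c"])
      (use TU mem chart_at chart_open(1)[OF chart_at(1)] in auto)
qed

lemma smooth_map_at_within:
  assumes "smooth_map A \<phi>"
  shows "smooth_at_within S (\<lambda>t. \<phi>) t p"
proof -
  let ?c = "chart_at A p" and ?c' = "chart_at A (\<phi> p)"
  let ?U = "fst ?c \<inter> \<phi> -` fst ?c'"
  have "open (\<phi> -` fst ?c')"
    using assms chart_open(1)[OF chart_at(1)] open_vimage by (auto simp: smooth_map_def)
  then have oU: "open ?U" using chart_open(1)[OF chart_at(1)] by auto
  have s: "smooth (snd ?c ` ?U) (snd ?c' \<circ> \<phi> \<circ> chart_inv ?c)"
    by (rule smooth_map_chart[OF assms chart_at(1) chart_at(1)])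
  have o: "open (UNIV \<times> snd ?c ` ?U)" by (intro open_Times open_UNIV smooth_open[OF s])
  have "smooth (UNIV \<times> snd ?c ` ?U) (\<lambda>q :: real \<times> 'e. (snd ?c' \<circ> \<phi> \<circ> chart_inv ?c) (snd q))"
    by (rule smooth_compose[OF s smooth_linear[OF o bounded_linear_snd]]) auto
  then have "smooth_on ((UNIV \<inter> S) \<times> snd ?c ` ?U) (\<lambda>q :: real \<times> 'e. (snd ?c' \<circ> \<phi> \<circ> chart_inv ?c) (snd q))"
    by (rule smooth_imp_on) auto
  then have "smooth_on ((UNIV \<inter> S) \<times> snd ?c ` ?U) (\<lambda>(t, x). snd ?c' (\<phi> (chart_inv ?c x)))"
    by (rule smooth_on_cong) auto
  then show ?thesis unfolding smooth_at_within_def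
    by (intro bexI[OF _ chart_at(1)] exI[of _ UNIV] exI[of _ ?U]) (use oU chart_at in auto)
qed

lemma smooth_map_slice:
  assumes "\<And>p. smooth_at_within S \<theta> t p" "t \<in> S"
  shows "smooth_map A (\<theta> t)"
proof -
  have *: "smooth_at_within UNIV (\<lambda>s. \<theta> t) s p" for s p
    using smooth_at_within_time[of S \<theta> 0 s t p UNIV] assms by simp
  have c: "continuous_on (UNIV \<times> UNIV) (\<lambda>(s::real, p). \<theta> t p)"
    by (rule smooth_at_within_continuous_on[of UNIV "\<lambda>s. \<theta> t"]) (rule *)
  have "continuous_on UNIV (\<lambda>p. (\<lambda>(s::real, p). \<theta> t p) (0, p))"
    by (rule continuous_on_compose2[OF c]) (auto intro!: continuous_intros)
  moreover have "smooth_on (snd c ` (fst c \<inter> \<theta> t -` fst c')) (snd c' \<circ> \<theta> t \<circ> chart_inv c)" if "c \<in> A" "c' \<in> A" for c c'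
  proof -
    have "smooth UNIV (\<lambda>x :: 'e. (0 :: real, x))"
      by (intro smooth_Pair smooth_const smooth_linear open_UNIV bounded_linear_ident)
    then have s: "smooth_on (snd c ` (fst c \<inter> \<theta> t -` fst c')) (\<lambda>x :: 'e. (0 :: real, x))"
      by (rule smooth_imp_on) auto
    have "smooth_on (snd c ` (fst c \<inter> \<theta> t -` fst c')) (\<lambda>x. (\<lambda>(s::real, x). snd c' (\<theta> t (chart_inv c x))) (0, x))"
      by (rule smooth_on_compose[OF smooth_at_within_imp_smooth_on[of UNIV "\<lambda>s. \<theta> t", OF * that] s]) (use that in auto)
    then show ?thesis by (simp add: o_def)
  qed
  ultimately show ?thesis by (simp add: smooth_map_def)
qed

lemma smooth_map_comp:
  assumes "smooth_map A \<phi>" "smooth_map A \<psi>"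
  shows "smooth_map A (\<psi> \<circ> \<phi>)"
  using smooth_map_slice[of UNIV "\<lambda>t. \<psi> \<circ> \<phi>" 0]
    smooth_at_within_comp[of UNIV "\<lambda>_. \<phi>" 0 _ "\<lambda>_. \<psi>"] smooth_map_at_within assms by (simp add: o_def)

end

section \<open>Flows of vector fields\<close>

lemma isCont_eventually: "isCont \<gamma> t \<Longrightarrow> open U \<Longrightarrow> \<gamma> t \<in> U \<Longrightarrow> \<forall>\<^sub>F s in nhds t. \<gamma> s \<in> U"
  unfolding continuous_at_open eventually_nhds by blast

text \<open>The segment from \<open>t1\<close> to a nearby t is rescaled to the unit interval, where
  the field acquires the factor t - t1; for t close to \<open>t1\<close> the Lipschitz constant
  drops to 1/2 and \<open>growth_bound\<close> with e = 0 applies.\<close>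

lemma ode_unique_local:
  fixes X :: "'a::euclidean_space \<Rightarrow> 'a"
  assumes X: "smooth V X" and eq: "u t1 = w t1" "u t1 \<in> V"
    and ev: "\<forall>\<^sub>F t in nhds t1. (u has_vector_derivative X (u t)) (at t) \<and> (w has_vector_derivative X (w t)) (at t)"
  shows "\<forall>\<^sub>F t in nhds t1. u t = w t"
proof -
  obtain r where r: "r > 0" "cball (u t1) r \<subseteq> V" using smooth_open[OF X] eq(2) open_contains_cball by blast
  obtain L where L: "L \<ge> 0" "\<And>x y. x \<in> cball (u t1) r \<Longrightarrow> y \<in> cball (u t1) r \<Longrightarrow> norm (X x - X y) \<le> L * norm (x - y)"
    using smooth_lipschitz[OF X compact_cball r(2) convex_cball] by metis
  have "(u has_vector_derivative X (u t1)) (at t1)" "(w has_vector_derivative X (w t1)) (at t1)"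
    using eventually_nhds_x_imp_x[OF ev] by auto
  then have "isCont u t1" "isCont w t1" by (auto intro: has_vector_derivative_continuous)
  moreover have "open (ball (u t1) r)" "u t1 \<in> ball (u t1) r" using r by auto
  ultimately have b: "\<forall>\<^sub>F t in nhds t1. u t \<in> ball (u t1) r" "\<forall>\<^sub>F t in nhds t1. w t \<in> ball (u t1) r"
    using eq(1) isCont_eventually by metis+
  have "\<forall>\<^sub>F t in nhds t1. ((u has_vector_derivative X (u t)) (at t) \<and> (w has_vector_derivative X (w t)) (at t))
      \<and> u t \<in> ball (u t1) r \<and> w t \<in> ball (u t1) r"
    by (rule eventually_conj[OF ev eventually_conj[OF b]])
  then obtain d where "d > 0" and d': "\<And>t. dist t t1 < d \<Longrightarrow> ((u has_vector_derivative X (u t)) (at t) \<and>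
      (w has_vector_derivative X (w t)) (at t)) \<and> u t \<in> ball (u t1) r \<and> w t \<in> ball (u t1) r"
    unfolding eventually_nhds_metric by blast
  then have d: "d > 0" "\<And>t. dist t t1 < d \<Longrightarrow> (u has_vector_derivative X (u t)) (at t)"
    "\<And>t. dist t t1 < d \<Longrightarrow> (w has_vector_derivative X (w t)) (at t)"
    "\<And>t. dist t t1 < d \<Longrightarrow> u t \<in> cball (u t1) r" "\<And>t. dist t t1 < d \<Longrightarrow> w t \<in> cball (u t1) r"
    using ball_subset_cball[of "u t1" r] by blast+
  define e where "e = min d (1 / (2 * (L + 1)))"
  have e: "e > 0" using d L by (simp add: e_def)
  have "u t = w t" if t: "dist t t1 < e" for t
  proof -
    define s where "s = t - t1"
    have sd: "\<bar>s\<bar> < d" and "\<bar>s\<bar> < 1 / (2 * (L + 1))" using t by (auto simp: e_def s_def dist_real_def)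
    then have "\<bar>s\<bar> * (L + 1) < 1 / 2" using L by (simp add: field_simps)
    then have sL: "\<bar>s\<bar> * L \<le> 1 / 2" by (simp add: distrib_left)
    have near: "dist (t1 + \<tau> * s) t1 < d" if "\<tau> \<in> {0..1}" for \<tau>
      using that sd mult_left_le_one_le[of "\<bar>s\<bar>" \<tau>] by (simp add: dist_real_def abs_mult)
    have chain: "((\<lambda>\<tau>. v (t1 + \<tau> * s)) has_vector_derivative s *\<^sub>R X (v (t1 + \<tau> * s))) (at \<tau> within {0..1})"
      if "(v has_vector_derivative X (v (t1 + \<tau> * s))) (at (t1 + \<tau> * s))" for v \<tau>
    proof -
      have "((\<lambda>\<tau>. t1 + \<tau> * s) has_vector_derivative s) (at \<tau>)"
        by (auto intro!: derivative_eq_intros simp: has_vector_derivative_def)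
      from vector_diff_chain_at[OF this that] show ?thesis
        by (simp add: o_def has_vector_derivative_at_within)
    qed
    let ?D = "\<lambda>\<tau>. u (t1 + \<tau> * s) - w (t1 + \<tau> * s)"
    have "norm (?D 1) \<le> 0 / (1 - 1/2)"
    proof (rule growth_bound[where D = ?D and c = "1/2" and e = 0 and t = 1
          and D' = "\<lambda>\<tau>. s *\<^sub>R X (u (t1 + \<tau> * s)) - s *\<^sub>R X (w (t1 + \<tau> * s))"])
      fix \<tau> :: real assume \<tau>: "\<tau> \<in> {0..1}"
      show "(?D has_vector_derivative (s *\<^sub>R X (u (t1 + \<tau> * s)) - s *\<^sub>R X (w (t1 + \<tau> * s)))) (at \<tau> within {0..1})"
        by (rule has_vector_derivative_diff[OF chain[OF d(2)[OF near[OF \<tau>]]] chain[OF d(3)[OF near[OF \<tau>]]]])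
      have "norm (s *\<^sub>R X (u (t1 + \<tau> * s)) - s *\<^sub>R X (w (t1 + \<tau> * s))) = \<bar>s\<bar> * norm (X (u (t1 + \<tau> * s)) - X (w (t1 + \<tau> * s)))"
        by (simp add: scaleR_diff_right[symmetric])
      also have "\<dots> \<le> \<bar>s\<bar> * (L * norm (?D \<tau>))"
        by (intro mult_left_mono L(2) d(4,5) near \<tau>) simp
      also have "\<dots> \<le> 1/2 * norm (?D \<tau>)"
        using mult_right_mono[OF sL, of "norm (?D \<tau>)"] by (simp add: mult.assoc)
      finally show "norm (s *\<^sub>R X (u (t1 + \<tau> * s)) - s *\<^sub>R X (w (t1 + \<tau> * s))) \<le> 1/2 * norm (?D \<tau>) + 0" by simp
    qed (use eq in auto)
    then show ?thesis by (simp add: s_def)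
  qed
  then show ?thesis using e eventually_nhds_metric by blast
qed

section \<open>Vector fields and integral curves on a manifold\<close>

context manifold
begin

definition field_rep :: "('m \<Rightarrow> 'e) \<Rightarrow> ('m, 'e) chart \<Rightarrow> 'e \<Rightarrow> 'e" where
  "field_rep X c x = chart_deriv id (chart_at A (chart_inv c x)) c (chart_inv c x) (X (chart_inv c x))"

definition smooth_field :: "('m \<Rightarrow> 'e) \<Rightarrow> bool" where
  "smooth_field X \<longleftrightarrow> (\<forall>c\<in>A. smooth (chart_image c) (field_rep X c))"

lemma velocity_chart_change:
  assumes c: "c \<in> A" "c' \<in> A" "\<gamma> t \<in> fst c" "\<gamma> t \<in> fst c'" and cont: "isCont \<gamma> t"
    and d: "((snd c \<circ> \<gamma>) has_vector_derivative w) (at t)"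
  shows "((snd c' \<circ> \<gamma>) has_vector_derivative chart_deriv id c c' (\<gamma> t) w) (at t)"
proof -
  let ?D = "chart_deriv id c c' (\<gamma> t)"
  have D: "((snd c' \<circ> id \<circ> chart_inv c) has_derivative ?D) (at (snd c (\<gamma> t)))"
    by (rule chart_deriv_works[OF smooth_map_id]) (use c in auto)
  have "((snd c' \<circ> id \<circ> chart_inv c) \<circ> (snd c \<circ> \<gamma>) has_derivative ?D \<circ> (\<lambda>h. h *\<^sub>R w)) (at t)"
    by (rule diff_chain_at) (use d D in \<open>simp_all add: has_vector_derivative_def\<close>)
  then have "((snd c' \<circ> \<gamma>) has_derivative ?D \<circ> (\<lambda>h. h *\<^sub>R w)) (at t)"
  proof (rule has_derivative_transform_eventually)
    have "\<forall>\<^sub>F s in nhds t. \<gamma> s \<in> fst c"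
      using isCont_eventually[OF cont chart_open(1)[OF c(1)] c(3)] .
    then show "\<forall>\<^sub>F s in at t. ((snd c' \<circ> id \<circ> chart_inv c) \<circ> (snd c \<circ> \<gamma>)) s = (snd c' \<circ> \<gamma>) s"
      unfolding eventually_at_filter by eventually_elim (use c in auto)
  qed (use c in auto)
  moreover have "?D \<circ> (\<lambda>h. h *\<^sub>R w) = (\<lambda>h. h *\<^sub>R ?D w)"
    using linear_scale[OF has_derivative_linear[OF D]] by auto
  ultimately show ?thesis by (simp add: has_vector_derivative_def)
qed

lemma has_velocity_chart:
  assumes c: "c \<in> A" "\<gamma> t \<in> fst c"
  shows "has_velocity A \<gamma> t w \<longleftrightarrow> isCont \<gamma> t \<and>
    ((snd c \<circ> \<gamma>) has_vector_derivative chart_deriv id (chart_at A (\<gamma> t)) c (\<gamma> t) w) (at t)"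
proof
  assume "has_velocity A \<gamma> t w"
  then show "isCont \<gamma> t \<and> ((snd c \<circ> \<gamma>) has_vector_derivative chart_deriv id (chart_at A (\<gamma> t)) c (\<gamma> t) w) (at t)"
    using velocity_chart_change[of "chart_at A (\<gamma> t)" c \<gamma> t w] c chart_at by (simp add: has_velocity_def)
next
  assume *: "isCont \<gamma> t \<and> ((snd c \<circ> \<gamma>) has_vector_derivative chart_deriv id (chart_at A (\<gamma> t)) c (\<gamma> t) w) (at t)"
  show "has_velocity A \<gamma> t w"
    using velocity_chart_change[of c "chart_at A (\<gamma> t)" \<gamma> t "chart_deriv id (chart_at A (\<gamma> t)) c (\<gamma> t) w"] *
      chart_deriv_inv[OF chart_at(1) c(1) chart_at(2) c(2), of w] c chart_at by (simp add: has_velocity_def)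
qed

lemma has_velocity_field:
  assumes "c \<in> A" "\<gamma> t \<in> fst c"
  shows "has_velocity A \<gamma> t (X (\<gamma> t)) \<longleftrightarrow> isCont \<gamma> t \<and>
    ((snd c \<circ> \<gamma>) has_vector_derivative field_rep X c (snd c (\<gamma> t))) (at t)"
  using assms by (simp add: has_velocity_chart field_rep_def)

lemma has_velocity_affine:
  assumes "has_velocity A \<gamma> (a * t + b) w"
  shows "has_velocity A (\<lambda>t. \<gamma> (a * t + b)) t (a *\<^sub>R w)"
proof -
  have "((\<lambda>t. a * t + b) has_vector_derivative a) (at t)"
    by (auto intro!: derivative_eq_intros simp: has_vector_derivative_def)
  from vector_diff_chain_at[OF this, of "snd (chart_at A (\<gamma> (a * t + b))) \<circ> \<gamma>" w] assms
  have "((snd (chart_at A (\<gamma> (a * t + b))) \<circ> (\<lambda>t. \<gamma> (a * t + b))) has_vector_derivative a *\<^sub>R w) (at t)"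
    by (simp add: o_def has_velocity_def)
  moreover have "isCont (\<lambda>t. a * t + b) t" by (intro continuous_intros)
  then have "isCont (\<lambda>t. \<gamma> (a * t + b)) t"
    by (rule isCont_o2) (use assms in \<open>simp add: has_velocity_def\<close>)
  ultimately show ?thesis unfolding has_velocity_def by simp
qed

lemma has_velocity_cong:
  assumes "has_velocity A \<gamma> t w" "\<forall>\<^sub>F s in nhds t. \<gamma> s = \<sigma> s"
  shows "has_velocity A \<sigma> t w"
proof -
  have eq: "\<gamma> t = \<sigma> t" using eventually_nhds_x_imp_x[OF assms(2)] .
  have "isCont \<gamma> t \<longleftrightarrow> isCont \<sigma> t" by (rule isCont_cong[OF assms(2)])
  moreover have "((snd (chart_at A (\<sigma> t)) \<circ> \<gamma>) has_derivative (\<lambda>x. x *\<^sub>R w)) (at t) \<Longrightarrow>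
     ((snd (chart_at A (\<sigma> t)) \<circ> \<sigma>) has_derivative (\<lambda>x. x *\<^sub>R w)) (at t)"
    by (erule has_derivative_transform_eventually)
      (use assms(2) eq in \<open>auto simp: eventually_at_filter elim: eventually_mono\<close>)
  ultimately show ?thesis using assms(1) eq by (simp add: has_velocity_def has_vector_derivative_def)
qed

text \<open>Connectedness of \<open>J\<close>: the times of agreement form an open set by local
  uniqueness in a chart, and those of disagreement by the Hausdorff property.\<close>

lemma integral_curve_unique:
  assumes X: "smooth_field X" and J: "open J" "connected J" "t0 \<in> J" "\<gamma> t0 = \<sigma> t0"
    and \<gamma>: "\<And>t. t \<in> J \<Longrightarrow> has_velocity A \<gamma> t (X (\<gamma> t))"
    and \<sigma>: "\<And>t. t \<in> J \<Longrightarrow> has_velocity A \<sigma> t (X (\<sigma> t))"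
    and t: "t \<in> J"
  shows "\<gamma> t = \<sigma> t"
proof -
  have c: "isCont \<gamma> t" "isCont \<sigma> t" if "t \<in> J" for t
    using \<gamma>[OF that] \<sigma>[OF that] by (auto simp: has_velocity_def)
  let ?E = "{t\<in>J. \<gamma> t = \<sigma> t}" and ?N = "{t\<in>J. \<gamma> t \<noteq> \<sigma> t}"
  have "open ?E"
    unfolding open_subopen[of ?E]
  proof
    fix t1 assume "t1 \<in> ?E"
    then have t1: "t1 \<in> J" "\<gamma> t1 = \<sigma> t1" by auto
    let ?c = "chart_at A (\<gamma> t1)"
    have s: "smooth (chart_image ?c) (field_rep X ?c)" using X chart_at(1) by (auto simp: smooth_field_def)
    have J': "\<forall>\<^sub>F t in nhds t1. t \<in> J" using J(1) t1(1) by (rule eventually_nhds_in_open)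
    have g: "\<forall>\<^sub>F t in nhds t1. \<gamma> t \<in> fst ?c" "\<forall>\<^sub>F t in nhds t1. \<sigma> t \<in> fst ?c"
      using isCont_eventually[OF c(1)[OF t1(1)] chart_open(1)[OF chart_at(1)] chart_at(2)]
        isCont_eventually[OF c(2)[OF t1(1)] chart_open(1)[OF chart_at(1)], of "\<gamma> t1"] chart_at(2)[of "\<gamma> t1"] t1(2) by auto
    have "\<forall>\<^sub>F t in nhds t1. (snd ?c \<circ> \<gamma>) t = (snd ?c \<circ> \<sigma>) t"
    proof (rule ode_unique_local[OF s])
      show "\<forall>\<^sub>F t in nhds t1. ((snd ?c \<circ> \<gamma>) has_vector_derivative field_rep X ?c ((snd ?c \<circ> \<gamma>) t)) (at t) \<and>
         ((snd ?c \<circ> \<sigma>) has_vector_derivative field_rep X ?c ((snd ?c \<circ> \<sigma>) t)) (at t)"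
        using J' g
      proof eventually_elim
        case (elim t)
        then show ?case
          using \<gamma>[of t] \<sigma>[of t] has_velocity_field[OF chart_at(1), of \<gamma> t "\<gamma> t1" X] has_velocity_field[OF chart_at(1), of \<sigma> t "\<gamma> t1" X]
          by simp
      qed
    qed (use t1 chart_at in auto)
    with J' g have "\<forall>\<^sub>F t in nhds t1. t \<in> ?E"
    proof eventually_elim
      case (elim t)
      then show ?case using chart_inv_coord[OF chart_at(1)[of "\<gamma> t1"]] by (metis (mono_tags, lifting) comp_apply mem_Collect_eq)
    qed
    then show "\<exists>T. open T \<and> t1 \<in> T \<and> T \<subseteq> ?E" unfolding eventually_nhds by blast
  qed
  moreover have "open ?N"
    unfolding open_subopen[of ?N]
  proof
    fix t1 assume "t1 \<in> ?N"
    then have t1: "t1 \<in> J" "\<gamma> t1 \<noteq> \<sigma> t1" by auto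
    obtain U V where UV: "open U" "open V" "\<gamma> t1 \<in> U" "\<sigma> t1 \<in> V" "U \<inter> V = {}"
      using hausdorff[OF t1(2)] by blast
    have "\<forall>\<^sub>F t in nhds t1. t \<in> J \<and> \<gamma> t \<in> U \<and> \<sigma> t \<in> V"
      by (intro eventually_conj eventually_nhds_in_open isCont_eventually c J(1) t1 UV)
    then have "\<forall>\<^sub>F t in nhds t1. t \<in> ?N"
      by eventually_elim (use UV(5) in auto)
    then show "\<exists>T. open T \<and> t1 \<in> T \<and> T \<subseteq> ?N" unfolding eventually_nhds by blast
  qed
  ultimately have "?E \<inter> J = {} \<or> ?N \<inter> J = {}"
    by (intro connectedD[OF J(2)]) auto
  then show ?thesis using J t by auto
qed

text \<open>\<open>U\<close> is the chart preimage of a ball on which the Euclidean flow stays in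
  the chart. One lifetime \<open>e\<close> for all starting points in \<open>U\<close> is what
  compactness will exploit.\<close>

lemma local_flow_chart:
  assumes X: "smooth_field X"
  shows "\<exists>U e \<theta>. open U \<and> p0 \<in> U \<and> e > 0 \<and> (\<forall>q\<in>U. \<theta> 0 q = q) \<and>
    (\<forall>s q. \<bar>s\<bar> < e \<longrightarrow> q \<in> U \<longrightarrow>
      has_velocity A (\<lambda>s. \<theta> s q) s (X (\<theta> s q)) \<and> smooth_at_within {-e<..<e} \<theta> s q)"
proof -
  define c where "c = chart_at A p0"
  have c: "c \<in> A" "p0 \<in> fst c" using chart_at by (auto simp: c_def)
  define x0 where "x0 = snd c p0"
  have s: "smooth (chart_image c) (field_rep X c)" "x0 \<in> chart_image c"
    using X c by (auto simp: smooth_field_def x0_def)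
  obtain r e \<Theta> where \<Theta>: "r > 0" "e > 0" "ball x0 r \<subseteq> chart_image c" "smooth ({-e<..<e} \<times> ball x0 r) \<Theta>"
    "\<And>x. x \<in> ball x0 r \<Longrightarrow> \<Theta> (0, x) = x"
    "\<And>s x. \<bar>s\<bar> < e \<Longrightarrow> x \<in> ball x0 r \<Longrightarrow> \<Theta> (s, x) \<in> chart_image c"
    "\<And>s x. \<bar>s\<bar> < e \<Longrightarrow> x \<in> ball x0 r \<Longrightarrow>
       ((\<lambda>s. \<Theta> (s, x)) has_vector_derivative field_rep X c (\<Theta> (s, x))) (at s)"
    using local_flow[OF s] by blast
  define U where "U = fst c \<inter> snd c -` ball x0 r"
  define \<theta> where "\<theta> s q = chart_inv c (\<Theta> (s, snd c q))" for s q
  have oU: "open U" unfolding U_def by (rule chart_preimage_open[OF c(1) open_ball])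
  have U: "snd c q \<in> ball x0 r" "q \<in> fst c" if "q \<in> U" for q using that by (auto simp: U_def)
  have \<theta>c: "\<theta> s q \<in> fst c" "snd c (\<theta> s q) = \<Theta> (s, snd c q)" if "\<bar>s\<bar> < e" "q \<in> U" for s q
    using chart_inv_image[OF c(1) \<Theta>(6)[OF that(1) U(1)[OF that(2)]]] by (auto simp: \<theta>_def)
  show ?thesis
  proof (intro exI[of _ U] exI[of _ e] exI[of _ \<theta>] conjI ballI allI impI)
    show "\<theta> 0 q = q" if "q \<in> U" for q using \<Theta>(5)[OF U(1)[OF that]] c U(2)[OF that] by (simp add: \<theta>_def)
    fix s q assume s: "\<bar>s\<bar> < e" and q: "q \<in> U"
    have d: "((\<lambda>s. \<Theta> (s, snd c q)) has_vector_derivative field_rep X c (\<Theta> (s, snd c q))) (at s)"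
      by (rule \<Theta>(7)[OF s U(1)[OF q]])
    have "isCont (chart_inv c) (\<Theta> (s, snd c q))"
      using chart_continuous(2)[OF c(1)] \<Theta>(6)[OF s U(1)[OF q]]
      unfolding continuous_on_eq_continuous_at[OF chart_open(2)[OF c(1)]] by blast
    then have ic: "isCont (\<lambda>s. \<theta> s q) s"
      unfolding \<theta>_def by (intro isCont_o2[OF has_vector_derivative_continuous[OF d]])
    have "((snd c \<circ> (\<lambda>s. \<theta> s q)) has_vector_derivative field_rep X c (\<Theta> (s, snd c q))) (at s)"
      using d
    proof (rule has_vector_derivative_transform_within_open[of _ _ _ "{-e<..<e}"])
      show "\<Theta> (s, snd c q) = (snd c \<circ> (\<lambda>s. \<theta> s q)) s" if "s \<in> {-e<..<e}" for s
        using \<theta>c(2)[of s q] q that by auto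
    qed (use s in auto)
    then show "has_velocity A (\<lambda>s. \<theta> s q) s (X (\<theta> s q))"
      using has_velocity_field[OF c(1), of "\<lambda>s. \<theta> s q" s X] \<theta>c[OF s q] ic by simp
    show "smooth_at_within {-e<..<e} \<theta> s q"
      unfolding smooth_at_within_def
    proof (intro bexI[OF _ c(1)] exI[of _ "{-e<..<e}"] exI[of _ U] conjI ballI)
      have sub: "({-e<..<e} \<inter> {-e<..<e}) \<times> snd c ` U \<subseteq> {-e<..<e} \<times> ball x0 r" using U by auto
      show "smooth_on (({-e<..<e} \<inter> {-e<..<e}) \<times> snd c ` U) (\<lambda>(t, x). snd c (\<theta> t (chart_inv c x)))"
      proof (rule smooth_on_cong[OF smooth_imp_on[OF \<Theta>(4) sub]])
        fix z assume "z \<in> ({-e<..<e} \<inter> {-e<..<e}) \<times> snd c ` U"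
        then obtain t p where z: "z = (t, snd c p)" "\<bar>t\<bar> < e" "p \<in> U" by auto
        show "\<Theta> z = (case z of (t, x) \<Rightarrow> snd c (\<theta> t (chart_inv c x)))"
          using \<theta>c(2)[OF z(2,3)] c(1) U(2)[OF z(3)] by (simp add: z(1))
      qed
    qed (use oU q s U \<theta>c in auto)
  qed (use oU \<Theta> c in \<open>auto simp: U_def x0_def\<close>)
qed

text \<open>The time sets have to agree only near t0, so smoothness on a bounded open interval
  passes to the whole line.\<close>

lemma smooth_at_within_cong:
  assumes "smooth_at_within S \<theta> t0 p0" "t0 \<in> S" "open N" "t0 \<in> N" "open V" "p0 \<in> V"
    and "\<And>t p. t \<in> S \<Longrightarrow> t \<in> N \<Longrightarrow> p \<in> V \<Longrightarrow> \<theta> t p = \<theta>' t p" and "S \<inter> N = S' \<inter> N"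
  shows "smooth_at_within S' \<theta>' t0 p0"
proof -
  obtain c c' T U where *: "c \<in> A" "c' \<in> A" "open T" "t0 \<in> T" "open U" "p0 \<in> U" "U \<subseteq> fst c"
    "\<And>t p. t \<in> T \<Longrightarrow> t \<in> S \<Longrightarrow> p \<in> U \<Longrightarrow> \<theta> t p \<in> fst c'"
    "smooth_on ((T \<inter> S) \<times> snd c ` U) (\<lambda>(t, x). snd c' (\<theta> t (chart_inv c x)))"
    using smooth_at_withinE[OF assms(1,2)] by metis
  have sub: "(T \<inter> N) \<inter> S' \<subseteq> T \<inter> S" "(T \<inter> N) \<inter> S' \<subseteq> N" using assms(8) by auto
  have "smooth_on (((T \<inter> N) \<inter> S') \<times> snd c ` (U \<inter> V)) (\<lambda>(t, x). snd c' (\<theta>' t (chart_inv c x)))"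
  proof (rule smooth_on_cong[OF smooth_on_subset[OF *(9)]])
    show "((T \<inter> N) \<inter> S') \<times> snd c ` (U \<inter> V) \<subseteq> (T \<inter> S) \<times> snd c ` U" using sub by auto
    fix z assume "z \<in> ((T \<inter> N) \<inter> S') \<times> snd c ` (U \<inter> V)"
    then obtain t p where z: "z = (t, snd c p)" "t \<in> S" "t \<in> N" "p \<in> U" "p \<in> V" using sub by blast
    have "p \<in> fst c" using z(4) *(7) by auto
    then show "(case z of (t, x) \<Rightarrow> snd c' (\<theta> t (chart_inv c x))) = (case z of (t, x) \<Rightarrow> snd c' (\<theta>' t (chart_inv c x)))"
      using assms(7)[OF z(2,3,5)] *(1) by (simp add: z(1))
  qed
  moreover have "\<forall>t\<in>(T \<inter> N) \<inter> S'. \<forall>p\<in>U \<inter> V. \<theta>' t p \<in> fst c'"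
    using *(8) assms(7) sub by (metis Int_iff subsetD)
  ultimately show ?thesis
    unfolding smooth_at_within_def
    by (intro bexI[OF _ *(1)] bexI[OF _ *(2)] exI[of _ "T \<inter> N"] exI[of _ "U \<inter> V"]) (use * assms(3-6) in auto)
qed

section \<open>Global flows\<close>

definition is_flow :: "('m \<Rightarrow> 'e) \<Rightarrow> (real \<Rightarrow> 'm \<Rightarrow> 'm) \<Rightarrow> bool" where
  "is_flow X \<theta> \<longleftrightarrow> (\<forall>p. \<theta> 0 p = p \<and> (\<forall>t. has_velocity A (\<lambda>s. \<theta> s p) t (X (\<theta> t p))))"

text \<open>Since every point has a curve of lifetime a, the given one is continued by restarting at
  the times a/2 and -a/2; uniqueness on the overlaps makes the pieces fit. The gain by a fixed
  factor is what allows iteration to reach every time.\<close>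

lemma integral_curve_extend:
  assumes X: "smooth_field X" and a: "a > 0"
    and E: "\<And>p. \<exists>\<gamma>. \<gamma> 0 = p \<and> (\<forall>t. \<bar>t\<bar> < a \<longrightarrow> has_velocity A \<gamma> t (X (\<gamma> t)))"
  shows "\<exists>\<gamma>. \<gamma> 0 = p \<and> (\<forall>t. \<bar>t\<bar> < 3/2 * a \<longrightarrow> has_velocity A \<gamma> t (X (\<gamma> t)))"
proof -
  obtain \<gamma> where \<gamma>: "\<gamma> 0 = p" "\<And>t. \<bar>t\<bar> < a \<Longrightarrow> has_velocity A \<gamma> t (X (\<gamma> t))" using E by blast
  obtain \<sigma> where \<sigma>: "\<sigma> 0 = \<gamma> (a/2)" "\<And>t. \<bar>t\<bar> < a \<Longrightarrow> has_velocity A \<sigma> t (X (\<sigma> t))" using E by blast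
  obtain \<tau> where \<tau>: "\<tau> 0 = \<gamma> (-(a/2))" "\<And>t. \<bar>t\<bar> < a \<Longrightarrow> has_velocity A \<tau> t (X (\<tau> t))" using E by blast
  define \<sigma>' where "\<sigma>' t = \<sigma> (1 * t + (- a/2))" for t
  define \<tau>' where "\<tau>' t = \<tau> (1 * t + a/2)" for t
  have \<sigma>': "has_velocity A \<sigma>' t (X (\<sigma>' t))" if "\<bar>t - a/2\<bar> < a" for t
    using has_velocity_affine[of \<sigma> 1 t "- a/2" "X (\<sigma>' t)"] \<sigma>(2)[of "1 * t + (-a/2)"] that
    unfolding \<sigma>'_def by simp
  have \<tau>': "has_velocity A \<tau>' t (X (\<tau>' t))" if "\<bar>t + a/2\<bar> < a" for t
    using has_velocity_affine[of \<tau> 1 t "a/2" "X (\<tau>' t)"] \<tau>(2)[of "1 * t + a/2"] that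
    unfolding \<tau>'_def by simp
  have u1: "\<gamma> t = \<sigma>' t" if "t \<in> {-(a/2)<..<a}" for t
    by (rule integral_curve_unique[OF X, of "{-(a/2)<..<a}" "a/2"])
      (use that a \<gamma> \<sigma>' \<sigma>(1) \<sigma>'_def[of "a/2"] in auto)
  have u2: "\<gamma> t = \<tau>' t" if "t \<in> {-a<..<a/2}" for t
    by (rule integral_curve_unique[OF X, of "{-a<..<a/2}" "-(a/2)"])
      (use that a \<gamma> \<tau>' \<tau>(1) \<tau>'_def[of "-(a/2)"] in auto)
  define \<delta> where "\<delta> t = (if \<bar>t\<bar> < a then \<gamma> t else if t > 0 then \<sigma>' t else \<tau>' t)" for t
  have "has_velocity A \<delta> t (X (\<delta> t))" if t: "\<bar>t\<bar> < 3/2 * a" for t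
  proof -
    consider "\<bar>t\<bar> < a" | "0 < t" "\<bar>t - a/2\<bar> < a" "t \<ge> a" | "t < 0" "\<bar>t + a/2\<bar> < a" "t \<le> -a"
      using t a by (cases "\<bar>t\<bar> < a"; cases "t > 0") (auto simp: abs_if split: if_splits)
    then show ?thesis
    proof cases
      case 1
      have "\<forall>\<^sub>F s in nhds t. s \<in> {-a<..<a}" by (rule eventually_nhds_in_open) (use 1 in auto)
      then have "\<forall>\<^sub>F s in nhds t. \<gamma> s = \<delta> s" by eventually_elim (auto simp: \<delta>_def)
      then show ?thesis using has_velocity_cong[OF \<gamma>(2)[OF 1]] 1 by (simp add: \<delta>_def)
    next
      case 2
      have "\<forall>\<^sub>F s in nhds t. s \<in> {0<..}" by (rule eventually_nhds_in_open) (use 2 in auto)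
      then have "\<forall>\<^sub>F s in nhds t. \<sigma>' s = \<delta> s"
        by eventually_elim (use u1 a in \<open>auto simp: \<delta>_def\<close>)
      then show ?thesis using has_velocity_cong[OF \<sigma>'[OF 2(2)]] 2 a by (simp add: \<delta>_def)
    next
      case 3
      have "\<forall>\<^sub>F s in nhds t. s \<in> {..<0}" by (rule eventually_nhds_in_open) (use 3 in auto)
      then have "\<forall>\<^sub>F s in nhds t. \<tau>' s = \<delta> s"
        by eventually_elim (use u2 a in \<open>auto simp: \<delta>_def\<close>)
      then show ?thesis using has_velocity_cong[OF \<tau>'[OF 3(2)]] 3 a by (simp add: \<delta>_def)
    qed
  qed
  moreover have "\<delta> 0 = p" using \<gamma>(1) a by (simp add: \<delta>_def)
  ultimately show ?thesis by blast
qed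

text \<open>The lifetimes grow geometrically and exceed any given time; uniqueness makes the curves
  of different lifetimes agree where both exist.\<close>

lemma integral_curve_complete:
  assumes X: "smooth_field X" and e: "e > 0"
    and E: "\<And>p. \<exists>\<gamma>. \<gamma> 0 = p \<and> (\<forall>t. \<bar>t\<bar> < e \<longrightarrow> has_velocity A \<gamma> t (X (\<gamma> t)))"
  shows "\<exists>\<gamma>. \<gamma> 0 = p \<and> (\<forall>t. has_velocity A \<gamma> t (X (\<gamma> t)))"
proof -
  define a where "a n = (3/2) ^ n * e" for n :: nat
  have a: "a n > 0" for n using e by (simp add: a_def)
  have "\<exists>\<gamma>. \<gamma> 0 = p \<and> (\<forall>t. \<bar>t\<bar> < a n \<longrightarrow> has_velocity A \<gamma> t (X (\<gamma> t)))" for n p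
  proof (induction n arbitrary: p)
    case (Suc n)
    then show ?case using integral_curve_extend[OF X a[of n], of p] by (simp add: a_def mult.assoc)
  qed (use E in \<open>simp add: a_def\<close>)
  then obtain g where g: "\<And>n. g n 0 = p" "\<And>n t. \<bar>t\<bar> < a n \<Longrightarrow> has_velocity A (g n) t (X (g n t))" by metis
  have big: "\<exists>n. \<bar>t\<bar> < a n" for t
  proof -
    obtain n where "\<bar>t\<bar> / e < (3/2) ^ n" using real_arch_pow[of "3/2" "\<bar>t\<bar> / e"] by auto
    then show ?thesis using e by (auto simp: a_def field_simps)
  qed
  have g_eq: "g m t = g n t" if "\<bar>t\<bar> < a m" "\<bar>t\<bar> < a n" for m n t
    by (rule integral_curve_unique[OF X, of "{- min (a m) (a n)<..<min (a m) (a n)}" 0])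
      (use g that a in auto)
  define \<gamma> where "\<gamma> t = g (LEAST n. \<bar>t\<bar> < a n) t" for t
  have \<gamma>: "\<gamma> t = g n t" if "\<bar>t\<bar> < a n" for t n
    unfolding \<gamma>_def by (rule g_eq[OF LeastI_ex[OF big] that])
  have "has_velocity A \<gamma> t (X (\<gamma> t))" for t
  proof -
    obtain n where n: "\<bar>t\<bar> < a n" using big by blast
    have "\<forall>\<^sub>F s in nhds t. s \<in> {- a n<..<a n}" by (rule eventually_nhds_in_open) (use n in auto)
    then have "\<forall>\<^sub>F s in nhds t. g n s = \<gamma> s"
    proof eventually_elim
      case (elim s)
      then show ?case using \<gamma>[of s n] by auto
    qed
    then show ?thesis using has_velocity_cong[OF g(2)[OF n]] \<gamma>[OF n] by simp
  qed
  moreover have "\<gamma> 0 = p" using \<gamma>[of 0 0] a g(1) by simp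
  ultimately show ?thesis by blast
qed

lemma is_flow_unique:
  assumes "smooth_field X" "is_flow X \<theta>" "is_flow X \<theta>'"
  shows "\<theta> = \<theta>'"
proof (intro ext)
  fix t p show "\<theta> t p = \<theta>' t p"
    by (rule integral_curve_unique[OF assms(1), of UNIV 0]) (use assms in \<open>auto simp: is_flow_def\<close>)
qed

lemma is_flow_add:
  assumes "smooth_field X" "is_flow X \<theta>"
  shows "\<theta> (s + t) p = \<theta> s (\<theta> t p)"
proof (rule integral_curve_unique[OF assms(1), where J = UNIV and ?t0.0 = 0 and t = s
      and \<gamma> = "\<lambda>s. \<theta> (s + t) p" and \<sigma> = "\<lambda>s. \<theta> s (\<theta> t p)"])
  show "has_velocity A (\<lambda>s. \<theta> (s + t) p) u (X (\<theta> (u + t) p))" for u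
    using has_velocity_affine[of "\<lambda>s. \<theta> s p" 1 u t] assms(2) by (simp add: is_flow_def)
qed (use assms(2) in \<open>auto simp: is_flow_def\<close>)

text \<open>Finitely many local flows cover the compact manifold, so all curves share a lifetime
  \<epsilon> and extend to the whole line. Smoothness is known for \<bar>t\<bar> < \<epsilon> first;
  the flow at time t is the square of that at time t/2, which doubles the interval at every
  induction step.\<close>

lemma flow_exists:
  assumes X: "smooth_field X" and cpt: "compact (UNIV :: 'm set)"
  shows "is_flow X (flow_of A X)" "smooth_at_within UNIV (flow_of A X) t p"
proof -
  define Q where "Q p U e \<theta> \<longleftrightarrow> open U \<and> p \<in> U \<and> e > 0 \<and> (\<forall>q\<in>U. \<theta> 0 q = q) \<and>
    (\<forall>s q. \<bar>s\<bar> < e \<longrightarrow> q \<in> U \<longrightarrow> has_velocity A (\<lambda>s. \<theta> s q) s (X (\<theta> s q)) \<and>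
      smooth_at_within {-e<..<e} \<theta> s q)" for p U e \<theta>
  have "\<exists>U e \<theta>. Q p U e \<theta>" for p
    unfolding Q_def by (rule local_flow_chart[OF X])
  then obtain U e \<Theta> where Q: "\<And>p. Q p (U p) (e p) (\<Theta> p)"
    by metis
  have L1: "open (U p)" and L2: "p \<in> U p" and L3: "e p > 0" for p
    using Q[of p] by (simp_all add: Q_def)
  have L4: "\<Theta> p 0 q = q" if "q \<in> U p" for p q
    using Q[of p] that by (simp add: Q_def)
  have "\<forall>s q. \<bar>s\<bar> < e p \<longrightarrow> q \<in> U p \<longrightarrow> has_velocity A (\<lambda>s. \<Theta> p s q) s (X (\<Theta> p s q)) \<and>
      smooth_at_within {-e p<..<e p} (\<Theta> p) s q" for p
    using Q[of p] unfolding Q_def by (elim conjE)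
  then have L5: "\<bar>s\<bar> < e p \<Longrightarrow> q \<in> U p \<Longrightarrow> has_velocity A (\<lambda>s. \<Theta> p s q) s (X (\<Theta> p s q))"
    and L6: "\<bar>s\<bar> < e p \<Longrightarrow> q \<in> U p \<Longrightarrow> smooth_at_within {- e p<..<e p} (\<Theta> p) s q" for p s q
    by blast+
  note L = L1 L2 L3 L4 L5 L6
  obtain D where D: "finite D" "(UNIV :: 'm set) \<subseteq> (\<Union>p\<in>D. U p)"
    by (rule compactE_image[OF cpt, of UNIV U]) (use L1 L2 in auto)
  define \<epsilon> where "\<epsilon> = Min (insert 1 (e ` D))"
  have \<epsilon>: "\<epsilon> > 0" "\<And>p. p \<in> D \<Longrightarrow> \<epsilon> \<le> e p" using D(1) L(3) by (auto simp: \<epsilon>_def)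
  have "\<exists>\<gamma>. \<gamma> 0 = p \<and> (\<forall>t. has_velocity A \<gamma> t (X (\<gamma> t)))" for p
  proof (rule integral_curve_complete[OF X \<epsilon>(1)])
    fix p
    obtain q where q: "q \<in> D" "p \<in> U q" using D(2) by blast
    then have "has_velocity A (\<lambda>s. \<Theta> q s p) t (X (\<Theta> q t p))" if "\<bar>t\<bar> < \<epsilon>" for t
      using L5[of t q p] \<epsilon>(2)[of q] that by simp
    then show "\<exists>\<gamma>. \<gamma> 0 = p \<and> (\<forall>t. \<bar>t\<bar> < \<epsilon> \<longrightarrow> has_velocity A \<gamma> t (X (\<gamma> t)))"
      using L4[OF q(2)] by (intro exI[of _ "\<lambda>s. \<Theta> q s p"]) simp
  qed
  then obtain \<theta>' where "\<And>p. \<theta>' p 0 = p" "\<And>p t. has_velocity A (\<theta>' p) t (X (\<theta>' p t))" by metis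
  then have "is_flow X (\<lambda>t p. \<theta>' p t)" by (simp add: is_flow_def)
  then have "\<exists>!\<theta>. is_flow X \<theta>" using is_flow_unique[OF X] by blast
  from theI'[OF this] show flow: "is_flow X (flow_of A X)"
    unfolding flow_of_def is_flow_def .
  let ?\<theta> = "flow_of A X"
  define a where "a n = 2 ^ n * \<epsilon>" for n :: nat
  have sm: "smooth_at_within {- a n<..<a n} ?\<theta> t p" if "\<bar>t\<bar> < a n" for n t p
    using that
  proof (induction n arbitrary: t p)
    case (0 t p)
    obtain q where q: "q \<in> D" "p \<in> U q" using D(2) by blast
    have "smooth_at_within {- e q<..<e q} (\<Theta> q) t p"
      using L(6)[of t q p] 0 \<epsilon>(2)[OF q(1)] q(2) by (auto simp: a_def)
    then show ?case
    proof (rule smooth_at_within_cong[OF smooth_at_within_subset, where N = UNIV and V = "U q"])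
      fix s p' assume s: "s \<in> {- a 0<..<a 0}" and p': "p' \<in> U q"
      show "\<Theta> q s p' = ?\<theta> s p'"
        by (rule integral_curve_unique[OF X, of "{- e q<..<e q}" 0])
          (use s p' L(3,4,5) flow \<epsilon>(2)[OF q(1)] in \<open>auto simp: is_flow_def a_def abs_less_iff\<close>)
    qed (use 0 q L \<epsilon>(2)[OF q(1)] in \<open>auto simp: a_def abs_less_iff\<close>)
  next
    case (Suc n t p)
    have t: "\<bar>t / 2\<bar> < a n" using Suc.prems by (simp add: a_def)
    have *: "smooth_at_within {- a (Suc n)<..<a (Suc n)} (\<lambda>t. ?\<theta> (1/2 * t + 0)) t q" for q
      by (rule smooth_at_within_time[where S = "{- a n<..<a n}"])
        (use Suc.IH[OF t] Suc.prems in \<open>auto simp: a_def\<close>)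
    have "smooth_at_within {- a (Suc n)<..<a (Suc n)} (\<lambda>t p. ?\<theta> (1/2 * t + 0) (?\<theta> (1/2 * t + 0) p)) t p"
      by (rule smooth_at_within_comp[OF * *]) (use Suc.prems in auto)
    moreover have "?\<theta> (1/2 * t + 0) (?\<theta> (1/2 * t + 0) p) = ?\<theta> t p" for t p
      using is_flow_add[OF X flow, of "1/2 * t" "1/2 * t" p] by simp
    ultimately show ?case by simp
  qed
  obtain n where n: "\<bar>t\<bar> < a n"
  proof -
    obtain n where "\<bar>t\<bar> / \<epsilon> < 2 ^ n" using real_arch_pow[of 2 "\<bar>t\<bar> / \<epsilon>"] by auto
    then show thesis using that[of n] \<epsilon>(1) by (auto simp: a_def field_simps)
  qed
  show "smooth_at_within UNIV ?\<theta> t p"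
    by (rule smooth_at_within_cong[OF sm[OF n], where N = "{- a n<..<a n}" and V = UNIV]) (use n in auto)
qed

end

section \<open>Reeb and Hamiltonian vector fields\<close>

context
  fixes a :: "'e::euclidean_space \<Rightarrow> real" and w :: "'e \<Rightarrow> 'e \<Rightarrow> real"
  assumes a: "linear a" and w: "\<And>v. linear (\<lambda>u. w u v)" "\<And>u v. w u v = - w v u"
    and nondeg: "\<And>u. a u = 0 \<Longrightarrow> (\<And>v. a v = 0 \<Longrightarrow> w u v = 0) \<Longrightarrow> u = 0"
begin

text \<open>Testing with v = u kills the alternating part and leaves the square of
  \<open>a u\<close>. Then u lies in the kernel of \<open>a\<close> and is annihilated by
  \<open>w\<close>, so nondegeneracy applies.\<close>

lemma contact_bilinear_injective:
  assumes "\<And>v. w u v + a u * a v = 0"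
  shows "u = 0"
proof (rule nondeg)
  have "w u u = 0" using w(2)[of u u] by simp
  then show "a u = 0" using assms[of u] by simp
  then show "w u v = 0" for v using assms[of v] by simp
qed

text \<open>In finite dimension injectivity gives existence as well; \<open>L\<close> packs the
  values of the bilinear form on the basis into an endomorphism.\<close>

lemma contact_bilinear_solve:
  assumes l: "linear l"
  shows "\<exists>!u. \<forall>v. w u v + a u * a v = l v"
proof -
  define L where "L u = (\<Sum>b\<in>Basis. (w u b + a u * a b) *\<^sub>R b)" for u
  have w': "linear (\<lambda>v. w u v)" for u
    using linear_compose_neg[OF w(1)[of u]] w(2)[of u] by (simp add: o_def)
  have B: "linear (\<lambda>v. w u v + a u * a v)" for u
    using linear_compose_add[OF w' linear_compose_scale_right[OF a, of "a u"]] by simp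
  have "linear L"
    unfolding L_def linear_iff
    by (auto simp: linear_add[OF w(1)] linear_scale[OF w(1)] linear_add[OF a] linear_scale[OF a]
        algebra_simps sum.distrib scaleR_sum_right)
  have coord: "L u \<bullet> b = w u b + a u * a b" if "b \<in> Basis" for u b
    using that by (simp add: L_def inner_sum_left_Basis)
  have ext: "w u v + a u * a v = k v" if "linear k" "\<And>b. b \<in> Basis \<Longrightarrow> w u b + a u * a b = k b" for u v k
    using linear_expand[OF B[of u], of v] linear_expand[OF that(1), of v] that(2) by simp
  have inj: "u = 0" if "L u = 0" for u
  proof (rule contact_bilinear_injective)
    show "w u v + a u * a v = 0" for v
      by (rule ext[of "\<lambda>_. 0"]) (use coord[of _ u] that in \<open>auto simp: linear_iff\<close>)
  qed
  have "inj L" using inj linear_injective_0[OF \<open>linear L\<close>] by blast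
  then have "surj L" using linear_injective_imp_surjective[OF \<open>linear L\<close>] by simp
  then obtain u where u: "L u = (\<Sum>b\<in>Basis. l b *\<^sub>R b)" by (metis surjD)
  have "w u b + a u * a b = l b" if "b \<in> Basis" for b
    using coord[OF that, of u] that unfolding u by (simp add: inner_sum_left_Basis)
  then have "\<forall>v. w u v + a u * a v = l v"
    using ext[OF l, of u] by blast
  moreover have "u' = u" if "\<forall>v. w u' v + a u' * a v = l v" "\<forall>v. w u v + a u * a v = l v" for u u'
  proof -
    have "u' - u = 0"
      by (rule contact_bilinear_injective)
        (use that in \<open>simp add: linear_diff[OF w(1)] linear_diff[OF a] algebra_simps\<close>)
    then show ?thesis by simp
  qed
  ultimately show ?thesis by blast
qed

text \<open>The vector dual to \<open>a\<close> itself is the Reeb vector: testing with v = r shows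
  that \<open>a r\<close> equals its square, and the value 0 would force r = 0 by nondegeneracy,
  against a v0 being nonzero.\<close>

lemma contact_bilinear_reeb:
  assumes ne: "a v0 \<noteq> 0" and r: "\<And>v. w r v + a r * a v = a v"
  shows "a r = 1" "w r v = 0"
proof -
  have "w r r = 0" using w(2)[of r r] by simp
  then have "a r = 0 \<or> a r = 1" using r[of r] by auto
  moreover have "a r \<noteq> 0"
  proof
    assume 0: "a r = 0"
    have "r = 0" by (rule nondeg) (use r 0 in auto)
    then show False using r[of v0] ne linear_0[OF w(1)[of v0]] linear_0[OF a] by simp
  qed
  ultimately show "a r = 1" by simp
  then show "w r v = 0" using r[of v] by simp
qed

end

text \<open>The infinitesimal form of Cartan's formula for the Lie derivative, along a trajectory \<open>y\<close> of
  \<open>X\<close> and a solution \<open>u\<close> of the linearized equation.\<close>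

lemma lie_derivative_form:
  fixes a :: "'e::euclidean_space \<Rightarrow> 'e \<Rightarrow> real"
  assumes lin: "\<And>z. z \<in> V \<Longrightarrow> linear (a z)" and a: "\<And>v. smooth V (\<lambda>z. a z v)" and X: "smooth V X"
    and y: "(y has_vector_derivative X (y t)) (at t)" "y t \<in> V"
    and u: "(u has_vector_derivative frechet_derivative X (at (y t)) (u t)) (at t)"
  shows "((\<lambda>t. a (y t) (u t)) has_real_derivative
     (frechet_derivative (\<lambda>z. a z (u t)) (at (y t)) (X (y t)) - frechet_derivative (\<lambda>z. a z (X (y t))) (at (y t)) (u t))
       + frechet_derivative (\<lambda>z. a z (X z)) (at (y t)) (u t)) (at t)"
proof -
  let ?D = "\<lambda>v h. frechet_derivative (\<lambda>z. a z v) (at (y t)) h"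
  let ?X' = "frechet_derivative X (at (y t))"
  have da: "((\<lambda>z. a z v) has_derivative ?D v) (at (y t))" for v
    by (rule smooth_has_derivative[OF a y(2)])
  \<comment> \<open>The point and the vector vary together. This product rule is used twice, once
    along the trajectory and once with \<open>g\<close> the identity, for the function that takes z
    to \<open>a z (X z)\<close>.\<close>
  have prod: "((\<lambda>s. a (g s) (k s)) has_derivative (\<lambda>h. ?D (k s0) (g' h) + a (y t) (k' h))) (at s0)"
    if g: "(g has_derivative g') (at s0)" "g s0 = y t" and k: "(k has_derivative k') (at s0)" and N: "open N" "s0 \<in> N" "\<And>s. s \<in> N \<Longrightarrow> g s \<in> V"
    for g :: "'c::real_normed_vector \<Rightarrow> 'e" and g' k k' s0 N
  proof -
    have "((\<lambda>s. a (g s) i) has_derivative (\<lambda>h. ?D i (g' h))) (at s0)" for i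
      using diff_chain_at[OF g(1), of "\<lambda>z. a z i" "?D i"] da[of i] g(2) by (simp add: o_def)
    then have "((\<lambda>s. \<Sum>i\<in>Basis. (k s \<bullet> i) * a (g s) i) has_derivative
       (\<lambda>h. \<Sum>i\<in>Basis. (k s0 \<bullet> i) * ?D i (g' h) + (k' h \<bullet> i) * a (g s0) i)) (at s0)"
      by (intro has_derivative_sum has_derivative_mult has_derivative_inner_left k)
    then have "((\<lambda>s. a (g s) (k s)) has_derivative
       (\<lambda>h. \<Sum>i\<in>Basis. (k s0 \<bullet> i) * ?D i (g' h) + (k' h \<bullet> i) * a (g s0) i)) (at s0)"
    proof (rule has_derivative_transform_within_open[OF _ N(1,2)])
      fix s assume "s \<in> N"
      then show "(\<Sum>i\<in>Basis. (k s \<bullet> i) * a (g s) i) = a (g s) (k s)"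
        using linear_expand[OF lin[OF N(3)], of s "k s"] by simp
    qed
    moreover have "(\<Sum>i\<in>Basis. (k s0 \<bullet> i) * ?D i (g' h) + (k' h \<bullet> i) * a (g s0) i) = ?D (k s0) (g' h) + a (y t) (k' h)" for h
    proof -
      have "((\<lambda>z. \<Sum>i\<in>Basis. (k s0 \<bullet> i) * a z i) has_derivative (\<lambda>h. \<Sum>i\<in>Basis. (k s0 \<bullet> i) * ?D i h)) (at (y t))"
        by (intro has_derivative_sum has_derivative_mult_right da)
      then have "((\<lambda>z. a z (k s0)) has_derivative (\<lambda>h. \<Sum>i\<in>Basis. (k s0 \<bullet> i) * ?D i h)) (at (y t))"
      proof (rule has_derivative_transform_within_open[OF _ smooth_open[OF X] y(2)])
        fix z assume "z \<in> V"
        then show "(\<Sum>i\<in>Basis. (k s0 \<bullet> i) * a z i) = a z (k s0)"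
          using linear_expand[OF lin, of z "k s0"] by simp
      qed
      from fun_cong[OF frechet_derivative_at[OF this], of "g' h"]
      show ?thesis using linear_expand[OF lin[OF y(2)], of "k' h"] g(2) by (simp add: sum.distrib)
    qed
    ultimately show ?thesis by simp
  qed
  have "\<exists>N. open N \<and> t \<in> N \<and> (\<forall>s\<in>N. y s \<in> V)"
    using isCont_eventually[OF has_vector_derivative_continuous[OF y(1)] smooth_open[OF X] y(2)]
    unfolding eventually_nhds by blast
  then obtain N where N: "open N" "t \<in> N" "\<And>s. s \<in> N \<Longrightarrow> y s \<in> V" by blast
  have "((\<lambda>t. a (y t) (u t)) has_derivative (\<lambda>h. ?D (u t) (h *\<^sub>R X (y t)) + a (y t) (h *\<^sub>R ?X' (u t)))) (at t)"
    by (rule prod[of y _ t u _ N, OF _ refl _ N]) (use y u in \<open>auto simp: has_vector_derivative_def\<close>)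
  moreover have "(\<lambda>h. ?D (u t) (h *\<^sub>R X (y t)) + a (y t) (h *\<^sub>R ?X' (u t))) =
     (\<lambda>h. (?D (u t) (X (y t)) + a (y t) (?X' (u t))) * h)"
    by (auto simp: linear_scale[OF has_derivative_linear[OF da]] linear_scale[OF lin[OF y(2)]] algebra_simps)
  ultimately have 1: "((\<lambda>t. a (y t) (u t)) has_real_derivative ?D (u t) (X (y t)) + a (y t) (?X' (u t))) (at t)"
    by (simp add: has_field_derivative_def)
  \<comment> \<open>The term with the derivative of X is common to this differential and to the time
    derivative found above; eliminating it is what produces the exterior derivative of the
    form.\<close>
  have "((\<lambda>z. a z (X z)) has_derivative (\<lambda>h. ?D (X (y t)) h + a (y t) (?X' h))) (at (y t))"
    by (rule prod[OF has_derivative_ident refl smooth_has_derivative[OF X y(2)] smooth_open[OF X] y(2)])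
  from fun_cong[OF frechet_derivative_at[OF this], of "u t"]
  have eq: "frechet_derivative (\<lambda>z. a z (X z)) (at (y t)) (u t) = ?D (X (y t)) (u t) + a (y t) (?X' (u t))" by simp
  show ?thesis using 1 unfolding eq by simp
qed

section \<open>Smooth functions, forms and fields\<close>

context manifold
begin

definition differential :: "('m \<Rightarrow> real) \<Rightarrow> 'm \<Rightarrow> 'e \<Rightarrow> real" where
  "differential f p v = frechet_derivative (f \<circ> chart_inv (chart_at A p)) (at (snd (chart_at A p) p)) v"

lemma smooth_fun_chart: "smooth_fun A f \<Longrightarrow> c \<in> A \<Longrightarrow> smooth (chart_image c) (f \<circ> chart_inv c)"
  using smooth_on_iff[OF chart_open(2), of c] unfolding smooth_fun_def by blast

lemma smooth_funI: "(\<And>c. c \<in> A \<Longrightarrow> smooth (chart_image c) (f \<circ> chart_inv c)) \<Longrightarrow> smooth_fun A f"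
  using smooth_on_iff[OF chart_open(2)] unfolding smooth_fun_def by blast

lemma smooth_formI:
  "(\<And>p. linear (\<omega> p)) \<Longrightarrow> (\<And>c v. c \<in> A \<Longrightarrow> smooth (chart_image c) (\<lambda>x. form_rep A \<omega> c x v)) \<Longrightarrow> smooth_form A \<omega>"
  using smooth_on_iff[OF chart_open(2)] unfolding smooth_form_def by blast

lemma smooth_fun_continuous:
  assumes "smooth_fun A f"
  shows "continuous_on UNIV f"
proof -
  have "isCont f p" for p
  proof -
    let ?c = "chart_at A p"
    have "continuous_on (fst ?c) (\<lambda>q. (f \<circ> chart_inv ?c) (snd ?c q))"
      by (rule continuous_on_compose2[OF smooth_continuous[OF smooth_fun_chart[OF assms chart_at(1)]] chart_continuous(1)[OF chart_at(1)]]) simp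
    then have "continuous_on (fst ?c) f"
      by (rule continuous_on_eq) (use chart_inv_coord[OF chart_at(1)] in auto)
    then show ?thesis
      using chart_at(2) by (simp add: continuous_on_eq_continuous_at[OF chart_open(1)[OF chart_at(1)]])
  qed
  then show ?thesis by (simp add: continuous_on_eq_continuous_at)
qed

lemma differential_map:
  assumes f: "smooth_fun A f" and \<phi>: "smooth_map A \<phi>" and c: "c \<in> A" "c' \<in> A" "p \<in> fst c" "\<phi> p \<in> fst c'"
  shows "((f \<circ> \<phi>) \<circ> chart_inv c has_derivative
     (\<lambda>v. frechet_derivative (f \<circ> chart_inv c') (at (snd c' (\<phi> p))) (chart_deriv \<phi> c c' p v))) (at (snd c p))"
proof -
  have "((f \<circ> chart_inv c') \<circ> (snd c' \<circ> \<phi> \<circ> chart_inv c) has_derivative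
     frechet_derivative (f \<circ> chart_inv c') (at (snd c' (\<phi> p))) \<circ> chart_deriv \<phi> c c' p) (at (snd c p))"
    by (rule diff_chain_at[OF chart_deriv_works])
      (use \<phi> c smooth_has_derivative[OF smooth_fun_chart[OF f c(2)]] in auto)
  then have "((f \<circ> \<phi>) \<circ> chart_inv c has_derivative
     frechet_derivative (f \<circ> chart_inv c') (at (snd c' (\<phi> p))) \<circ> chart_deriv \<phi> c c' p) (at (snd c p))"
    by (rule has_derivative_transform_within_open[OF _ smooth_open[OF smooth_map_chart[OF \<phi> c(1,2)]]])
      (use c in auto)
  then show ?thesis by (simp add: o_def)
qed

lemma differential_chart:
  assumes f: "smooth_fun A f" and c: "c \<in> A" "p \<in> fst c"
  shows "differential f p v = frechet_derivative (f \<circ> chart_inv c) (at (snd c p)) (chart_deriv id (chart_at A p) c p v)"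
  using fun_cong[OF frechet_derivative_at[OF differential_map[OF f smooth_map_id chart_at(1) c(1) chart_at(2), of p]], of v] c
  by (simp add: differential_def)

lemma smooth_fun_map:
  assumes f: "smooth_fun A f" and \<phi>: "smooth_map A \<phi>"
  shows "smooth_fun A (f \<circ> \<phi>)"
proof (rule smooth_funI)
  fix c assume c: "c \<in> A"
  show "smooth (chart_image c) ((f \<circ> \<phi>) \<circ> chart_inv c)"
  proof (rule smooth_Union[OF _ chart_open(2)[OF c]])
    fix x assume "x \<in> chart_image c"
    then obtain p where p: "p \<in> fst c" "x = snd c p" by auto
    let ?c' = "chart_at A (\<phi> p)"
    let ?U = "snd c ` (fst c \<inter> \<phi> -` fst ?c')"
    have "smooth ?U (\<lambda>x. (f \<circ> chart_inv ?c') ((snd ?c' \<circ> \<phi> \<circ> chart_inv c) x))"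
      by (rule smooth_compose[OF smooth_fun_chart[OF f chart_at(1)] smooth_map_chart[OF \<phi> c chart_at(1)]])
        (use c in auto)
    then have "smooth ?U ((f \<circ> \<phi>) \<circ> chart_inv c)"
      by (rule smooth_cong) (use c chart_at chart_inv_coord[OF chart_at(1)] in auto)
    moreover have "x \<in> ?U" using p chart_at by auto
    ultimately show "\<exists>V. x \<in> V \<and> smooth V ((f \<circ> \<phi>) \<circ> chart_inv c)"
      by (intro exI[of _ ?U] conjI)
  qed
qed

lemma smooth_fun_compose:
  assumes f: "smooth_fun A f" and g: "smooth U g" and U: "\<And>p. f p \<in> U"
  shows "smooth_fun A (\<lambda>p. g (f p))"
  by (rule smooth_funI) (use smooth_compose[OF g smooth_fun_chart[OF f]] U in \<open>auto simp: o_def\<close>)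

lemma smooth_fun_mult: "smooth_fun A f \<Longrightarrow> smooth_fun A g \<Longrightarrow> smooth_fun A (\<lambda>p. f p * g p)"
  by (rule smooth_funI) (use smooth_mult[OF smooth_fun_chart smooth_fun_chart, of f _ g] in \<open>auto simp: o_def\<close>)

lemma smooth_fun_add: "smooth_fun A f \<Longrightarrow> smooth_fun A g \<Longrightarrow> smooth_fun A (\<lambda>p. f p + g p)"
  by (rule smooth_funI) (use smooth_add[OF smooth_fun_chart smooth_fun_chart, of f _ g] in \<open>auto simp: o_def\<close>)

lemma smooth_fun_const: "smooth_fun A (\<lambda>p. r)"
  by (rule smooth_funI) (auto simp: o_def intro: smooth_const chart_open)

lemma smooth_fun_sum: "(\<And>i. i \<in> I \<Longrightarrow> smooth_fun A (F i)) \<Longrightarrow> smooth_fun A (\<lambda>p. \<Sum>i\<in>I. F i p)"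
  by (induction I rule: infinite_finite_induct) (auto intro: smooth_fun_const smooth_fun_add)

lemma form_rep_add: "form_rep A (\<lambda>p v. \<alpha> p v + \<beta> p v) c x v = form_rep A \<alpha> c x v + form_rep A \<beta> c x v"
  by (simp add: form_rep_def)

lemma form_rep_scale: "form_rep A (scale_form h \<alpha>) c x v = h (chart_inv c x) * form_rep A \<alpha> c x v"
  by (simp add: form_rep_def scale_form_def)

lemma form_rep_differential:
  assumes "smooth_fun A f" "c \<in> A" "x \<in> chart_image c"
  shows "form_rep A (differential f) c x v = frechet_derivative (f \<circ> chart_inv c) (at x) v"
proof -
  obtain p where p: "p \<in> fst c" "x = snd c p" using assms(3) by auto
  then show ?thesis using assms
    by (simp add: form_rep_eq differential_chart[of f c p] chart_deriv_inv chart_at)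
qed

lemma smooth_form_add:
  assumes "smooth_form A \<alpha>" "smooth_form A \<beta>"
  shows "smooth_form A (\<lambda>p v. \<alpha> p v + \<beta> p v)"
  by (rule smooth_formI) (use assms smooth_form_linear in \<open>auto simp: form_rep_add intro!: smooth_add smooth_form_rep linear_compose_add\<close>)

lemma smooth_form_scale:
  assumes "smooth_form A \<alpha>" "smooth_fun A h"
  shows "smooth_form A (scale_form h \<alpha>)"
proof (rule smooth_formI)
  show "linear (scale_form h \<alpha> p)" for p
    using linear_compose_scale_right[OF smooth_form_linear[OF assms(1)], of "h p" p] by (simp add: scale_form_def)
  show "smooth (chart_image c) (\<lambda>x. form_rep A (scale_form h \<alpha>) c x v)" if "c \<in> A" for c v
    unfolding form_rep_scale
    using smooth_mult[OF smooth_fun_chart[OF assms(2) that] smooth_form_rep[OF assms(1) that]] by simp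
qed

lemma smooth_form_differential:
  assumes "smooth_fun A f"
  shows "smooth_form A (differential f)"
proof (rule smooth_formI)
  show "linear (differential f p)" for p
    unfolding differential_def
    by (rule has_derivative_linear[OF smooth_has_derivative[OF smooth_fun_chart[OF assms chart_at(1)]]])
      (use chart_at in auto)
  show "smooth (chart_image c) (\<lambda>x. form_rep A (differential f) c x v)" if "c \<in> A" for c v
    by (rule smooth_cong[OF smooth_deriv[OF smooth_fun_chart[OF assms that], of v]])
      (use form_rep_differential[OF assms that] in simp)
qed

lemma form_rep_field:
  assumes "c \<in> A" "x \<in> chart_image c"
  shows "form_rep A \<alpha> c x (field_rep X c x) = \<alpha> (chart_inv c x) (X (chart_inv c x))"
  unfolding field_rep_def using form_rep_point[of c "chart_inv c x" \<alpha>] assms chart_inv_image by simp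

lemma smooth_form_field:
  assumes \<alpha>: "smooth_form A \<alpha>" and X: "smooth_field X"
  shows "smooth_fun A (\<lambda>p. \<alpha> p (X p))"
proof (rule smooth_funI)
  fix c assume c: "c \<in> A"
  have X': "smooth (chart_image c) (field_rep X c)" using X c by (simp add: smooth_field_def)
  have "smooth (chart_image c) (\<lambda>x. \<Sum>b\<in>Basis. (field_rep X c x \<bullet> b) * form_rep A \<alpha> c x b)"
    by (intro smooth_sum smooth_mult smooth_inner X' smooth_const chart_open c smooth_form_rep \<alpha>)
  then show "smooth (chart_image c) ((\<lambda>p. \<alpha> p (X p)) \<circ> chart_inv c)"
  proof (rule smooth_cong)
    fix x assume x: "x \<in> chart_image c"
    show "(\<Sum>b\<in>Basis. (field_rep X c x \<bullet> b) * form_rep A \<alpha> c x b) = ((\<lambda>p. \<alpha> p (X p)) \<circ> chart_inv c) x"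
      using linear_expand[OF form_rep_linear[where \<alpha> = \<alpha>, OF smooth_form_linear[OF \<alpha>] c x], of "field_rep X c x"]
      by (simp add: form_rep_field[OF c x, symmetric])
  qed
qed

lemma smooth_form_pullback:
  assumes \<omega>: "smooth_form A \<omega>" and \<phi>: "smooth_map A \<phi>"
  shows "smooth_form A (pullback A \<phi> \<omega>)"
proof (rule smooth_formI)
  show "linear (pullback A \<phi> \<omega> p)" for p
    using linear_compose[OF tangent_map_linear[OF \<phi>, of p] smooth_form_linear[OF \<omega>, of "\<phi> p"]]
    by (simp add: pullback_def o_def)
  fix c v assume c: "c \<in> A"
  show "smooth (chart_image c) (\<lambda>x. form_rep A (pullback A \<phi> \<omega>) c x v)"
  proof (rule smooth_Union[OF _ chart_open(2)[OF c]])
    fix x assume "x \<in> chart_image c"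
    then obtain p where p: "p \<in> fst c" "x = snd c p" by auto
    let ?c' = "chart_at A (\<phi> p)"
    let ?U = "snd c ` (fst c \<inter> \<phi> -` fst ?c')" and ?F = "snd ?c' \<circ> \<phi> \<circ> chart_inv c"
    have F: "smooth ?U ?F" by (rule smooth_map_chart[OF \<phi> c chart_at(1)])
    have "smooth ?U (\<lambda>x. \<Sum>b\<in>Basis. (frechet_derivative ?F (at x) v \<bullet> b) * form_rep A \<omega> ?c' (?F x) b)"
      by (intro smooth_sum smooth_mult smooth_inner smooth_deriv[OF F] smooth_const smooth_open[OF F]
          smooth_compose[OF smooth_form_rep[OF \<omega> chart_at(1)] F]) (use c in auto)
    then have "smooth ?U (\<lambda>x. form_rep A (pullback A \<phi> \<omega>) c x v)"
    proof (rule smooth_cong)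
      fix y assume "y \<in> ?U"
      then obtain q where q: "q \<in> fst c" "\<phi> q \<in> fst ?c'" "y = snd c q" by auto
      have y: "?F y = snd ?c' (\<phi> q)" using q c by simp
      show "(\<Sum>b\<in>Basis. (frechet_derivative ?F (at y) v \<bullet> b) * form_rep A \<omega> ?c' (?F y) b) = form_rep A (pullback A \<phi> \<omega>) c y v"
        unfolding q(3) form_rep_pullback[OF \<phi> c chart_at(1) q(1,2)] y[unfolded q(3)]
        using linear_expand[OF form_rep_linear[where \<alpha> = \<omega>, OF smooth_form_linear[OF \<omega>] chart_at(1)[of "\<phi> p"], where x = "snd ?c' (\<phi> q)"],
            of "chart_deriv \<phi> c ?c' q v"] q(2)
        by (simp add: chart_deriv_def)
    qed
    moreover have "x \<in> ?U" using p chart_at by auto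
    ultimately show "\<exists>V. x \<in> V \<and> smooth V (\<lambda>x. form_rep A (pullback A \<phi> \<omega>) c x v)"
      by (intro exI[of _ ?U] conjI)
  qed
qed

lemma chart_ext_deriv_linear:
  assumes \<alpha>: "smooth_form A \<alpha>" and c: "c \<in> A" "x \<in> chart_image c"
  shows "linear (\<lambda>u. chart_ext_deriv A \<alpha> c x u v)"
proof -
  let ?D = "\<lambda>u h. frechet_derivative (\<lambda>y. form_rep A \<alpha> c y u) (at x) h"
  have d: "((\<lambda>y. form_rep A \<alpha> c y u) has_derivative ?D u) (at x)" for u
    by (rule smooth_has_derivative[OF smooth_form_rep[OF \<alpha> c(1)] c(2)])
  have lin: "linear (form_rep A \<alpha> c y)" if "y \<in> chart_image c" for y
    by (rule form_rep_linear[where \<alpha> = \<alpha>, OF smooth_form_linear[OF \<alpha>] c(1) that])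
  have "?D (s *\<^sub>R u + u') v = s * ?D u v + ?D u' v" for s u u'
  proof -
    have "((\<lambda>y. s * form_rep A \<alpha> c y u + form_rep A \<alpha> c y u') has_derivative (\<lambda>h. s * ?D u h + ?D u' h)) (at x)"
      by (intro has_derivative_add has_derivative_mult_right d)
    then have "((\<lambda>y. form_rep A \<alpha> c y (s *\<^sub>R u + u')) has_derivative (\<lambda>h. s * ?D u h + ?D u' h)) (at x)"
      by (rule has_derivative_transform_within_open[OF _ chart_open(2)[OF c(1)] c(2)])
        (simp add: linear_add[OF lin] linear_scale[OF lin])
    from fun_cong[OF frechet_derivative_at[OF this], of v] show ?thesis by simp
  qed
  from this[of 1] this[of _ _ 0] have "linear (\<lambda>u. ?D u v)"
    using linear_0[OF lin] by (intro linearI) (auto simp: frechet_derivative_cong_open[OF chart_open(2)[OF c(1)] c(2), of "\<lambda>y. form_rep A \<alpha> c y 0" "\<lambda>_. 0"])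
  moreover have "linear (\<lambda>u. ?D v u)" by (rule has_derivative_linear[OF d])
  ultimately show ?thesis unfolding chart_ext_deriv_def by (intro linear_compose_sub)
qed

lemma chart_ext_deriv_antisym: "chart_ext_deriv A \<alpha> c x u v = - chart_ext_deriv A \<alpha> c x v u"
  by (simp add: chart_ext_deriv_def)

lemma ext_deriv_eq: "ext_deriv A \<alpha> p u v = chart_ext_deriv A \<alpha> (chart_at A p) (snd (chart_at A p) p) u v"
  by (simp add: ext_deriv_def chart_ext_deriv_def Let_def)

lemma ext_deriv_linear: "smooth_form A \<alpha> \<Longrightarrow> linear (\<lambda>u. ext_deriv A \<alpha> p u v)"
  unfolding ext_deriv_eq by (intro chart_ext_deriv_linear chart_at) (auto intro: chart_at)

lemma ext_deriv_antisym: "ext_deriv A \<alpha> p u v = - ext_deriv A \<alpha> p v u"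
  unfolding ext_deriv_eq by (rule chart_ext_deriv_antisym)

text \<open>One inversion serves both purposes: the dual of \<alpha> itself is the Reeb field, and
  other covectors give the Hamiltonian fields. Smoothness is thus proved once.\<close>

definition form_dual :: "('m, 'e) form \<Rightarrow> ('m, 'e) form \<Rightarrow> 'm \<Rightarrow> 'e" where
  "form_dual \<alpha> l p = (THE u. \<forall>v. ext_deriv A \<alpha> p u v + \<alpha> p u * \<alpha> p v = l p v)"

lemma contact_form_smooth: "contact_form A \<alpha> \<Longrightarrow> smooth_form A \<alpha>"
  by (simp add: contact_form_def)

lemma contact_form_nondeg:
  "contact_form A \<alpha> \<Longrightarrow> \<alpha> p u = 0 \<Longrightarrow> (\<And>v. \<alpha> p v = 0 \<Longrightarrow> ext_deriv A \<alpha> p u v = 0) \<Longrightarrow> u = 0"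
  by (auto simp: contact_form_def)

lemma form_dual_eq:
  assumes \<alpha>: "contact_form A \<alpha>" and l: "linear (l p)"
  shows "ext_deriv A \<alpha> p (form_dual \<alpha> l p) v + \<alpha> p (form_dual \<alpha> l p) * \<alpha> p v = l p v"
proof -
  note s = contact_form_smooth[OF \<alpha>]
  have "\<exists>!u. \<forall>v. ext_deriv A \<alpha> p u v + \<alpha> p u * \<alpha> p v = l p v"
    by (rule contact_bilinear_solve[where w = "ext_deriv A \<alpha> p" and a = "\<alpha> p", OF smooth_form_linear[OF s] ext_deriv_linear[OF s] ext_deriv_antisym contact_form_nondeg[OF \<alpha>] l])
  from theI'[OF this] show ?thesis by (simp add: form_dual_def)
qed

text \<open>In a chart the dual vector solves a linear system with smooth coefficients that is
  injective at every point, which is the situation of \<open>linear_system_smooth\<close>.\<close>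

lemma form_dual_smooth:
  assumes \<alpha>: "contact_form A \<alpha>" and l: "smooth_form A l"
  shows "smooth_field (form_dual \<alpha> l)"
  unfolding smooth_field_def
proof
  fix c assume c: "c \<in> A"
  note s = contact_form_smooth[OF \<alpha>]
  define B where "B x u v = chart_ext_deriv A \<alpha> c x u v + form_rep A \<alpha> c x u * form_rep A \<alpha> c x v" for x u v
  have B_point: "B (snd c p) (chart_deriv id (chart_at A p) c p u) (chart_deriv id (chart_at A p) c p v) =
      ext_deriv A \<alpha> p u v + \<alpha> p u * \<alpha> p v" if "p \<in> fst c" for p u v
    using that c by (simp add: B_def form_rep_point ext_deriv_chart[OF s c])
  have surj: "\<exists>v'. v = chart_deriv id (chart_at A p) c p v'" if "p \<in> fst c" for p v
    using chart_deriv_inv[OF c chart_at(1) that chart_at(2)] by metis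
  have B_lin: "linear (\<lambda>u. B x u v)" "linear (\<lambda>v. B x u v)" if x: "x \<in> chart_image c" for x u v
  proof -
    note f = form_rep_linear[where \<alpha> = \<alpha>, OF smooth_form_linear[OF s] c x] and d = chart_ext_deriv_linear[OF s c x]
    have d': "linear (\<lambda>v. chart_ext_deriv A \<alpha> c x u v)"
      using linear_compose_neg[OF d[of u]] chart_ext_deriv_antisym[of \<alpha> c x u] by simp
    show "linear (\<lambda>v. B x u v)"
      using linear_compose_add[OF d' linear_compose_scale_right[OF f, of "form_rep A \<alpha> c x u"]] by (simp add: B_def)
    show "linear (\<lambda>u. B x u v)"
      using linear_compose_add[OF d linear_compose_scale_right[OF f, of "form_rep A \<alpha> c x v"]] by (simp add: B_def mult.commute)
  qed
  show "smooth (chart_image c) (field_rep (form_dual \<alpha> l) c)"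
  proof (rule linear_system_smooth[where L = "\<lambda>x u. \<Sum>b\<in>Basis. B x u b *\<^sub>R b" and w = "\<lambda>x. \<Sum>b\<in>Basis. form_rep A l c x b *\<^sub>R b"])
    fix x assume x: "x \<in> chart_image c"
    then obtain p where p: "p \<in> fst c" "x = snd c p" by auto
    have "B x (field_rep (form_dual \<alpha> l) c x) b = form_rep A l c x b" for b
    proof -
      obtain b' where b': "b = chart_deriv id (chart_at A p) c p b'" using surj[OF p(1)] by blast
      have "B x (field_rep (form_dual \<alpha> l) c x) b = ext_deriv A \<alpha> p (form_dual \<alpha> l p) b' + \<alpha> p (form_dual \<alpha> l p) * \<alpha> p b'"
        unfolding b' p(2) field_rep_def using B_point[OF p(1)] c p(1) by simp
      then show ?thesis
        unfolding b' p(2) using form_dual_eq[where l = l, OF \<alpha> smooth_form_linear[OF l]] c p(1) by (simp add: form_rep_point)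
    qed
    then show "(\<Sum>b\<in>Basis. B x (field_rep (form_dual \<alpha> l) c x) b *\<^sub>R b) = (\<Sum>b\<in>Basis. form_rep A l c x b *\<^sub>R b)" by simp
    show "linear (\<lambda>u. \<Sum>b\<in>Basis. B x u b *\<^sub>R b)"
      unfolding linear_iff
      by (auto simp: linear_add[OF B_lin(1)[OF x]] linear_scale[OF B_lin(1)[OF x]] scaleR_sum_right scaleR_add_left sum.distrib)
    fix z assume z: "(\<Sum>b\<in>Basis. B x z b *\<^sub>R b) = 0"
    obtain z' where z': "z = chart_deriv id (chart_at A p) c p z'" using surj[OF p(1)] by blast
    have "B x z b = 0" if "b \<in> Basis" for b
    proof -
      have "(\<Sum>b\<in>Basis. B x z b *\<^sub>R b) \<bullet> b = 0" using z by simp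
      then show ?thesis using that by (simp add: inner_sum_left_Basis)
    qed
    then have "B x z v = 0" for v using linear_expand[OF B_lin(2)[OF x], of z v] by simp
    then have "ext_deriv A \<alpha> p z' v + \<alpha> p z' * \<alpha> p v = 0" for v
      using B_point[OF p(1), of z' v] p(2) z' by simp
    then have "z' = 0"
      using contact_bilinear_injective[where w = "ext_deriv A \<alpha> p" and a = "\<alpha> p",
            OF smooth_form_linear[OF s, of p] ext_deriv_linear[OF s, of p] ext_deriv_antisym[of \<alpha> p] contact_form_nondeg[OF \<alpha>, of p]]
      by simp
    moreover have "linear (chart_deriv id (chart_at A p) c p)"
      by (intro chart_deriv_linear smooth_map_id chart_at c) (use p chart_at in auto)
    ultimately show "z = 0" using z' linear_0 by blast
  next
    show "smooth (chart_image c) (\<lambda>x. \<Sum>b\<in>Basis. form_rep A l c x b *\<^sub>R b)"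
      by (intro smooth_sum smooth_scaleR smooth_const chart_open c smooth_form_rep l)
    show "smooth (chart_image c) (\<lambda>x. \<Sum>b\<in>Basis. B x z b *\<^sub>R b)" for z
      unfolding B_def chart_ext_deriv_def
      by (intro smooth_sum smooth_scaleR smooth_const chart_open c smooth_add smooth_mult smooth_diff
          smooth_deriv smooth_form_rep s)
  qed
qed

text \<open>The two conditions on a Reeb vector r amount to the single equation d\<alpha>(r, v) +
  \<alpha> r \<alpha> v = \<alpha> v for all v, which has exactly one solution.\<close>

lemma Reeb_field_eq:
  assumes \<alpha>: "contact_form A \<alpha>"
  shows "\<alpha> p (Reeb_field A \<alpha> p) = 1" "ext_deriv A \<alpha> p (Reeb_field A \<alpha> p) v = 0"
    and Reeb_field_dual: "Reeb_field A \<alpha> = form_dual \<alpha> \<alpha>"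
    and Reeb_field_unique: "\<And>r. \<alpha> p r = 1 \<Longrightarrow> (\<And>u. ext_deriv A \<alpha> p r u = 0) \<Longrightarrow> r = Reeb_field A \<alpha> p"
proof -
  note s = contact_form_smooth[OF \<alpha>]
  note hyps = smooth_form_linear[OF s] ext_deriv_linear[OF s] ext_deriv_antisym contact_form_nondeg[OF \<alpha>]
  have dual: "\<alpha> p (form_dual \<alpha> \<alpha> p) = 1" "ext_deriv A \<alpha> p (form_dual \<alpha> \<alpha> p) v = 0" for p v
  proof -
    obtain v0 where v0: "\<alpha> p v0 \<noteq> 0" using \<alpha> by (auto simp: contact_form_def)
    note d = form_dual_eq[where l = \<alpha> and p = p, OF \<alpha> smooth_form_linear[OF s]]
    show "\<alpha> p (form_dual \<alpha> \<alpha> p) = 1" "ext_deriv A \<alpha> p (form_dual \<alpha> \<alpha> p) v = 0"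
      using contact_bilinear_reeb[where w = "ext_deriv A \<alpha> p" and a = "\<alpha> p", OF hyps v0 d] by auto
  qed
  have uniq: "r = form_dual \<alpha> \<alpha> p" if "(\<forall>u. ext_deriv A \<alpha> p r u = 0) \<and> \<alpha> p r = 1" for r p
  proof -
    have "\<exists>!u. \<forall>v. ext_deriv A \<alpha> p u v + \<alpha> p u * \<alpha> p v = \<alpha> p v"
      by (rule contact_bilinear_solve[where w = "ext_deriv A \<alpha> p" and a = "\<alpha> p", OF hyps smooth_form_linear[OF s]])
    moreover have "\<forall>v. ext_deriv A \<alpha> p r v + \<alpha> p r * \<alpha> p v = \<alpha> p v" using that by simp
    moreover have "\<forall>v. ext_deriv A \<alpha> p (form_dual \<alpha> \<alpha> p) v + \<alpha> p (form_dual \<alpha> \<alpha> p) * \<alpha> p v = \<alpha> p v"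
      using dual by simp
    ultimately show ?thesis by blast
  qed
  have "Reeb_field A \<alpha> p = form_dual \<alpha> \<alpha> p" for p
    unfolding Reeb_field_def by (rule the_equality) (use dual uniq in auto)
  then show eq: "Reeb_field A \<alpha> = form_dual \<alpha> \<alpha>" by auto
  show "\<alpha> p (Reeb_field A \<alpha> p) = 1" "ext_deriv A \<alpha> p (Reeb_field A \<alpha> p) v = 0"
    using dual by (simp_all add: eq)
  show "r = Reeb_field A \<alpha> p" if "\<alpha> p r = 1" "\<And>u. ext_deriv A \<alpha> p r u = 0" for r
    using uniq[of p r] that by (simp add: eq)
qed

lemma Reeb_field_smooth: "contact_form A \<alpha> \<Longrightarrow> smooth_field (Reeb_field A \<alpha>)"
  unfolding Reeb_field_dual using form_dual_smooth contact_form_smooth by blast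

definition Reeb_deriv :: "('m, 'e) form \<Rightarrow> ('m \<Rightarrow> real) \<Rightarrow> 'm \<Rightarrow> real" where
  "Reeb_deriv \<alpha> h p = differential h p (Reeb_field A \<alpha> p)"

text \<open>The vector field \<open>X\<close> with \<open>\<alpha> X = h\<close> and \<open>d\<alpha>(X, v) = dh(R) \<alpha> v - dh v\<close>, obtained by inverting the
  nondegenerate bilinear form \<open>d\<alpha> + \<alpha> \<otimes> \<alpha>\<close>.\<close>

definition Hamiltonian_field :: "('m, 'e) form \<Rightarrow> ('m \<Rightarrow> real) \<Rightarrow> 'm \<Rightarrow> 'e" where
  "Hamiltonian_field \<alpha> h =
     form_dual \<alpha> (\<lambda>p v. scale_form (\<lambda>p. h p + Reeb_deriv \<alpha> h p) \<alpha> p v + scale_form (\<lambda>p. -1) (differential h) p v)"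

lemma Reeb_deriv_smooth: "contact_form A \<alpha> \<Longrightarrow> smooth_fun A h \<Longrightarrow> smooth_fun A (Reeb_deriv \<alpha> h)"
  unfolding Reeb_deriv_def[abs_def]
  by (rule smooth_form_field[OF smooth_form_differential Reeb_field_smooth])

text \<open>On the Reeb vector the defining equation loses its d\<alpha> term and becomes \<alpha> X
  = h; the summand \<open>Reeb_deriv \<alpha> h\<close> was put into the covector to cancel dh
  there. Inserting \<alpha> X = h back gives the formula for d\<alpha>(X, v).\<close>

lemma Hamiltonian_field:
  assumes \<alpha>: "contact_form A \<alpha>" and h: "smooth_fun A h"
  shows "smooth_field (Hamiltonian_field \<alpha> h)" "\<alpha> p (Hamiltonian_field \<alpha> h p) = h p"
    "ext_deriv A \<alpha> p (Hamiltonian_field \<alpha> h p) v = Reeb_deriv \<alpha> h p * \<alpha> p v - differential h p v"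
proof -
  let ?l = "\<lambda>p v. scale_form (\<lambda>p. h p + Reeb_deriv \<alpha> h p) \<alpha> p v + scale_form (\<lambda>p. -1) (differential h) p v"
  let ?X = "Hamiltonian_field \<alpha> h p" and ?R = "Reeb_field A \<alpha> p"
  have l: "smooth_form A ?l"
    by (intro smooth_form_add smooth_form_scale contact_form_smooth[OF \<alpha>] smooth_fun_add h Reeb_deriv_smooth[OF \<alpha> h]
        smooth_fun_const smooth_form_differential)
  then show "smooth_field (Hamiltonian_field \<alpha> h)"
    unfolding Hamiltonian_field_def by (rule form_dual_smooth[OF \<alpha>])
  have eq: "ext_deriv A \<alpha> p ?X v + \<alpha> p ?X * \<alpha> p v = ?l p v" for v
    unfolding Hamiltonian_field_def by (rule form_dual_eq[OF \<alpha> smooth_form_linear[OF l]])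
  have "ext_deriv A \<alpha> p ?X ?R = 0"
    using ext_deriv_antisym[of \<alpha> p ?X ?R] Reeb_field_eq(2)[OF \<alpha>] by simp
  then show 1: "\<alpha> p ?X = h p"
    using eq[of ?R] Reeb_field_eq(1)[OF \<alpha>] by (simp add: scale_form_def Reeb_deriv_def)
  show "ext_deriv A \<alpha> p ?X v = Reeb_deriv \<alpha> h p * \<alpha> p v - differential h p v"
    using eq[of v] by (simp add: scale_form_def 1 algebra_simps)
qed

end

section \<open>Contactomorphisms\<close>

lemma linear_ode_exp:
  fixes B k :: "real \<Rightarrow> real"
  assumes B: "\<And>t. (B has_real_derivative k t * B t) (at t)" and k: "continuous_on UNIV k" and t: "0 \<le> t"
  shows "B t = exp (integral {0..t} k) * B 0"
proof -
  let ?K = "\<lambda>s. integral {0..s} k"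
  have K: "(?K has_real_derivative k s) (at s within {0..t})" if "s \<in> {0..t}" for s
    by (rule integral_has_real_derivative[OF continuous_on_subset[OF k] that]) simp
  have "((\<lambda>s. exp (- ?K s) * B s) has_real_derivative 0) (at s within {0..t})" if s: "s \<in> {0..t}" for s
    by (rule derivative_eq_intros K[OF s] has_field_derivative_at_within[OF B] refl)+ (simp add: algebra_simps)
  then obtain C where C: "\<forall>s\<in>{0..t}. exp (- ?K s) * B s = C"
    using has_field_derivative_zero_constant[of "{0..t}" "\<lambda>s. exp (- ?K s) * B s"] by auto
  then have "exp (- ?K t) * B t = B 0" using t C[rule_format, of 0] C[rule_format, of t] by simp
  then show ?thesis by (simp add: exp_minus field_simps)
qed

lemma open_slice:
  assumes "open W"
  shows "open {s. (s, x) \<in> W}" "open {x. (s, x) \<in> W}"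
proof -
  have "open ((\<lambda>s. (s, x)) -` W)" "open ((\<lambda>x. (s, x)) -` W)"
    by (intro open_vimage assms continuous_intros)+
  then show "open {s. (s, x) \<in> W}" "open {x. (s, x) \<in> W}" by (simp_all add: vimage_def)
qed

context manifold
begin

text \<open>At an end of the time interval smoothness only means a local smooth extension. This
  names such an extension \<open>g\<close> and reads the tangent maps at all nearby admissible times
  off its space derivative.\<close>

lemma flow_tangent_chart:
  assumes \<theta>: "smooth_at_within S \<theta> t0 p" and t0: "t0 \<in> S" and c: "c \<in> A" "c' \<in> A" "p \<in> fst c" "\<theta> t0 p \<in> fst c'"
  obtains W g where "smooth W g" "(t0, snd c p) \<in> W"
    "\<And>t. t \<in> S \<Longrightarrow> (t, snd c p) \<in> W \<Longrightarrow> \<theta> t p \<in> fst c' \<and> g (t, snd c p) = snd c' (\<theta> t p) \<and>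
        (\<forall>v. chart_deriv (\<theta> t) c c' p v = frechet_derivative g (at (t, snd c p)) (0, v))"
    "\<And>t x. t \<in> S \<Longrightarrow> (t, x) \<in> W \<Longrightarrow> x \<in> chart_image c \<and> \<theta> t (chart_inv c x) \<in> fst c' \<and> g (t, x) = snd c' (\<theta> t (chart_inv c x))"
proof -
  obtain T U where TU: "open T" "t0 \<in> T" "open U" "p \<in> U" "U \<subseteq> fst c"
    "\<And>t p. t \<in> T \<Longrightarrow> t \<in> S \<Longrightarrow> p \<in> U \<Longrightarrow> \<theta> t p \<in> fst c'"
    "smooth_on ((T \<inter> S) \<times> snd c ` U) (\<lambda>(t, x). snd c' (\<theta> t (chart_inv c x)))"
    using smooth_at_within_charts[OF \<theta> t0 c] by metis
  let ?x = "snd c p"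
  have "(t0, ?x) \<in> (T \<inter> S) \<times> snd c ` U" using TU t0 by auto
  then obtain W0 g where g: "(t0, ?x) \<in> W0" "\<forall>y\<in>W0 \<inter> (T \<inter> S) \<times> snd c ` U. g y = (case y of (t, x) \<Rightarrow> snd c' (\<theta> t (chart_inv c x)))" "smooth W0 g"
    using TU(7) unfolding smooth_on_alt by metis
  define W where "W = W0 \<inter> T \<times> snd c ` U"
  have oW: "open W" unfolding W_def using smooth_open[OF g(3)] TU chart_image_open[OF c(1) TU(3,5)] by (intro open_Int open_Times)
  have gW: "x \<in> chart_image c \<and> \<theta> t (chart_inv c x) \<in> fst c' \<and> g (t, x) = snd c' (\<theta> t (chart_inv c x))" if tx: "t \<in> S" "(t, x) \<in> W" for t x
  proof -
    obtain q where q: "q \<in> U" "x = snd c q" "t \<in> T" using tx(2) by (auto simp: W_def)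
    have "chart_inv c x = q" using q TU(5) c(1) by auto
    moreover have "(t, x) \<in> W0 \<inter> (T \<inter> S) \<times> snd c ` U" using tx by (auto simp: W_def)
    ultimately show ?thesis using g(2) TU(5,6) q tx(1) by auto
  qed
  show thesis
  proof (rule that[of W g])
    show sg: "smooth W g" by (rule smooth_subset[OF g(3) oW]) (auto simp: W_def)
    show "(t0, ?x) \<in> W" using g(1) TU by (auto simp: W_def)
    fix t assume t: "t \<in> S" "(t, ?x) \<in> W"
    have d: "((\<lambda>x. (t, x)) has_derivative (\<lambda>v. (0, v))) (at ?x)" by (auto intro!: derivative_eq_intros)
    have "(g \<circ> (\<lambda>x. (t, x)) has_derivative frechet_derivative g (at (t, ?x)) \<circ> (\<lambda>v. (0, v))) (at ?x)"
      by (rule diff_chain_at[OF d smooth_has_derivative[OF sg t(2)]])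
    then have "((snd c' \<circ> \<theta> t \<circ> chart_inv c) has_derivative frechet_derivative g (at (t, ?x)) \<circ> (\<lambda>v. (0, v))) (at ?x)"
    proof (rule has_derivative_transform_within_open)
      show "open {x. (t, x) \<in> W}" by (rule open_slice[OF oW])
    qed (use t gW in auto)
    from fun_cong[OF frechet_derivative_at[OF this]] show "\<theta> t p \<in> fst c' \<and> g (t, ?x) = snd c' (\<theta> t p) \<and>
        (\<forall>v. chart_deriv (\<theta> t) c c' p v = frechet_derivative g (at (t, ?x)) (0, v))"
      using gW[OF t] c by (simp add: chart_deriv_def)
  qed (use gW in auto)
qed

lemma form_along_flow:
  assumes "smooth_map A \<theta>" "c \<in> A" "\<theta> p \<in> fst c"
  shows "\<alpha> (\<theta> p) (tangent_map A \<theta> p v) = form_rep A \<alpha> c (snd c (\<theta> p)) (chart_deriv \<theta> (chart_at A p) c p v)"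
  using form_rep_point[OF assms(2,3), of \<alpha> "tangent_map A \<theta> p v"]
    tangent_map_chart[OF assms(1) chart_at(1) assms(2) chart_at(2) assms(3), of v]
  by (simp add: chart_deriv_id chart_at)

text \<open>By Cartan's formula the Lie derivative of \<alpha> along X is d\<alpha>(X, .) + dh, and
  here dh cancels, which leaves \<alpha> times the Reeb derivative of h. In a chart,
  \<open>g\<close> is the flow, \<open>y\<close> the trajectory of p and \<open>u\<close> the
  transported vector.\<close>

lemma Hamiltonian_flow_derivative:
  assumes \<alpha>: "contact_form A \<alpha>" and h: "smooth_fun A h"
    and flow: "is_flow (Hamiltonian_field \<alpha> h) \<theta>" and sm: "\<And>t p. smooth_at_within UNIV \<theta> t p"
  shows "((\<lambda>t. \<alpha> (\<theta> t p) (tangent_map A (\<theta> t) p v)) has_real_derivative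
     Reeb_deriv \<alpha> h (\<theta> t p) * \<alpha> (\<theta> t p) (tangent_map A (\<theta> t) p v)) (at t)"
proof -
  let ?X = "Hamiltonian_field \<alpha> h"
  define c0 c where "c0 = chart_at A p" and "c = chart_at A (\<theta> t p)"
  have c: "c0 \<in> A" "c \<in> A" "p \<in> fst c0" "\<theta> t p \<in> fst c" using chart_at by (auto simp: c0_def c_def)
  note s = contact_form_smooth[OF \<alpha>]
  define x0 q where "x0 = snd c0 p" and "q = \<theta> t p"
  obtain W g where W: "smooth W g" "(t, x0) \<in> W"
    and g: "\<And>s. (s, x0) \<in> W \<Longrightarrow> \<theta> s p \<in> fst c \<and> g (s, x0) = snd c (\<theta> s p) \<and>
        (\<forall>v. chart_deriv (\<theta> s) c0 c p v = frechet_derivative g (at (s, x0)) (0, v))"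
    and g': "\<And>s x. (s, x) \<in> W \<Longrightarrow> x \<in> chart_image c0 \<and> \<theta> s (chart_inv c0 x) \<in> fst c \<and> g (s, x) = snd c (\<theta> s (chart_inv c0 x))"
    using flow_tangent_chart[OF sm UNIV_I c] unfolding x0_def by (metis UNIV_I)
  have Xc: "smooth (chart_image c) (field_rep ?X c)"
    using Hamiltonian_field(1)[OF \<alpha> h] c by (simp add: smooth_field_def)
  have smap: "smooth_map A (\<theta> s)" for s by (rule smooth_map_slice[OF sm UNIV_I])
  have gc: "g z \<in> chart_image c" if "z \<in> W" for z using g'[of "fst z" "snd z"] that by auto
  have dt: "((\<lambda>s. g (s, x)) has_vector_derivative field_rep ?X c (g (s, x))) (at s)" if z: "(s, x) \<in> W" for s x
  proof -
    let ?q = "chart_inv c0 x"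
    have "((snd c \<circ> (\<lambda>s. \<theta> s ?q)) has_vector_derivative field_rep ?X c (snd c (\<theta> s ?q))) (at s)"
      using has_velocity_field[OF c(2), of "\<lambda>s. \<theta> s ?q" s ?X] g'[OF z] flow by (simp add: is_flow_def)
    then have "((\<lambda>s. g (s, x)) has_vector_derivative field_rep ?X c (snd c (\<theta> s ?q))) (at s)"
    proof (rule has_vector_derivative_transform_within_open)
      show "open {s. (s, x) \<in> W}" by (rule open_slice[OF smooth_open[OF W(1)]])
    qed (use z g' in auto)
    then show ?thesis using g'[OF z] by simp
  qed
  have line: "(s, x) = (0, x) + s *\<^sub>R (1, 0 :: 'e)" for s :: real and x :: 'e by simp
  \<comment> \<open>The flow equation holds for all points near p, and so may be differentiated in
    the space direction below.\<close>
  have D1: "frechet_derivative g (at z) (1, 0) = field_rep ?X c (g z)" if z: "z \<in> W" for z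
  proof -
    obtain s x where z': "z = (s, x)" by (cases z)
    have "((\<lambda>s. g (s, x)) has_vector_derivative frechet_derivative g (at (s, x)) (1, 0)) (at s)"
      using smooth_line[OF W(1), of "(0, x)" s "(1, 0)"] z z' by simp
    then show ?thesis using vector_derivative_unique_at dt z z' by blast
  qed
  define y u where "y s = g (s, x0)" and "u s = frechet_derivative g (at (s, x0)) (0, v)" for s
  have y: "(y has_vector_derivative field_rep ?X c (y t)) (at t)"
    unfolding y_def[abs_def] by (rule dt[OF W(2)])
  have "(u has_vector_derivative frechet_derivative (\<lambda>z. frechet_derivative g (at z) (0, v)) (at (t, x0)) (1, 0)) (at t)"
    using smooth_line[OF smooth_deriv[OF W(1), of "(0, v)"], of "(0, x0)" t "(1, 0)"] W(2) by (simp add: u_def[abs_def])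
  \<comment> \<open>Interchanging the time and space derivatives of \<open>g\<close> shows that
    \<open>u\<close> solves the equation linearised along \<open>y\<close>.\<close>
  moreover have "frechet_derivative (\<lambda>z. frechet_derivative g (at z) (0, v)) (at (t, x0)) (1, 0) =
     frechet_derivative (\<lambda>z. frechet_derivative g (at z) (1, 0)) (at (t, x0)) (0, v)"
    by (rule deriv_commute[OF W])
  moreover have "frechet_derivative (\<lambda>z. frechet_derivative g (at z) (1, 0)) (at (t, x0)) =
     frechet_derivative (\<lambda>z. field_rep ?X c (g z)) (at (t, x0))"
    by (rule frechet_derivative_cong_open[OF smooth_open[OF W(1)] W(2) D1])
  moreover have "frechet_derivative (field_rep ?X c \<circ> g) (at (t, x0)) =
     frechet_derivative (field_rep ?X c) (at (g (t, x0))) \<circ> frechet_derivative g (at (t, x0))"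
    by (rule frechet_derivative_compose[OF smooth_differentiable[OF W] smooth_differentiable[OF Xc gc[OF W(2)]]])
  ultimately have u: "(u has_vector_derivative frechet_derivative (field_rep ?X c) (at (y t)) (u t)) (at t)"
    by (simp add: o_def y_def u_def)
  let ?a = "form_rep A \<alpha> c"
  have yt: "y t = snd c q" using g[OF W(2)] by (simp add: y_def q_def)
  have yV: "y t \<in> chart_image c" using gc[OF W(2)] by (simp add: y_def)
  have val: "\<alpha> (\<theta> s p) (tangent_map A (\<theta> s) p v) = ?a (y s) (u s)" if "(s, x0) \<in> W" for s
    using form_along_flow[OF smap c(2), of s p \<alpha> v] g[OF that] by (simp add: y_def u_def c0_def)
  define w where "w = tangent_map A (\<theta> t) p v"
  have fw: "chart_deriv id (chart_at A q) c q w = u t"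
    using tangent_map_chart[OF smap c(1,2,3,4), of v] g[OF W(2)] c
    by (simp add: w_def q_def u_def c0_def chart_deriv_id chart_at)
  have fX: "chart_deriv id (chart_at A q) c q (?X q) = field_rep ?X c (y t)"
    unfolding field_rep_def yt using c by (simp add: q_def)
  have qc: "q \<in> fst c" using c by (simp add: q_def)
  have "chart_ext_deriv A \<alpha> c (y t) (field_rep ?X c (y t)) (u t) = ext_deriv A \<alpha> q (?X q) w"
    using ext_deriv_chart[OF s c(2) qc, of "?X q" w] fw fX yt by simp
  also have "\<dots> = Reeb_deriv \<alpha> h q * \<alpha> q w - differential h q w"
    by (rule Hamiltonian_field(3)[OF \<alpha> h])
  also have "differential h q w = frechet_derivative (h \<circ> chart_inv c) (at (y t)) (u t)"
    using differential_chart[OF h c(2) qc, of w] fw yt by simp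
  also have "frechet_derivative (h \<circ> chart_inv c) (at (y t)) = frechet_derivative (\<lambda>z. ?a z (field_rep ?X c z)) (at (y t))"
    by (rule frechet_derivative_cong_open[OF chart_open(2)[OF c(2)] yV])
      (simp add: form_rep_field[OF c(2)] Hamiltonian_field(2)[OF \<alpha> h])
  finally have "chart_ext_deriv A \<alpha> c (y t) (field_rep ?X c (y t)) (u t) + frechet_derivative (\<lambda>z. ?a z (field_rep ?X c z)) (at (y t)) (u t)
     = Reeb_deriv \<alpha> h q * \<alpha> q w" by simp
  moreover have "((\<lambda>t. ?a (y t) (u t)) has_real_derivative
     (chart_ext_deriv A \<alpha> c (y t) (field_rep ?X c (y t)) (u t) + frechet_derivative (\<lambda>z. ?a z (field_rep ?X c z)) (at (y t)) (u t))) (at t)"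
    unfolding chart_ext_deriv_def
    by (rule lie_derivative_form[where a = ?a and X = "field_rep ?X c" and V = "chart_image c",
          OF form_rep_linear[where \<alpha> = \<alpha>, OF smooth_form_linear[OF s] c(2)] smooth_form_rep[OF s c(2)] Xc y yV u])
  ultimately have "((\<lambda>t. ?a (y t) (u t)) has_real_derivative Reeb_deriv \<alpha> h q * \<alpha> q w) (at t)" by simp
  then have "((\<lambda>t. \<alpha> (\<theta> t p) (tangent_map A (\<theta> t) p v)) has_real_derivative Reeb_deriv \<alpha> h q * \<alpha> q w) (at t)"
  proof (rule has_field_derivative_transform_within_open)
    show "open {s. (s, x0) \<in> W}" by (rule open_slice[OF smooth_open[OF W(1)]])
  qed (use W val in auto)
  then show ?thesis by (simp add: q_def w_def)
qed

section \<open>Diffeomorphisms acting on contact forms\<close>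

lemma diffeoD: "diffeo A \<phi> \<Longrightarrow> smooth_map A \<phi>" "diffeo A \<phi> \<Longrightarrow> smooth_map A (inv \<phi>)" "diffeo A \<phi> \<Longrightarrow> bij \<phi>"
  by (auto simp: diffeo_def)

lemma diffeo_comp:
  assumes "diffeo A \<phi>" "diffeo A \<psi>"
  shows "diffeo A (\<psi> \<circ> \<phi>)"
  unfolding diffeo_def using assms
  by (auto simp: o_inv_distrib diffeoD bij_comp intro: smooth_map_comp dest: diffeoD)

lemma diffeo_inv: "diffeo A \<phi> \<Longrightarrow> diffeo A (inv \<phi>)"
  by (auto simp: diffeo_def bij_imp_bij_inv inv_inv_eq)

lemma diffeo_tangent_inv:
  assumes "diffeo A \<phi>"
  shows "tangent_map A (inv \<phi>) (\<phi> p) (tangent_map A \<phi> p v) = v"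
    "tangent_map A \<phi> p (tangent_map A (inv \<phi>) (\<phi> p) w) = w"
proof -
  note d = diffeoD[OF assms]
  have i: "inv \<phi> \<circ> \<phi> = id" "\<phi> \<circ> inv \<phi> = id"
    using d(3) inv_o_cancel[of \<phi>] surj_iff[of \<phi>] by (auto simp: bij_def)
  show "tangent_map A (inv \<phi>) (\<phi> p) (tangent_map A \<phi> p v) = v"
    using tangent_map_comp[OF d(1,2), of p v] i tangent_map_id by simp
  have "inv \<phi> (\<phi> p) = p" using i by (metis comp_apply id_apply)
  then show "tangent_map A \<phi> p (tangent_map A (inv \<phi>) (\<phi> p) w) = w"
    using tangent_map_comp[OF d(2,1), of "\<phi> p" w] i tangent_map_id by simp
qed

lemma form_rep_scale_deriv:
  assumes \<alpha>: "smooth_form A \<alpha>" and f: "smooth_fun A f" and c: "c \<in> A" "x \<in> chart_image c"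
  shows "chart_ext_deriv A (scale_form f \<alpha>) c x u v = f (chart_inv c x) * chart_ext_deriv A \<alpha> c x u v
    + frechet_derivative (f \<circ> chart_inv c) (at x) u * form_rep A \<alpha> c x v
    - frechet_derivative (f \<circ> chart_inv c) (at x) v * form_rep A \<alpha> c x u"
proof -
  have "frechet_derivative (\<lambda>y. form_rep A (scale_form f \<alpha>) c y w) (at x) z =
      f (chart_inv c x) * frechet_derivative (\<lambda>y. form_rep A \<alpha> c y w) (at x) z +
      frechet_derivative (f \<circ> chart_inv c) (at x) z * form_rep A \<alpha> c x w" for w z
  proof -
    have "((\<lambda>y. (f \<circ> chart_inv c) y * form_rep A \<alpha> c y w) has_derivative
      (\<lambda>z. (f \<circ> chart_inv c) x * frechet_derivative (\<lambda>y. form_rep A \<alpha> c y w) (at x) z +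
        frechet_derivative (f \<circ> chart_inv c) (at x) z * form_rep A \<alpha> c x w)) (at x)"
      by (intro has_derivative_mult smooth_has_derivative[OF smooth_fun_chart[OF f c(1)] c(2)]
          smooth_has_derivative[OF smooth_form_rep[OF \<alpha> c(1)] c(2)])
    from fun_cong[OF frechet_derivative_at[OF this], of z] show ?thesis
      by (simp add: form_rep_scale)
  qed
  then show ?thesis by (simp add: chart_ext_deriv_def algebra_simps)
qed

lemma ext_deriv_scale:
  assumes \<alpha>: "smooth_form A \<alpha>" and f: "smooth_fun A f"
  shows "ext_deriv A (scale_form f \<alpha>) p u v = f p * ext_deriv A \<alpha> p u v
    + differential f p u * \<alpha> p v - differential f p v * \<alpha> p u"
proof -
  have x: "snd (chart_at A p) p \<in> chart_image (chart_at A p)" using chart_at by auto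
  have "form_rep A \<alpha> (chart_at A p) (snd (chart_at A p) p) w = \<alpha> p w" for w
    using form_rep_point[OF chart_at(1)[of p] chart_at(2)[of p], of \<alpha> w] by (simp add: chart_deriv_id chart_at)
  then show ?thesis
    using form_rep_scale_deriv[OF \<alpha> f chart_at(1) x, of u v] chart_at[of p]
    by (simp add: ext_deriv_eq differential_def)
qed

text \<open>Rescaling keeps the kernel, and in d(f \<alpha>) the terms with df carry a factor
  \<alpha>, so on the kernel only f d\<alpha> remains.\<close>

lemma contact_form_scale:
  assumes \<alpha>: "contact_form A \<alpha>" and f: "smooth_fun A f" "\<And>p. f p \<noteq> 0"
  shows "contact_form A (scale_form f \<alpha>)"
  unfolding contact_form_def
proof (intro conjI allI impI)
  note s = contact_form_smooth[OF \<alpha>]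
  show "smooth_form A (scale_form f \<alpha>)" by (rule smooth_form_scale[OF s f(1)])
  show "\<exists>v. scale_form f \<alpha> p v \<noteq> 0" for p using \<alpha> f(2) by (simp add: scale_form_def contact_form_def)
  fix p u assume u: "scale_form f \<alpha> p u = 0 \<and> (\<forall>v. scale_form f \<alpha> p v = 0 \<longrightarrow> ext_deriv A (scale_form f \<alpha>) p u v = 0)"
  have u0: "\<alpha> p u = 0" using u f(2) by (simp add: scale_form_def)
  then show "u = 0"
  proof (rule contact_form_nondeg[OF \<alpha>])
    fix v assume v: "\<alpha> p v = 0"
    then have "ext_deriv A (scale_form f \<alpha>) p u v = 0" using u by (simp add: scale_form_def)
    then show "ext_deriv A \<alpha> p u v = 0" using ext_deriv_scale[OF s f(1), of p u v] v u0 f(2) by simp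
  qed
qed

lemma contact_form_pullback:
  assumes \<alpha>: "contact_form A \<alpha>" and \<phi>: "diffeo A \<phi>"
  shows "contact_form A (pullback A \<phi> \<alpha>)"
  unfolding contact_form_def
proof (intro conjI allI impI)
  note s = contact_form_smooth[OF \<alpha>] and d = diffeoD[OF \<phi>] and T = diffeo_tangent_inv[OF \<phi>]
  show sp: "smooth_form A (pullback A \<phi> \<alpha>)" by (rule smooth_form_pullback[OF s d(1)])
  fix p
  obtain v where "\<alpha> (\<phi> p) v \<noteq> 0" using \<alpha> by (auto simp: contact_form_def)
  then have "pullback A \<phi> \<alpha> p (tangent_map A (inv \<phi>) (\<phi> p) v) \<noteq> 0" by (simp add: pullback_def T)
  then show "\<exists>v. pullback A \<phi> \<alpha> p v \<noteq> 0" by blast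
  fix u assume u: "pullback A \<phi> \<alpha> p u = 0 \<and> (\<forall>v. pullback A \<phi> \<alpha> p v = 0 \<longrightarrow> ext_deriv A (pullback A \<phi> \<alpha>) p u v = 0)"
  have "tangent_map A \<phi> p u = 0"
  proof (rule contact_form_nondeg[OF \<alpha>])
    show "\<alpha> (\<phi> p) (tangent_map A \<phi> p u) = 0" using u by (simp add: pullback_def)
    fix w assume "\<alpha> (\<phi> p) w = 0"
    then have "pullback A \<phi> \<alpha> p (tangent_map A (inv \<phi>) (\<phi> p) w) = 0" by (simp add: pullback_def T)
    then have "ext_deriv A (pullback A \<phi> \<alpha>) p u (tangent_map A (inv \<phi>) (\<phi> p) w) = 0" using u by blast
    then show "ext_deriv A \<alpha> (\<phi> p) (tangent_map A \<phi> p u) w = 0"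
      using ext_deriv_pullback[OF s d(1) sp] by (simp add: T)
  qed
  then show "u = 0" using T(1)[of p u] linear_0[OF tangent_map_linear[OF d(2)]] by simp
qed

section \<open>Contactomorphisms isotopic to the identity\<close>

definition is_contact_map :: "('m \<Rightarrow> 'e set) \<Rightarrow> ('m \<Rightarrow> 'm) \<Rightarrow> bool" where
  "is_contact_map \<xi> \<phi> \<longleftrightarrow> diffeo A \<phi> \<and> (\<forall>p. tangent_map A \<phi> p ` \<xi> p = \<xi> (\<phi> p))"

lemma is_contact_map_comp:
  assumes "is_contact_map \<xi> \<phi>" "is_contact_map \<xi> \<psi>"
  shows "is_contact_map \<xi> (\<psi> \<circ> \<phi>)"
proof -
  have d: "diffeo A \<phi>" "diffeo A \<psi>" using assms by (auto simp: is_contact_map_def)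
  have "tangent_map A (\<psi> \<circ> \<phi>) p ` \<xi> p = tangent_map A \<psi> (\<phi> p) ` (tangent_map A \<phi> p ` \<xi> p)" for p
    unfolding image_image using tangent_map_comp[OF diffeoD(1)[OF d(1)] diffeoD(1)[OF d(2)]] by simp
  then show ?thesis using assms diffeo_comp[OF d] by (simp add: is_contact_map_def)
qed

lemma is_contact_map_inv:
  assumes "is_contact_map \<xi> \<phi>"
  shows "is_contact_map \<xi> (inv \<phi>)"
proof -
  have d: "diffeo A \<phi>" using assms by (auto simp: is_contact_map_def)
  have "tangent_map A (inv \<phi>) q ` \<xi> q = \<xi> (inv \<phi> q)" for q
  proof -
    define p where "p = inv \<phi> q"
    have q: "q = \<phi> p" using diffeoD(3)[OF d] by (simp add: p_def bij_is_surj surj_f_inv_f)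
    have "\<xi> q = tangent_map A \<phi> p ` \<xi> p" using assms q by (auto simp: is_contact_map_def)
    then have "tangent_map A (inv \<phi>) q ` \<xi> q = \<xi> p"
      by (simp add: q image_image diffeo_tangent_inv[OF d])
    then show ?thesis by (simp add: p_def)
  qed
  then show ?thesis using diffeo_inv[OF d] by (simp add: is_contact_map_def)
qed

lemma is_contact_map_iff:
  assumes "is_contact_map \<xi> \<phi>"
  shows "tangent_map A \<phi> p v \<in> \<xi> (\<phi> p) \<longleftrightarrow> v \<in> \<xi> p"
proof -
  have d: "diffeo A \<phi>" and im: "\<xi> (\<phi> p) = tangent_map A \<phi> p ` \<xi> p" using assms by (auto simp: is_contact_map_def)
  have eq: "v = u" if "tangent_map A \<phi> p v = tangent_map A \<phi> p u" for u
    using diffeo_tangent_inv(1)[OF d, of p v] diffeo_tangent_inv(1)[OF d, of p u] unfolding that by (rule trans[OF sym])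
  show ?thesis
  proof
    assume "tangent_map A \<phi> p v \<in> \<xi> (\<phi> p)"
    then obtain u where "u \<in> \<xi> p" "tangent_map A \<phi> p v = tangent_map A \<phi> p u" unfolding im by auto
    then show "v \<in> \<xi> p" using eq by simp
  qed (simp add: im)
qed

text \<open>Smoothness of the isotopy is traded for its pointwise form, which is closed under
  composition and change of time.\<close>

lemma Cont0_iff:
  "\<phi> \<in> Cont0 A \<xi> \<longleftrightarrow> (\<exists>\<Phi>. (\<forall>t\<in>{0..1}. is_contact_map \<xi> (\<Phi> t)) \<and>
     (\<forall>t\<in>{0..1}. \<forall>p. smooth_at_within {0..1} \<Phi> t p) \<and> \<Phi> 0 = id \<and> \<Phi> 1 = \<phi>)" (is "_ \<longleftrightarrow> (\<exists>\<Phi>. ?P \<Phi>)")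
proof
  assume "\<phi> \<in> Cont0 A \<xi>"
  then obtain \<Phi> where \<Phi>: "smooth_isotopy A \<Phi>" "\<forall>t\<in>{0..1}. \<forall>p. tangent_map A (\<Phi> t) p ` \<xi> p = \<xi> (\<Phi> t p)" "\<Phi> 0 = id" "\<Phi> 1 = \<phi>"
    unfolding Cont0_def by blast
  have "\<forall>t\<in>{0..1}. diffeo A (\<Phi> t)" using \<Phi>(1) unfolding smooth_isotopy_def by blast
  then have "?P \<Phi>" using \<Phi> smooth_isotopyD[OF \<Phi>(1)] by (simp add: is_contact_map_def)
  then show "\<exists>\<Phi>. ?P \<Phi>" by blast
next
  assume "\<exists>\<Phi>. ?P \<Phi>"
  then obtain \<Phi> where \<Phi>: "?P \<Phi>" by blast
  have "smooth_isotopy A \<Phi>"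
    by (rule smooth_isotopyI) (use \<Phi> in \<open>auto simp: is_contact_map_def\<close>)
  then show "\<phi> \<in> Cont0 A \<xi>" unfolding Cont0_def using \<Phi> by (intro CollectI exI[of _ \<Phi>]) (simp add: is_contact_map_def)
qed

lemma Cont0_contact_map: "\<phi> \<in> Cont0 A \<xi> \<Longrightarrow> is_contact_map \<xi> \<phi>"
  unfolding Cont0_iff by (metis atLeastAtMost_iff order_refl zero_le_one)

lemma Cont0_comp:
  assumes "\<phi> \<in> Cont0 A \<xi>" "\<psi> \<in> Cont0 A \<xi>"
  shows "\<psi> \<circ> \<phi> \<in> Cont0 A \<xi>"
proof -
  obtain \<Phi> where \<Phi>: "\<forall>t\<in>{0..1}. is_contact_map \<xi> (\<Phi> t)" "\<forall>t\<in>{0..1}. \<forall>p. smooth_at_within {0..1} \<Phi> t p" "\<Phi> 0 = id" "\<Phi> 1 = \<phi>"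
    using assms(1) unfolding Cont0_iff by blast
  obtain \<Psi> where \<Psi>: "\<forall>t\<in>{0..1}. is_contact_map \<xi> (\<Psi> t)" "\<forall>t\<in>{0..1}. \<forall>p. smooth_at_within {0..1} \<Psi> t p" "\<Psi> 0 = id" "\<Psi> 1 = \<psi>"
    using assms(2) unfolding Cont0_iff by blast
  have "smooth_at_within {0..1} (\<lambda>t. \<Psi> t \<circ> \<Phi> t) t p" if "t \<in> {0..1}" for t p
    using smooth_at_within_comp[of "{0..1}" \<Phi> t p \<Psi>] \<Phi>(2) \<Psi>(2) that by (simp add: o_def)
  then show ?thesis unfolding Cont0_iff
    using \<Phi> \<Psi> is_contact_map_comp by (intro exI[of _ "\<lambda>t. \<Psi> t \<circ> \<Phi> t"]) auto
qed

text \<open>The reversed path \<open>\<Phi> (1 - t) \<circ> inv \<phi>\<close> leads from the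
  identity to \<open>inv \<phi>\<close>. Only one fixed inverse occurs in it, so smooth dependence
  of the inverses on time does not come up.\<close>

lemma Cont0_inv:
  assumes "\<phi> \<in> Cont0 A \<xi>"
  shows "inv \<phi> \<in> Cont0 A \<xi>"
proof -
  obtain \<Phi> where \<Phi>: "\<forall>t\<in>{0..1}. is_contact_map \<xi> (\<Phi> t)" "\<forall>t\<in>{0..1}. \<forall>p. smooth_at_within {0..1} \<Phi> t p" "\<Phi> 0 = id" "\<Phi> 1 = \<phi>"
    using assms unfolding Cont0_iff by blast
  have c: "is_contact_map \<xi> (inv \<phi>)" by (rule is_contact_map_inv[OF Cont0_contact_map[OF assms]])
  then have d: "diffeo A (inv \<phi>)" by (simp add: is_contact_map_def)
  have "bij \<phi>" using Cont0_contact_map[OF assms] diffeoD(3) by (simp add: is_contact_map_def)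
  then have i: "\<phi> \<circ> inv \<phi> = id" using surj_iff[of \<phi>] by (auto simp: bij_def)
  have "smooth_at_within {0..1} (\<lambda>t. \<Phi> (1 - t) \<circ> inv \<phi>) t p" if t: "t \<in> {0..1}" for t p
  proof -
    have "smooth_at_within {0..1} \<Phi> (- 1 * t + 1) q" for q using \<Phi>(2) t by auto
    then have "smooth_at_within {0..1} (\<lambda>t. \<Phi> (- 1 * t + 1)) t q" for q
      by (rule smooth_at_within_time[where a = "- 1" and b = 1, OF _ t]) auto
    from smooth_at_within_comp[where \<theta> = "\<lambda>_. inv \<phi>" and \<phi> = "\<lambda>t. \<Phi> (- 1 * t + 1)",
        OF smooth_map_at_within[OF diffeoD(1)[OF d]] this t]
    have "smooth_at_within {0..1} (\<lambda>t p. \<Phi> (- 1 * t + 1) (inv \<phi> p)) t p" .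
    then show ?thesis by (simp add: o_def)
  qed
  moreover have "is_contact_map \<xi> (\<Phi> (1 - t) \<circ> inv \<phi>)" if t: "t \<in> {0..1}" for t
    by (rule is_contact_map_comp[OF c]) (use \<Phi>(1) t in auto)
  ultimately show ?thesis unfolding Cont0_iff
    using \<Phi> i by (intro exI[of _ "\<lambda>t. \<Phi> (1 - t) \<circ> inv \<phi>"]) auto
qed

text \<open>Positivity is where the isotopy enters: for a transverse v the value of \<alpha> on the
  vector transported to time t is continuous in t, never 0 because the hyperplanes are preserved,
  and positive at t = 0. By the intermediate value theorem it stays positive up to t = 1.\<close>

lemma contact_forms_pullback:
  assumes \<alpha>: "\<alpha> \<in> contact_forms A \<xi> P" and \<phi>: "\<phi> \<in> Cont0 A \<xi>"
  shows "pullback A \<phi> \<alpha> \<in> contact_forms A \<xi> P"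
proof -
  have c: "contact_form A \<alpha>" and \<xi>: "v \<in> \<xi> p \<longleftrightarrow> \<alpha> p v = 0" and P: "v \<in> P p \<Longrightarrow> 0 < \<alpha> p v" for p v
    using \<alpha> by (auto simp: contact_forms_def)
  obtain \<Phi> where \<Phi>: "\<forall>t\<in>{0..1}. is_contact_map \<xi> (\<Phi> t)" "\<forall>t\<in>{0..1}. \<forall>p. smooth_at_within {0..1} \<Phi> t p" "\<Phi> 0 = id" "\<Phi> 1 = \<phi>"
    using \<phi> unfolding Cont0_iff by blast
  have d: "diffeo A (\<Phi> t)" if "t \<in> {0..1}" for t using \<Phi>(1) that by (auto simp: is_contact_map_def)
  have iff: "\<alpha> (\<Phi> t p) (tangent_map A (\<Phi> t) p v) = 0 \<longleftrightarrow> \<alpha> p v = 0" if "t \<in> {0..1}" for t p v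
    using is_contact_map_iff[of \<xi> "\<Phi> t" p v] \<Phi>(1) that by (simp add: \<xi>)
  have cont: "continuous_on {0..1} (\<lambda>t. \<alpha> (\<Phi> t p) (tangent_map A (\<Phi> t) p v))" for p v
  proof (rule continuous_on_local)
    fix t0 :: real assume t0: "t0 \<in> {0..1}"
    let ?c = "chart_at A p" and ?c' = "chart_at A (\<Phi> t0 p)"
    let ?x = "snd ?c p"
    have "smooth_at_within {0..1} \<Phi> t0 p" using \<Phi>(2) t0 by blast
    then obtain W g where W: "smooth W g" "(t0, ?x) \<in> W"
      and g: "\<And>t. t \<in> {0..1} \<Longrightarrow> (t, ?x) \<in> W \<Longrightarrow> \<Phi> t p \<in> fst ?c' \<and> g (t, ?x) = snd ?c' (\<Phi> t p) \<and>
        (\<forall>v. chart_deriv (\<Phi> t) ?c ?c' p v = frechet_derivative g (at (t, ?x)) (0, v))"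
      using flow_tangent_chart[OF _ t0 chart_at(1) chart_at(1) chart_at(2) chart_at(2)] by metis
    let ?T = "{t. (t, ?x) \<in> W}"
    have line: "continuous_on ({0..1} \<inter> ?T) (\<lambda>t. (t, ?x))" by (intro continuous_intros)
    have cg: "continuous_on ({0..1} \<inter> ?T) (\<lambda>t. g (t, ?x))"
      by (rule continuous_on_compose2[OF smooth_continuous[OF W(1)] line]) auto
    have cd: "continuous_on ({0..1} \<inter> ?T) (\<lambda>t. frechet_derivative g (at (t, ?x)) (0, v))"
      by (rule continuous_on_compose2[OF smooth_continuous[OF smooth_deriv[OF W(1)]] line]) auto
    note s = contact_form_smooth[OF c]
    have "continuous_on ({0..1} \<inter> ?T) (\<lambda>t. \<Sum>b\<in>Basis. (frechet_derivative g (at (t, ?x)) (0, v) \<bullet> b) * form_rep A \<alpha> ?c' (g (t, ?x)) b)"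
      by (intro continuous_on_sum continuous_on_mult continuous_on_inner cd continuous_on_const
          continuous_on_compose2[OF smooth_continuous[OF smooth_form_rep[OF s chart_at(1)]] cg])
        (use g in auto)
    then have "continuous_on ({0..1} \<inter> ?T) (\<lambda>t. \<alpha> (\<Phi> t p) (tangent_map A (\<Phi> t) p v))"
    proof (rule continuous_on_eq)
      fix t assume "t \<in> {0..1} \<inter> ?T"
      then have t: "t \<in> {0..1}" "(t, ?x) \<in> W" by auto
      have "\<alpha> (\<Phi> t p) (tangent_map A (\<Phi> t) p v) = form_rep A \<alpha> ?c' (g (t, ?x)) (frechet_derivative g (at (t, ?x)) (0, v))"
        using form_along_flow[OF diffeoD(1)[OF d[OF t(1)]] chart_at(1), of p "\<Phi> t0 p" \<alpha> v] g[OF t] by simp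
      then show "(\<Sum>b\<in>Basis. (frechet_derivative g (at (t, ?x)) (0, v) \<bullet> b) * form_rep A \<alpha> ?c' (g (t, ?x)) b) =
          \<alpha> (\<Phi> t p) (tangent_map A (\<Phi> t) p v)"
        using linear_expand[OF form_rep_linear[where \<alpha> = \<alpha>, OF smooth_form_linear[OF s] chart_at(1)[of "\<Phi> t0 p"], where x = "g (t, ?x)"],
            of "frechet_derivative g (at (t, ?x)) (0, v)"] g[OF t] by simp
    qed
    then show "\<exists>T. open T \<and> t0 \<in> T \<and> continuous_on ({0..1} \<inter> T) (\<lambda>t. \<alpha> (\<Phi> t p) (tangent_map A (\<Phi> t) p v))"
      using W(2) open_slice(1)[OF smooth_open[OF W(1)]] by (intro exI[of _ ?T]) simp
  qed
  have pos: "0 < pullback A \<phi> \<alpha> p v" if v: "v \<in> P p" for p v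
  proof (rule ccontr)
    let ?f = "\<lambda>t. \<alpha> (\<Phi> t p) (tangent_map A (\<Phi> t) p v)"
    assume "\<not> 0 < pullback A \<phi> \<alpha> p v"
    then have "?f 1 \<le> 0" using \<Phi>(4) by (simp add: pullback_def)
    moreover have f0: "0 < ?f 0" using P[OF v] \<Phi>(3) by (simp add: tangent_map_id)
    ultimately obtain t where "0 \<le> t" "t \<le> 1" "?f t = 0"
      using IVT2'[of ?f 1 0 0] cont[of p v] by auto
    then show False using iff[of t p v] P[OF v] by auto
  qed
  have "{v. pullback A \<phi> \<alpha> p v = 0} = \<xi> p" for p
    using iff[of 1 p] \<Phi>(4) \<xi> by (auto simp: pullback_def)
  then show ?thesis
    using contact_form_pullback[OF c, of \<phi>] d[of 1] \<Phi>(4) pos by (simp add: contact_forms_def)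
qed

lemma contact_forms_scale:
  assumes "\<alpha> \<in> contact_forms A \<xi> P" "smooth_fun A f" "\<And>p. 0 < f p"
  shows "scale_form f \<alpha> \<in> contact_forms A \<xi> P"
proof -
  have "f p \<noteq> 0" for p using assms(3)[of p] by simp
  then show ?thesis
    using assms contact_form_scale[of \<alpha> f] by (auto simp: contact_forms_def scale_form_def)
qed

end

section \<open>The Banach--Mazur pseudo-metric and geodesics\<close>

lemma CkP_local:
  fixes F :: "'t::t2_space \<times> 'a::real_normed_vector \<Rightarrow> 'b::real_normed_vector"
  assumes "\<And>q. q \<in> W \<Longrightarrow> \<exists>N. open N \<and> q \<in> N \<and> CkP n (W \<inter> N) F"
  shows "CkP n W F"
  using assms
proof (induction n arbitrary: F)
  case 0
  show ?case unfolding CkP.simps by (rule continuous_on_local) (use 0 in auto)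
next
  case (Suc n)
  have "continuous_on W F"
  proof (rule continuous_on_local)
    fix q assume "q \<in> W"
    from Suc.prems[OF this] obtain N where "open N" "q \<in> N" "CkP (Suc n) (W \<inter> N) F" by blast
    then show "\<exists>N. open N \<and> q \<in> N \<and> continuous_on (W \<inter> N) F" using CkP_continuous by blast
  qed
  moreover have "(\<lambda>y. F (fst p, y)) differentiable at (snd p)" if "p \<in> W" for p
    using Suc.prems[OF that] that by auto
  moreover have "CkP n W (slice_deriv F v)" for v
  proof (rule Suc.IH)
    fix q assume "q \<in> W"
    from Suc.prems[OF this] obtain N where "open N" "q \<in> N" "CkP (Suc n) (W \<inter> N) F" by blast
    then show "\<exists>N. open N \<and> q \<in> N \<and> CkP n (W \<inter> N) (slice_deriv F v)" by auto
  qed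
  ultimately show ?case by simp
qed

lemma CkP_iter_deriv:
  assumes "CkP (length vs + n) W F"
  shows "CkP n W (\<lambda>p. iter_deriv vs (\<lambda>y. F (fst p, y)) (snd p))"
  using assms
proof (induction vs arbitrary: F rule: rev_induct)
  case (snoc v vs)
  have "CkP (length vs + n) W (slice_deriv F v)" using snoc.prems by simp
  from snoc.IH[OF this] show ?case by (simp add: iter_deriv_snoc slice_deriv_def)
qed simp

text \<open>The C-infinity topology controls iterated derivatives; this is their entrance into the
  calculus with a parameter, and \<open>CkP_iter_deriv\<close> is the exit.\<close>

lemma iter_deriv_CkP:
  assumes "\<And>vs. continuous_on W (\<lambda>p. iter_deriv vs (\<lambda>y. F (fst p, y)) (snd p))"
    and "\<And>vs p. p \<in> W \<Longrightarrow> iter_deriv vs (\<lambda>y. F (fst p, y)) differentiable at (snd p)"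
  shows "CkP n W F"
  using assms
proof (induction n arbitrary: F)
  case 0
  then show ?case using 0(1)[of "[]"] by simp
next
  case (Suc n)
  have "CkP n W (slice_deriv F v)" for v
  proof (rule Suc.IH)
    show "continuous_on W (\<lambda>p. iter_deriv vs (\<lambda>y. slice_deriv F v (fst p, y)) (snd p))" for vs
      using Suc.prems(1)[of "vs @ [v]"] by (simp add: slice_deriv_def iter_deriv_snoc)
    show "iter_deriv vs (\<lambda>y. slice_deriv F v (fst p, y)) differentiable at (snd p)" if "p \<in> W" for vs p
      using Suc.prems(2)[OF that, of "vs @ [v]"] by (simp add: slice_deriv_def iter_deriv_snoc)
  qed
  then show ?case using Suc.prems(1)[of "[]"] Suc.prems(2)[of _ "[]"] by simp
qed

lemma smooth_iter_deriv: "smooth U f \<Longrightarrow> smooth U (iter_deriv vs f)"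
  by (induction vs) (auto intro: smooth_deriv)

text \<open>The maximum over the compact set leaves a positive margin below e at the given time, and
  uniform continuity preserves it at nearby times. Preimages of subbasic neighbourhoods of forms
  have this shape.\<close>

lemma uniform_open_tube:
  fixes g :: "real \<times> 'a::metric_space \<Rightarrow> real"
  assumes g: "continuous_on (S \<times> K) g" and K: "compact K" and S: "compact S"
  shows "openin (top_of_set S) {t\<in>S. \<forall>x\<in>K. g (t, x) < e}"
proof (cases "K = {}")
  case False
  have uc: "uniformly_continuous_on (S \<times> K) g"
    by (intro compact_uniformly_continuous g compact_Times S K)
  show ?thesis
    unfolding openin_euclidean_subtopology_iff
  proof (intro conjI ballI)
    fix t0 assume "t0 \<in> {t\<in>S. \<forall>x\<in>K. g (t, x) < e}"
    then have t0: "t0 \<in> S" "\<And>x. x \<in> K \<Longrightarrow> g (t0, x) < e" by auto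
    have "continuous_on K (\<lambda>x. g (t0, x))"
      by (rule continuous_on_compose2[OF g]) (use t0 in \<open>auto intro!: continuous_intros\<close>)
    then obtain x0 where x0: "x0 \<in> K" "\<And>x. x \<in> K \<Longrightarrow> g (t0, x) \<le> g (t0, x0)"
      using continuous_attains_sup[OF K False, of "\<lambda>x. g (t0, x)"] by auto
    have "e - g (t0, x0) > 0" using t0(2)[OF x0(1)] by simp
    then obtain d where d: "d > 0" "\<And>z z'. z \<in> S \<times> K \<Longrightarrow> z' \<in> S \<times> K \<Longrightarrow> dist z' z < d \<Longrightarrow> dist (g z') (g z) < e - g (t0, x0)"
      using uc unfolding uniformly_continuous_on_def by metis
    have "g (t, x) < e" if "t \<in> S" "dist t t0 < d" "x \<in> K" for t x
      using d(2)[of "(t0, x)" "(t, x)"] that t0(1) x0(2)[OF that(3)] by (auto simp: dist_Pair_Pair dist_real_def)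
    then show "\<exists>d>0. \<forall>t\<in>S. dist t t0 < d \<longrightarrow> t \<in> {t\<in>S. \<forall>x\<in>K. g (t, x) < e}" using d(1) by blast
  qed auto
qed simp

context manifold
begin

text \<open>Every derivative is jointly continuous in (t, x) by a triangle inequality through (t1,
  x): closeness of \<psi> t to \<psi> t1 in the map topology is uniform in x on a compact ball, and
  the single map \<psi> t1 is smooth.\<close>

lemma map_path_CkP:
  fixes \<psi> :: "real \<Rightarrow> 'm \<Rightarrow> 'm"
  assumes \<psi>: "continuous_map (top_of_set {0..1}) (Cinf_map_topology A) \<psi>"
    and sm: "\<And>t. t \<in> {0..1} \<Longrightarrow> smooth_map A (\<psi> t)"
    and c: "c \<in> A" "c' \<in> A" "p \<in> fst c" "\<psi> t0 p \<in> fst c'" and t0: "t0 \<in> {0..1}"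
  obtains T B where "open T" "t0 \<in> T" "open B" "snd c p \<in> B" "B \<subseteq> chart_image c"
    "\<And>t x. t \<in> T \<Longrightarrow> t \<in> {0..1} \<Longrightarrow> x \<in> B \<Longrightarrow> \<psi> t (chart_inv c x) \<in> fst c'"
    "\<And>n. CkP n (({0..1} \<inter> T) \<times> B) (\<lambda>q. snd c' (\<psi> (fst q) (chart_inv c (snd q))))"
proof -
  let ?N = "\<lambda>\<phi> K vs e. {\<rho>. smooth_map A \<rho> \<and> \<rho> ` K \<subseteq> fst c' \<and>
            (\<forall>x\<in>snd c ` K. norm (iter_deriv vs (snd c' \<circ> \<rho> \<circ> chart_inv c) x
                               - iter_deriv vs (snd c' \<circ> \<phi> \<circ> chart_inv c) x) < e)}"
  have nb: "openin (top_of_set {0..1}) (\<psi> -` ?N \<phi> K vs e \<inter> {0..1})"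
    if "smooth_map A \<phi>" "compact K" "K \<subseteq> fst c" "\<phi> ` K \<subseteq> fst c'" "0 < (e::real)" for \<phi> K vs e
  proof -
    have "?N \<phi> K vs e \<in> {{\<psi>. smooth_map A \<psi> \<and> \<psi> ` K \<subseteq> fst c' \<and>
            (\<forall>x\<in>snd c ` K. norm (iter_deriv vs (snd c' \<circ> \<psi> \<circ> chart_inv c) x
                               - iter_deriv vs (snd c' \<circ> \<phi> \<circ> chart_inv c) x) < \<epsilon>)}
        | \<phi> c c' K vs \<epsilon>.
            smooth_map A \<phi> \<and> c \<in> A \<and> c' \<in> A \<and> compact K \<and> K \<subseteq> fst c \<and> \<phi> ` K \<subseteq> fst c' \<and> 0 < (\<epsilon>::real)}"
      using that c
      by (intro CollectI exI[of _ \<phi>] exI[of _ c] exI[of _ c'] exI[of _ K] exI[of _ vs] exI[of _ e]) simp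
    from \<psi>[unfolded Cinf_map_topology_def continuous_on_generated_topo_iff, THEN conjunct1, rule_format, OF this]
    show ?thesis by (simp only: topspace_euclidean_subtopology)
  qed
  let ?x0 = "snd c p"
  have S: "smooth (snd c ` (fst c \<inter> \<psi> t -` fst c')) (snd c' \<circ> \<psi> t \<circ> chart_inv c)" if "t \<in> {0..1}" for t
    by (rule smooth_map_chart[OF sm[OF that] c(1,2)])
  have "?x0 \<in> snd c ` (fst c \<inter> \<psi> t0 -` fst c')" using c by auto
  then obtain r where r: "r > 0" "cball ?x0 r \<subseteq> snd c ` (fst c \<inter> \<psi> t0 -` fst c')"
    using smooth_open[OF S[OF t0]] open_contains_cball by blast
  let ?K = "chart_inv c ` cball ?x0 r"
  have sub: "cball ?x0 r \<subseteq> chart_image c" using r(2) by auto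
  have K: "compact ?K"
    by (intro compact_continuous_image continuous_on_subset[OF chart_continuous(2)[OF c(1)] sub] compact_cball)
  have Kc: "?K \<subseteq> fst c" using sub chart_inv_image[OF c(1)] by auto
  have sK: "snd c ` ?K = cball ?x0 r"
    using sub chart_inv_image[OF c(1)] by (force simp: image_image)
  have K0: "\<psi> t0 ` ?K \<subseteq> fst c'"
  proof safe
    fix x assume "x \<in> cball ?x0 r"
    then obtain q where "q \<in> fst c" "\<psi> t0 q \<in> fst c'" "x = snd c q" using r(2) by auto
    then show "\<psi> t0 (chart_inv c x) \<in> fst c'" using c by simp
  qed
  \<comment> \<open>This neighbourhood serves to keep the image of \<open>?K\<close> inside the
    target chart; the empty list of derivatives and the radius 1 are arbitrary choices.\<close>
  obtain T where T: "open T" "\<psi> -` ?N (\<psi> t0) ?K [] 1 \<inter> {0..1} = {0..1} \<inter> T"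
    using nb[OF sm[OF t0] K Kc K0, of 1 "[]"] by (auto simp: openin_open)
  have TK: "\<psi> t ` ?K \<subseteq> fst c'" if "t \<in> {0..1} \<inter> T" for t
    using that unfolding T(2)[symmetric] by blast
  have t0T: "t0 \<in> T"
  proof -
    have "\<psi> t0 \<in> ?N (\<psi> t0) ?K [] 1" using sm[OF t0] K0 by simp
    then have "t0 \<in> \<psi> -` ?N (\<psi> t0) ?K [] 1 \<inter> {0..1}" using t0 by simp
    then show ?thesis unfolding T(2) by simp
  qed
  let ?F = "\<lambda>q. snd c' (\<psi> (fst q) (chart_inv c (snd q)))"
  let ?B = "ball ?x0 r"
  have slice: "(\<lambda>y. ?F (t, y)) = snd c' \<circ> \<psi> t \<circ> chart_inv c" for t by auto
  have St: "smooth ?B (snd c' \<circ> \<psi> t \<circ> chart_inv c)" if t: "t \<in> {0..1} \<inter> T" for t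
  proof (rule smooth_subset[OF S open_ball])
    show "?B \<subseteq> snd c ` (fst c \<inter> \<psi> t -` fst c')"
    proof
      fix x assume "x \<in> ?B"
      then have x: "x \<in> cball ?x0 r" by auto
      then have "chart_inv c x \<in> fst c" "\<psi> t (chart_inv c x) \<in> fst c'" "snd c (chart_inv c x) = x"
        using TK[OF t] Kc sub chart_inv_image[OF c(1)] by auto
      then show "x \<in> snd c ` (fst c \<inter> \<psi> t -` fst c')" by (intro image_eqI[of _ _ "chart_inv c x"]) auto
    qed
  qed (use t in auto)
  have "CkP n (({0..1} \<inter> T) \<times> ?B) ?F" for n
  proof (rule iter_deriv_CkP)
    fix vs
    let ?H = "\<lambda>q. iter_deriv vs (\<lambda>y. ?F (fst q, y)) (snd q)"
    show "iter_deriv vs (\<lambda>y. ?F (fst p, y)) differentiable at (snd p)" if "p \<in> ({0..1} \<inter> T) \<times> ?B" for p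
      unfolding slice using that by (intro smooth_differentiable[OF smooth_iter_deriv[OF St]]) auto
    show "continuous_on (({0..1} \<inter> T) \<times> ?B) ?H"
      unfolding continuous_on_iff
    proof (intro ballI allI impI)
      fix q :: "real \<times> 'e" and e :: real assume q: "q \<in> ({0..1} \<inter> T) \<times> ?B" and e: "e > 0"
      obtain t1 x1 where q': "q = (t1, x1)" "t1 \<in> {0..1} \<inter> T" "x1 \<in> ?B" using q by auto
      have "openin (top_of_set {0..1}) (\<psi> -` ?N (\<psi> t1) ?K vs (e/2) \<inter> {0..1})"
        by (rule nb[OF sm K Kc TK]) (use q' e in auto)
      moreover have "t1 \<in> \<psi> -` ?N (\<psi> t1) ?K vs (e/2) \<inter> {0..1}"
        using q' sm TK[OF q'(2)] e by simp
      ultimately obtain d1 where d1: "d1 > 0" "\<And>t. t \<in> {0..1} \<Longrightarrow> dist t t1 < d1 \<Longrightarrow> \<psi> t \<in> ?N (\<psi> t1) ?K vs (e/2)"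
        unfolding openin_euclidean_subtopology_iff by (metis (no_types, lifting) Int_iff vimageD)
      have "continuous_on ?B (iter_deriv vs (snd c' \<circ> \<psi> t1 \<circ> chart_inv c))"
        by (rule smooth_continuous[OF smooth_iter_deriv[OF St[OF q'(2)]]])
      then obtain d2 where d2: "d2 > 0" "\<And>x. x \<in> ?B \<Longrightarrow> dist x x1 < d2 \<Longrightarrow>
          dist (iter_deriv vs (snd c' \<circ> \<psi> t1 \<circ> chart_inv c) x) (iter_deriv vs (snd c' \<circ> \<psi> t1 \<circ> chart_inv c) x1) < e/2"
        using q'(3) e unfolding continuous_on_iff by (meson half_gt_zero)
      show "\<exists>d>0. \<forall>x'\<in>({0..1} \<inter> T) \<times> ?B. dist x' q < d \<longrightarrow> dist (?H x') (?H q) < e"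
      proof (intro exI[of _ "min d1 d2"] conjI ballI impI)
        fix z assume z: "z \<in> ({0..1} \<inter> T) \<times> ?B" "dist z q < min d1 d2"
        obtain t x where z': "z = (t, x)" "t \<in> {0..1} \<inter> T" "x \<in> ?B" using z(1) by auto
        have "dist t t1 < d1" "dist x x1 < d2"
          using z(2) dist_fst_le[of z q] dist_snd_le[of z q] by (auto simp: z' q')
        then have "\<psi> t \<in> ?N (\<psi> t1) ?K vs (e/2)" using d1(2) z'(2) by blast
        then have "\<forall>x\<in>snd c ` ?K. norm (iter_deriv vs (snd c' \<circ> \<psi> t \<circ> chart_inv c) x
                               - iter_deriv vs (snd c' \<circ> \<psi> t1 \<circ> chart_inv c) x) < e/2"
          by (elim CollectE conjE)
        moreover have "x \<in> snd c ` ?K" unfolding sK using z'(3) by simp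
        ultimately have "dist (iter_deriv vs (snd c' \<circ> \<psi> t \<circ> chart_inv c) x) (iter_deriv vs (snd c' \<circ> \<psi> t1 \<circ> chart_inv c) x) < e/2"
          unfolding dist_norm by (rule bspec)
        moreover have "dist (iter_deriv vs (snd c' \<circ> \<psi> t1 \<circ> chart_inv c) x) (iter_deriv vs (snd c' \<circ> \<psi> t1 \<circ> chart_inv c) x1) < e/2"
          by (rule d2(2)[OF z'(3) \<open>dist x x1 < d2\<close>])
        ultimately show "dist (?H z) (?H q) < e"
          unfolding z'(1) q'(1) fst_conv snd_conv comp_def
          by - (rule dist_triangle_half_l, assumption, subst dist_commute, assumption)
      qed (use d1 d2 in auto)
    qed
  qed
  moreover have "\<psi> t (chart_inv c x) \<in> fst c'" if "t \<in> T" "t \<in> {0..1}" "x \<in> ?B" for t x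
    using TK[of t] that by auto
  moreover have "?B \<subseteq> chart_image c" using sub by auto
  ultimately show thesis using that[of T ?B] T(1) t0T r(1) by auto
qed

lemma form_path_continuous:
  fixes \<gamma> :: "real \<Rightarrow> ('m, 'e) form"
  assumes \<gamma>: "\<And>t. t \<in> {0..1} \<Longrightarrow> smooth_form A (\<gamma> t)"
    and C: "\<And>n c v. c \<in> A \<Longrightarrow> CkP n ({0..1} \<times> chart_image c) (\<lambda>q. form_rep A (\<gamma> (fst q)) c (snd q) v)"
  shows "continuous_map (top_of_set {0..1}) (Cinf_form_topology A) \<gamma>"
  unfolding Cinf_form_topology_def continuous_on_generated_topo_iff
proof (intro conjI allI impI)
  let ?\<S> = "{{\<beta>. smooth_form A \<beta> \<and>
            (\<forall>x\<in>snd c ` K. \<bar>iter_deriv vs (\<lambda>y. form_rep A \<beta> c y v) x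
                           - iter_deriv vs (\<lambda>y. form_rep A \<alpha> c y v) x\<bar> < \<epsilon>)}
        | \<alpha> c K vs v \<epsilon>.
            smooth_form A \<alpha> \<and> c \<in> A \<and> compact K \<and> K \<subseteq> fst c \<and> 0 < (\<epsilon>::real)}"
  show "\<gamma> ` topspace (top_of_set {0..1}) \<subseteq> \<Union> ?\<S>"
  proof
    fix \<omega> assume "\<omega> \<in> \<gamma> ` topspace (top_of_set {0..1})"
    then have \<omega>: "smooth_form A \<omega>" using \<gamma> by auto
    \<comment> \<open>The empty compact set makes the estimate vacuous, so this subbasic set
      contains every smooth form.\<close>
    let ?U = "{\<beta>. smooth_form A \<beta> \<and> (\<forall>x\<in>snd (chart_at A undefined) ` {}. \<bar>iter_deriv [] (\<lambda>y. form_rep A \<beta> (chart_at A undefined) y 0) x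
         - iter_deriv [] (\<lambda>y. form_rep A \<omega> (chart_at A undefined) y 0) x\<bar> < 1)}"
    have "?U \<in> ?\<S>"
      by (intro CollectI exI[of _ \<omega>] exI[of _ "chart_at A undefined"] exI[of _ "{}"] exI[of _ "[]"] exI[of _ 0] exI[of _ 1] conjI refl)
        (use \<omega> chart_at in simp_all)
    moreover have "\<omega> \<in> ?U" using \<omega> by simp
    ultimately show "\<omega> \<in> \<Union> ?\<S>" by (rule UnionI)
  qed
  fix U assume "U \<in> ?\<S>"
  then obtain \<alpha> c K vs v e where U: "U = {\<beta>. smooth_form A \<beta> \<and> (\<forall>x\<in>snd c ` K. \<bar>iter_deriv vs (\<lambda>y. form_rep A \<beta> c y v) x
       - iter_deriv vs (\<lambda>y. form_rep A \<alpha> c y v) x\<bar> < e)}"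
    and h: "smooth_form A \<alpha>" "c \<in> A" "compact K" "K \<subseteq> fst c" "0 < (e::real)"
    by (elim CollectE exE conjE) (rule that, assumption+)
  let ?g = "\<lambda>q. \<bar>iter_deriv vs (\<lambda>y. form_rep A (\<gamma> (fst q)) c y v) (snd q) - iter_deriv vs (\<lambda>y. form_rep A \<alpha> c y v) (snd q)\<bar>"
  have sub: "snd c ` K \<subseteq> chart_image c" using h(4) by auto
  have "continuous_on ({0..1} \<times> chart_image c) (\<lambda>q. iter_deriv vs (\<lambda>y. form_rep A (\<gamma> (fst q)) c y v) (snd q))"
    using CkP_continuous[OF CkP_iter_deriv[of vs 0, OF C[OF h(2), of "length vs + 0" v]]] by simp
  moreover have "continuous_on ({0..1::real} \<times> chart_image c) (\<lambda>q. iter_deriv vs (\<lambda>y. form_rep A \<alpha> c y v) (snd q))"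
    by (rule continuous_on_compose2[OF smooth_continuous[OF smooth_iter_deriv[OF smooth_form_rep[OF h(1,2)]]]])
      (auto intro!: continuous_intros)
  ultimately have "continuous_on ({0..1} \<times> chart_image c) ?g"
    by (rule continuous_on_rabs[OF continuous_on_diff])
  then have "continuous_on ({0..1} \<times> snd c ` K) ?g" by (rule continuous_on_subset) (use sub in auto)
  moreover have "compact (snd c ` K)"
    by (intro compact_continuous_image continuous_on_subset[OF chart_continuous(1)[OF h(2)] h(4)] h(3))
  ultimately have "openin (top_of_set {0..1}) {t\<in>{0..1}. \<forall>x\<in>snd c ` K. ?g (t, x) < e}"
    by (intro uniform_open_tube) auto
  moreover have "\<gamma> -` U \<inter> topspace (top_of_set {0..1}) = {t\<in>{0..1}. \<forall>x\<in>snd c ` K. ?g (t, x) < e}"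
    using \<gamma> by (auto simp: U)
  ultimately show "openin (top_of_set {0..1}) (\<gamma> -` U \<inter> topspace (top_of_set {0..1}))" by simp
qed

text \<open>In charts the form is a finite sum of products of first space derivatives of \<psi> with
  smooth functions of t and \<psi>. Hence order n of the form rests on order n + 1 of the path, and
  all orders are available.\<close>

lemma pullback_path_CkP:
  assumes \<psi>: "continuous_map (top_of_set {0..1}) (Cinf_map_topology A) \<psi>"
    and sm: "\<And>t. t \<in> {0..1} \<Longrightarrow> smooth_map A (\<psi> t)"
    and \<alpha>: "smooth_form A \<alpha>" and f: "smooth_fun A f" and c: "c \<in> A"
  shows "CkP n ({0..1} \<times> chart_image c)
     (\<lambda>q. form_rep A (pullback A (\<psi> (fst q)) (scale_form (\<lambda>p. exp (fst q * f p)) \<alpha>)) c (snd q) v)"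
proof (rule CkP_local)
  fix q :: "real \<times> 'e" assume "q \<in> {0..1} \<times> chart_image c"
  then obtain t0 :: real and p where q: "q = (t0, snd c p)" "t0 \<in> {0..1}" "p \<in> fst c" by auto
  define c' where "c' = chart_at A (\<psi> t0 p)"
  have c': "c' \<in> A" "\<psi> t0 p \<in> fst c'" using chart_at by (auto simp: c'_def)
  show "\<exists>N. open N \<and> q \<in> N \<and> CkP n ({0..1} \<times> chart_image c \<inter> N)
     (\<lambda>q. form_rep A (pullback A (\<psi> (fst q)) (scale_form (\<lambda>p. exp (fst q * f p)) \<alpha>)) c (snd q) v)"
  proof (rule map_path_CkP[OF \<psi> sm c c'(1) q(3) c'(2) q(2)])
    fix T B assume TB: "open T" "t0 \<in> T" "open B" "snd c p \<in> B" "B \<subseteq> chart_image c"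
      "\<And>t x. t \<in> T \<Longrightarrow> t \<in> {0..1} \<Longrightarrow> x \<in> B \<Longrightarrow> \<psi> t (chart_inv c x) \<in> fst c'"
      "\<And>n. CkP n (({0..1} \<inter> T) \<times> B) (\<lambda>q. snd c' (\<psi> (fst q) (chart_inv c (snd q))))"
    let ?W = "({0..1} \<inter> T) \<times> B"
    define F where "F q = snd c' (\<psi> (fst q) (chart_inv c (snd q)))" for q
    have F: "CkP n ?W F" for n unfolding F_def[abs_def] by (rule TB(7))
    have o: "open_slices ?W" by (rule open_slices_Times[OF TB(3)])
    have Fi: "F q \<in> chart_image c'" if "q \<in> ?W" for q using TB(6)[of "fst q" "snd q"] that by (auto simp: F_def)
    have d: "CkP n ?W (slice_deriv F v)" using F[of "Suc n"] by simp
    have ck: "Ck n (chart_image c') (f \<circ> chart_inv c')" "Ck n (chart_image c') (\<lambda>x. form_rep A \<alpha> c' x b)" "Ck n UNIV (exp :: real \<Rightarrow> real)" for b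
      using smooth_fun_chart[OF f c'(1)] smooth_form_rep[OF \<alpha> c'(1)] smooth_exp by (auto simp: smooth_def)
    have "CkP n ?W (\<lambda>q. exp (fst q * (f \<circ> chart_inv c') (F q)) * (\<Sum>b\<in>Basis. (slice_deriv F v q \<bullet> b) * form_rep A \<alpha> c' (F q) b))"
      by (intro CkP_bilinear[OF o bounded_bilinear_mult] CkP_sum[OF o] CkP_bounded_linear[OF o bounded_linear_inner_left d]
          Ck_compose_CkP[OF ck(3) o] Ck_compose_CkP[OF ck(1) o F] Ck_compose_CkP[OF ck(2) o F] Fi CkP_param[OF o])
        (auto intro!: continuous_intros)
    then have "CkP n ?W (\<lambda>q. form_rep A (pullback A (\<psi> (fst q)) (scale_form (\<lambda>p. exp (fst q * f p)) \<alpha>)) c (snd q) v)"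
    proof (rule CkP_cong[OF o, rotated])
      fix z assume "z \<in> ?W"
      then obtain t x where z: "z = (t, x)" "t \<in> {0..1}" "t \<in> T" "x \<in> B" by auto
      define r where "r = chart_inv c x"
      have r: "r \<in> fst c" "snd c r = x" "\<psi> t r \<in> fst c'" 
        using chart_inv_image[OF c, of x] TB(5,6) z by (auto simp: r_def)
      have F': "F (t, x) = snd c' (\<psi> t r)" by (simp add: F_def r_def)
      have "slice_deriv F v z = chart_deriv (\<psi> t) c c' r v"
        unfolding slice_deriv_def chart_deriv_def r(2) z(1) fst_conv snd_conv by (simp add: F_def o_def)
      then show "exp (fst z * (f \<circ> chart_inv c') (F z)) * (\<Sum>b\<in>Basis. (slice_deriv F v z \<bullet> b) * form_rep A \<alpha> c' (F z) b) =
        form_rep A (pullback A (\<psi> (fst z)) (scale_form (\<lambda>p. exp (fst z * f p)) \<alpha>)) c (snd z) v"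
        using form_rep_pullback[OF sm[OF z(2)] c c'(1) r(1,3), of "scale_form (\<lambda>p. exp (t * f p)) \<alpha>" v]
          linear_expand[OF form_rep_linear[where \<alpha> = \<alpha>, OF smooth_form_linear[OF \<alpha>] c'(1), where x = "F (t, x)"], of "chart_deriv (\<psi> t) c c' r v"]
          r c' by (simp add: form_rep_scale F' z(1))
    qed
    moreover have "({0..1} \<times> chart_image c) \<inter> (T \<times> B) = ?W" using TB(5) by auto
    ultimately show "\<exists>N. open N \<and> q \<in> N \<and> CkP n ({0..1} \<times> chart_image c \<inter> N)
       (\<lambda>q. form_rep A (pullback A (\<psi> (fst q)) (scale_form (\<lambda>p. exp (fst q * f p)) \<alpha>)) c (snd q) v)"
      using TB q by (intro exI[of _ "T \<times> B"]) (auto intro: open_Times)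
  qed
qed

end

section \<open>Distances and lengths on a closed manifold\<close>

locale closed_manifold = manifold +
  assumes compact: "compact (UNIV :: 'a set)"
begin

lemma smooth_fun_bounded:
  assumes "smooth_fun A f"
  shows "f p \<le> max_val f" "min_val f \<le> f p" "\<exists>p. f p = max_val f" "\<exists>p. f p = min_val f"
proof -
  note c = smooth_fun_continuous[OF assms]
  obtain a b where "\<And>p. f p \<le> f a" "\<And>p. f b \<le> f p"
    using continuous_attains_sup[OF compact _ c] continuous_attains_inf[OF compact _ c] by auto
  then have "max_val f = f a" "min_val f = f b" 
    by (auto intro!: cSup_eq_maximum cInf_eq_minimum)
  then show "f p \<le> max_val f" "min_val f \<le> f p" "\<exists>p. f p = max_val f" "\<exists>p. f p = min_val f"
    using \<open>\<And>p. f p \<le> f a\<close> \<open>\<And>p. f b \<le> f p\<close> by auto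
qed

text \<open>Arbitrary bounds of f may stand for its extrema, which spares the computation of extrema
  of transported functions. Nonnegative oscillations bound the competing values below, so that the
  infimum is a genuine lower bound.\<close>

lemma bm_dist_le:
  assumes f: "smooth_fun A f" and \<phi>: "\<phi> \<in> Cont0 A \<xi>" "pullback A \<phi> \<beta> = scale_form (\<lambda>p. exp (f p)) \<alpha>"
    and b: "\<And>p. f p \<le> b" "\<And>p. a \<le> f p"
  shows "bm_dist A \<xi> \<alpha> \<beta> \<le> b - a"
proof -
  let ?S = "{max_val f - min_val f | f. smooth_fun A f \<and>
            (\<exists>\<phi>\<in>Cont0 A \<xi>. pullback A \<phi> \<beta> = scale_form (\<lambda>p. exp (f p)) \<alpha>)}"
  have "bdd_below ?S"
  proof (rule bdd_belowI)
    fix x assume "x \<in> ?S"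
    then obtain g where "x = max_val g - min_val g" "smooth_fun A g" by blast
    then show "0 \<le> x" using smooth_fun_bounded(1,2)[of g undefined] by linarith
  qed
  then have "bm_dist A \<xi> \<alpha> \<beta> \<le> max_val f - min_val f"
    unfolding bm_dist_def using f \<phi> by (intro cInf_lower) auto
  moreover have "max_val f \<le> b" "a \<le> min_val f" using smooth_fun_bounded(3,4)[OF f] b by metis+
  ultimately show ?thesis by linarith
qed

text \<open>Pullback by \<open>?\<rho>\<close> replaces \<psi> t by \<psi> s in \<gamma> t, and what
  separates the result from \<gamma> s is the factor exp ((t - s) f) at \<psi> s p. Its exponent
  oscillates by at most t - s times the oscillation of f.\<close>

lemma geodesic_segment:
  assumes \<alpha>: "\<alpha> \<in> contact_forms A \<xi> P" and f: "smooth_fun A f"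
    and \<psi>: "\<psi> s \<in> Cont0 A \<xi>" "\<psi> t \<in> Cont0 A \<xi>" and st: "s \<le> t"
  defines "\<gamma> \<equiv> \<lambda>t::real. pullback A (\<psi> t) (scale_form (\<lambda>p. exp (t * f p)) \<alpha>)"
  shows "bm_dist A \<xi> (\<gamma> s) (\<gamma> t) \<le> (t - s) * (max_val f - min_val f)"
proof -
  have d: "diffeo A (\<psi> s)" "diffeo A (\<psi> t)" using Cont0_contact_map \<psi> by (auto simp: is_contact_map_def)
  let ?\<rho> = "inv (\<psi> t) \<circ> \<psi> s" and ?f = "\<lambda>p. (t - s) * (f \<circ> \<psi> s) p"
  have i: "\<psi> t \<circ> inv (\<psi> t) = id" using diffeoD(3)[OF d(2)] surj_iff[of "\<psi> t"] by (auto simp: bij_def)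
  have "pullback A ?\<rho> (\<gamma> t) = pullback A (\<psi> s) (pullback A (\<psi> t \<circ> inv (\<psi> t)) (scale_form (\<lambda>p. exp (t * f p)) \<alpha>))"
    unfolding \<gamma>_def using diffeoD[OF d(1)] diffeoD[OF d(2)] by (simp only: pullback_comp)
  also have "\<dots> = scale_form (\<lambda>p. exp (?f p)) (\<gamma> s)"
    unfolding i pullback_id \<gamma>_def pullback_scale by (auto simp: scale_form_def exp_add[symmetric] algebra_simps mult.assoc[symmetric])
  finally have eq: "pullback A ?\<rho> (\<gamma> t) = scale_form (\<lambda>p. exp (?f p)) (\<gamma> s)" .
  have "bm_dist A \<xi> (\<gamma> s) (\<gamma> t) \<le> (t - s) * max_val f - (t - s) * min_val f"
  proof (rule bm_dist_le[OF _ _ eq])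
    show "smooth_fun A ?f" by (intro smooth_fun_mult smooth_fun_const smooth_fun_map[OF f diffeoD(1)[OF d(1)]])
    show "?\<rho> \<in> Cont0 A \<xi>" by (intro Cont0_comp Cont0_inv \<psi>)
  qed (use smooth_fun_bounded(1,2)[OF f] st in \<open>auto intro: mult_left_mono\<close>)
  then show ?thesis by (simp add: algebra_simps)
qed

text \<open>Time increments telescope to 1, so no partition sum exceeds the distance of the end
  points, while the partition into a single step attains it.\<close>

lemma geodesic_length:
  assumes \<gamma>: "\<And>s t. 0 \<le> s \<Longrightarrow> s \<le> t \<Longrightarrow> t \<le> 1 \<Longrightarrow> bm_dist A \<xi> (\<gamma> s) (\<gamma> t) \<le> (t - s) * bm_dist A \<xi> (\<gamma> 0) (\<gamma> 1)"
  shows "bm_length A \<xi> \<gamma> = ereal (bm_dist A \<xi> (\<gamma> 0) (\<gamma> 1))"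
  unfolding bm_length_def
proof (rule Sup_eqI)
  let ?D = "bm_dist A \<xi> (\<gamma> 0) (\<gamma> 1)"
  fix y assume "y \<in> {ereal (\<Sum>j=1..k. bm_dist A \<xi> (\<gamma> (t (j - 1))) (\<gamma> (t j))) | (k::nat) (t::nat \<Rightarrow> real).
            t 0 = 0 \<and> t k = 1 \<and> (\<forall>j<k. t j < t (Suc j))}"
  moreover define Q :: "nat \<Rightarrow> (nat \<Rightarrow> real) \<Rightarrow> bool" where
    "Q k t \<longleftrightarrow> y = ereal (\<Sum>j=1..k. bm_dist A \<xi> (\<gamma> (t (j - 1))) (\<gamma> (t j))) \<and>
       t 0 = 0 \<and> t k = 1 \<and> (\<forall>j<k. t j < t (Suc j))" for k t
  ultimately have "\<exists>k t. Q k t" unfolding Q_def by (elim CollectE)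
  then obtain k t where "Q k t" by blast
  then have y: "y = ereal (\<Sum>j=1..k. bm_dist A \<xi> (\<gamma> (t (j - 1))) (\<gamma> (t j)))"
    and t: "t 0 = 0" "t k = 1" "\<And>j. j < k \<Longrightarrow> t j < t (Suc j)" by (simp_all add: Q_def)
  have mono: "t i \<le> t j" if "i \<le> j" "j \<le> k" for i j
    using that
  proof (induction j rule: dec_induct)
    case (step n)
    then show ?case using t(3)[of n] by simp
  qed simp
  have "(\<Sum>j=1..k. bm_dist A \<xi> (\<gamma> (t (j - 1))) (\<gamma> (t j))) \<le> (\<Sum>j=1..k. (t j - t (j - 1)) * ?D)"
  proof (rule sum_mono)
    fix j assume "j \<in> {1..k}"
    then show "bm_dist A \<xi> (\<gamma> (t (j - 1))) (\<gamma> (t j)) \<le> (t j - t (j - 1)) * ?D"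
      using mono[of 0 "j - 1"] mono[of "j - 1" j] mono[of j k] t(1,2) by (intro \<gamma>) auto
  qed
  also have "\<dots> = (\<Sum>j=1..k. t j - t (j - 1)) * ?D" by (simp add: sum_distrib_right)
  also have "(\<Sum>j=1..k. t j - t (j - 1)) = (\<Sum>j<k. t (Suc j) - t j)"
    by (rule sum.reindex_bij_witness[of _ Suc "\<lambda>j. j - 1"]) auto
  also have "\<dots> = 1" using sum_lessThan_telescope[of t k] t by simp
  finally show "y \<le> ereal ?D" using y by simp
next
  let ?D = "bm_dist A \<xi> (\<gamma> 0) (\<gamma> 1)"
  fix y assume y: "\<And>z. z \<in> {ereal (\<Sum>j=1..k. bm_dist A \<xi> (\<gamma> (t (j - 1))) (\<gamma> (t j))) | (k::nat) (t::nat \<Rightarrow> real).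
            t 0 = 0 \<and> t k = 1 \<and> (\<forall>j<k. t j < t (Suc j))} \<Longrightarrow> z \<le> y"
  \<comment> \<open>The witness is the one-step partition with the points 0 and 1, given by the
    embedding \<open>real\<close>.\<close>
  show "ereal ?D \<le> y"
    by (rule y, rule CollectI, rule exI[of _ 1], rule exI[of _ real]) simp
qed

lemma conformal_path_geodesic:
  assumes \<alpha>: "\<alpha> \<in> contact_forms A \<xi> P" and \<beta>: "\<beta> \<in> contact_forms A \<xi> P" and f: "smooth_fun A f"
    and \<phi>: "\<phi> \<in> Cont0 A \<xi>" "pullback A \<phi> \<beta> = scale_form (\<lambda>p. exp (f p)) \<alpha>"
    and d: "bm_dist A \<xi> \<alpha> \<beta> = max_val f - min_val f"
    and \<psi>: "\<forall>t\<in>{0..1}. \<psi> t \<in> Cont0 A \<xi>" "continuous_map (top_of_set {0..1}) (Cinf_map_topology A) \<psi>"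
      "\<psi> 0 = id" "\<psi> 1 = inv \<phi>"
  defines "\<gamma> \<equiv> \<lambda>t::real. pullback A (\<psi> t) (scale_form (\<lambda>p. exp (t * f p)) \<alpha>)"
  shows "minimizing_geodesic A \<xi> P \<gamma>" "\<gamma> 0 = \<alpha>" "\<gamma> 1 = \<beta>"
proof -
  have d\<phi>: "diffeo A \<phi>" using Cont0_contact_map[OF \<phi>(1)] by (simp add: is_contact_map_def)
  show \<gamma>0: "\<gamma> 0 = \<alpha>" using \<psi>(3) by (simp add: \<gamma>_def pullback_id scale_form_def)
  have i: "\<phi> \<circ> inv \<phi> = id" using diffeoD(3)[OF d\<phi>] surj_iff[of \<phi>] by (auto simp: bij_def)
  have "\<gamma> 1 = pullback A (inv \<phi>) (pullback A \<phi> \<beta>)" using \<psi>(4) \<phi>(2) by (simp add: \<gamma>_def)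
  also have "\<dots> = pullback A (\<phi> \<circ> inv \<phi>) \<beta>" using diffeoD[OF d\<phi>] by (simp only: pullback_comp)
  finally show \<gamma>1: "\<gamma> 1 = \<beta>" unfolding i pullback_id .
  have sm: "smooth_map A (\<psi> t)" if "t \<in> {0..1}" for t
    using Cont0_contact_map[of "\<psi> t" \<xi>] \<psi>(1) that diffeoD(1) by (simp add: is_contact_map_def)
  have e: "smooth_fun A (\<lambda>p. exp (t * f p))" for t
    by (rule smooth_fun_compose[OF _ smooth_exp]) (auto intro: smooth_fun_mult smooth_fun_const f)
  have mem: "\<gamma> t \<in> contact_forms A \<xi> P" if "t \<in> {0..1}" for t
    unfolding \<gamma>_def by (intro contact_forms_pullback contact_forms_scale \<alpha> e) (use \<psi>(1) that in auto)
  have s\<alpha>: "smooth_form A \<alpha>" using \<alpha> by (auto simp: contact_forms_def contact_form_smooth)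
  have "continuous_map (top_of_set {0..1}) (Cinf_form_topology A) \<gamma>"
  proof (rule form_path_continuous)
    show "smooth_form A (\<gamma> t)" if "t \<in> {0..1}" for t
      using mem[OF that] by (auto simp: contact_forms_def contact_form_smooth)
    show "CkP n ({0..1} \<times> chart_image c) (\<lambda>q. form_rep A (\<gamma> (fst q)) c (snd q) v)" if "c \<in> A" for n c v
      unfolding \<gamma>_def by (rule pullback_path_CkP[OF \<psi>(2) sm s\<alpha> f that])
  qed
  then have "continuous_map (top_of_set {0..1}) (subtopology (Cinf_form_topology A) (contact_forms A \<xi> P)) \<gamma>"
    using mem by (auto simp: continuous_map_in_subtopology)
  \<comment> \<open>Minimality of f enters here, through \<open>d\<close>: it turns the oscillation
    of f in the segment estimate into the distance of the end points.\<close>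
  moreover have "bm_length A \<xi> \<gamma> = ereal (bm_dist A \<xi> (\<gamma> 0) (\<gamma> 1))"
  proof (rule geodesic_length)
    fix s t :: real assume "0 \<le> s" "s \<le> t" "t \<le> 1"
    then show "bm_dist A \<xi> (\<gamma> s) (\<gamma> t) \<le> (t - s) * bm_dist A \<xi> (\<gamma> 0) (\<gamma> 1)"
      unfolding \<gamma>0 \<gamma>1 d unfolding \<gamma>_def using \<psi>(1) by (intro geodesic_segment[OF \<alpha> f]) auto
  qed
  ultimately show "minimizing_geodesic A \<xi> P \<gamma>" by (simp add: minimizing_geodesic_def)
qed

end

section \<open>First variation of the oscillation\<close>

text \<open>The compact factor carries a topology only, so a tube lemma at time 0 takes the place of
  uniform continuity.\<close>

lemma uniform_near_zero:
  fixes H :: "real \<times> 'a::topological_space \<Rightarrow> real"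
  assumes H: "continuous_on (UNIV \<times> K) H" and K: "compact K"
    and H0: "\<And>x. x \<in> K \<Longrightarrow> H (0, x) = 0" and e: "0 < e"
  shows "\<exists>d>0. \<forall>t x. \<bar>t\<bar> < d \<longrightarrow> x \<in> K \<longrightarrow> \<bar>H (t, x)\<bar> < e"
proof -
  have "openin (top_of_set (UNIV \<times> K)) ((UNIV \<times> K) \<inter> H -` {-e<..<e})"
    using H by (intro continuous_openin_preimage_gen) auto
  then obtain W where W: "open W" "(UNIV \<times> K) \<inter> H -` {-e<..<e} = (UNIV \<times> K) \<inter> W"
    by (auto simp: openin_open)
  have nb: "\<exists>r U. r > 0 \<and> open U \<and> x \<in> U \<and> (\<forall>t y. \<bar>t\<bar> < r \<longrightarrow> y \<in> U \<longrightarrow> (t, y) \<in> W)" if "x \<in> K" for x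
  proof -
    have "(0, x) \<in> (UNIV \<times> K) \<inter> H -` {-e<..<e}" using that H0 e by auto
    then have "(0, x) \<in> W" unfolding W(2) by simp
    then obtain A B where AB: "open A" "open B" "(0, x) \<in> A \<times> B" "A \<times> B \<subseteq> W"
      by (rule open_prod_elim[OF W(1)])
    obtain r where "r > 0" "ball 0 r \<subseteq> A" using AB(1,3) by (meson SigmaD1 openE)
    then show ?thesis using AB by (intro exI[of _ r] exI[of _ B]) (auto simp: dist_real_def)
  qed
  then obtain r U where rU: "\<And>x. x \<in> K \<Longrightarrow> r x > 0" "\<And>x. x \<in> K \<Longrightarrow> open (U x)" "\<And>x. x \<in> K \<Longrightarrow> x \<in> U x"
    "\<And>x t y. x \<in> K \<Longrightarrow> \<bar>t\<bar> < r x \<Longrightarrow> y \<in> U x \<Longrightarrow> (t, y) \<in> W"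
    by metis
  obtain F where F: "F \<subseteq> K" "finite F" "K \<subseteq> (\<Union>x\<in>F. U x)"
    by (rule compactE_image[OF K, of K U]) (use rU(2,3) in auto)
  define d where "d = Min (insert 1 (r ` F))"
  have d: "d > 0" "\<And>x. x \<in> F \<Longrightarrow> d \<le> r x" using F rU(1) by (auto simp: d_def)
  have "\<bar>H (t, y)\<bar> < e" if "\<bar>t\<bar> < d" "y \<in> K" for t y
  proof -
    obtain x where x: "x \<in> F" "y \<in> U x" using F(3) \<open>y \<in> K\<close> by auto
    then have "(t, y) \<in> (UNIV \<times> K) \<inter> W" using rU(4)[of x t y] F(1) d(2)[of x] that by auto
    then show ?thesis unfolding W(2)[symmetric] by auto
  qed
  then show ?thesis using d(1) by blast
qed

lemma riemann_sum_error:
  fixes g :: "real \<Rightarrow> real"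
  assumes g: "continuous_on UNIV g" and \<tau>: "0 \<le> \<tau>"
    and e: "\<And>j s. j < N \<Longrightarrow> s \<in> {real j * \<tau>..real (Suc j) * \<tau>} \<Longrightarrow> \<bar>g s - g (real j * \<tau>)\<bar> \<le> e"
  shows "\<bar>integral {0..real N * \<tau>} g - (\<Sum>j<N. \<tau> * g (real j * \<tau>))\<bar> \<le> real N * \<tau> * e"
  using e
proof (induction N)
  case (Suc N)
  let ?a = "real N * \<tau>" and ?b = "real (Suc N) * \<tau>"
  have ab: "0 \<le> ?a" "?a \<le> ?b" using \<tau> by (auto simp: algebra_simps)
  have c: "continuous_on S g" for S using g continuous_on_subset by blast
  have I: "integral {0..?b} g = integral {0..?a} g + integral {?a..?b} g"
    using Henstock_Kurzweil_Integration.integral_combine[OF ab integrable_continuous_real[OF c]] by simp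
  have "integral {?a..?b} (\<lambda>s. g s - g ?a) = integral {?a..?b} g - \<tau> * g ?a"
    using integral_diff[OF integrable_continuous_real[OF c, of ?a ?b] integrable_const_ivl[of "g ?a" ?a ?b]] ab
    by (simp add: algebra_simps)
  moreover have "norm (integral {?a..?b} (\<lambda>s. g s - g ?a)) \<le> e * (?b - ?a)"
    by (rule integral_bound[OF ab(2)]) (use Suc.prems[of N] in \<open>auto intro!: continuous_intros c\<close>)
  moreover have "?b - ?a = \<tau>" by (simp add: algebra_simps)
  ultimately have 2: "\<bar>integral {?a..?b} g - \<tau> * g ?a\<bar> \<le> \<tau> * e" by (simp add: mult.commute)
  have "\<bar>integral {0..?a} g - (\<Sum>j<N. \<tau> * g (real j * \<tau>))\<bar> \<le> ?a * e" by (rule Suc.IH) (use Suc.prems in auto)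
  then show ?case using 2 unfolding I by (simp add: algebra_simps)
qed simp

context manifold
begin

lemma fun_along_curve:
  assumes f: "smooth_fun A f" and \<gamma>: "has_velocity A \<gamma> t w"
  shows "((\<lambda>s. f (\<gamma> s)) has_real_derivative differential f (\<gamma> t) w) (at t)"
proof -
  let ?c = "chart_at A (\<gamma> t)"
  have c: "?c \<in> A" "\<gamma> t \<in> fst ?c" using chart_at by auto
  have "(f \<circ> chart_inv ?c has_derivative differential f (\<gamma> t)) (at (snd ?c (\<gamma> t)))"
    unfolding differential_def[abs_def]
    by (rule frechet_derivative_works[THEN iffD1, OF smooth_differentiable[OF smooth_fun_chart[OF f c(1)]]])
      (use c in auto)
  moreover have \<gamma>': "isCont \<gamma> t" "(snd ?c \<circ> \<gamma> has_derivative (\<lambda>s. s *\<^sub>R w)) (at t)"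
    using \<gamma> by (auto simp: has_velocity_def has_vector_derivative_def)
  ultimately have "((f \<circ> chart_inv ?c) \<circ> (snd ?c \<circ> \<gamma>) has_derivative differential f (\<gamma> t) \<circ> (\<lambda>s. s *\<^sub>R w)) (at t)"
    by (intro diff_chain_at) auto
  moreover have "differential f (\<gamma> t) \<circ> (\<lambda>s. s *\<^sub>R w) = (*) (differential f (\<gamma> t) w)"
    using smooth_form_linear[OF smooth_form_differential[OF f], of "\<gamma> t"] by (auto simp: linear_scale)
  ultimately have "((\<lambda>s. f (chart_inv ?c (snd ?c (\<gamma> s)))) has_real_derivative differential f (\<gamma> t) w) (at t)"
    by (simp add: has_field_derivative_def o_def)
  moreover have ev: "\<forall>\<^sub>F s in nhds t. f (chart_inv ?c (snd ?c (\<gamma> s))) = f (\<gamma> s)"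
    using isCont_eventually[OF \<gamma>'(1) chart_open(1)[OF c(1)] c(2)] by eventually_elim (simp add: c(1))
  ultimately show ?thesis unfolding DERIV_cong_ev[OF refl ev refl] by blast
qed

end

section \<open>Flows and Hamiltonian isotopies on a closed manifold\<close>

context closed_manifold
begin

lemma flow_is_flow: "smooth_field X \<Longrightarrow> is_flow X (flow_of A X)"
  and flow_smooth: "smooth_field X \<Longrightarrow> smooth_at_within UNIV (flow_of A X) t p"
  using flow_exists[OF _ compact] by auto

lemma flow_zero: "smooth_field X \<Longrightarrow> flow_of A X 0 p = p"
  using flow_is_flow by (auto simp: is_flow_def)

lemma flow_add: "smooth_field X \<Longrightarrow> flow_of A X (s + t) p = flow_of A X s (flow_of A X t p)"
  using is_flow_add flow_is_flow by blast

lemma flow_velocity: "smooth_field X \<Longrightarrow> has_velocity A (\<lambda>s. flow_of A X s p) t (X (flow_of A X t p))"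
  using flow_is_flow by (auto simp: is_flow_def)

lemma flow_continuous:
  assumes "smooth_field X"
  shows "continuous_on UNIV (\<lambda>(t, p). flow_of A X t p)"
  using smooth_at_within_continuous_on[of UNIV "flow_of A X"] flow_smooth[OF assms] by simp

lemma flow_smooth_map: "smooth_field X \<Longrightarrow> smooth_map A (flow_of A X t)"
  using smooth_map_slice[of UNIV "flow_of A X" t] flow_smooth by auto

lemma flow_inverse:
  assumes "smooth_field X"
  shows "flow_of A X (- t) (flow_of A X t p) = p" "flow_of A X t (flow_of A X (- t) p) = p"
  using flow_add[OF assms, of "- t" t p] flow_add[OF assms, of t "- t" p] flow_zero[OF assms] by auto

lemma flow_diffeo:
  assumes "smooth_field X"
  shows "diffeo A (flow_of A X t)"
proof -
  have "bij (flow_of A X t)"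
    by (rule bij_betw_byWitness[of _ "flow_of A X (- t)"]) (auto simp: flow_inverse[OF assms])
  moreover have "inv (flow_of A X t) = flow_of A X (- t)"
    by (rule inv_unique_comp) (auto simp: flow_inverse[OF assms])
  ultimately show ?thesis using flow_smooth_map[OF assms] by (simp add: diffeo_def)
qed

lemma fun_flow_continuous:
  assumes "smooth_field X" "continuous_on UNIV f" "continuous_on S a" "continuous_on S b"
  shows "continuous_on S (\<lambda>x. f (flow_of A X (a x) (b x)))"
proof -
  have "continuous_on S (\<lambda>x. (\<lambda>(t, p). flow_of A X t p) (a x, b x))"
    by (rule continuous_on_compose2[OF flow_continuous[OF assms(1)]]) (auto intro!: continuous_intros assms)
  then have "continuous_on S (\<lambda>x. flow_of A X (a x) (b x))" by simp
  then show ?thesis by (rule continuous_on_compose2[OF assms(2)]) auto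
qed

text \<open>For fixed p the values of the pulled back form on all vectors solve the same scalar
  equation B' = k B, so a single factor serves for every v.\<close>

lemma Hamiltonian_conformal:
  assumes \<alpha>: "contact_form A \<alpha>" and h: "smooth_fun A h" and t: "0 \<le> t"
  defines "\<theta> \<equiv> flow_of A (Hamiltonian_field \<alpha> h)"
  shows "pullback A (\<theta> t) \<alpha> = scale_form (\<lambda>p. exp (integral {0..t} (\<lambda>s. Reeb_deriv \<alpha> h (\<theta> s p)))) \<alpha>"
proof (intro ext)
  fix p v
  note X = Hamiltonian_field(1)[OF \<alpha> h]
  have "\<alpha> (\<theta> t p) (tangent_map A (\<theta> t) p v) =
      exp (integral {0..t} (\<lambda>s. Reeb_deriv \<alpha> h (\<theta> s p))) * \<alpha> (\<theta> 0 p) (tangent_map A (\<theta> 0) p v)"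
  proof (rule linear_ode_exp[OF _ _ t])
    show "((\<lambda>t. \<alpha> (\<theta> t p) (tangent_map A (\<theta> t) p v)) has_real_derivative
         Reeb_deriv \<alpha> h (\<theta> t p) * \<alpha> (\<theta> t p) (tangent_map A (\<theta> t) p v)) (at t)" for t
      unfolding \<theta>_def by (rule Hamiltonian_flow_derivative[OF \<alpha> h flow_is_flow[OF X] flow_smooth[OF X]])
    show "continuous_on UNIV (\<lambda>s. Reeb_deriv \<alpha> h (\<theta> s p))"
      unfolding \<theta>_def
      by (rule fun_flow_continuous[OF X smooth_fun_continuous[OF Reeb_deriv_smooth[OF \<alpha> h]]]) (auto intro!: continuous_intros)
  qed
  moreover have "\<theta> 0 = id" using flow_zero[OF X] by (auto simp: \<theta>_def)
  ultimately show "pullback A (\<theta> t) \<alpha> p v = scale_form (\<lambda>p. exp (integral {0..t} (\<lambda>s. Reeb_deriv \<alpha> h (\<theta> s p)))) \<alpha> p v"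
    by (simp add: pullback_def scale_form_def tangent_map_id)
qed

text \<open>Evaluation on the Reeb field recovers the factor, so its smoothness comes from that of
  the pulled back form, with no differentiation of the time integral in its exponent.\<close>

lemma conformal_factor_smooth:
  assumes \<alpha>: "contact_form A \<alpha>" and \<phi>: "smooth_map A \<phi>" and eq: "pullback A \<phi> \<alpha> = scale_form (\<lambda>p. exp (g p)) \<alpha>"
  shows "smooth_fun A g"
proof -
  have R: "pullback A \<phi> \<alpha> p (Reeb_field A \<alpha> p) = exp (g p)" for p
    unfolding eq scale_form_def using Reeb_field_eq(1)[OF \<alpha>] by simp
  have "smooth_fun A (\<lambda>p. pullback A \<phi> \<alpha> p (Reeb_field A \<alpha> p))"
    by (intro smooth_form_field smooth_form_pullback contact_form_smooth[OF \<alpha>] \<phi> Reeb_field_smooth[OF \<alpha>])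
  then have "smooth_fun A (\<lambda>p. ln (exp (g p)))"
    unfolding R by (rule smooth_fun_compose[OF _ smooth_ln]) simp
  then show ?thesis by simp
qed

text \<open>The flow itself, with time rescaled to the unit interval, is the isotopy; by
  conformality it preserves the kernel of \<alpha>.\<close>

lemma Hamiltonian_Cont0:
  assumes \<alpha>: "\<alpha> \<in> contact_forms A \<xi> P" and h: "smooth_fun A h" and t: "0 \<le> t"
  shows "flow_of A (Hamiltonian_field \<alpha> h) t \<in> Cont0 A \<xi>"
proof -
  have c: "contact_form A \<alpha>" and \<xi>: "\<And>p. \<xi> p = {v. \<alpha> p v = 0}" using \<alpha> by (auto simp: contact_forms_def)
  note X = Hamiltonian_field(1)[OF c h]
  let ?\<theta> = "flow_of A (Hamiltonian_field \<alpha> h)"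
  have iff: "tangent_map A (?\<theta> s) p v \<in> \<xi> (?\<theta> s p) \<longleftrightarrow> v \<in> \<xi> p" if "0 \<le> s" for s p v
    using Hamiltonian_conformal[OF c h that, THEN fun_cong, of p, THEN fun_cong, of v]
    by (simp add: \<xi> pullback_def scale_form_def)
  have "is_contact_map \<xi> (?\<theta> s)" if "0 \<le> s" for s
    unfolding is_contact_map_def
  proof (intro conjI allI flow_diffeo[OF X] equalityI subsetI)
    fix p w assume w: "w \<in> \<xi> (?\<theta> s p)"
    have "tangent_map A (?\<theta> s) p (tangent_map A (inv (?\<theta> s)) (?\<theta> s p) w) = w"
      by (rule diffeo_tangent_inv(2)[OF flow_diffeo[OF X]])
    with w iff[OF that] show "w \<in> tangent_map A (?\<theta> s) p ` \<xi> p" by (metis imageI)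
  qed (use iff[OF that] in auto)
  moreover have "smooth_at_within {0..1} (\<lambda>s. ?\<theta> (t * s + 0)) s p" if "s \<in> {0..1}" for s p
    by (rule smooth_at_within_time[OF flow_smooth[OF X] that]) simp
  ultimately show ?thesis
    unfolding Cont0_iff using t flow_zero[OF X]
    by (intro exI[of _ "\<lambda>s. ?\<theta> (t * s + 0)"]) auto
qed

text \<open>An oscillation of \<open>f + Reeb_deriv \<alpha> h\<close> below that of \<open>f\<close> would contradict minimality, because the
  time-\<open>\<epsilon>\<close> flow of \<open>h\<close> changes \<open>f\<close> into \<open>f + \<epsilon> Reeb_deriv \<alpha> h\<close> to first order.\<close>

lemma bm_dist_first_variation:
  assumes \<alpha>: "\<alpha> \<in> contact_forms A \<xi> P" and f: "smooth_fun A f" and \<phi>: "\<phi> \<in> Cont0 A \<xi>"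
    and eq: "pullback A \<phi> \<beta> = scale_form (\<lambda>p. exp (f p)) \<alpha>"
    and d: "bm_dist A \<xi> \<alpha> \<beta> = max_val f - min_val f"
    and h: "smooth_fun A h" and b: "\<And>p. f p + Reeb_deriv \<alpha> h p \<le> b" "\<And>p. a \<le> f p + Reeb_deriv \<alpha> h p"
  shows "max_val f - min_val f \<le> b - a"
proof (rule ccontr)
  assume neg: "\<not> ?thesis"
  \<comment> \<open>A third of the supposed gain: an error of \<epsilon> \<eta> on either side
    consumes two thirds of it, and \<epsilon> \<eta> is left for the contradiction.\<close>
  define \<eta> where "\<eta> = (max_val f - min_val f - (b - a)) / 3"
  have \<eta>: "\<eta> > 0" using neg by (simp add: \<eta>_def)
  have c: "contact_form A \<alpha>" using \<alpha> by (auto simp: contact_forms_def)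
  note X = Hamiltonian_field(1)[OF c h]
  let ?\<theta> = "flow_of A (Hamiltonian_field \<alpha> h)" and ?k = "Reeb_deriv \<alpha> h"
  have k: "continuous_on UNIV ?k" by (rule smooth_fun_continuous[OF Reeb_deriv_smooth[OF c h]])
  have kf: "continuous_on S (\<lambda>x. ?k (?\<theta> (u x) (v x)))" if "continuous_on S u" "continuous_on S v" for S :: "'x::topological_space set" and u v
    by (rule fun_flow_continuous[OF X k that])
  have "continuous_on (UNIV \<times> UNIV) (\<lambda>x. ?k (?\<theta> (fst x) (snd x)) - ?k (snd x))"
    by (intro continuous_intros kf continuous_on_compose2[OF k]) auto
  from uniform_near_zero[OF this compact _ \<eta>]
  obtain e0 where e0: "e0 > 0" "\<And>t p. \<bar>t\<bar> < e0 \<Longrightarrow> \<bar>?k (?\<theta> t p) - ?k p\<bar> < \<eta>"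
    using flow_zero[OF X] by auto
  define \<epsilon> where "\<epsilon> = min 1 (e0 / 2)"
  have \<epsilon>: "0 < \<epsilon>" "\<epsilon> \<le> 1" "\<epsilon> < e0" using e0(1) by (auto simp: \<epsilon>_def)
  let ?g = "\<lambda>p. integral {0..\<epsilon>} (\<lambda>s. ?k (?\<theta> s p))"
  have conf: "pullback A (?\<theta> \<epsilon>) \<alpha> = scale_form (\<lambda>p. exp (?g p)) \<alpha>"
    using Hamiltonian_conformal[OF c h] \<epsilon> by simp
  \<comment> \<open>The exponent of the conformal factor is compared with the Reeb derivative at the
    end point of the trajectory, because f is evaluated there as well; both terms then depend on the
    same point \<open>?q\<close>.\<close>
  have g: "\<bar>?g p - \<epsilon> * ?k (?\<theta> \<epsilon> p)\<bar> \<le> \<epsilon> * \<eta>" for p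
  proof -
    let ?q = "?\<theta> \<epsilon> p"
    have cs: "continuous_on {0..\<epsilon>} (\<lambda>s. ?k (?\<theta> s p))" by (intro kf continuous_intros)
    have "norm (integral {0..\<epsilon>} (\<lambda>s. ?k (?\<theta> s p) - ?k ?q)) \<le> \<eta> * (\<epsilon> - 0)"
    proof (rule integral_bound)
      fix s assume s: "s \<in> {0..\<epsilon>}"
      have "?\<theta> s p = ?\<theta> (s - \<epsilon>) ?q" using flow_add[OF X, of "s - \<epsilon>" \<epsilon> p] by simp
      then show "norm (?k (?\<theta> s p) - ?k ?q) \<le> \<eta>" using e0(2)[of "s - \<epsilon>" ?q] s \<epsilon> by auto
    qed (use \<epsilon> cs in \<open>auto intro!: continuous_intros\<close>)
    moreover have "integral {0..\<epsilon>} (\<lambda>s. ?k (?\<theta> s p) - ?k ?q) = ?g p - \<epsilon> * ?k ?q"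
      using integral_diff[OF integrable_continuous_real[OF cs] integrable_const_ivl[of "?k ?q" 0 \<epsilon>]] \<epsilon> by simp
    ultimately show ?thesis by (simp add: mult.commute)
  qed
  let ?F = "\<lambda>p. (f \<circ> ?\<theta> \<epsilon>) p + ?g p"
  have sF: "smooth_fun A ?F"
    by (intro smooth_fun_add smooth_fun_map[OF f flow_smooth_map[OF X]]
        conformal_factor_smooth[OF c flow_smooth_map[OF X] conf])
  have sm: "smooth_map A \<phi>" using Cont0_contact_map[OF \<phi>] diffeoD(1) by (auto simp: is_contact_map_def)
  have "pullback A (\<phi> \<circ> ?\<theta> \<epsilon>) \<beta> = pullback A (?\<theta> \<epsilon>) (scale_form (\<lambda>p. exp (f p)) \<alpha>)"
    unfolding pullback_comp[OF flow_smooth_map[OF X] sm] eq ..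
  also have "\<dots> = scale_form (\<lambda>p. exp (?F p)) \<alpha>"
    unfolding pullback_scale conf by (simp add: scale_form_def exp_add mult.assoc)
  finally have pb: "pullback A (\<phi> \<circ> ?\<theta> \<epsilon>) \<beta> = scale_form (\<lambda>p. exp (?F p)) \<alpha>" .
  \<comment> \<open>The value of f at \<open>?q\<close> is split with weights 1 - \<epsilon> and
    \<epsilon>. The second share joins the Hamiltonian term and obeys the bounds a and b; the
    condition \<epsilon> \<le> 1 keeps the first weight nonnegative.\<close>
  have bd: "(1 - \<epsilon>) * min_val f + \<epsilon> * a - \<epsilon> * \<eta> \<le> ?F p \<and> ?F p \<le> (1 - \<epsilon>) * max_val f + \<epsilon> * b + \<epsilon> * \<eta>" for p
  proof -
    let ?q = "?\<theta> \<epsilon> p"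
    have "(1 - \<epsilon>) * min_val f \<le> (1 - \<epsilon>) * f ?q" "(1 - \<epsilon>) * f ?q \<le> (1 - \<epsilon>) * max_val f"
      using smooth_fun_bounded(1,2)[OF f, of ?q] \<epsilon> by (auto intro: mult_left_mono)
    moreover have "\<epsilon> * a \<le> \<epsilon> * (f ?q + ?k ?q)" "\<epsilon> * (f ?q + ?k ?q) \<le> \<epsilon> * b"
      using b[of ?q] \<epsilon> by (auto intro: mult_left_mono)
    moreover have "f ?q = (1 - \<epsilon>) * f ?q + \<epsilon> * (f ?q + ?k ?q) - \<epsilon> * ?k ?q" by (simp add: algebra_simps)
    ultimately show ?thesis using g[of p] unfolding o_def by linarith
  qed
  have "bm_dist A \<xi> \<alpha> \<beta> \<le> ((1 - \<epsilon>) * max_val f + \<epsilon> * b + \<epsilon> * \<eta>) - ((1 - \<epsilon>) * min_val f + \<epsilon> * a - \<epsilon> * \<eta>)"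
    by (rule bm_dist_le[OF sF Cont0_comp[OF Hamiltonian_Cont0[OF \<alpha> h] \<phi>] pb]) (use bd \<epsilon> in auto)
  also have "\<dots> = max_val f - min_val f - \<epsilon> * \<eta>" 
  proof -
    have "b - a = max_val f - min_val f - 3 * \<eta>" by (simp add: \<eta>_def field_simps)
    then have "\<epsilon> * (b - a) = \<epsilon> * (max_val f - min_val f - 3 * \<eta>)" by simp
    then show ?thesis by (simp add: algebra_simps)
  qed
  finally show False using d mult_pos_pos[OF \<epsilon>(1) \<eta>] by linarith
qed

section \<open>Averages along Reeb orbits\<close>

lemma Reeb_deriv_eqI:
  assumes \<alpha>: "contact_form A \<alpha>" and h: "smooth_fun A h"
    and D: "((\<lambda>t. h (Reeb_flow A \<alpha> t p)) has_real_derivative D) (at 0)"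
  shows "Reeb_deriv \<alpha> h p = D"
proof -
  note R = Reeb_field_smooth[OF \<alpha>]
  have "((\<lambda>t. h (Reeb_flow A \<alpha> t p)) has_real_derivative Reeb_deriv \<alpha> h p) (at 0)"
    using fun_along_curve[OF h flow_velocity[OF R, of p 0]] flow_zero[OF R, of p]
    by (simp add: Reeb_flow_def Reeb_deriv_def)
  then show ?thesis using D DERIV_unique by blast
qed

lemma Reeb_flow_derivative:
  assumes \<alpha>: "contact_form A \<alpha>" and f: "smooth_fun A f"
  shows "((\<lambda>t. f (Reeb_flow A \<alpha> t p)) has_real_derivative Reeb_deriv \<alpha> f (Reeb_flow A \<alpha> t p)) (at t)"
  unfolding Reeb_flow_def Reeb_deriv_def by (rule fun_along_curve[OF f flow_velocity[OF Reeb_field_smooth[OF \<alpha>]]])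

text \<open>For f transported by the Reeb flow, differentiating along R is the same as
  differentiating in the flow time. The Reeb derivative of a weighted sum over flow times is
  therefore a Riemann sum of an integral that can be evaluated by parts.\<close>

lemma Reeb_average:
  assumes \<alpha>: "contact_form A \<alpha>" and f: "smooth_fun A f" and T: "0 < T" and \<eta>: "0 < \<eta>"
  shows "\<exists>h. smooth_fun A h \<and>
    (\<forall>p. \<bar>f p + Reeb_deriv \<alpha> h p - integral {0..T} (\<lambda>s. f (Reeb_flow A \<alpha> s p)) / T\<bar> \<le> \<eta>)"
proof -
  let ?\<rho> = "Reeb_flow A \<alpha>" and ?k = "Reeb_deriv \<alpha> f"
  note R = Reeb_field_smooth[OF \<alpha>]
  have k: "continuous_on UNIV ?k" by (rule smooth_fun_continuous[OF Reeb_deriv_smooth[OF \<alpha> f]])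
  have kf: "continuous_on S (\<lambda>x. ?k (?\<rho> (u x) (v x)))" if "continuous_on S u" "continuous_on S v" for S :: "'x::topological_space set" and u v
    unfolding Reeb_flow_def by (rule fun_flow_continuous[OF R k that])
  \<comment> \<open>The derivative term in the integration by parts; the weight T - s drops to 0 at
    the end of the segment.\<close>
  define G where "G s p = (T - s) * ?k (?\<rho> s p)" for s p
  have "continuous_on (UNIV \<times> ({0..T} \<times> UNIV)) (\<lambda>x. G (fst (snd x) + fst x) (snd (snd x)) - G (fst (snd x)) (snd (snd x)))"
    unfolding G_def by (intro continuous_intros kf)
  from uniform_near_zero[OF this compact_Times[OF compact_Icc compact] _ \<eta>]
  obtain d where d: "d > 0" "\<And>t s p. \<bar>t\<bar> < d \<Longrightarrow> s \<in> {0..T} \<Longrightarrow> \<bar>G (s + t) p - G s p\<bar> < \<eta>"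
    by auto
  obtain N :: nat where N: "T / d < real N" using reals_Archimedean2 by blast
  have N0: "N > 0" using N T d(1) by (cases N) (auto simp: field_simps)
  define \<tau> where "\<tau> = T / real N"
  have \<tau>: "\<tau> > 0" "\<tau> < d" "real N * \<tau> = T" using N N0 T d(1) by (auto simp: \<tau>_def field_simps)
  \<comment> \<open>The left Riemann sum, with step \<tau>, of the integral over s of (T - s) / T
    times f after Reeb time s. The step is below \<open>d\<close>, which works for all points at
    once.\<close>
  define h where "h p = (\<Sum>j<N. (\<tau> * (T - real j * \<tau>) / T) * (f \<circ> ?\<rho> (real j * \<tau>)) p)" for p
  have h: "smooth_fun A h"
    unfolding h_def Reeb_flow_def by (intro smooth_fun_sum smooth_fun_mult smooth_fun_const smooth_fun_map[OF f flow_smooth_map[OF R]])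
  have Rh: "Reeb_deriv \<alpha> h p = (\<Sum>j<N. \<tau> * G (real j * \<tau>) p) / T" for p
  proof (rule Reeb_deriv_eqI[OF \<alpha> h])
    have "((\<lambda>t. (f \<circ> ?\<rho> (real j * \<tau>)) (?\<rho> t p)) has_real_derivative ?k (?\<rho> (real j * \<tau>) p)) (at 0)" for j
    proof -
      have "((\<lambda>t. f (?\<rho> (real j * \<tau> + t) p)) has_real_derivative ?k (?\<rho> (real j * \<tau>) p)) (at 0)"
        using Reeb_flow_derivative[OF \<alpha> f, of p "real j * \<tau>"] DERIV_at_within_shift[of "\<lambda>t. f (?\<rho> t p)" _ "real j * \<tau>" 0 UNIV]
        by (simp add: add.commute)
      then show ?thesis unfolding Reeb_flow_def flow_add[OF R] by simp
    qed
    then have "((\<lambda>t. h (?\<rho> t p)) has_real_derivative (\<Sum>j<N. (\<tau> * (T - real j * \<tau>) / T) * ?k (?\<rho> (real j * \<tau>) p))) (at 0)"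
      unfolding h_def by (intro DERIV_sum DERIV_cmult)
    then show "((\<lambda>t. h (?\<rho> t p)) has_real_derivative (\<Sum>j<N. \<tau> * G (real j * \<tau>) p) / T) (at 0)"
      by (simp add: G_def sum_divide_distrib mult.assoc)
  qed
  \<comment> \<open>Integration by parts: the weight vanishes at s = T, so the only boundary term is
    T times f at the starting point.\<close>
  have int: "integral {0..T} (\<lambda>s. G s p) = integral {0..T} (\<lambda>s. f (?\<rho> s p)) - T * f p" for p
  proof -
    have D: "((\<lambda>s. (T - s) * f (?\<rho> s p)) has_real_derivative G s p - f (?\<rho> s p)) (at s within {0..T})" for s
      unfolding G_def by (rule DERIV_subset[of _ _ _ UNIV])
        (auto intro!: derivative_eq_intros Reeb_flow_derivative[OF \<alpha> f] simp: algebra_simps)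
    have "((\<lambda>s. G s p - f (?\<rho> s p)) has_integral ((T - T) * f (?\<rho> T p) - (T - 0) * f (?\<rho> 0 p))) {0..T}"
      by (rule fundamental_theorem_of_calculus) (use T D has_real_derivative_iff_has_vector_derivative in auto)
    then have "integral {0..T} (\<lambda>s. G s p - f (?\<rho> s p)) = - T * f p"
      using flow_zero[OF R] by (simp add: Reeb_flow_def integral_unique)
    moreover have "continuous_on {0..T} (\<lambda>s. G s p)" unfolding G_def by (intro continuous_intros kf)
    moreover have "continuous_on {0..T} (\<lambda>s. f (?\<rho> s p))"
      unfolding Reeb_flow_def by (intro fun_flow_continuous[OF R smooth_fun_continuous[OF f]] continuous_intros)
    ultimately show ?thesis by (simp add: integral_diff integrable_continuous_real)
  qed
  have "\<bar>f p + Reeb_deriv \<alpha> h p - integral {0..T} (\<lambda>s. f (?\<rho> s p)) / T\<bar> \<le> \<eta>" for p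
  proof -
    have "\<bar>integral {0..real N * \<tau>} (\<lambda>s. G s p) - (\<Sum>j<N. \<tau> * G (real j * \<tau>) p)\<bar> \<le> real N * \<tau> * \<eta>"
    proof (rule riemann_sum_error)
      show "continuous_on UNIV (\<lambda>s. G s p)" unfolding G_def by (intro continuous_intros kf)
      fix j s assume j: "j < N" and s: "s \<in> {real j * \<tau>..real (Suc j) * \<tau>}"
      have "real j * \<tau> \<le> real N * \<tau>" using j \<tau>(1) by (intro mult_right_mono) auto
      moreover have "\<bar>s - real j * \<tau>\<bar> < d" using s \<tau> by (auto simp: algebra_simps)
      ultimately show "\<bar>G s p - G (real j * \<tau>) p\<bar> \<le> \<eta>"
        using d(2)[of "s - real j * \<tau>" "real j * \<tau>" p] \<tau> by simp
    qed (use \<tau> in auto)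
    then have "\<bar>T * f p + (\<Sum>j<N. \<tau> * G (real j * \<tau>) p) - integral {0..T} (\<lambda>s. f (?\<rho> s p))\<bar> \<le> T * \<eta>"
      unfolding \<tau>(3) int by linarith
    then have "\<bar>T * f p + (\<Sum>j<N. \<tau> * G (real j * \<tau>) p) - integral {0..T} (\<lambda>s. f (?\<rho> s p))\<bar> / T \<le> \<eta>"
      using T by (simp add: field_simps)
    then have "\<bar>(T * f p + (\<Sum>j<N. \<tau> * G (real j * \<tau>) p) - integral {0..T} (\<lambda>s. f (?\<rho> s p))) / T\<bar> \<le> \<eta>"
      using T by (simp add: abs_divide)
    then show ?thesis unfolding Rh using T by (simp add: diff_divide_distrib add_divide_distrib)
  qed
  with h show ?thesis by blast
qed

text \<open>All averages lie between the extrema of f, yet they oscillate at least as much as f.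
  Hence some average equals max f and another equals min f, and a continuous function whose average
  equals one of its bounds is constant along the segment.\<close>

lemma extremal_orbit_segment:
  assumes \<alpha>: "\<alpha> \<in> contact_forms A \<xi> P" and f: "smooth_fun A f" and \<phi>: "\<phi> \<in> Cont0 A \<xi>"
    and eq: "pullback A \<phi> \<beta> = scale_form (\<lambda>p. exp (f p)) \<alpha>"
    and d: "bm_dist A \<xi> \<alpha> \<beta> = max_val f - min_val f" and T: "0 < T"
  shows "\<exists>p. \<forall>s\<in>{0..T}. f (Reeb_flow A \<alpha> s p) = max_val f" "\<exists>p. \<forall>s\<in>{0..T}. f (Reeb_flow A \<alpha> s p) = min_val f"
proof -
  have c: "contact_form A \<alpha>" using \<alpha> by (auto simp: contact_forms_def)
  note R = Reeb_field_smooth[OF c]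
  let ?\<rho> = "Reeb_flow A \<alpha>"
  define I where "I p = integral {0..T} (\<lambda>s. f (?\<rho> s p))" for p
  have ff: "continuous_on S (\<lambda>x. f (?\<rho> (u x) (v x)))" if "continuous_on S u" "continuous_on S v" for S :: "'x::topological_space set" and u v
    unfolding Reeb_flow_def by (rule fun_flow_continuous[OF R smooth_fun_continuous[OF f] that])
  have fs: "continuous_on {0..T} (\<lambda>s. f (?\<rho> s p))" for p by (intro ff continuous_intros)
  have "continuous_on UNIV (\<lambda>p. integral (cbox 0 T) (\<lambda>s. f (?\<rho> s p)))"
    by (rule integral_continuous_on_param) (auto simp: split_beta intro!: ff continuous_intros)
  then have I: "continuous_on UNIV I" by (simp add: I_def[abs_def])
  obtain p1 p0 where p1: "\<And>p. I p \<le> I p1" and p0: "\<And>p. I p0 \<le> I p"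
    using continuous_attains_sup[OF compact _ I] continuous_attains_inf[OF compact _ I] by auto
  \<comment> \<open>The error e is shared between the upper and the lower bound, e/2 each; T stays
    fixed while e tends to 0.\<close>
  have dev: "max_val f - min_val f \<le> I p1 / T - I p0 / T"
  proof (rule field_le_epsilon)
    fix e :: real assume "0 < e"
    then obtain h where h: "smooth_fun A h" "\<And>p. \<bar>f p + Reeb_deriv \<alpha> h p - I p / T\<bar> \<le> e / 2"
      using Reeb_average[OF c f T, of "e / 2"] by (auto simp: I_def)
    have "max_val f - min_val f \<le> (I p1 / T + e / 2) - (I p0 / T - e / 2)"
    proof (rule bm_dist_first_variation[OF \<alpha> f \<phi> eq d h(1)])
      fix p
      have "I p0 / T \<le> I p / T" "I p / T \<le> I p1 / T" using p1 p0 T by (auto intro: divide_right_mono)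
      then show "f p + Reeb_deriv \<alpha> h p \<le> I p1 / T + e / 2" "I p0 / T - e / 2 \<le> f p + Reeb_deriv \<alpha> h p"
        using h(2)[of p] by linarith+
    qed
    then show "max_val f - min_val f \<le> I p1 / T - I p0 / T + e" by simp
  qed
  have I_const: "integral {0..T} (\<lambda>s. r) = T * r" for r :: real using T by simp
  have fi: "(\<lambda>s. f (?\<rho> s p)) integrable_on {0..T}" for p by (rule integrable_continuous_real[OF fs])
  have le: "I p \<le> T * max_val f" "T * min_val f \<le> I p" for p
    using integral_le[OF fi integrable_const_ivl, of p "max_val f"] integral_le[OF integrable_const_ivl fi, of "min_val f" p]
      smooth_fun_bounded(1,2)[OF f] unfolding I_def I_const by auto
  have "T * (max_val f - min_val f) \<le> I p1 - I p0" using dev T by (simp add: field_simps)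
  then have I1: "I p1 = T * max_val f" and I0: "I p0 = T * min_val f"
    using le(1)[of p1] le(2)[of p0] by (auto simp: algebra_simps)
  have "integral {0..T} (\<lambda>s. max_val f - f (?\<rho> s p1)) = 0"
    using integral_diff[OF integrable_const_ivl[of "max_val f"] fi[of p1]] I1 T by (simp add: I_def)
  then have "\<forall>s\<in>{0..T}. max_val f - f (?\<rho> s p1) = 0"
    using integral_eq_0_iff[of 0 T "\<lambda>s. max_val f - f (?\<rho> s p1)"] T smooth_fun_bounded(1)[OF f]
    by (simp add: continuous_on_diff fs)
  then show "\<exists>p. \<forall>s\<in>{0..T}. f (?\<rho> s p) = max_val f" by (auto intro!: exI[of _ p1])
  have "integral {0..T} (\<lambda>s. f (?\<rho> s p0) - min_val f) = 0"
    using integral_diff[OF fi[of p0] integrable_const_ivl[of "min_val f"]] I0 T by (simp add: I_def)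
  then have "\<forall>s\<in>{0..T}. f (?\<rho> s p0) - min_val f = 0"
    using integral_eq_0_iff[of 0 T "\<lambda>s. f (?\<rho> s p0) - min_val f"] T smooth_fun_bounded(2)[OF f]
    by (simp add: continuous_on_diff fs)
  then show "\<exists>p. \<forall>s\<in>{0..T}. f (?\<rho> s p) = min_val f" by (auto intro!: exI[of _ p0])
qed

end

section \<open>Limits of probability measures\<close>

lemma compact_t2_regular:
  assumes "compact (UNIV :: 'a::t2_space set)" "open G" "(x::'a) \<in> G"
  shows "\<exists>B. open B \<and> x \<in> B \<and> closure B \<subseteq> G"
proof -
  have K: "compact (- G)" using compact_Int_closed[OF assms(1), of "- G"] assms(2) by (simp add: closed_Compl)
  have "\<exists>U V. open U \<and> open V \<and> x \<in> U \<and> y \<in> V \<and> U \<inter> V = {}" if "y \<in> - G" for y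
    using hausdorff[of x y] that assms(3) by blast
  then obtain U V where UV: "\<And>y. y \<in> - G \<Longrightarrow> open (U y)" "\<And>y. y \<in> - G \<Longrightarrow> open (V y)" "\<And>y. y \<in> - G \<Longrightarrow> x \<in> U y"
    "\<And>y. y \<in> - G \<Longrightarrow> y \<in> V y" "\<And>y. y \<in> - G \<Longrightarrow> U y \<inter> V y = {}" by metis
  obtain F where F: "F \<subseteq> - G" "finite F" "- G \<subseteq> (\<Union>y\<in>F. V y)"
    by (rule compactE_image[OF K, of "- G" V]) (use UV in auto)
  have "(\<Inter>y\<in>F. U y) \<subseteq> - (\<Union>y\<in>F. V y)" using F(1) UV(5) by fastforce
  then have "closure (\<Inter>y\<in>F. U y) \<subseteq> - (\<Union>y\<in>F. V y)"
    by (rule closure_minimal) (use F UV(2) in \<open>auto intro!: closed_Compl open_UN\<close>)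
  then have "closure (\<Inter>y\<in>F. U y) \<subseteq> G" using F(3) by blast
  moreover have "open (\<Inter>y\<in>F. U y)" "x \<in> (\<Inter>y\<in>F. U y)" using F(1,2) UV(1,3) by (auto intro!: open_INT)
  ultimately show ?thesis by blast
qed

text \<open>These are the properties of probability measures that survive a limit of values set by
  set: each is a closed condition on finitely many values. Countable additivity is not among
  them.\<close>

locale open_content =
  fixes \<nu> :: "'a::t2_space set \<Rightarrow> real"
  assumes space_compact: "compact (UNIV :: 'a set)"
    and nonneg: "open V \<Longrightarrow> 0 \<le> \<nu> V" and total: "\<nu> UNIV = 1" and empty: "\<nu> {} = 0"
    and mono: "open V \<Longrightarrow> open W \<Longrightarrow> V \<subseteq> W \<Longrightarrow> \<nu> V \<le> \<nu> W"
    and subadd: "open V \<Longrightarrow> open W \<Longrightarrow> \<nu> (V \<union> W) \<le> \<nu> V + \<nu> W"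
    and superadd: "open V \<Longrightarrow> open W \<Longrightarrow> V \<inter> W = {} \<Longrightarrow> \<nu> V + \<nu> W \<le> \<nu> (V \<union> W)"
begin

text \<open>Replacing the finitely additive \<open>\<nu>\<close> by its inner regularisation on open sets makes it countably
  subadditive, by compactness of \<open>closure V\<close>.\<close>

definition inner :: "'a set \<Rightarrow> ennreal" where
  "inner G = (SUP V\<in>{V. open V \<and> closure V \<subseteq> G}. ennreal (\<nu> V))"

definition outer :: "'a set \<Rightarrow> ennreal" where
  "outer S = (INF G\<in>{G. open G \<and> S \<subseteq> G}. inner G)"

lemma inner_upper: "open V \<Longrightarrow> closure V \<subseteq> G \<Longrightarrow> ennreal (\<nu> V) \<le> inner G"
  unfolding inner_def by (rule SUP_upper) simp

lemma inner_least: "(\<And>V. open V \<Longrightarrow> closure V \<subseteq> G \<Longrightarrow> ennreal (\<nu> V) \<le> z) \<Longrightarrow> inner G \<le> z"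
  unfolding inner_def by (rule SUP_least) simp

lemma outer_lower: "open G \<Longrightarrow> S \<subseteq> G \<Longrightarrow> outer S \<le> inner G"
  unfolding outer_def by (rule INF_lower) simp

lemma outer_greatest: "(\<And>G. open G \<Longrightarrow> S \<subseteq> G \<Longrightarrow> z \<le> inner G) \<Longrightarrow> z \<le> outer S"
  unfolding outer_def by (rule INF_greatest) simp

lemma inner_mono: "G \<subseteq> H \<Longrightarrow> inner G \<le> inner H"
  by (rule inner_least) (use inner_upper in blast)

lemma inner_le:
  assumes G: "open G"
  shows "inner G \<le> ennreal (\<nu> G)"
proof (rule inner_least)
  fix V assume "open V" "closure V \<subseteq> G"
  then show "ennreal (\<nu> V) \<le> ennreal (\<nu> G)" using closure_subset[of V] by (intro ennreal_leI mono[OF _ G]) auto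
qed

lemma outer_mono: "S \<subseteq> T \<Longrightarrow> outer S \<le> outer T"
  by (rule outer_greatest) (use outer_lower in blast)

lemma outer_open: "open G \<Longrightarrow> outer G = inner G"
  by (rule antisym) (auto intro: outer_lower outer_greatest inner_mono)

lemma finite_subadd:
  assumes "finite I" "\<And>i. i \<in> I \<Longrightarrow> open (W i)"
  shows "\<nu> (\<Union>i\<in>I. W i) \<le> (\<Sum>i\<in>I. \<nu> (W i))"
  using assms
proof (induction I rule: finite_induct)
  case (insert j I)
  have "\<nu> (W j \<union> (\<Union>i\<in>I. W i)) \<le> \<nu> (W j) + \<nu> (\<Union>i\<in>I. W i)"
    by (rule subadd) (use insert.prems in auto)
  then show ?case using insert by auto
qed (simp add: empty)

text \<open>Each point of \<open>closure V\<close> has a neighbourhood whose closure lies in one of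
  the \<open>G i\<close>. Finitely many of them cover, and grouping these by their index cuts
  \<open>V\<close> into pieces \<open>W j\<close> admissible for \<open>inner (G j)\<close>; finite
  subadditivity does the rest.\<close>

lemma inner_countably_subadditive:
  fixes G :: "nat \<Rightarrow> 'a set"
  assumes G: "\<And>i. open (G i)"
  shows "inner (\<Union>i. G i) \<le> (\<Sum>i. inner (G i))"
proof (rule inner_least)
  fix V :: "'a set" assume V: "open V" "closure V \<subseteq> (\<Union>i. G i)"
  have cV: "compact (closure V)" using compact_Int_closed[OF space_compact, of "closure V"] by simp
  have "\<exists>i B. open B \<and> x \<in> B \<and> closure B \<subseteq> G i" if "x \<in> closure V" for x
  proof -
    obtain j where "x \<in> G j" using V(2) \<open>x \<in> closure V\<close> by blast
    from compact_t2_regular[OF space_compact G this] show ?thesis by blast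
  qed
  then obtain i B where iB: "\<And>x. x \<in> closure V \<Longrightarrow> open (B x)" "\<And>x. x \<in> closure V \<Longrightarrow> x \<in> B x"
    "\<And>x. x \<in> closure V \<Longrightarrow> closure (B x) \<subseteq> G (i x)" by metis
  obtain F where F: "F \<subseteq> closure V" "finite F" "closure V \<subseteq> (\<Union>x\<in>F. B x)"
    by (rule compactE_image[OF cV, of "closure V" B]) (use iB in auto)
  define W where "W j = V \<inter> (\<Union>x\<in>{x \<in> F. i x = j}. B x)" for j
  have W: "open (W j)" for j unfolding W_def using V(1) F(1) iB(1) by auto
  have "closure (W j) \<subseteq> (\<Union>x\<in>{x \<in> F. i x = j}. closure (B x))" for j
  proof (rule closure_minimal)
    show "W j \<subseteq> (\<Union>x\<in>{x \<in> F. i x = j}. closure (B x))" unfolding W_def using closure_subset by fast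
    show "closed (\<Union>x\<in>{x \<in> F. i x = j}. closure (B x))" by (rule closed_UN) (use F(2) in auto)
  qed
  then have cW: "closure (W j) \<subseteq> G j" for j using iB(3) F(1) by fastforce
  have "V = (\<Union>j\<in>i ` F. W j)" using F(3) closure_subset[of V] by (fastforce simp: W_def)
  then have "\<nu> V \<le> (\<Sum>j\<in>i ` F. \<nu> (W j))" using finite_subadd[of "i ` F" W] F(2) W by simp
  then have "ennreal (\<nu> V) \<le> (\<Sum>j\<in>i ` F. ennreal (\<nu> (W j)))"
    using W nonneg by (subst sum_ennreal) (auto intro: ennreal_leI)
  also have "\<dots> \<le> (\<Sum>j\<in>i ` F. inner (G j))" by (intro sum_mono inner_upper W cW)
  also have "\<dots> \<le> (\<Sum>j. inner (G j))" by (rule sum_le_suminf) (use F(2) in auto)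
  finally show "ennreal (\<nu> V) \<le> (\<Sum>j. inner (G j))" .
qed

lemma outer_countably_subadditive: "outer (\<Union>i. S i) \<le> (\<Sum>i. outer (S i))" for S :: "nat \<Rightarrow> 'a set"
proof (rule ennreal_le_epsilon)
  fix e :: real assume e: "0 < e" and fin: "(\<Sum>i. outer (S i)) < top"
  have "\<exists>G. open G \<and> S n \<subseteq> G \<and> inner G < outer (S n) + e * (1/2)^Suc n" for n
  proof -
    have "outer (S n) < top" using fin by (auto simp: less_top dest!: ennreal_suminf_lessD)
    then have "outer (S n) < outer (S n) + e * (1/2)^Suc n" using e by (auto simp: less_top)
    then show ?thesis unfolding outer_def[of "S n"] INF_less_iff by auto
  qed
  then obtain G where G: "\<And>n. open (G n)" "\<And>n. S n \<subseteq> G n" "\<And>n. inner (G n) < outer (S n) + e * (1/2)^Suc n" by metis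
  have "outer (\<Union>i. S i) \<le> inner (\<Union>i. G i)" by (rule outer_lower) (use G in auto)
  also have "\<dots> \<le> (\<Sum>i. inner (G i))" by (rule inner_countably_subadditive[OF G(1)])
  also have "\<dots> \<le> (\<Sum>n. outer (S n) + e * (1/2) ^ Suc n)" by (intro suminf_le allI less_imp_le[OF G(3)]) auto
  also have "\<dots> = (\<Sum>n. outer (S n)) + (\<Sum>n. ennreal e * ennreal ((1/2) ^ Suc n))"
    using e by (subst suminf_add[symmetric]) (auto simp del: ennreal_suminf_cmult simp add: ennreal_mult[symmetric])
  also have "\<dots> = (\<Sum>n. outer (S n)) + e"
    unfolding ennreal_suminf_cmult by (subst suminf_ennreal_eq[OF zero_le_power power_half_series]) auto
  finally show "outer (\<Union>i. S i) \<le> (\<Sum>n. outer (S n)) + e" .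
qed

lemma outer_empty: "outer {} = 0"
  using inner_le[of "{}"] outer_open[of "{}"] by (simp add: empty)

lemma outer_measure_space: "outer_measure_space UNIV outer"
  using outer_empty outer_mono outer_countably_subadditive
  by (auto simp: outer_measure_space_def positive_def increasing_def countably_subadditive_def)

text \<open>Caratheodory's condition for open G. In an open U containing S, choose V with closure in
  U \<inter> G, then W with closure in U - \<open>closure V\<close>. They are disjoint and their
  union is admissible for U, so superadditivity applies; suprema over W and then over V
  finish.\<close>

lemma open_in_lambda_system:
  assumes G: "open G"
  shows "G \<in> lambda_system UNIV UNIV outer"
proof -
  have "outer (G \<inter> S) + outer ((UNIV - G) \<inter> S) = outer S" for S
  proof (rule antisym)
    show "outer (G \<inter> S) + outer ((UNIV - G) \<inter> S) \<le> outer S"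
    proof (rule outer_greatest)
      fix U assume U: "open U" "S \<subseteq> U"
      have "outer (U - G) + inner (U \<inter> G) \<le> inner U"
        unfolding inner_def[of "U \<inter> G"]
      proof (subst ennreal_SUP_add_right)
        show "(SUP V\<in>{V. open V \<and> closure V \<subseteq> U \<inter> G}. outer (U - G) + ennreal (\<nu> V)) \<le> inner U"
        proof (rule SUP_least)
          fix V assume "V \<in> {V. open V \<and> closure V \<subseteq> U \<inter> G}"
          then have V: "open V" "closure V \<subseteq> U \<inter> G" by auto
          have "outer (U - G) \<le> inner (U - closure V)"
            by (rule outer_lower) (use U V in auto)
          then have "outer (U - G) + ennreal (\<nu> V) \<le> ennreal (\<nu> V) + inner (U - closure V)"
            by (simp add: add.commute add_left_mono)
          also have "\<dots> \<le> inner U"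
            unfolding inner_def[of "U - closure V"]
          proof (subst ennreal_SUP_add_right)
            show "(SUP W\<in>{W. open W \<and> closure W \<subseteq> U - closure V}. ennreal (\<nu> V) + ennreal (\<nu> W)) \<le> inner U"
            proof (rule SUP_least)
              fix W assume "W \<in> {W. open W \<and> closure W \<subseteq> U - closure V}"
              then have W: "open W" "closure W \<subseteq> U - closure V" by auto
              have "V \<inter> W = {}" using W(2) closure_subset[of V] closure_subset[of W] by blast
              then have "\<nu> V + \<nu> W \<le> \<nu> (V \<union> W)" by (rule superadd[OF V(1) W(1)])
              then have "ennreal (\<nu> V) + ennreal (\<nu> W) \<le> ennreal (\<nu> (V \<union> W))"
                using nonneg V W by (simp add: ennreal_leI flip: ennreal_plus)
              also have "\<dots> \<le> inner U" by (rule inner_upper) (use V W in auto)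
              finally show "ennreal (\<nu> V) + ennreal (\<nu> W) \<le> inner U" .
            qed
          qed (auto intro!: exI[of _ "{}"])
          finally show "outer (U - G) + ennreal (\<nu> V) \<le> inner U" .
        qed
      qed (auto intro!: exI[of _ "{}"])
      moreover have "outer (G \<inter> S) \<le> inner (U \<inter> G)" by (rule outer_lower) (use U G in auto)
      moreover have "outer ((UNIV - G) \<inter> S) \<le> outer (U - G)" by (rule outer_mono) (use U in auto)
      ultimately show "outer (G \<inter> S) + outer ((UNIV - G) \<inter> S) \<le> inner U"
        by - (subst add.commute, rule order_trans[OF add_mono], assumption+)
    qed
  next
    let ?S = "\<lambda>i::nat. if i = 0 then G \<inter> S else if i = 1 then (UNIV - G) \<inter> S else {}"
    have "outer (\<Union>i. ?S i) \<le> (\<Sum>i. outer (?S i))" by (rule outer_countably_subadditive)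
    also have "(\<Sum>i. outer (?S i)) = (\<Sum>i\<in>{0, 1}. outer (?S i))"
      by (rule suminf_finite) (auto simp: outer_empty)
    also have "(\<Union>i. ?S i) = S" by (auto split: if_splits)
    finally show "outer S \<le> outer (G \<inter> S) + outer ((UNIV - G) \<inter> S)" by simp
  qed
  then show ?thesis by (simp add: lambda_system_def)
qed

definition content_measure :: "'a measure" where
  "content_measure = measure_of UNIV (sets borel) outer"

lemma sets_content_measure: "sets content_measure = sets borel"
  and space_content_measure: "space content_measure = UNIV"
  using sigma_algebra.sets_measure_of_eq[of UNIV "sets borel" outer] sets.sigma_algebra_axioms[of "borel :: 'a measure"]
  by (auto simp: content_measure_def space_measure_of_conv)

lemma emeasure_content_measure:
  assumes "S \<in> sets borel"
  shows "emeasure content_measure S = outer S"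
  unfolding content_measure_def
proof (rule emeasure_measure_of_sigma[OF _ _ _ assms])
  show s: "sigma_algebra UNIV (sets (borel :: 'a measure))"
    using sets.sigma_algebra_axioms[of "borel :: 'a measure"] by simp
  have m: "measure_space UNIV (lambda_system UNIV UNIV outer) outer"
    using sigma_algebra.caratheodory_lemma[OF sigma_algebra_Pow[of UNIV]] outer_measure_space by simp
  then have "sigma_sets UNIV {G. open G} \<subseteq> lambda_system UNIV UNIV outer"
    using open_in_lambda_system by (intro sigma_algebra.sigma_sets_subset) (auto simp: measure_space_def)
  then have sub: "sets borel \<subseteq> lambda_system UNIV UNIV outer" by (simp add: borel_def)
  show "positive (sets borel) outer" by (simp add: positive_def outer_empty)
  show "countably_additive (sets borel) outer"
    using m sub unfolding measure_space_def countably_additive_def by blast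
qed

text \<open>Regularisation may lose mass on an open set, so only an inequality holds; it suffices to
  transfer null sets.\<close>

lemma content_measure_open_le: "open G \<Longrightarrow> emeasure content_measure G \<le> ennreal (\<nu> G)"
  using inner_le by (simp add: emeasure_content_measure outer_open)

text \<open>The whole space is its own closure, so no mass is lost in total.\<close>

lemma borel_prob_content_measure: "borel_prob content_measure"
proof -
  have "inner UNIV = 1" 
    using inner_le[of UNIV] inner_upper[of UNIV UNIV] by (intro antisym) (simp_all add: total)
  then have "emeasure content_measure (space content_measure) = 1"
    by (simp add: space_content_measure emeasure_content_measure outer_open)
  then show ?thesis by (simp add: borel_prob_def prob_spaceI sets_content_measure)
qed

lemma inner_vimage_ge:
  assumes "continuous_on UNIV \<theta>" "\<And>V. open V \<Longrightarrow> \<nu> (\<theta> -` V) = \<nu> V"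
  shows "inner G \<le> inner (\<theta> -` G)"
proof (rule inner_least)
  fix V assume V: "open V" "closure V \<subseteq> G"
  have c: "closed (\<theta> -` closure V)" "open (\<theta> -` V)"
    using continuous_closed_vimage[of "closure V" \<theta>] open_vimage[OF V(1) assms(1)] assms(1)
    by (auto simp: continuous_on_eq_continuous_at)
  have "closure (\<theta> -` V) \<subseteq> \<theta> -` closure V" by (rule closure_minimal[OF _ c(1)]) (use closure_subset in blast)
  then have "ennreal (\<nu> (\<theta> -` V)) \<le> inner (\<theta> -` G)" by (intro inner_upper[OF c(2)]) (use V in blast)
  then show "ennreal (\<nu> V) \<le> inner (\<theta> -` G)" using assms(2)[OF V(1)] by simp
qed

text \<open>One inequality, applied to \<theta> and to its inverse \<theta>', becomes an equality of
  \<open>inner\<close> and then of \<open>outer\<close> on arbitrary sets; measurability matters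
  only for the push-forward itself.\<close>

lemma content_measure_invariant:
  assumes \<theta>: "continuous_on UNIV \<theta>" "continuous_on UNIV \<theta>'" "\<And>x. \<theta> (\<theta>' x) = x" "\<And>x. \<theta>' (\<theta> x) = x"
    and \<nu>: "\<And>V. open V \<Longrightarrow> \<nu> (\<theta> -` V) = \<nu> V"
  shows "distr content_measure borel \<theta> = content_measure"
proof -
  have v: "\<theta> -` \<theta>' -` S = S" "\<theta>' -` \<theta> -` S = S" for S using \<theta> by auto
  have \<nu>': "\<nu> (\<theta>' -` V) = \<nu> V" if "open V" for V
    using \<nu>[OF open_vimage[OF that \<theta>(2)]] by (simp add: v)
  have i: "inner (\<theta> -` G) = inner G" "inner (\<theta>' -` G) = inner G" for G
    using inner_vimage_ge[OF \<theta>(1) \<nu>, of G] inner_vimage_ge[OF \<theta>(2) \<nu>', of "\<theta> -` G"]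
      inner_vimage_ge[OF \<theta>(1) \<nu>, of "\<theta>' -` G"] inner_vimage_ge[OF \<theta>(2) \<nu>', of G] v by auto
  have le: "outer (\<theta> -` S) \<le> outer S" for S
  proof (rule outer_greatest)
    fix G assume "open G" "S \<subseteq> G"
    then have "outer (\<theta> -` S) \<le> inner (\<theta> -` G)" by (intro outer_lower open_vimage[OF _ \<theta>(1)] vimage_mono)
    then show "outer (\<theta> -` S) \<le> inner G" by (simp only: i)
  qed
  have ge: "outer (\<theta>' -` S) \<le> outer S" for S
  proof (rule outer_greatest)
    fix G assume "open G" "S \<subseteq> G"
    then have "outer (\<theta>' -` S) \<le> inner (\<theta>' -` G)" by (intro outer_lower open_vimage[OF _ \<theta>(2)] vimage_mono)
    then show "outer (\<theta>' -` S) \<le> inner G" by (simp only: i)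
  qed
  have o: "outer (\<theta> -` S) = outer S" for S using le[of S] ge[of "\<theta> -` S"] v by auto
  have \<theta>m: "\<theta> \<in> borel_measurable borel" by (rule borel_measurable_continuous_onI[OF \<theta>(1)])
  then have m: "\<theta> \<in> measurable content_measure borel"
    by (simp add: measurable_cong_sets[OF sets_content_measure refl])
  show ?thesis
  proof (rule measure_eqI)
    fix S assume "S \<in> sets (distr content_measure borel \<theta>)"
    then have S: "S \<in> sets borel" by simp
    have "\<theta> -` S \<in> sets borel" using measurable_sets[OF \<theta>m S] by simp
    then show "emeasure (distr content_measure borel \<theta>) S = emeasure content_measure S"
      using S o by (simp add: emeasure_distr[OF m S] space_content_measure emeasure_content_measure)
  qed (simp add: sets_content_measure)
qed

end

text \<open>By Tychonoff's theorem the set functions lie in a compact product of unit intervals and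
  have a cluster point. The index set consists of all subsets, so a cluster point is taken in place
  of a convergent subsequence; it satisfies every closed condition that holds eventually.\<close>

lemma cluster_set_function:
  fixes \<nu> :: "nat \<Rightarrow> 'a set \<Rightarrow> real"
  assumes "\<And>n S. 0 \<le> \<nu> n S" "\<And>n S. \<nu> n S \<le> 1"
  shows "\<exists>\<omega>. \<forall>C. closed C \<longrightarrow> (\<forall>\<^sub>F n in sequentially. \<nu> n \<in> C) \<longrightarrow> \<omega> \<in> C"
proof -
  let ?B = "PiE UNIV (\<lambda>_::'a set. {0..1::real})"
  have "compactin (product_topology (\<lambda>_. euclidean) UNIV) ?B"
    unfolding compactin_PiE by simp
  then have B: "compact ?B" by (simp add: euclidean_product_topology)
  have "\<forall>\<^sub>F \<omega> in filtermap \<nu> sequentially. \<omega> \<in> ?B" using assms by (simp add: eventually_filtermap PiE_def)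
  moreover have "filtermap \<nu> sequentially \<noteq> bot" by (simp add: filtermap_bot_iff)
  ultimately obtain \<omega> where \<omega>: "inf (nhds \<omega>) (filtermap \<nu> sequentially) \<noteq> bot"
    using B unfolding compact_filter by blast
  have "\<omega> \<in> C" if C: "closed C" "\<forall>\<^sub>F n in sequentially. \<nu> n \<in> C" for C
  proof (rule ccontr)
    assume "\<omega> \<notin> C"
    then have "\<forall>\<^sub>F x in nhds \<omega>. x \<in> - C" using C(1) by (intro eventually_nhds_in_open) auto
    moreover have "\<forall>\<^sub>F x in filtermap \<nu> sequentially. x \<in> C" using C(2) by (simp add: eventually_filtermap)
    ultimately have "\<forall>\<^sub>F x in inf (nhds \<omega>) (filtermap \<nu> sequentially). False"
      unfolding eventually_inf by blast
    then show False using \<omega> by (simp add: trivial_limit_def)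
  qed
  then show ?thesis by blast
qed

text \<open>Evaluation at a set is continuous on set functions, so equations and weak inequalities
  between finitely many values pass from \<open>M n\<close> to the cluster point. Null open sets and
  asymptotic invariance are transferred in this way before the content is turned into a
  measure.\<close>

lemma limit_measure:
  fixes M :: "nat \<Rightarrow> 'a::t2_space measure"
  assumes cpt: "compact (UNIV :: 'a set)" and M: "\<And>n. borel_prob (M n)"
  shows "\<exists>\<mu>. borel_prob \<mu> \<and> (\<forall>G. open G \<longrightarrow> (\<forall>n. measure (M n) G = 0) \<longrightarrow> emeasure \<mu> G = 0) \<and>
    (\<forall>\<theta> \<theta>'. continuous_on UNIV \<theta> \<longrightarrow> continuous_on UNIV \<theta>' \<longrightarrow> (\<forall>x. \<theta> (\<theta>' x) = x) \<longrightarrow> (\<forall>x. \<theta>' (\<theta> x) = x) \<longrightarrow>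
       (\<forall>V. open V \<longrightarrow> (\<lambda>n. measure (M n) (\<theta> -` V) - measure (M n) V) \<longlonglongrightarrow> 0) \<longrightarrow> distr \<mu> borel \<theta> = \<mu>)"
proof -
  have P: "prob_space (M n)" and S: "sets (M n) = sets borel" for n using M by (auto simp: borel_prob_def)
  obtain \<omega> where "\<forall>C. closed C \<longrightarrow> (\<forall>\<^sub>F n in sequentially. measure (M n) \<in> C) \<longrightarrow> \<omega> \<in> C"
    using cluster_set_function[of "\<lambda>n. measure (M n)"] prob_space.prob_le_1[OF P] by auto
  then have cl: "\<omega> \<in> C" if "closed C" "\<forall>\<^sub>F n in sequentially. measure (M n) \<in> C" for C using that by blast
  have co: "continuous_on UNIV (\<lambda>\<omega>::'a set \<Rightarrow> real. \<omega> W)" for W by simp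
  have op: "open V \<Longrightarrow> V \<in> sets (M n)" for V n using S by auto
  interpret open_content \<omega>
  proof
    fix V W :: "'a set"
    show "compact (UNIV :: 'a set)" by (rule cpt)
    have "\<omega> \<in> {\<omega>. \<omega> UNIV = 1}"
      by (rule cl) (use prob_space.prob_space[OF P] sets_eq_imp_space_eq[OF S] co in \<open>auto intro!: closed_Collect_eq\<close>)
    then show "\<omega> UNIV = 1" by simp
    have "\<omega> \<in> {\<omega>. \<omega> {} = 0}" by (rule cl) (use co in \<open>auto intro!: closed_Collect_eq\<close>)
    then show "\<omega> {} = 0" by simp
    assume V: "open V"
    have "\<omega> \<in> {\<omega>. 0 \<le> \<omega> V}" by (rule cl) (use co in \<open>auto intro!: closed_Collect_le\<close>)
    then show "0 \<le> \<omega> V" by simp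
    assume W: "open W"
    have fin: "finite_measure (M n)" for n using P by (rule prob_space.finite_measure)
    show "\<omega> V \<le> \<omega> W" if "V \<subseteq> W"
    proof -
      have "\<omega> \<in> {\<omega>. \<omega> V \<le> \<omega> W}"
        by (rule cl) (use co finite_measure.finite_measure_mono[OF fin that op[OF W]] in \<open>auto intro!: closed_Collect_le\<close>)
      then show ?thesis by simp
    qed
    have "\<omega> \<in> {\<omega>. \<omega> (V \<union> W) \<le> \<omega> V + \<omega> W}"
      by (rule cl) (use measure_Un_le[OF op[OF V] op[OF W]] co in
          \<open>auto intro!: closed_Collect_le continuous_on_add\<close>)
    then show "\<omega> (V \<union> W) \<le> \<omega> V + \<omega> W" by simp
    show "\<omega> V + \<omega> W \<le> \<omega> (V \<union> W)" if "V \<inter> W = {}"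
    proof -
      have "\<omega> \<in> {\<omega>. \<omega> V + \<omega> W \<le> \<omega> (V \<union> W)}"
        by (rule cl) (use finite_measure.finite_measure_Union[OF fin op[OF V] op[OF W] that] co in
            \<open>auto intro!: closed_Collect_le continuous_on_add\<close>)
      then show ?thesis by simp
    qed
  qed
  show ?thesis
  proof (intro exI[of _ content_measure] conjI allI impI borel_prob_content_measure)
    fix G :: "'a set" assume G: "open G" "\<forall>n. measure (M n) G = 0"
    have "\<omega> \<in> {\<omega>. \<omega> G = 0}" by (rule cl) (use co G in \<open>auto intro!: closed_Collect_eq\<close>)
    then show "emeasure content_measure G = 0" using content_measure_open_le[OF G(1)] by simp
  next
    fix \<theta> \<theta>' :: "'a \<Rightarrow> 'a"
    assume \<theta>: "continuous_on UNIV \<theta>" "continuous_on UNIV \<theta>'" "\<forall>x. \<theta> (\<theta>' x) = x" "\<forall>x. \<theta>' (\<theta> x) = x"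
      and lim: "\<forall>V. open V \<longrightarrow> (\<lambda>n. measure (M n) (\<theta> -` V) - measure (M n) V) \<longlonglongrightarrow> 0"
    have "\<omega> (\<theta> -` V) = \<omega> V" if V: "open V" for V
    proof -
      \<comment> \<open>Convergence to 0 is not one closed condition that holds eventually, but its
        version with a fixed tolerance e is.\<close>
      have "\<bar>\<omega> (\<theta> -` V) - \<omega> V\<bar> \<le> e" if e: "e > 0" for e
      proof -
        have "\<omega> \<in> {\<omega>. \<bar>\<omega> (\<theta> -` V) - \<omega> V\<bar> \<le> e}"
        proof (rule cl)
          show "closed {\<omega>. \<bar>\<omega> (\<theta> -` V) - \<omega> V\<bar> \<le> e}"
            by (intro closed_Collect_le continuous_on_rabs continuous_on_diff co continuous_on_const)
          have "\<forall>\<^sub>F n in sequentially. \<bar>measure (M n) (\<theta> -` V) - measure (M n) V\<bar> < e"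
            using lim V e by (auto simp: tendsto_iff dist_real_def)
          then show "\<forall>\<^sub>F n in sequentially. measure (M n) \<in> {\<omega>. \<bar>\<omega> (\<theta> -` V) - \<omega> V\<bar> \<le> e}"
            by eventually_elim simp
        qed
        then show ?thesis by simp
      qed
      then have "\<bar>\<omega> (\<theta> -` V) - \<omega> V\<bar> \<le> 0" by (rule field_le_epsilon[where y = 0, simplified])
      then show ?thesis by simp
    qed
    then show "distr content_measure borel \<theta> = content_measure"
      using \<theta> by (intro content_measure_invariant[where \<theta>' = \<theta>']) auto
  qed
qed

lemma measure_interval_shift_le:
  fixes E :: "real set"
  assumes E: "E \<in> sets borel" and T: "0 \<le> T"
  shows "measure lborel ({a..a + T} \<inter> E) \<le> measure lborel ({b..b + T} \<inter> E) + \<bar>a - b\<bar>"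
proof -
  \<comment> \<open>An interval of length \<bar>a - b\<bar> that covers the part of the first
    interval missed by the second.\<close>
  define J where "J = (if a \<le> b then {a..b} else {b + T..a + T})"
  have "measure lborel ({a..a + T} \<inter> E) \<le> measure lborel ({b..b + T} \<inter> E \<union> J)"
  proof (rule measure_mono_fmeasurable)
    show "{b..b + T} \<inter> E \<union> J \<in> fmeasurable lborel"
      by (intro fmeasurable.Un fmeasurable_Int_fmeasurable fmeasurable_compact) (use E in \<open>auto simp: J_def\<close>)
  qed (use E in \<open>auto simp: J_def\<close>)
  also have "\<dots> \<le> measure lborel ({b..b + T} \<inter> E) + measure lborel J"
    by (rule measure_Un_le) (use E in \<open>auto simp: J_def\<close>)
  also have "measure lborel J = \<bar>a - b\<bar>" by (simp add: J_def)
  finally show ?thesis .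
qed

section \<open>Invariant measures on extremal level sets\<close>

context manifold
begin

lemma differential_extremum:
  assumes f: "smooth_fun A f" and p: "(\<forall>q. f q \<le> f p) \<or> (\<forall>q. f p \<le> f q)"
  shows "differential f p v = 0"
proof -
  let ?c = "chart_at A p"
  have c: "?c \<in> A" "p \<in> fst ?c" using chart_at by auto
  let ?x = "snd ?c p" and ?f = "f \<circ> chart_inv ?c"
  have D: "(?f has_derivative frechet_derivative ?f (at ?x)) (at ?x)"
    by (rule frechet_derivative_works[THEN iffD1, OF smooth_differentiable[OF smooth_fun_chart[OF f c(1)]]])
      (use c in auto)
  have "frechet_derivative ?f (at ?x) = (\<lambda>v. 0)"
    by (rule differential_zero_maxmin[OF _ chart_open(2)[OF c(1)] D]) (use c p in auto)
  then show ?thesis by (simp add: differential_def)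
qed

end

context closed_manifold
begin

lemma flow_time_continuous: "smooth_field X \<Longrightarrow> continuous_on UNIV (flow_of A X t)"
  using flow_smooth_map by (simp add: smooth_map_def)

lemma flow_orbit_continuous:
  assumes "smooth_field X"
  shows "continuous_on UNIV (\<lambda>t. flow_of A X t p)"
proof -
  have "continuous_on UNIV (\<lambda>t. (\<lambda>(t, p). flow_of A X t p) (t, p))"
    by (rule continuous_on_compose2[OF flow_continuous[OF assms]]) (auto intro!: continuous_intros)
  then show ?thesis by simp
qed

text \<open>The Krylov-Bogolyubov construction: flowing by time t changes the uniform measure on an
  orbit segment of length \<open>T n\<close> by at most \<bar>t\<bar> / \<open>T n\<close> on each
  open set, and each such measure vanishes on the open complement of \<open>K\<close>.\<close>

lemma flow_invariant_measure_exists: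
  assumes X: "smooth_field X" and K: "closed K" and orbit: "\<And>T. 0 < T \<Longrightarrow> \<exists>p. \<forall>s\<in>{0..T}. flow_of A X s p \<in> K"
  shows "\<exists>\<mu>. borel_prob \<mu> \<and> supported_in \<mu> K \<and> flow_invariant (flow_of A X) \<mu>"
proof -
  let ?\<theta> = "flow_of A X"
  define T where "T n = real (Suc n)" for n
  have T: "0 < T n" for n by (simp add: T_def)
  have "\<forall>n. \<exists>p. \<forall>s\<in>{0..T n}. ?\<theta> s p \<in> K" using orbit T by blast
  then obtain p where p: "\<And>n s. s \<in> {0..T n} \<Longrightarrow> ?\<theta> s (p n) \<in> K" by metis
  define \<gamma> where "\<gamma> n s = ?\<theta> s (p n)" for n s
  define U where "U n = uniform_measure lborel {0..T n}" for n
  define M where "M n = distr (U n) borel (\<gamma> n)" for n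
  have "continuous_on UNIV (\<gamma> n)" for n unfolding \<gamma>_def[abs_def] by (rule flow_orbit_continuous[OF X])
  then have \<gamma>b: "\<gamma> n \<in> borel_measurable borel" for n by (rule borel_measurable_continuous_onI)
  then have \<gamma>m: "\<gamma> n \<in> measurable (U n) borel" for n
    using measurable_cong_sets[of "U n" borel borel borel] by (simp add: U_def)
  have "prob_space (U n)" for n
    unfolding U_def by (rule prob_space_uniform_measure) (use T[of n] in auto)
  then have M: "borel_prob (M n)" for n
    unfolding M_def borel_prob_def using prob_space.prob_space_distr[OF _ \<gamma>m] by simp
  have pre: "\<gamma> n -` V \<in> sets borel" if "V \<in> sets borel" for n V
    using measurable_sets[OF \<gamma>b that] by simp
  have mM: "measure (M n) V = measure lborel ({0..T n} \<inter> \<gamma> n -` V) / T n" if V: "V \<in> sets borel" for n V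
  proof -
    have "measure (M n) V = measure (U n) (\<gamma> n -` V)"
      unfolding M_def by (subst measure_distr[OF \<gamma>m V]) (simp add: U_def)
    also have "\<dots> = measure lborel ({0..T n} \<inter> \<gamma> n -` V) / measure lborel {0..T n}"
      unfolding U_def by (rule measure_uniform_measure) (use T[of n] pre[OF V] in auto)
    finally show ?thesis using T[of n] by simp
  qed
  have shift: "\<bar>measure (M n) (?\<theta> t -` V) - measure (M n) V\<bar> \<le> \<bar>t\<bar> / T n" if V: "open V" for n t V
  proof -
    let ?E = "\<gamma> n -` V"
    have E: "?E \<in> sets borel" using V by (intro pre) simp
    have vb: "?\<theta> t -` V \<in> sets borel" using open_vimage[OF V flow_time_continuous[OF X]] by simp
    \<comment> \<open>The group law turns the action of the flow on the orbit into a shift of the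
      time window by t.\<close>
    have "\<gamma> n -` (?\<theta> t -` V) = (\<lambda>s. t + s) -` ?E"
      unfolding \<gamma>_def using flow_add[OF X, of t] by auto
    then have "(+) t ` ({0..T n} \<inter> \<gamma> n -` (?\<theta> t -` V)) = {t..t + T n} \<inter> ?E"
      by (force simp: image_iff intro!: bexI[of _ "_ - t"])
    then have "measure lebesgue ({0..T n} \<inter> \<gamma> n -` (?\<theta> t -` V)) = measure lebesgue ({t..t + T n} \<inter> ?E)"
      using measure_translation[of t "{0..T n} \<inter> \<gamma> n -` (?\<theta> t -` V)"] by simp
    then have "measure lborel ({0..T n} \<inter> \<gamma> n -` (?\<theta> t -` V)) = measure lborel ({t..t + T n} \<inter> ?E)"
      using E pre[OF vb, of n] by (simp add: measure_completion)
    then have "\<bar>measure lborel ({0..T n} \<inter> \<gamma> n -` (?\<theta> t -` V)) - measure lborel ({0..T n} \<inter> ?E)\<bar> \<le> \<bar>t\<bar>"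
      using measure_interval_shift_le[OF E, of "T n" t 0] measure_interval_shift_le[OF E, of "T n" 0 t] T[of n] by simp
    then show ?thesis
      using V T[of n] by (simp add: mM[OF vb] mM abs_divide divide_right_mono flip: diff_divide_distrib)
  qed
  obtain \<mu> where \<mu>: "borel_prob \<mu>" "\<forall>G. open G \<longrightarrow> (\<forall>n. measure (M n) G = 0) \<longrightarrow> emeasure \<mu> G = 0"
    "\<forall>\<theta> \<theta>'. continuous_on UNIV \<theta> \<longrightarrow> continuous_on UNIV \<theta>' \<longrightarrow> (\<forall>x. \<theta> (\<theta>' x) = x) \<longrightarrow> (\<forall>x. \<theta>' (\<theta> x) = x) \<longrightarrow>
       (\<forall>V. open V \<longrightarrow> (\<lambda>n. measure (M n) (\<theta> -` V) - measure (M n) V) \<longlonglongrightarrow> 0) \<longrightarrow> distr \<mu> borel \<theta> = \<mu>"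
    using limit_measure[where M = M, OF compact M] by (elim exE conjE) (rule that, assumption+)
  have "supported_in \<mu> K"
    unfolding supported_in_def
  proof (rule \<mu>(2)[rule_format])
    fix n
    have "{0..T n} \<inter> \<gamma> n -` (- K) = {}" using p by (auto simp: \<gamma>_def)
    then show "measure (M n) (- K) = 0" using K by (subst mM) auto
  qed (use K in auto)
  moreover have "flow_invariant ?\<theta> \<mu>"
    unfolding flow_invariant_def
  proof (intro allI conjI)
    fix t
    show "?\<theta> t \<in> borel_measurable borel" by (rule borel_measurable_continuous_onI[OF flow_time_continuous[OF X]])
    show "distr \<mu> borel (?\<theta> t) = \<mu>"
    proof (rule \<mu>(3)[THEN spec[of _ "?\<theta> t"], THEN spec[of _ "?\<theta> (- t)"], rule_format])
      fix V :: "'a set" assume V: "open V"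
      have "(\<lambda>n. \<bar>t\<bar> * inverse (real (Suc n))) \<longlonglongrightarrow> 0"
        by (intro tendsto_mult_right_zero LIMSEQ_inverse_real_of_nat)
      then show "(\<lambda>n. measure (M n) (?\<theta> t -` V) - measure (M n) V) \<longlonglongrightarrow> 0"
        by (rule Lim_null_comparison[rotated]) (use shift[OF V] in \<open>auto simp: T_def divide_inverse\<close>)
    qed (auto simp: flow_inverse[OF X] intro: flow_time_continuous[OF X])
  qed
  ultimately show ?thesis using \<mu>(1) by blast
qed

text \<open>Both Reeb fields are proportional along the orbit because \<open>df\<close> vanishes there.\<close>

lemma Reeb_flow_scale_extremum:
  assumes \<alpha>: "contact_form A \<alpha>" and f: "smooth_fun A f"
    and c: "(\<forall>q. f q \<le> c) \<or> (\<forall>q. c \<le> f q)" and orbit: "\<And>t. f (Reeb_flow A \<alpha> t p) = c"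
  shows "Reeb_flow A (scale_form (\<lambda>p. exp (f p)) \<alpha>) t p = Reeb_flow A \<alpha> (exp (- c) * t) p"
proof -
  let ?e = "\<lambda>p. exp (f p)" and ?\<alpha>' = "scale_form (\<lambda>p. exp (f p)) \<alpha>"
  have e: "smooth_fun A ?e" by (rule smooth_fun_compose[OF f smooth_exp]) simp
  have \<alpha>': "contact_form A ?\<alpha>'" by (rule contact_form_scale[OF \<alpha> e]) simp
  note R = Reeb_field_smooth[OF \<alpha>] and R' = Reeb_field_smooth[OF \<alpha>']
  \<comment> \<open>On the level set the new form is \<open>exp c\<close> times \<alpha>, so the
    factor \<open>exp (- c)\<close> normalises its value on the Reeb vector to 1.\<close>
  have field: "exp (- c) *\<^sub>R Reeb_field A \<alpha> q = Reeb_field A ?\<alpha>' q" if q: "f q = c" for q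
  proof (rule Reeb_field_unique[OF \<alpha>'])
    have lin: "linear (\<alpha> q)" "linear (\<lambda>r. ext_deriv A ?\<alpha>' q r u)" for u
      using smooth_form_linear ext_deriv_linear contact_form_smooth \<alpha> \<alpha>' by auto
    show "?\<alpha>' q (exp (- c) *\<^sub>R Reeb_field A \<alpha> q) = 1"
      using Reeb_field_eq(1)[OF \<alpha>] q by (simp add: scale_form_def linear_scale[OF lin(1)] flip: exp_add)
    fix u
    have "differential ?e q v = 0" for v by (rule differential_extremum[OF e]) (use c q in auto)
    then have "ext_deriv A ?\<alpha>' q (Reeb_field A \<alpha> q) u = 0"
      using Reeb_field_eq(2)[OF \<alpha>] by (simp add: ext_deriv_scale[OF contact_form_smooth[OF \<alpha>] e])
    then show "ext_deriv A ?\<alpha>' q (exp (- c) *\<^sub>R Reeb_field A \<alpha> q) u = 0"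
      by (simp add: linear_scale[OF lin(2)])
  qed
  show ?thesis
    unfolding Reeb_flow_def
  proof (rule integral_curve_unique[where X = "Reeb_field A ?\<alpha>'" and J = UNIV and ?t0.0 = 0 and t = t
        and \<gamma> = "\<lambda>t. flow_of A (Reeb_field A ?\<alpha>') t p" and \<sigma> = "\<lambda>t. flow_of A (Reeb_field A \<alpha>) (exp (- c) * t) p"])
    fix s
    show "has_velocity A (\<lambda>t. flow_of A (Reeb_field A ?\<alpha>') t p) s (Reeb_field A ?\<alpha>' (flow_of A (Reeb_field A ?\<alpha>') s p))"
      by (rule flow_velocity[OF R'])
    have "has_velocity A (\<lambda>t. flow_of A (Reeb_field A \<alpha>) (exp (- c) * t + 0) p) s
        (exp (- c) *\<^sub>R Reeb_field A \<alpha> (flow_of A (Reeb_field A \<alpha>) (exp (- c) * s + 0) p))"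
      by (rule has_velocity_affine[where \<gamma> = "\<lambda>t. flow_of A (Reeb_field A \<alpha>) t p", OF flow_velocity[OF R]])
    then show "has_velocity A (\<lambda>t. flow_of A (Reeb_field A \<alpha>) (exp (- c) * t) p) s
        (Reeb_field A ?\<alpha>' (flow_of A (Reeb_field A \<alpha>) (exp (- c) * s) p))"
      using field[OF orbit, of "exp (- c) * s"] by (simp add: Reeb_flow_def)
  qed (use R' flow_zero[OF R] flow_zero[OF R'] in auto)
qed

text \<open>Invariance bounds the bad points by a null set for each time separately. Rational times
  keep the union null, and closedness of \<open>K\<close> with continuity of the orbit recovers all
  real times.\<close>

lemma flow_invariant_AE_orbit:
  assumes X: "smooth_field X" and K: "closed K" and \<mu>: "borel_prob \<mu>" "supported_in \<mu> K" "flow_invariant (flow_of A X) \<mu>"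
  shows "AE p in \<mu>. \<forall>t. flow_of A X t p \<in> K"
proof -
  let ?\<theta> = "flow_of A X"
  have S: "sets \<mu> = sets borel" "space \<mu> = UNIV" using \<mu>(1) sets_eq_imp_space_eq[of \<mu> borel] by (auto simp: borel_prob_def)
  have "AE p in \<mu>. ?\<theta> t p \<in> K" for t
  proof -
    have m: "?\<theta> t \<in> measurable \<mu> borel" using \<mu>(3) measurable_cong_sets[OF S(1) refl] by (auto simp: flow_invariant_def)
    have d: "distr \<mu> borel (?\<theta> t) = \<mu>" using \<mu>(3) by (simp add: flow_invariant_def)
    have "emeasure \<mu> (?\<theta> t -` (- K)) = emeasure (distr \<mu> borel (?\<theta> t)) (- K)"
      by (subst emeasure_distr[OF m]) (use K S in auto)
    then have "emeasure \<mu> (?\<theta> t -` (- K)) = 0" using \<mu>(2) by (simp add: d supported_in_def)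
    moreover have "?\<theta> t -` (- K) \<in> sets \<mu>" using measurable_sets[OF m, of "- K"] K S by auto
    ultimately show ?thesis by (intro AE_I[where N = "?\<theta> t -` (- K)"]) auto
  qed
  then have "AE p in \<mu>. \<forall>r::rat. ?\<theta> (of_rat r) p \<in> K" by (simp add: AE_all_countable)
  then show ?thesis
  proof eventually_elim
    fix p assume "\<forall>r::rat. ?\<theta> (of_rat r) p \<in> K"
    then have "\<rat> \<subseteq> (\<lambda>t. ?\<theta> t p) -` K" by (auto simp: Rats_def)
    moreover have "closed ((\<lambda>t. ?\<theta> t p) -` K)"
      using flow_orbit_continuous[OF X, of p] K by (simp add: continuous_closed_vimage continuous_on_eq_continuous_at)
    ultimately have "closure \<rat> \<subseteq> (\<lambda>t. ?\<theta> t p) -` K" by (rule closure_minimal)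
    then show "\<forall>t. ?\<theta> t p \<in> K" unfolding Rats_closure_real by auto
  qed
qed

text \<open>Almost every point has its whole orbit in the level set, and along such an orbit the
  second flow at time t is the first at time exp (- c) t. The two push-forwards thus coincide,
  although the flows may differ off the level set.\<close>

lemma Reeb_invariant_measure_extremum:
  assumes \<alpha>: "contact_form A \<alpha>" and f: "smooth_fun A f" and c: "(\<forall>q. f q \<le> c) \<or> (\<forall>q. c \<le> f q)"
    and orbit: "\<And>T. 0 < T \<Longrightarrow> \<exists>p. \<forall>s\<in>{0..T}. f (Reeb_flow A \<alpha> s p) = c"
  shows "\<exists>\<mu>. borel_prob \<mu> \<and> supported_in \<mu> {p. f p = c} \<and> flow_invariant (Reeb_flow A \<alpha>) \<mu> \<and>
    flow_invariant (Reeb_flow A (scale_form (\<lambda>p. exp (f p)) \<alpha>)) \<mu>"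
proof -
  let ?K = "{p. f p = c}" and ?\<alpha>' = "scale_form (\<lambda>p. exp (f p)) \<alpha>"
  note R = Reeb_field_smooth[OF \<alpha>]
  have e: "smooth_fun A (\<lambda>p. exp (f p))" by (rule smooth_fun_compose[OF f smooth_exp]) simp
  have \<alpha>': "contact_form A ?\<alpha>'" by (rule contact_form_scale[OF \<alpha> e]) simp
  note R' = Reeb_field_smooth[OF \<alpha>']
  have K: "closed ?K" by (intro closed_Collect_eq smooth_fun_continuous[OF f] continuous_on_const)
  obtain \<mu> where \<mu>: "borel_prob \<mu>" "supported_in \<mu> ?K" "flow_invariant (Reeb_flow A \<alpha>) \<mu>"
    using flow_invariant_measure_exists[OF R K] orbit unfolding Reeb_flow_def by auto
  have ae: "AE p in \<mu>. \<forall>t. Reeb_flow A \<alpha> t p \<in> ?K"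
    using flow_invariant_AE_orbit[OF R K \<mu>(1,2)] \<mu>(3) unfolding Reeb_flow_def by blast
  have "flow_invariant (Reeb_flow A ?\<alpha>') \<mu>"
    unfolding flow_invariant_def
  proof (intro allI conjI)
    fix t
    show m: "Reeb_flow A ?\<alpha>' t \<in> borel_measurable borel"
      unfolding Reeb_flow_def by (rule borel_measurable_continuous_onI[OF flow_time_continuous[OF R']])
    have S: "sets \<mu> = sets borel" using \<mu>(1) by (simp add: borel_prob_def)
    have "distr \<mu> borel (Reeb_flow A ?\<alpha>' t) = distr \<mu> borel (Reeb_flow A \<alpha> (exp (- c) * t))"
    proof (rule distr_cong_AE)
      show "AE p in \<mu>. Reeb_flow A ?\<alpha>' t p = Reeb_flow A \<alpha> (exp (- c) * t) p"
        using ae by eventually_elim (rule Reeb_flow_scale_extremum[OF \<alpha> f c], simp)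
    qed (use m \<mu>(3) in \<open>auto simp: measurable_cong_sets[OF S refl] flow_invariant_def\<close>)
    also have "\<dots> = \<mu>" using \<mu>(3) by (simp add: flow_invariant_def)
    finally show "distr \<mu> borel (Reeb_flow A ?\<alpha>' t) = \<mu>" .
  qed
  then show ?thesis using \<mu> by blast
qed

end

theorem theorem4:
  fixes A :: "('m::{t2_space,second_countable_topology}, 'e::euclidean_space) chart set"
    and \<xi> P :: "'m \<Rightarrow> 'e set"
    and \<alpha> \<beta> :: "('m, 'e) form"
    and f :: "'m \<Rightarrow> real"
    and \<phi> :: "'m \<Rightarrow> 'm"
  assumes "smooth_atlas A"
    and "compact (UNIV :: 'm set)"
    and "cooriented_contact_structure A \<xi> P"
    and "\<alpha> \<in> contact_forms A \<xi> P"
    and "\<beta> \<in> contact_forms A \<xi> P"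
    and "smooth_fun A f"
    and "\<phi> \<in> Cont0 A \<xi>"
    and "pullback A \<phi> \<beta> = scale_form (\<lambda>p. exp (f p)) \<alpha>"
    and "bm_dist A \<xi> \<alpha> \<beta> = max_val f - min_val f"
  shows "(\<exists>\<mu>\<^sub>0 \<mu>\<^sub>1 :: 'm measure.
            borel_prob \<mu>\<^sub>0 \<and> supported_in \<mu>\<^sub>0 {p. f p = min_val f} \<and>
            flow_invariant (Reeb_flow A \<alpha>) \<mu>\<^sub>0 \<and>
            flow_invariant (Reeb_flow A (pullback A \<phi> \<beta>)) \<mu>\<^sub>0 \<and>
            borel_prob \<mu>\<^sub>1 \<and> supported_in \<mu>\<^sub>1 {p. f p = max_val f} \<and>
            flow_invariant (Reeb_flow A \<alpha>) \<mu>\<^sub>1 \<and>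
            flow_invariant (Reeb_flow A (pullback A \<phi> \<beta>)) \<mu>\<^sub>1)
       \<and> (\<forall>\<psi> \<gamma>.
            (\<forall>t\<in>{0..1}. \<psi> t \<in> Cont0 A \<xi>) \<longrightarrow>
            continuous_map (top_of_set {0..1}) (Cinf_map_topology A) \<psi> \<longrightarrow>
            \<psi> 0 = id \<longrightarrow>
            \<psi> 1 = inv \<phi> \<longrightarrow>
            \<gamma> = (\<lambda>t::real. pullback A (\<psi> t) (scale_form (\<lambda>p. exp (t * f p)) \<alpha>)) \<longrightarrow>
            minimizing_geodesic A \<xi> P \<gamma> \<and> \<gamma> 0 = \<alpha> \<and> \<gamma> 1 = \<beta>)"
proof -
  interpret closed_manifold A
    by unfold_locales (rule assms(1), rule assms(2))
  have \<alpha>: "contact_form A \<alpha>" using assms(4) by (simp add: contact_forms_def)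
  note orbit = extremal_orbit_segment[OF assms(4,6,7,8,9)]
  obtain \<mu>\<^sub>0 where 0: "borel_prob \<mu>\<^sub>0" "supported_in \<mu>\<^sub>0 {p. f p = min_val f}" "flow_invariant (Reeb_flow A \<alpha>) \<mu>\<^sub>0"
    "flow_invariant (Reeb_flow A (pullback A \<phi> \<beta>)) \<mu>\<^sub>0"
    using Reeb_invariant_measure_extremum[OF \<alpha> assms(6), of "min_val f"] smooth_fun_bounded(2)[OF assms(6)] orbit(2)
    unfolding assms(8) by blast
  obtain \<mu>\<^sub>1 where 1: "borel_prob \<mu>\<^sub>1" "supported_in \<mu>\<^sub>1 {p. f p = max_val f}" "flow_invariant (Reeb_flow A \<alpha>) \<mu>\<^sub>1"
    "flow_invariant (Reeb_flow A (pullback A \<phi> \<beta>)) \<mu>\<^sub>1"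
    using Reeb_invariant_measure_extremum[OF \<alpha> assms(6), of "max_val f"] smooth_fun_bounded(1)[OF assms(6)] orbit(1)
    unfolding assms(8) by blast
  show ?thesis
    using 0 1 conformal_path_geodesic[OF assms(4-9)] by blast
qed

end
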